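(* For every integer $n\geq 0$ there is a canonical isomorphism $$\mathrm{comp}_{B,dR}:\ H^1_{dR}(\mathcal{M}_{1,1};\mathscr{V}_n)\otimes_{\mathbb{Q}}\mathbb{C}\ \overset{\sim}{\longrightarrow}\ H^1(\mathrm{SL}_2(\mathbb{Z});V_n^B\otimes_{\mathbb{Q}}\mathbb{C}),$$ namely the composite of Grothendieck's comparison isomorphism between algebraic de Rham cohomology with coefficients in $(\mathscr{V}_n,\nabla)$ and the cohomology of $\mathcal{M}_{1,1}(\mathbb{C})$ with coefficients in the local system of flat sections of $\mathscr{V}_n$, with the identification of the cohomology of the orbifold $\mathcal{M}_{1,1}(\mathbb{C})=\mathrm{SL}_2(\mathbb{Z})\backslash\!\backslash\mathfrak{H}$ with the group cohomology of $\mathrm{SL}_2(\mathbb{Z})$.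
   Context: Work over $\mathbb{Q}$. Let $\Delta=u^3-27v^2$ and $X=\operatorname{Spec}\mathbb{Q}[u,v][\Delta^{-1}]$, with the action of $\mathbb{G}_m$ given by $\lambda\cdot(u,v)=(\lambda^4u,\lambda^6v)$. The moduli stack of elliptic curves over $\mathbb{Q}$ is $\mathcal{M}_{1,1}=\mathbb{G}_m\backslash\!\backslash X$ (universal curve $y^2=4x^3-ux-v$). Put $\psi=\frac1{12}\frac{d\Delta}{\Delta}$, $\omega=\frac32\frac{2u\,dv-3v\,du}{\Delta}$. The bundle $\mathscr{V}=\mathcal{O}_X\mathsf{S}\oplus\mathcal{O}_X\mathsf{T}$ ($\mathsf{T}=dx/y$, $\mathsf{S}=x\,dx/y$), with $\lambda\cdot\mathsf{S}=\lambda\mathsf{S}$, $\lambda\cdot\mathsf{T}=\lambda^{-1}\mathsf{T}$, carries the $\mathbb{G}_m$-invariant Gauss--Manin connection $\nabla\mathsf{S}=\psi\,\mathsf{S}-\frac{u}{12}\omega\,\mathsf{T}$, $\nabla\mathsf{T}=\omega\,\mathsf{S}-\psi\,\mathsf{T}$; $\mathscr{V}_n=\mathrm{Sym}^n\mathscr{V}$ with the induced connection. All of these descend to $\mathcal{M}_{1,1}$. $H^\bullet_{dR}(\mathcal{M}_{1,1};\mathscr{V}_n)$ is the algebraic de Rham cohomology of the stack with coefficients in $(\mathscr{V}_n,\nabla)$. Concretely, let $j:Z\hookrightarrow X$ be the closed subscheme $\Delta=1$, on which $\boldsymbol{\mu}_{12}\subset\mathbb{G}_m$ acts; then $\mathcal{M}_{1,1}=\boldsymbol{\mu}_{12}\backslash\!\backslash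 Z$ with $Z\to\mathcal{M}_{1,1}$ étale and $Z$ affine, so it is the cohomology of the complex of $\boldsymbol{\mu}_{12}$-invariants of $\Gamma(Z,\Omega_Z^\bullet\otimes j^*\mathscr{V}_n)$ with differential $\nabla$. The map $\rho:\mathfrak{H}\to X(\mathbb{C})$, $\rho(z)=(20\mathsf{G}_4(z),\frac73\mathsf{G}_6(z))$, where $\mathsf{G}_{2k}=-\frac{B_{2k}}{4k}+\sum_{m\ge1}\sigma_{2k-1}(m)q^m$ and $q=e^{2\pi iz}$, induces an isomorphism of analytic stacks $\mathrm{SL}_2(\mathbb{Z})\backslash\!\backslash\mathfrak{H}\cong\mathcal{M}_{1,1}(\mathbb{C})$. $V^B=\mathbb{Q}\mathbf{a}\oplus\mathbb{Q}\mathbf{b}$ is the standard two-dimensional representation of $\mathrm{SL}_2$ and $V^B_n=\mathrm{Sym}^nV^B$; it is the fibre of the local system of flat sections of $\mathscr{V}_n$ (with its rational structure $\mathrm{Sym}^n$ of the first rational Betti cohomology of the elliptic curves $\mathbb{C}/(\mathbb{Z}\oplus z\mathbb{Z})$), the pullback $\rho^*\mathscr{V}^{an}$ being identified with $\mathcal{O}_{\mathfrak{H}}\otimes V^B$, with $\nabla$ corresponding to $d$ and $\mathsf{T}$ corresponding to $2\pi i(z\mathbf{a}-\mathbf{b})$. One may use the right action $\mathbf{a}|\gamma=\delta\mathbf{a}+c\mathbf{b}$, $\mathbf{b}|\gamma=\beta\mathbf{a}+\alpha\mathbf{b}$ for $\gamma=\begin{pmatrix}\alpha&\beta\\c&\delta\end{pmatrix}$,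 with one-cocycles satisfying $\kappa(\gamma\gamma')=\kappa(\gamma)|\gamma'+\kappa(\gamma')$. *)

theory Defs
  imports
    "HOL-Analysis.Analysis"
    "HOL-Computational_Algebra.Polynomial"
    "HOL-Library.Function_Algebras"
    "HOL-Library.Poly_Mapping"
    "HOL-Algebra.Module"
    "HOL-Algebra.AbelCoset"
begin

section \<open>Modules, quotients, extension of scalars from \<open>\<rat>\<close> to \<open>\<complex>\<close>\<close>

text \<open>
  A subspace \<open>Z\<close> of a type with scalar multiplication \<open>s\<close>, as a module record; the fields
  \<open>mult\<close> and \<open>one\<close> of the record are irrelevant for modules.
\<close>

definition submod :: "('k \<Rightarrow> 'a \<Rightarrow> 'a) \<Rightarrow> 'a::ab_group_add set \<Rightarrow> ('k, 'a) module" where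
  "submod s Z =
     \<lparr>carrier = Z, mult = undefined, one = undefined, zero = 0, add = (+), module.smult = s\<rparr>"

definition quot_module :: "('k, 'a) module \<Rightarrow> 'a set \<Rightarrow> ('k, 'a set) module" where
  "quot_module M N =
     \<lparr>carrier = a_rcosets\<^bsub>M\<^esub> N, mult = undefined, one = undefined, zero = N,
      add = set_add M, module.smult = (\<lambda>r X. \<Union>x\<in>X. N +>\<^bsub>M\<^esub> (r \<odot>\<^bsub>M\<^esub> x))\<rparr>"

definition module_iso :: "('k, 'a) module \<Rightarrow> ('k, 'b) module \<Rightarrow> ('a \<Rightarrow> 'b) \<Rightarrow> bool" where
  "module_iso M N f \<longleftrightarrow>
     f \<in> iso (add_monoid M) (add_monoid N) \<and>
     (\<forall>r. \<forall>x\<in>carrier M. f (r \<odot>\<^bsub>M\<^esub> x) = r \<odot>\<^bsub>N\<^esub> f x)"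

definition fsmult :: "complex \<Rightarrow> ('a \<Rightarrow>\<^sub>0 complex) \<Rightarrow> ('a \<Rightarrow>\<^sub>0 complex)" where
  "fsmult c f = Poly_Mapping.map ((*) c) f"

text \<open>
  \<open>M \<otimes>\<^sub>\<rat> \<complex>\<close>: the free complex vector space on the set \<open>M\<close> modulo the relations that make
  \<open>x \<mapsto> [x]\<close> a \<open>\<rat>\<close>-linear map. The class of \<open>Poly_Mapping.single x c\<close> is \<open>x \<otimes> c\<close>.
\<close>

definition tensor_rels :: "(rat, 'a) module \<Rightarrow> ('a \<Rightarrow>\<^sub>0 complex) set" where
  "tensor_rels M = Modules.module.span fsmult
     ({Poly_Mapping.single (x \<oplus>\<^bsub>M\<^esub> y) 1 - Poly_Mapping.single x 1 - Poly_Mapping.single y 1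
         | x y. x \<in> carrier M \<and> y \<in> carrier M} \<union>
      {Poly_Mapping.single (r \<odot>\<^bsub>M\<^esub> x) 1 - Poly_Mapping.single x (of_rat r)
         | r x. x \<in> carrier M})"

definition tensor_complex :: "(rat, 'a) module \<Rightarrow> (complex, ('a \<Rightarrow>\<^sub>0 complex) set) module" where
  "tensor_complex M =
     quot_module (submod fsmult {f. Poly_Mapping.keys f \<subseteq> carrier M}) (tensor_rels M)"


section \<open>The curve \<open>Z\<close>\<close>

text \<open>
  In \<open>rat poly poly\<close> the inner variable is \<open>u\<close> and the outer variable is \<open>v\<close>. As \<open>\<Delta>\<close> is
  invertible on \<open>\<Delta> = 1\<close>, the ring of functions on \<open>Z\<close> is \<open>\<rat>[u,v]/(\<Delta> - 1)\<close>.
\<close>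

definition pol_u :: "rat poly poly" where "pol_u = [:[:0, 1:]:]"
definition pol_v :: "rat poly poly" where "pol_v = [:0, 1:]"
definition pol_Delta :: "rat poly poly" where "pol_Delta = pol_u ^ 3 - 27 * pol_v ^ 2"

(* otherwise lift_definition descends through poly to nat => nat => rat *)
lifting_forget poly.lifting

quotient_type regZ = "rat poly poly" / "\<lambda>p q. (pol_Delta - 1) dvd (p - q)"
proof (rule equivpI)
  show "reflp (\<lambda>p q. (pol_Delta - 1) dvd (p - q))"
    by (simp add: reflp_def)
  show "symp (\<lambda>p q. (pol_Delta - 1) dvd (p - q))"
    by (metis (no_types, lifting) dvd_minus_iff minus_diff_eq sympI)
  show "transp (\<lambda>p q. (pol_Delta - 1) dvd (p - q))"
  proof (rule transpI)
    fix p q r assume "(pol_Delta - 1) dvd (p - q)" "(pol_Delta - 1) dvd (q - r)"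
    then have "(pol_Delta - 1) dvd (p - q) + (q - r)" by (rule dvd_add)
    then show "(pol_Delta - 1) dvd (p - r)" by simp
  qed
qed

lemma pol_Delta_pCons: "pol_Delta - 1 = [:[:- 1, 0, 0, 1:], 0, [:- 27:]:]"
  by (simp add: pol_Delta_def pol_u_def pol_v_def numeral_3_eq_3 power2_eq_square numeral_poly
      one_pCons)

lemma not_unit_pol_Delta: "\<not> (pol_Delta - 1) dvd 1"
proof
  assume "(pol_Delta - 1) dvd 1"
  then obtain c where "pol_Delta - 1 = [:c:]"
    using is_unit_poly_iff by blast
  then show False
    by (simp add: pol_Delta_pCons)
qed

instantiation regZ :: comm_ring_1
begin

lift_definition zero_regZ :: regZ is 0 .
lift_definition one_regZ :: regZ is 1 .
lift_definition plus_regZ :: "regZ \<Rightarrow> regZ \<Rightarrow> regZ" is "(+)"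
  by (metis add_diff_add dvd_add)
lift_definition uminus_regZ :: "regZ \<Rightarrow> regZ" is uminus
  by (metis dvd_minus_iff minus_diff_minus)
lift_definition minus_regZ :: "regZ \<Rightarrow> regZ \<Rightarrow> regZ" is "(-)"
  by (metis (no_types, lifting) diff_diff_eq2 diff_diff_add add.commute add_diff_eq dvd_diff
      diff_add_eq)
lift_definition times_regZ :: "regZ \<Rightarrow> regZ \<Rightarrow> regZ" is "(*)"
proof -
  fix p p' q q' :: "rat poly poly"
  assume "(pol_Delta - 1) dvd (p - p')" "(pol_Delta - 1) dvd (q - q')"
  then have "(pol_Delta - 1) dvd ((p - p') * q + p' * (q - q'))"
    by (intro dvd_add dvd_mult dvd_mult2)
  then show "(pol_Delta - 1) dvd (p * q - p' * q')"
    by (simp add: algebra_simps)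
qed

instance
proof
  show "(0::regZ) \<noteq> 1"
    by transfer (use not_unit_pol_Delta in simp)
qed (transfer; simp add: algebra_simps)+

end

definition constZ :: "rat \<Rightarrow> regZ" where "constZ c = abs_regZ [:[:c:]:]"
definition uZ :: regZ where "uZ = abs_regZ pol_u"
definition vZ :: regZ where "vZ = abs_regZ pol_v"

definition eval_pol :: "rat poly poly \<Rightarrow> complex \<Rightarrow> complex \<Rightarrow> complex" where
  "eval_pol P x y = poly (map_poly (\<lambda>p. poly (map_poly of_rat p) x) P) y"

lemma eval_pol_0 [simp]: "eval_pol 0 x y = 0"
  by (simp add: eval_pol_def)

lemma eval_pol_pCons [simp]:
  "eval_pol (pCons p P) x y = poly (map_poly of_rat p) x + y * eval_pol P x y"
  by (cases "p = 0 \<and> P = 0") (auto simp: eval_pol_def map_poly_pCons)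

lemma poly_of_rat_add:
  "poly (map_poly of_rat (p + q)) (x::complex) = poly (map_poly of_rat p) x + poly (map_poly of_rat q) x"
proof -
  have "map_poly of_rat (p + q) = map_poly of_rat p + (map_poly of_rat q :: complex poly)"
    by (intro poly_eqI) (simp add: coeff_map_poly of_rat_add)
  then show ?thesis by simp
qed

lemma poly_of_rat_mult:
  "poly (map_poly of_rat (p * q)) (x::complex) = poly (map_poly of_rat p) x * poly (map_poly of_rat q) x"
proof -
  have s: "map_poly of_rat (Polynomial.smult c q) = Polynomial.smult (of_rat c) (map_poly of_rat q :: complex poly)" for c q
    by (intro poly_eqI) (simp add: coeff_map_poly of_rat_mult)
  show ?thesis
    by (induction p)
      (simp_all add: poly_of_rat_add s map_poly_pCons algebra_simps)
qed

lemma eval_pol_add: "eval_pol (P + Q) x y = eval_pol P x y + eval_pol Q x y"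
proof (induction P arbitrary: Q)
  case 0
  then show ?case by simp
next
  case (pCons p P)
  show ?case
    by (cases Q) (simp add: pCons.IH poly_of_rat_add distrib_left)
qed

lemma eval_pol_mult: "eval_pol (P * Q) x y = eval_pol P x y * eval_pol Q x y"
proof (induction P)
  case 0
  then show ?case by simp
next
  case (pCons p P)
  have "eval_pol (Polynomial.smult p Q) x y = poly (map_poly of_rat p) x * eval_pol Q x y"
    by (induction Q) (simp_all add: poly_of_rat_mult algebra_simps)
  then show ?case
    by (simp add: eval_pol_add pCons.IH algebra_simps)
qed

lemma eval_pol_Delta: "eval_pol (pol_Delta - 1) x y = x ^ 3 - 27 * y ^ 2 - 1"
  by (simp add: pol_Delta_pCons map_poly_pCons of_rat_minus algebra_simps power2_eq_square
      power3_eq_cube)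

text \<open>The value of a function at a complex point of \<open>Z\<close>; the value off \<open>Z\<close> is irrelevant.\<close>

lift_definition eval_regZ :: "regZ \<Rightarrow> complex \<Rightarrow> complex \<Rightarrow> complex"
  is "\<lambda>P x y. if x ^ 3 - 27 * y ^ 2 = 1 then eval_pol P x y else 0"
proof -
  fix P Q assume "(pol_Delta - 1) dvd (P - Q)"
  then obtain R where "P = Q + (pol_Delta - 1) * R"
    by (metis dvdE add.commute diff_add_cancel)
  then show "(\<lambda>x y. if x ^ 3 - 27 * y ^ 2 = 1 then eval_pol P x y else 0) =
             (\<lambda>x y. if x ^ 3 - 27 * y ^ 2 = 1 then eval_pol Q x y else 0)"
    by (auto simp: fun_eq_iff eval_pol_add eval_pol_mult eval_pol_Delta)
qed

lemma eval_regZ_add: "eval_regZ (f + g) x y = eval_regZ f x y + eval_regZ g x y"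
  by transfer (simp add: eval_pol_add)

lemma eval_regZ_mult: "eval_regZ (f * g) x y = eval_regZ f x y * eval_regZ g x y"
  by transfer (simp add: eval_pol_mult)

lemma eval_regZ_diff: "eval_regZ (f - g) x y = eval_regZ f x y - eval_regZ g x y"
  using eval_regZ_add[of "f - g" g x y] by simp

lemma eval_regZ_gens:
  assumes "x ^ 3 - 27 * y ^ 2 = 1"
  shows "eval_regZ uZ x y = x" "eval_regZ vZ x y = y" "eval_regZ (constZ c) x y = of_rat c"
  using assms unfolding uZ_def vZ_def constZ_def pol_u_def pol_v_def
  by (transfer, simp add: map_poly_pCons)+

lemma numeral_regZ: "numeral k = constZ (numeral k)" "- numeral k = constZ (- numeral k)"
proof -
  have *: "of_nat m = constZ (of_nat m)" for m
  proof (induction m)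
    case 0
    show ?case by (simp add: constZ_def zero_regZ_def)
  next
    case (Suc m)
    then show ?case
      by (simp add: constZ_def one_regZ_def plus_regZ.abs_eq one_pCons)
  qed
  show "numeral k = constZ (numeral k)"
    using *[of "numeral k"] by simp
  then have "- numeral k = - constZ (numeral k)"
    by simp
  also have "\<dots> = constZ (- numeral k)"
    by (simp add: constZ_def uminus_regZ.abs_eq)
  finally show "- numeral k = constZ (- numeral k)" .
qed

lifting_forget regZ.lifting

text \<open>
  Kaehler differentials: \<open>(f, g)\<close> stands for \<open>f du + g dv\<close>, subject to
  \<open>0 = d\<Delta> = 3 u\<^sup>2 du - 54 v dv\<close>.
\<close>

quotient_type kaehlerZ = "regZ \<times> regZ" /
  "\<lambda>(f, g) (f', g'). \<exists>c. f - f' = c * (3 * uZ ^ 2) \<and> g - g' = c * (- 54 * vZ)"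
proof (rule equivpI)
  show "reflp (\<lambda>(f, g) (f', g'). \<exists>c. f - f' = c * (3 * uZ ^ 2) \<and> g - g' = c * (- 54 * vZ))"
    by (auto simp: reflp_def intro!: exI[of _ 0])
  show "symp (\<lambda>(f, g) (f', g'). \<exists>c. f - f' = c * (3 * uZ ^ 2) \<and> g - g' = c * (- 54 * vZ))"
  proof (rule sympI, clarify)
    fix f g f' g' c
    assume "f - f' = c * (3 * uZ ^ 2)" "g - g' = c * (- 54 * vZ)"
    then show "\<exists>c. f' - f = c * (3 * uZ ^ 2) \<and> g' - g = c * (- 54 * vZ)"
      by (intro exI[of _ "- c"]) (simp add: algebra_simps)
  qed
  show "transp (\<lambda>(f, g) (f', g'). \<exists>c. f - f' = c * (3 * uZ ^ 2) \<and> g - g' = c * (- 54 * vZ))"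
  proof (rule transpI, clarify)
    fix f g f' g' f'' g'' c c'
    assume "f - f' = c * (3 * uZ ^ 2)" "g - g' = c * (- 54 * vZ)"
      "f' - f'' = c' * (3 * uZ ^ 2)" "g' - g'' = c' * (- 54 * vZ)"
    then show "\<exists>c. f - f'' = c * (3 * uZ ^ 2) \<and> g - g'' = c * (- 54 * vZ)"
      by (intro exI[of _ "c + c'"]) (simp add: algebra_simps)
  qed
qed

instantiation kaehlerZ :: ab_group_add
begin

lift_definition zero_kaehlerZ :: kaehlerZ is "(0, 0)" .
lift_definition plus_kaehlerZ :: "kaehlerZ \<Rightarrow> kaehlerZ \<Rightarrow> kaehlerZ"
  is "\<lambda>(f, g) (f', g'). (f + f', g + g')"
proof clarify
  fix f g f' g' h k h' k' c d
  assume "f - f' = c * (3 * uZ ^ 2)" "g - g' = c * (- 54 * vZ)"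
    "h - h' = d * (3 * uZ ^ 2)" "k - k' = d * (- 54 * vZ)"
  then show "\<exists>c. f + h - (f' + h') = c * (3 * uZ ^ 2) \<and> g + k - (g' + k') = c * (- 54 * vZ)"
    by (intro exI[of _ "c + d"]) (simp add: algebra_simps)
qed
lift_definition uminus_kaehlerZ :: "kaehlerZ \<Rightarrow> kaehlerZ" is "\<lambda>(f, g). (- f, - g)"
proof clarify
  fix f g f' g' c
  assume "f - f' = c * (3 * uZ ^ 2)" "g - g' = c * (- 54 * vZ)"
  then show "\<exists>c. - f - - f' = c * (3 * uZ ^ 2) \<and> - g - - g' = c * (- 54 * vZ)"
    by (intro exI[of _ "- c"]) (simp add: algebra_simps)
qed
definition minus_kaehlerZ :: "kaehlerZ \<Rightarrow> kaehlerZ \<Rightarrow> kaehlerZ" where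
  "minus_kaehlerZ x y = x + (- y)"

instance
  by standard
    (simp add: minus_kaehlerZ_def | (transfer; force simp: algebra_simps intro: exI[of _ 0]))+

end

lift_definition kmult :: "regZ \<Rightarrow> kaehlerZ \<Rightarrow> kaehlerZ" is "\<lambda>r (f, g). (r * f, r * g)"
proof clarify
  fix r f g f' g' c
  assume "f - f' = c * (3 * uZ ^ 2)" "g - g' = c * (- 54 * vZ)"
  then show "\<exists>c. r * f - r * f' = c * (3 * uZ ^ 2) \<and> r * g - r * g' = c * (- 54 * vZ)"
    by (intro exI[of _ "r * c"])
      (simp add: mult.assoc flip: right_diff_distrib)
qed

lift_definition kaehlerZ_of :: "regZ \<Rightarrow> regZ \<Rightarrow> kaehlerZ" is "\<lambda>f g. (f, g)" .

text \<open>
  The value of a differential at a complex point \<open>(x, y)\<close> of \<open>Z\<close> on a tangent vector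
  \<open>(x', y')\<close>; the value at other arguments is irrelevant.
\<close>

lift_definition eval_kaehlerZ ::
    "kaehlerZ \<Rightarrow> complex \<Rightarrow> complex \<Rightarrow> complex \<Rightarrow> complex \<Rightarrow> complex"
  is "\<lambda>(f, g) x y x' y'.
        if x ^ 3 - 27 * y ^ 2 = 1 \<and> 3 * x ^ 2 * x' - 54 * y * y' = 0
        then eval_regZ f x y * x' + eval_regZ g x y * y' else 0"
proof clarify
  fix f g f' g' c
  assume 1: "f - f' = c * (3 * uZ ^ 2)" and 2: "g - g' = c * (- 54 * vZ)"
  from 1 have f: "f = f' + c * (3 * uZ ^ 2)" by (simp add: algebra_simps)
  from 2 have g: "g = g' + c * (- 54 * vZ)" by (simp add: algebra_simps)
  have "eval_regZ f x y * x' + eval_regZ g x y * y' =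
        eval_regZ f' x y * x' + eval_regZ g' x y * y'"
    if Z: "x ^ 3 - 27 * y ^ 2 = 1" and t: "3 * x ^ 2 * x' - 54 * y * y' = 0" for x y x' y'
  proof -
    have "eval_regZ f x y * x' + eval_regZ g x y * y' =
          eval_regZ f' x y * x' + eval_regZ g' x y * y' +
          eval_regZ c x y * (3 * x ^ 2 * x' - 54 * y * y')"
      unfolding f g numeral_regZ
      by (simp add: eval_regZ_add eval_regZ_diff eval_regZ_mult eval_regZ_gens[OF Z] power2_eq_square
          of_rat_minus distrib_left distrib_right right_diff_distrib mult_ac)
    then show ?thesis by (simp only: t mult_zero_right add_0_right)
  qed
  then show "(\<lambda>x y x' y'. if x ^ 3 - 27 * y ^ 2 = 1 \<and> 3 * x ^ 2 * x' - 54 * y * y' = 0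
               then eval_regZ f x y * x' + eval_regZ g x y * y' else 0) =
             (\<lambda>x y x' y'. if x ^ 3 - 27 * y ^ 2 = 1 \<and> 3 * x ^ 2 * x' - 54 * y * y' = 0
               then eval_regZ f' x y * x' + eval_regZ g' x y * y' else 0)"
    by (auto simp: fun_eq_iff)
qed

lemma kaehlerZ_of_eqI:
  assumes "f - f' = c * (3 * uZ ^ 2)" "g - g' = c * (- 54 * vZ)"
  shows "kaehlerZ_of f g = kaehlerZ_of f' g'"
  using assms by transfer auto

lifting_forget kaehlerZ.lifting
unbundle regZ.lifting

lemma pderiv_u_add:
  "map_poly pderiv (p + q) = map_poly pderiv p + map_poly pderiv (q :: rat poly poly)"
  by (intro poly_eqI) (simp add: coeff_map_poly pderiv_add)

lemma pderiv_u_diff: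
  "map_poly pderiv (p - q) = map_poly pderiv p - map_poly pderiv (q :: rat poly poly)"
  by (intro poly_eqI) (simp add: coeff_map_poly pderiv_diff)

lemma pderiv_u_smult:
  "map_poly pderiv (Polynomial.smult a q) = Polynomial.smult (pderiv a) q + Polynomial.smult a (map_poly pderiv (q :: rat poly poly))"
  by (intro poly_eqI) (simp add: coeff_map_poly pderiv_mult algebra_simps)

lemma pderiv_u_mult:
  "map_poly pderiv (p * q) =
     p * map_poly pderiv q + map_poly pderiv p * (q :: rat poly poly)"
proof (induction p)
  case 0
  then show ?case by simp
next
  case (pCons a p)
  have *: "map_poly pderiv (pCons b r) = pCons (pderiv b) (map_poly pderiv r)"
    for b and r :: "rat poly poly"
    by (intro poly_eqI) (simp add: coeff_map_poly coeff_pCons split: nat.split)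
  show ?case
    by (simp add: pCons.IH pderiv_u_add pderiv_u_smult * algebra_simps)
qed

lemma pderiv_Delta:
  "map_poly pderiv (pol_Delta - 1) = 3 * pol_u ^ 2" "pderiv (pol_Delta - 1) = - 54 * pol_v"
  unfolding pol_Delta_pCons
  by (simp_all add: pol_u_def pol_v_def map_poly_pCons pderiv_pCons power2_eq_square numeral_poly)

lift_definition dZ :: "regZ \<Rightarrow> kaehlerZ"
  is "\<lambda>p. kaehlerZ_of (abs_regZ (map_poly pderiv p)) (abs_regZ (pderiv p))"
proof -
  fix p q assume "(pol_Delta - 1) dvd (p - q)"
  then obtain r where r: "p - q = (pol_Delta - 1) * r" by (elim dvdE)
  have u: "map_poly pderiv p - map_poly pderiv q =
           (pol_Delta - 1) * map_poly pderiv r + r * (3 * pol_u ^ 2)"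
    by (simp only: r pderiv_u_mult pderiv_Delta mult.commute[of r] flip: pderiv_u_diff)
  have v: "pderiv p - pderiv q = (pol_Delta - 1) * pderiv r + r * (- 54 * pol_v)"
    by (simp only: r pderiv_mult pderiv_Delta flip: pderiv_diff)
  have e: "abs_regZ x - abs_regZ y = abs_regZ r * abs_regZ z"
    if "x - y = (pol_Delta - 1) * w + r * z" for x y z w
  proof -
    have "abs_regZ (x - y) = abs_regZ (r * z)"
      unfolding regZ.abs_eq_iff that by simp
    then show ?thesis
      by (simp add: minus_regZ.abs_eq times_regZ.abs_eq)
  qed
  have n: "abs_regZ (3 * pol_u ^ 2) = 3 * uZ ^ 2" "abs_regZ (- 54 * pol_v) = - 54 * vZ"
    by (simp_all add: numeral_regZ constZ_def uZ_def vZ_def times_regZ.abs_eq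
        uminus_regZ.abs_eq power2_eq_square numeral_poly)
  show "kaehlerZ_of (abs_regZ (map_poly pderiv p)) (abs_regZ (pderiv p)) =
        kaehlerZ_of (abs_regZ (map_poly pderiv q)) (abs_regZ (pderiv q))"
    using e[OF u] e[OF v] unfolding n by (rule kaehlerZ_of_eqI)
qed


section \<open>Algebraic de Rham cohomology of \<open>\<M>\<^sub>1\<^sub>,\<^sub>1 = [Z / \<mu>\<^sub>1\<^sub>2]\<close>\<close>

text \<open>
  An action of the group scheme \<open>\<mu>\<^sub>1\<^sub>2\<close> is a grading by \<open>\<int>/12\<close>: \<open>\<lambda>\<close> acts on the piece of
  weight \<open>k\<close> by \<open>\<lambda>\<^sup>k\<close>, and the invariants are the piece of weight \<open>0\<close>. Here \<open>u\<close>, \<open>du\<close> have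
  weight \<open>4\<close> and \<open>v\<close>, \<open>dv\<close> have weight \<open>6\<close>.
\<close>

definition regZ_weight :: "int \<Rightarrow> regZ set" where
  "regZ_weight k =
     {abs_regZ P | P. \<forall>a b. coeff (coeff P b) a \<noteq> 0 \<longrightarrow> (4 * int a + 6 * int b) mod 12 = k mod 12}"

definition kaehlerZ_weight :: "int \<Rightarrow> kaehlerZ set" where
  "kaehlerZ_weight k =
     {kaehlerZ_of f g | f g. f \<in> regZ_weight (k - 4) \<and> g \<in> regZ_weight (k - 6)}"

text \<open>
  A section of \<open>Sym\<^sup>n(\<O> S \<oplus> \<O> T)\<close>, with or without differentials, is a polynomial of degree
  at most \<open>n\<close> whose \<open>i\<close>-th coefficient is the coefficient of \<open>S\<^sup>i T\<^sup>n\<^sup>-\<^sup>i\<close>. As \<open>S\<close>, \<open>T\<close> have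
  weights \<open>1\<close>, \<open>-1\<close>, such a section is invariant iff its \<open>i\<close>-th coefficient has weight
  \<open>n - 2i\<close> modulo \<open>12\<close>.
\<close>

definition invariant_sections :: "nat \<Rightarrow> regZ poly set" where
  "invariant_sections n =
     {s. degree s \<le> n \<and> (\<forall>i\<le>n. coeff s i \<in> regZ_weight (int n - 2 * int i))}"

definition invariant_forms :: "nat \<Rightarrow> kaehlerZ poly set" where
  "invariant_forms n =
     {\<theta>. degree \<theta> \<le> n \<and> (\<forall>i\<le>n. coeff \<theta> i \<in> kaehlerZ_weight (int n - 2 * int i))}"

text \<open>The restrictions of \<open>\<psi>\<close> and \<open>\<omega>\<close> to \<open>Z\<close>, where the denominator \<open>\<Delta>\<close> is \<open>1\<close>.\<close>

definition psiZ :: kaehlerZ where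
  "psiZ = kmult (constZ (1 / 12)) (dZ (uZ ^ 3 - 27 * vZ ^ 2))"

definition omegaZ :: kaehlerZ where
  "omegaZ = kmult (constZ (3 / 2)) (kmult (2 * uZ) (dZ vZ) - kmult (3 * vZ) (dZ uZ))"

text \<open>
  The Gauss--Manin connection on \<open>Sym\<^sup>n\<close> by the Leibniz rule, with
  \<open>\<nabla>(S\<^sup>i T\<^sup>n\<^sup>-\<^sup>i) = i S\<^sup>i\<^sup>-\<^sup>1 T\<^sup>n\<^sup>-\<^sup>i (\<psi> S - (u/12) \<omega> T) + (n - i) S\<^sup>i T\<^sup>n\<^sup>-\<^sup>i\<^sup>-\<^sup>1 (\<omega> S - \<psi> T)\<close>.
\<close>

definition nablaZ :: "nat \<Rightarrow> regZ poly \<Rightarrow> kaehlerZ poly" where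
  "nablaZ n s = (\<Sum>i\<le>n. let f = coeff s i in
       monom (dZ f) i
     + monom (kmult (of_nat i * f) psiZ) i
     - monom (kmult (of_nat i * f * constZ (1 / 12) * uZ) omegaZ) (i - 1)
     + monom (kmult (of_nat (n - i) * f) omegaZ) (i + 1)
     - monom (kmult (of_nat (n - i) * f) psiZ) i)"

text \<open>As \<open>Z\<close> is a curve, every 1-form is a cocycle.\<close>

definition H1dR :: "nat \<Rightarrow> (rat, kaehlerZ poly set) module" where
  "H1dR n = quot_module
     (submod (\<lambda>c. map_poly (kmult (constZ c))) (invariant_forms n))
     (nablaZ n ` invariant_sections n)"


section \<open>Group cohomology of \<open>SL\<^sub>2(\<int>)\<close>\<close>

definition SL2Z :: "(int^2^2) set" where "SL2Z = {\<gamma>. det \<gamma> = 1}"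

text \<open>
  An element of \<open>V\<^sub>n\<^sup>B \<otimes> \<complex> = Sym\<^sup>n(\<complex> a \<oplus> \<complex> b)\<close> is a polynomial of degree at most \<open>n\<close> whose
  \<open>i\<close>-th coefficient is the coefficient of \<open>a\<^sup>i b\<^sup>n\<^sup>-\<^sup>i\<close>. The action is
  \<open>a|\<gamma> = \<delta> a + c b\<close>, \<open>b|\<gamma> = \<beta> a + \<alpha> b\<close> for \<open>\<gamma> = (\<alpha>, \<beta>; c, \<delta>)\<close>.
\<close>

definition actB :: "nat \<Rightarrow> int^2^2 \<Rightarrow> complex poly \<Rightarrow> complex poly" where
  "actB n \<gamma> P = (\<Sum>i\<le>n. Polynomial.smult (coeff P i)
     ([:of_int (\<gamma>$2$1), of_int (\<gamma>$2$2):] ^ i * [:of_int (\<gamma>$1$1), of_int (\<gamma>$1$2):] ^ (n - i)))"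

definition coboundary :: "nat \<Rightarrow> complex poly \<Rightarrow> (int^2^2 \<Rightarrow> complex poly)" where
  "coboundary n P = (\<lambda>\<gamma>. if \<gamma> \<in> SL2Z then actB n \<gamma> P - P else 0)"

definition group_cocycles :: "nat \<Rightarrow> (int^2^2 \<Rightarrow> complex poly) set" where
  "group_cocycles n =
     {\<kappa>. (\<forall>\<gamma>\<in>SL2Z. degree (\<kappa> \<gamma>) \<le> n) \<and> (\<forall>\<gamma>. \<gamma> \<notin> SL2Z \<longrightarrow> \<kappa> \<gamma> = 0) \<and>
         (\<forall>\<gamma>\<in>SL2Z. \<forall>\<gamma>'\<in>SL2Z. \<kappa> (\<gamma> ** \<gamma>') = actB n \<gamma>' (\<kappa> \<gamma>) + \<kappa> \<gamma>')}"

definition H1grp :: "nat \<Rightarrow> (complex, (int^2^2 \<Rightarrow> complex poly) set) module" where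
  "H1grp n = quot_module
     (submod (\<lambda>c \<kappa> \<gamma>. Polynomial.smult c (\<kappa> \<gamma>)) (group_cocycles n))
     (coboundary n ` {P. degree P \<le> n})"


section \<open>Cohomology of \<open>\<M>\<^sub>1\<^sub>,\<^sub>1(\<complex>) = [\<HH> / SL\<^sub>2(\<int>)]\<close> in the local system of flat sections\<close>

text \<open>
  By the Poincare lemma the local system of flat sections is resolved by the holomorphic
  de Rham complex of \<open>\<V>\<^sub>n\<^sup>a\<^sup>n\<close>, whose terms are acyclic since \<open>\<M>\<^sub>1\<^sub>,\<^sub>1(\<complex>)\<close> is the quotient of
  the Stein manifold \<open>Z(\<complex>)\<close> by a finite group. On the upper half plane \<open>(\<V>\<^sub>n\<^sup>a\<^sup>n, \<nabla>)\<close> is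
  \<open>(\<O> \<otimes> V\<^sub>n\<^sup>B, d)\<close>, so \<open>H\<^sup>1\<close> is computed by the \<open>SL\<^sub>2(\<int>)\<close>-invariant holomorphic functions and
  1-forms with values in \<open>V\<^sub>n\<^sup>B \<otimes> \<complex>\<close>. A 1-form \<open>F dz\<close> is represented by \<open>F\<close>.
\<close>

definition upper_half :: "complex set" where "upper_half = {z. Im z > 0}"

definition moebius :: "int^2^2 \<Rightarrow> complex \<Rightarrow> complex" where
  "moebius \<gamma> z = (of_int (\<gamma>$1$1) * z + of_int (\<gamma>$1$2)) / (of_int (\<gamma>$2$1) * z + of_int (\<gamma>$2$2))"

definition hol :: "nat \<Rightarrow> (complex \<Rightarrow> complex poly) set" where
  "hol n = {F. (\<forall>z\<in>upper_half. degree (F z) \<le> n) \<and> (\<forall>z. z \<notin> upper_half \<longrightarrow> F z = 0) \<and>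
               (\<forall>i. (\<lambda>z. coeff (F z) i) holomorphic_on upper_half)}"

definition an_functions :: "nat \<Rightarrow> (complex \<Rightarrow> complex poly) set" where
  "an_functions n =
     {G \<in> hol n. \<forall>\<gamma>\<in>SL2Z. \<forall>z\<in>upper_half. actB n \<gamma> (G (moebius \<gamma> z)) = G z}"

definition an_forms :: "nat \<Rightarrow> (complex \<Rightarrow> complex poly) set" where
  "an_forms n =
     {F \<in> hol n. \<forall>\<gamma>\<in>SL2Z. \<forall>z\<in>upper_half.
        Polynomial.smult (1 / (of_int (\<gamma>$2$1) * z + of_int (\<gamma>$2$2)) ^ 2) (actB n \<gamma> (F (moebius \<gamma> z)))
          = F z}"

definition deriv_an :: "nat \<Rightarrow> (complex \<Rightarrow> complex poly) \<Rightarrow> (complex \<Rightarrow> complex poly)" where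
  "deriv_an n G =
     (\<lambda>z. if z \<in> upper_half then \<Sum>i\<le>n. monom (deriv (\<lambda>w. coeff (G w) i) z) i else 0)"

definition H1an :: "nat \<Rightarrow> (complex, (complex \<Rightarrow> complex poly) set) module" where
  "H1an n = quot_module
     (submod (\<lambda>c F z. Polynomial.smult c (F z)) (an_forms n))
     (deriv_an n ` an_functions n)"


section \<open>The uniformization \<open>\<rho>\<close> and the pullback of forms\<close>

fun bernoulli :: "nat \<Rightarrow> rat" where
  "bernoulli n = (if n = 0 then 1
     else - (\<Sum>k<n. of_nat ((n + 1) choose k) * bernoulli k) / of_nat (n + 1))"

declare bernoulli.simps [simp del]

text \<open>\<open>eisenstein_G k\<close> is \<open>G\<^sub>k\<close>, for even \<open>k\<close>.\<close>

definition eisenstein_G :: "nat \<Rightarrow> complex \<Rightarrow> complex" where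
  "eisenstein_G k z = - of_rat (bernoulli k) / of_nat (2 * k) +
     suminf (\<lambda>m. of_nat (\<Sum>d | d dvd Suc m. d ^ (k - 1)) * exp (2 * pi * \<i> * z) ^ Suc m)"

definition rho_u :: "complex \<Rightarrow> complex" where "rho_u z = 20 * eisenstein_G 4 z"
definition rho_v :: "complex \<Rightarrow> complex" where "rho_v z = 7 / 3 * eisenstein_G 6 z"
definition rho_Delta :: "complex \<Rightarrow> complex" where
  "rho_Delta z = rho_u z ^ 3 - 27 * rho_v z ^ 2"

text \<open>The coefficients of \<open>dz\<close> in \<open>\<rho>\<^sup>*\<psi>\<close> and \<open>\<rho>\<^sup>*\<omega>\<close>.\<close>

definition rho_psi :: "complex \<Rightarrow> complex" where
  "rho_psi z = 1 / 12 * deriv rho_Delta z / rho_Delta z"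

definition rho_omega :: "complex \<Rightarrow> complex" where
  "rho_omega z =
     3 / 2 * (2 * rho_u z * deriv rho_v z - 3 * rho_v z * deriv rho_u z) / rho_Delta z"

text \<open>
  The frame \<open>T\<close>, \<open>S\<close> in terms of \<open>a\<close>, \<open>b\<close>. Here \<open>T = 2\<pi>i (z a - b)\<close>, and \<open>S\<close> is then
  determined by \<open>dT = \<omega> S - \<psi> T\<close>.
\<close>

definition frame_T :: "complex \<Rightarrow> complex poly" where
  "frame_T z = [:- 2 * pi * \<i>, 2 * pi * \<i> * z:]"

definition frame_S :: "complex \<Rightarrow> complex poly" where
  "frame_S z = Polynomial.smult (1 / rho_omega z)
     ([:0, 2 * pi * \<i>:] + Polynomial.smult (rho_psi z) (frame_T z))"

text \<open>
  A lift \<open>z \<mapsto> \<lambda>(z)\<cdot>\<rho>(z)\<close> of the upper half plane to \<open>Z(\<complex>)\<close>. Two choices of \<open>\<lambda>\<close> differ by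
  a twelfth root of unity, so the pullback of invariant forms does not depend on the choice.
\<close>

definition lam :: "complex \<Rightarrow> complex" where
  "lam = (SOME l. l holomorphic_on upper_half \<and> (\<forall>z\<in>upper_half. l z ^ 12 * rho_Delta z = 1))"

definition lift_u :: "complex \<Rightarrow> complex" where "lift_u z = lam z ^ 4 * rho_u z"
definition lift_v :: "complex \<Rightarrow> complex" where "lift_v z = lam z ^ 6 * rho_v z"

text \<open>
  Under the equivariant structure of \<open>\<V>\<close> the frame \<open>S\<close>, \<open>T\<close> at \<open>\<lambda>(z)\<cdot>\<rho>(z)\<close> corresponds to
  \<open>\<lambda>(z) S\<close>, \<open>\<lambda>(z)\<^sup>-\<^sup>1 T\<close> at \<open>\<rho>(z)\<close>.
\<close>

definition pullback :: "nat \<Rightarrow> kaehlerZ poly \<Rightarrow> (complex \<Rightarrow> complex poly)" where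
  "pullback n \<theta> = (\<lambda>z. if z \<in> upper_half then
     \<Sum>i\<le>n. Polynomial.smult
       (eval_kaehlerZ (coeff \<theta> i) (lift_u z) (lift_v z) (deriv lift_u z) (deriv lift_v z))
       (Polynomial.smult (lam z) (frame_S z) ^ i *
        Polynomial.smult (1 / lam z) (frame_T z) ^ (n - i))
     else 0)"


section \<open>The comparison isomorphism\<close>

text \<open>
  Maps out of quotients are given on representatives; \<open>the_elem\<close> picks the common value
  at all representatives of a class.
\<close>

definition pullback_class :: "nat \<Rightarrow> kaehlerZ poly set \<Rightarrow> (complex \<Rightarrow> complex poly) set" where
  "pullback_class n X = the_elem
     ((\<lambda>\<theta>. deriv_an n ` an_functions n
             +>\<^bsub>submod (\<lambda>c F z. Polynomial.smult c (F z)) (an_forms n)\<^esub> pullback n \<theta>) ` X)"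

definition grothendieck ::
    "nat \<Rightarrow> (kaehlerZ poly set \<Rightarrow>\<^sub>0 complex) set \<Rightarrow> (complex \<Rightarrow> complex poly) set" where
  "grothendieck n X = the_elem
     ((\<lambda>f. finsum (H1an n)
        (\<lambda>x. Poly_Mapping.lookup f x \<odot>\<^bsub>H1an n\<^esub> pullback_class n x) (Poly_Mapping.keys f)) ` X)"

text \<open>
  The class of an invariant form \<open>F dz\<close> with primitive \<open>G\<close> goes to the class of the cocycle
  \<open>\<gamma> \<mapsto> G|\<gamma> - G\<close>, which is the integral of \<open>F dz\<close> from \<open>\<gamma>\<^sup>-\<^sup>1 z\<^sub>0\<close> to \<open>z\<^sub>0\<close> if \<open>G(z\<^sub>0) = 0\<close>. This is
  the connecting homomorphism of \<open>0 \<rightarrow> V\<^sub>n\<^sup>B \<otimes> \<complex> \<rightarrow> hol n \<rightarrow> hol n dz \<rightarrow> 0\<close>.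
\<close>

definition is_period_cocycle ::
    "nat \<Rightarrow> (complex \<Rightarrow> complex poly) \<Rightarrow> (int^2^2 \<Rightarrow> complex poly) \<Rightarrow> bool" where
  "is_period_cocycle n F \<kappa> \<longleftrightarrow> \<kappa> \<in> group_cocycles n \<and>
     (\<exists>G\<in>hol n. deriv_an n G = F \<and>
        (\<forall>\<gamma>\<in>SL2Z. \<forall>z\<in>upper_half. \<kappa> \<gamma> = actB n \<gamma> (G (moebius \<gamma> z)) - G z))"

definition orbifold_to_group ::
    "nat \<Rightarrow> (complex \<Rightarrow> complex poly) set \<Rightarrow> (int^2^2 \<Rightarrow> complex poly) set" where
  "orbifold_to_group n X = the_elem
     {coboundary n ` {P. degree P \<le> n}
        +>\<^bsub>submod (\<lambda>c \<kappa> \<gamma>. Polynomial.smult c (\<kappa> \<gamma>)) (group_cocycles n)\<^esub> \<kappa>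
      | \<kappa> F. F \<in> X \<and> is_period_cocycle n F \<kappa>}"

definition comp_B_dR ::
    "nat \<Rightarrow> (kaehlerZ poly set \<Rightarrow>\<^sub>0 complex) set \<Rightarrow> (int^2^2 \<Rightarrow> complex poly) set" where
  "comp_B_dR n = orbifold_to_group n \<circ> grothendieck n"

end

theory Submission
  imports Defs "HOL-Complex_Analysis.Complex_Analysis" "HOL-Real_Asymp.Real_Asymp"
begin

text \<open>
  Algebraic de Rham cohomology and group cohomology are compared through a third space: invariant
  holomorphic forms on \<open>\<HH>\<close> with values in \<open>Sym\<^sup>n\<close>, modulo derivatives of invariant
  functions.

  Periods. An invariant form has a primitive on \<open>\<HH>\<close>, and the failure of the primitive to be
  invariant is a cocycle. This map is injective on classes for trivial reasons: if the cocycle is a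
  coboundary, the primitive can be shifted by a constant so as to become invariant
  (\<open>per_coboundary_iff\<close>). So all three isomorphisms follow from two facts about algebraic forms, that
  is, complex combinations of pullbacks of invariant forms on \<open>Z\<close>.

  (1) If an algebraic form is the derivative of an invariant holomorphic function \<open>G\<close>, it is the
  derivative of an algebraic one (\<open>exact_algebraic_forms\<close>). Indeed the coefficients of an algebraic
  form grow at the cusp at most like \<open>\<bar>q\<bar>\<^sup>-\<^sup>N\<close> times a power of the height, integration preserves this
  bound, and in the frame \<open>S, T\<close> the coordinates of \<open>G\<close> transform like modular forms. Multiplied by
  \<open>\<Delta>\<^sup>N\<close> they are modular forms of level one, hence polynomials in \<open>u\<close>, \<open>v\<close>, \<open>\<Delta>\<close>
  (\<open>modform_induct\<close>), and \<open>G\<close> is algebraic (\<open>algebraic_primitive\<close>).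

  (2) Every cocycle is cohomologous to the period cocycle of an algebraic form
  (\<open>cocycles_are_algebraic_periods\<close>). For odd \<open>n\<close> the element \<open>-1\<close> makes every cocycle a coboundary.
  For \<open>n = 2h\<close> dimensions are counted. A cocycle is determined by its values at the elements \<open>S\<close> and \<open>U\<close>
  of order \<open>4\<close> and \<open>6\<close>, which lie in sums of eigenspaces of known dimension
  (\<open>cocycle_eigenvectors\<close>). On the other side are the constants and the primitives of the
  algebraic forms of pole order bounded by \<open>h\<close>; by (1) those of period zero are algebraic sections of
  bounded pole order. Counting monomials shows that the image has at least the dimension of the
  target (\<open>dimension_count\<close>).

  The passage to \<open>\<otimes> \<complex>\<close> uses moreover that the monomial forms remain linearly independent over \<open>\<complex>\<close>
  (\<open>forms_independent\<close>), which follows from their different growth along the imaginary axis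
  (\<open>rational_form.tensor_iso\<close>, \<open>grothendieck_iso\<close>).

  What is needed about the uniformization is proved from its definition by \<open>q\<close>-series: modularity of
  \<open>u\<close> and \<open>v\<close> by Lipschitz's formula and lattice sums (\<open>rho_S\<close>), \<open>\<Delta> \<noteq> 0\<close> by a numerical estimate on
  the fundamental domain (\<open>rho_Delta_nonzero\<close>), and Ramanujan's differential equations
  (\<open>rho_omega_eq\<close>, \<open>deriv_rho_psi\<close>), by which the pullback of the Gauss-Manin connection is \<open>d\<close>
  (\<open>deriv_pullsec\<close>).
\<close>

unbundle no fps_syntax
hide_const (open) module.smult

abbreviation upper_half_plane ("\<HH>") where "\<HH> \<equiv> upper_half"
abbreviation "tpi \<equiv> 2 * complex_of_real pi * \<i>"
abbreviation "keys \<equiv> Poly_Mapping.keys"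
abbreviation "single \<equiv> Poly_Mapping.single"
abbreviation "lookup \<equiv> Poly_Mapping.lookup"

section \<open>The modular group and its action on the upper half plane\<close>

definition mat2 :: "int \<Rightarrow> int \<Rightarrow> int \<Rightarrow> int \<Rightarrow> int^2^2" where
  "mat2 a b c d = vector [vector [a, b], vector [c, d]]"

abbreviation ea :: "int^2^2 \<Rightarrow> int" where "ea \<gamma> \<equiv> \<gamma> $ 1 $ 1"
abbreviation eb :: "int^2^2 \<Rightarrow> int" where "eb \<gamma> \<equiv> \<gamma> $ 1 $ 2"
abbreviation ec :: "int^2^2 \<Rightarrow> int" where "ec \<gamma> \<equiv> \<gamma> $ 2 $ 1"
abbreviation ed :: "int^2^2 \<Rightarrow> int" where "ed \<gamma> \<equiv> \<gamma> $ 2 $ 2"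

lemma mat2_sel [simp]:
  "ea (mat2 a b c d) = a" "eb (mat2 a b c d) = b"
  "ec (mat2 a b c d) = c" "ed (mat2 a b c d) = d"
  by (simp_all add: mat2_def)

lemma mat2_eq_iff:
  "\<gamma> = \<gamma>' \<longleftrightarrow> ea \<gamma> = ea \<gamma>' \<and> eb \<gamma> = eb \<gamma>' \<and> ec \<gamma> = ec \<gamma>' \<and> ed \<gamma> = (ed \<gamma>')"
  unfolding vec_eq_iff forall_2 by blast

lemma mat2_mult_sel [simp]:
  "ea (\<gamma> ** \<gamma>') = ea \<gamma> * ea \<gamma>' + eb \<gamma> * ec \<gamma>'"
  "eb (\<gamma> ** \<gamma>') = ea \<gamma> * eb \<gamma>' + eb \<gamma> * ed \<gamma>'"
  "ec (\<gamma> ** \<gamma>') = ec \<gamma> * ea \<gamma>' + ed \<gamma> * ec \<gamma>'"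
  "ed (\<gamma> ** \<gamma>') = ec \<gamma> * eb \<gamma>' + ed \<gamma> * ed \<gamma>'"
  by (simp_all add: matrix_matrix_mult_def sum_2)

lemma SL2Z_iff: "\<gamma> \<in> SL2Z \<longleftrightarrow> ea \<gamma> * ed \<gamma> - eb \<gamma> * ec \<gamma> = 1"
  by (simp add: SL2Z_def det_2)

lemma SL2Z_mult: "\<gamma> \<in> SL2Z \<Longrightarrow> \<gamma>' \<in> SL2Z \<Longrightarrow> \<gamma> ** \<gamma>' \<in> SL2Z"
  by (simp add: SL2Z_def det_mul)

definition SI :: "int^2^2" where "SI = mat2 1 0 0 1"
definition SS :: "int^2^2" where "SS = mat2 0 (-1) 1 0"
definition ST :: "int \<Rightarrow> int^2^2" where "ST m = mat2 1 m 0 1"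

lemma SL2Z_gens [simp]: "SI \<in> SL2Z" "SS \<in> SL2Z" "ST m \<in> SL2Z"
  by (simp_all add: SL2Z_iff SI_def SS_def ST_def)

text \<open>
  Generation of the modular group by \<open>S\<close> and \<open>T\<close>, by Euclid's algorithm on the lower row: a power of
  \<open>T\<close> followed by \<open>S\<close> replaces \<open>c\<close> by \<open>d mod c\<close>.
\<close>

lemma SL2Z_induct [consumes 1, case_names one S T T']:
  assumes "\<gamma> \<in> SL2Z"
    and one: "P SI"
    and S: "\<And>\<gamma>. \<gamma> \<in> SL2Z \<Longrightarrow> P \<gamma> \<Longrightarrow> P (\<gamma> ** SS)"
    and T: "\<And>\<gamma>. \<gamma> \<in> SL2Z \<Longrightarrow> P \<gamma> \<Longrightarrow> P (\<gamma> ** ST 1)"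
    and T': "\<And>\<gamma>. \<gamma> \<in> SL2Z \<Longrightarrow> P \<gamma> \<Longrightarrow> P (\<gamma> ** ST (-1))"
  shows "P \<gamma>"
proof -
  have Tm: "P (\<gamma> ** ST m)" if "\<gamma> \<in> SL2Z" "P \<gamma>" for \<gamma> m
  proof (induction m rule: int_induct[where k = 0])
    case base
    have "\<gamma> ** ST 0 = \<gamma>" by (simp add: mat2_eq_iff ST_def)
    then show ?case using that by simp
  next
    case (step1 i)
    have "\<gamma> ** ST (i + 1) = (\<gamma> ** ST i) ** ST 1"
      by (simp add: mat2_eq_iff ST_def algebra_simps)
    then show ?case using T[OF SL2Z_mult[OF that(1), of "ST i"]] step1 by simp
  next
    case (step2 i)
    have "\<gamma> ** ST (i - 1) = (\<gamma> ** ST i) ** ST (-1)"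
      by (simp add: mat2_eq_iff ST_def algebra_simps)
    then show ?case using T'[OF SL2Z_mult[OF that(1), of "ST i"]] step2 by simp
  qed
  have S3: "P (((\<gamma> ** SS) ** SS) ** SS)" if "\<gamma> \<in> SL2Z" "P \<gamma>" for \<gamma>
    using that by (intro S SL2Z_mult SL2Z_gens)
  from assms(1) show ?thesis
  proof (induction "nat \<bar>ec \<gamma>\<bar>" arbitrary: \<gamma> rule: less_induct)
    case less
    let ?a = "ea \<gamma>" and ?b = "eb \<gamma>" and ?c = "ec \<gamma>" and ?d = "ed \<gamma>"
    show ?case
    proof (cases "?c = 0")
      case True
      then have ad: "?a * ?d = 1" using less.prems by (simp add: SL2Z_iff)
      then consider "?a = 1" "?d = 1" | "?a = -1" "?d = -1"
        by (auto simp: zmult_eq_1_iff)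
      then show ?thesis
      proof cases
        case 1
        then have "\<gamma> = SI ** ST ?b"
          using True by (simp add: mat2_eq_iff SI_def ST_def)
        then show ?thesis using Tm[OF SL2Z_gens(1) one, of ?b] by simp
      next
        case 2
        then have "\<gamma> = ((SI ** SS) ** SS) ** ST (- ?b)"
          using True by (simp add: mat2_eq_iff SI_def SS_def ST_def)
        moreover have "P (((SI ** SS) ** SS) ** ST (- ?b))"
          by (intro Tm S SL2Z_mult SL2Z_gens one)
        ultimately show ?thesis by simp
      qed
    next
      case False
      define m where "m = - (?d div ?c)"
      define \<gamma>' where "\<gamma>' = (\<gamma> ** ST m) ** SS"
      have \<gamma>': "\<gamma>' \<in> SL2Z" unfolding \<gamma>'_def by (intro SL2Z_mult less.prems SL2Z_gens)
      have "ec \<gamma>' = ?d mod ?c"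
        by (simp add: \<gamma>'_def ST_def SS_def m_def minus_div_mult_eq_mod [symmetric] algebra_simps)
      then have "nat \<bar>ec \<gamma>'\<bar> < nat \<bar>?c\<bar>"
        using abs_mod_less[OF False, of ?d] by simp
      from less.hyps[OF this \<gamma>'] have "P \<gamma>'" .
      then have "P ((((\<gamma>' ** SS) ** SS) ** SS) ** ST (- m))"
        using \<gamma>' by (intro Tm S3 SL2Z_mult SL2Z_gens)
      moreover have "(((\<gamma>' ** SS) ** SS) ** SS) ** ST (- m) = \<gamma>"
        by (simp add: mat2_eq_iff \<gamma>'_def ST_def SS_def algebra_simps)
      ultimately show ?thesis by simp
    qed
  qed
qed

definition jfac :: "int^2^2 \<Rightarrow> complex \<Rightarrow> complex" where
  "jfac \<gamma> z = of_int (ec \<gamma>) * z + of_int (ed \<gamma>)"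

lemma moebius_alt: "moebius \<gamma> z = (of_int (ea \<gamma>) * z + of_int (eb \<gamma>)) / jfac \<gamma> z"
  by (simp add: moebius_def jfac_def)

lemma upper_half_iff: "z \<in> \<HH> \<longleftrightarrow> Im z > 0"
  by (simp add: upper_half_def)

lemma open_upper_half: "open \<HH>"
  by (simp add: upper_half_def open_halfspace_Im_gt)

lemma convex_upper_half: "convex \<HH>"
  by (simp add: upper_half_def convex_halfspace_Im_gt)

lemma i_upper_half [simp]: "\<i> \<in> \<HH>"
  by (simp add: upper_half_def)

lemma jfac_nonzero:
  assumes "\<gamma> \<in> SL2Z" "z \<in> \<HH>"
  shows "jfac \<gamma> z \<noteq> 0"
proof
  assume 0: "jfac \<gamma> z = 0"
  then have "Im (jfac \<gamma> z) = 0" by simp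
  then have "ec \<gamma> = 0" using assms by (simp add: jfac_def upper_half_iff)
  with 0 have "ed \<gamma> = 0" by (simp add: jfac_def)
  with \<open>ec \<gamma> = 0\<close> assms(1) show False by (simp add: SL2Z_iff)
qed

lemma SL2Z_det_of_int:
  assumes "\<gamma> \<in> SL2Z"
  shows "of_int (ea \<gamma>) * of_int (ed \<gamma>) - of_int (eb \<gamma>) * of_int (ec \<gamma>) = (1 :: 'a::ring_1)"
proof -
  have "of_int (ea \<gamma> * ed \<gamma> - eb \<gamma> * ec \<gamma>) = (1 :: 'a)"
    using assms by (simp only: SL2Z_iff of_int_1)
  then show ?thesis by (simp only: of_int_diff of_int_mult)
qed

lemma Im_moebius:
  assumes "\<gamma> \<in> SL2Z" "z \<in> \<HH>"
  shows "Im (moebius \<gamma> z) = Im z / norm (jfac \<gamma> z) ^ 2"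
proof -
  let ?a = "real_of_int (ea \<gamma>)" and ?b = "real_of_int (eb \<gamma>)"
  let ?c = "real_of_int (ec \<gamma>)" and ?d = "real_of_int (ed \<gamma>)"
  have det: "?a * ?d - ?b * ?c = 1"
    by (rule SL2Z_det_of_int[OF assms(1)])
  have "Im (moebius \<gamma> z) = (?a * Im z * (?c * Re z + ?d) - (?a * Re z + ?b) * (?c * Im z)) / norm (jfac \<gamma> z) ^ 2"
    by (simp add: moebius_alt Im_divide cmod_power2 jfac_def)
  also have "?a * Im z * (?c * Re z + ?d) - (?a * Re z + ?b) * (?c * Im z) = (?a * ?d - ?b * ?c) * Im z"
    by (simp add: algebra_simps)
  finally show ?thesis by (simp only: det mult_1)
qed

lemma moebius_upper_half:
  assumes "\<gamma> \<in> SL2Z" "z \<in> \<HH>"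
  shows "moebius \<gamma> z \<in> \<HH>"
  using Im_moebius[OF assms] jfac_nonzero[OF assms] assms(2) by (simp add: upper_half_iff)

lemma moebius_jfac:
  assumes "\<gamma> \<in> SL2Z" "z \<in> \<HH>"
  shows "moebius \<gamma> z * jfac \<gamma> z = of_int (ea \<gamma>) * z + of_int (eb \<gamma>)"
  using jfac_nonzero[OF assms] by (simp add: moebius_alt)

lemma jfac_mult:
  assumes "\<gamma>' \<in> SL2Z" "z \<in> \<HH>"
  shows "jfac (\<gamma> ** \<gamma>') z = jfac \<gamma> (moebius \<gamma>' z) * jfac \<gamma>' z"
proof -
  have "jfac \<gamma> (moebius \<gamma>' z) * jfac \<gamma>' z = of_int (ec \<gamma>) * (moebius \<gamma>' z * jfac \<gamma>' z) + of_int (ed \<gamma>) * jfac \<gamma>' z"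
    by (simp add: jfac_def[of \<gamma>] distrib_right)
  also have "\<dots> = jfac (\<gamma> ** \<gamma>') z"
    unfolding moebius_jfac[OF assms] by (simp add: jfac_def algebra_simps)
  finally show ?thesis by simp
qed

lemma moebius_mult:
  assumes "\<gamma> \<in> SL2Z" "\<gamma>' \<in> SL2Z" "z \<in> \<HH>"
  shows "moebius (\<gamma> ** \<gamma>') z = moebius \<gamma> (moebius \<gamma>' z)"
proof -
  have nz: "jfac \<gamma>' z \<noteq> 0" "jfac \<gamma> (moebius \<gamma>' z) \<noteq> 0"
    using assms jfac_nonzero moebius_upper_half by blast+
  have "moebius (\<gamma> ** \<gamma>') z * jfac (\<gamma> ** \<gamma>') z = of_int (ea (\<gamma> ** \<gamma>')) * z + of_int (eb (\<gamma> ** \<gamma>'))"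
    by (rule moebius_jfac[OF SL2Z_mult[OF assms(1,2)] assms(3)])
  also have "\<dots> = of_int (ea \<gamma>) * (moebius \<gamma>' z * jfac \<gamma>' z) + of_int (eb \<gamma>) * jfac \<gamma>' z"
    unfolding moebius_jfac[OF assms(2,3)] by (simp add: jfac_def algebra_simps)
  also have "\<dots> = (of_int (ea \<gamma>) * moebius \<gamma>' z + of_int (eb \<gamma>)) * jfac \<gamma>' z"
    by (simp add: distrib_right)
  also have "\<dots> = (moebius \<gamma> (moebius \<gamma>' z) * jfac \<gamma> (moebius \<gamma>' z)) * jfac \<gamma>' z"
    by (simp only: moebius_jfac[OF assms(1) moebius_upper_half[OF assms(2,3)]])
  also have "\<dots> = moebius \<gamma> (moebius \<gamma>' z) * jfac (\<gamma> ** \<gamma>') z"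
    by (simp add: jfac_mult[OF assms(2,3)])
  finally show ?thesis using nz by (simp add: jfac_mult[OF assms(2,3)])
qed

lemma moebius_gens:
  "moebius SI z = z" "moebius SS z = - 1 / z" "moebius (ST m) z = z + of_int m"
  "jfac SI z = 1" "jfac SS z = z" "jfac (ST m) z = 1"
  by (simp_all add: moebius_def jfac_def SI_def SS_def ST_def)

lemma moebius_has_derivative:
  assumes "\<gamma> \<in> SL2Z" "z \<in> \<HH>"
  shows "(moebius \<gamma> has_field_derivative 1 / jfac \<gamma> z ^ 2) (at z)"
proof -
  have det: "complex_of_int (ea \<gamma>) * of_int (ed \<gamma>) - of_int (eb \<gamma>) * of_int (ec \<gamma>) = 1"
    by (rule SL2Z_det_of_int[OF assms(1)])
  have "(moebius \<gamma> has_field_derivative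
      (of_int (ea \<gamma>) * jfac \<gamma> z - (of_int (ea \<gamma>) * z + of_int (eb \<gamma>)) * of_int (ec \<gamma>))
       / (jfac \<gamma> z * jfac \<gamma> z)) (at z)"
    unfolding moebius_alt[abs_def] using jfac_nonzero[OF assms]
    by (auto intro!: derivative_eq_intros simp: jfac_def)
  also have "of_int (ea \<gamma>) * jfac \<gamma> z - (of_int (ea \<gamma>) * z + of_int (eb \<gamma>)) * of_int (ec \<gamma>)
     = complex_of_int (ea \<gamma>) * of_int (ed \<gamma>) - of_int (eb \<gamma>) * of_int (ec \<gamma>)"
    by (simp add: jfac_def algebra_simps)
  finally show ?thesis by (simp add: det power2_eq_square)
qed

text \<open>
  Among the translates of \<open>z\<close> one has the largest imaginary part, because only finitely many
  \<open>(c, d)\<close> satisfy \<open>\<bar>c z + d\<bar> \<le> 1\<close>. After a translation by an integer its real part is at most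
  \<open>1/2\<close> in absolute value, and it has absolute value at least \<open>1\<close> since \<open>S\<close> does not increase
  the imaginary part.
\<close>

lemma fundamental_domain:
  assumes z: "z \<in> \<HH>"
  obtains \<gamma> where "\<gamma> \<in> SL2Z" "Im (moebius \<gamma> z) \<ge> sqrt 3 / 2"
proof -
  define y where "y = Im z"
  have y: "y > 0" using z by (simp add: y_def upper_half_iff)
  define B where "B = \<lceil>1 / y\<rceil>"
  define D where "D = \<lceil>1 + of_int B * norm z\<rceil>"
  define A where "A = {(ec \<gamma>, ed \<gamma>) | \<gamma>. \<gamma> \<in> SL2Z \<and> norm (jfac \<gamma> z) \<le> 1}"
  have "A \<subseteq> {-B..B} \<times> {-D..D}"
  proof
    fix p assume "p \<in> A"
    then obtain \<gamma> where p: "p = (ec \<gamma>, ed \<gamma>)" and le: "norm (jfac \<gamma> z) \<le> 1"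
      unfolding A_def by blast
    have "\<bar>real_of_int (ec \<gamma>)\<bar> * y = \<bar>Im (jfac \<gamma> z)\<bar>"
      using y by (simp add: jfac_def y_def abs_mult)
    also have "\<dots> \<le> 1" using le abs_Im_le_cmod order_trans by blast
    finally have "\<bar>real_of_int (ec \<gamma>)\<bar> \<le> 1 / y" using y by (simp add: field_simps)
    then have "\<bar>real_of_int (ec \<gamma>)\<bar> \<le> of_int B" unfolding B_def by linarith
    then have c: "\<bar>ec \<gamma>\<bar> \<le> B" by linarith
    have "norm (of_int (ed \<gamma>) :: complex) \<le> norm (jfac \<gamma> z) + norm (of_int (ec \<gamma>) * z)"
      unfolding jfac_def by (metis add_diff_cancel_left' norm_triangle_ineq4 add.commute)
    also have "\<dots> \<le> 1 + of_int B * norm z"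
      using le c by (intro add_mono) (auto simp: norm_mult intro!: mult_right_mono)
    finally have "\<bar>real_of_int (ed \<gamma>)\<bar> \<le> of_int D" unfolding D_def
      by simp linarith
    then have "\<bar>ed \<gamma>\<bar> \<le> D" by linarith
    with c show "p \<in> {-B..B} \<times> {-D..D}" by (auto simp: p)
  qed
  then have fin: "finite A" by (rule finite_subset) simp
  have "(0, 1) \<in> A"
    unfolding A_def by (rule CollectI, rule exI[of _ SI]) (simp add: moebius_gens SI_def[symmetric], simp add: SI_def)
  then have ne: "A \<noteq> {}" by auto
  define g where "g = (\<lambda>(c::int, d::int). norm (of_int c * z + of_int d))"
  obtain p where p: "p \<in> A" "\<And>p'. p' \<in> A \<Longrightarrow> g p \<le> g p'"
    using fin ne arg_min_if_finite(1)[OF fin ne, of g] arg_min_least[OF fin ne, of _ g] by blast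
  obtain \<gamma> where \<gamma>: "\<gamma> \<in> SL2Z" "norm (jfac \<gamma> z) \<le> 1" and "p = (ec \<gamma>, ed \<gamma>)"
    using p(1) unfolding A_def by blast
  then have gp: "g p = norm (jfac \<gamma> z)" by (simp add: g_def jfac_def)
  have min: "norm (jfac \<gamma> z) \<le> norm (jfac \<gamma>' z)" if "\<gamma>' \<in> SL2Z" for \<gamma>'
  proof (cases "norm (jfac \<gamma>' z) \<le> 1")
    case True
    then have "(ec \<gamma>', ed \<gamma>') \<in> A" using that unfolding A_def by blast
    from p(2)[OF this] show ?thesis unfolding gp by (simp add: g_def jfac_def)
  next
    case False
    then show ?thesis using \<gamma>(2) by linarith
  qed
  define w where "w = moebius \<gamma> z"
  define m where "m = - round (Re w)"
  define \<gamma>1 where "\<gamma>1 = ST m ** \<gamma>"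
  have \<gamma>1: "\<gamma>1 \<in> SL2Z" unfolding \<gamma>1_def using \<gamma>(1) by (intro SL2Z_mult) auto
  have j1: "jfac \<gamma>1 z = jfac \<gamma> z" unfolding \<gamma>1_def using \<gamma>(1) z by (simp add: jfac_mult moebius_gens)
  define w1 where "w1 = moebius \<gamma>1 z"
  have w1: "w1 = w + of_int m" unfolding w1_def \<gamma>1_def using \<gamma>(1) z
    by (simp add: moebius_mult w_def moebius_gens)
  have w1H: "w1 \<in> \<HH>" unfolding w1_def by (rule moebius_upper_half[OF \<gamma>1 z])
  have Re: "\<bar>Re w1\<bar> \<le> 1/2"
    unfolding w1 m_def using of_int_round_abs_le[of "Re w"] by (simp add: abs_minus_commute)
  have "norm (jfac \<gamma> z) \<le> norm (jfac (SS ** \<gamma>1) z)" by (intro min SL2Z_mult \<gamma>1) auto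
  also have "\<dots> = norm w1 * norm (jfac \<gamma> z)"
    using \<gamma>1 z by (simp add: jfac_mult moebius_gens w1_def[symmetric] norm_mult j1)
  finally have "norm w1 \<ge> 1" using jfac_nonzero[OF \<gamma>(1) z] by simp
  then have "1 \<le> norm w1 ^ 2" by (simp add: one_le_power)
  then have "1 \<le> Re w1 ^ 2 + Im w1 ^ 2" by (simp only: cmod_power2)
  moreover have "Re w1 ^ 2 \<le> (1/2)^2" using power_mono[OF Re, of 2] by simp
  ultimately have "Im w1 ^ 2 \<ge> 3/4" by (simp add: power2_eq_square)
  then have "sqrt (3/4) \<le> Im w1" using w1H by (intro real_le_lsqrt) (auto simp: upper_half_iff)
  then have "Im w1 \<ge> sqrt 3 / 2" by (simp add: real_sqrt_divide)
  then show ?thesis using that[OF \<gamma>1] by (simp add: w1_def)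
qed

section \<open>Symmetric powers as binary forms\<close>

lemma smult_sum_right: "smult (d::complex) (sum f A) = (\<Sum>x\<in>A. smult d (f x))"
  by (induction A rule: infinite_finite_induct) (simp_all add: smult_add_right)

lemma power_smult: "smult (a :: complex) P ^ k = smult (a ^ k) (P ^ k)"
  by (induction k) (simp_all add: mult_ac)

lemma powi_balanced:
  assumes "(x::complex) \<noteq> 0" "i \<le> n"
  shows "x powi (2 * int i - int n) = x ^ i * (1 / x) ^ (n - i)"
proof -
  have "2 * int i - int n = int i + - int (n - i)" using assms(2) by simp
  moreover have "x powi (int i + - int (n - i)) = x powi int i * x powi (- int (n - i))"
    by (rule power_int_add) (use assms(1) in simp)
  ultimately have "x powi (2 * int i - int n) = x powi int i * x powi (- int (n - i))" by metis
  then show ?thesis by (simp add: power_int_minus power_one_over inverse_eq_divide)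
qed

text \<open>
  The substitution \<open>a \<mapsto> r b + s a\<close>, \<open>b \<mapsto> p b + q a\<close> with complex entries: besides the action of
  the modular group it covers the change between the frame \<open>a, b\<close> and the frame \<open>S, T\<close>, and the
  diagonalisation of elements of finite order.
\<close>

definition cact :: "nat \<Rightarrow> complex \<Rightarrow> complex \<Rightarrow> complex \<Rightarrow> complex \<Rightarrow> complex poly \<Rightarrow> complex poly" where
  "cact n p q r s P = (\<Sum>i\<le>n. smult (coeff P i) ([:r, s:] ^ i * [:p, q:] ^ (n - i)))"

lemma actB_cact:
  "actB n \<gamma> = cact n (of_int (ea \<gamma>)) (of_int (eb \<gamma>)) (of_int (ec \<gamma>)) (of_int (ed \<gamma>))"
  by (simp add: fun_eq_iff actB_def cact_def)

lemma cact_add: "cact n p q r s (P + Q) = cact n p q r s P + cact n p q r s Q"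
  by (simp add: cact_def smult_add_left sum.distrib)

lemma cact_smult: "cact n p q r s (smult c P) = smult c (cact n p q r s P)"
  by (simp add: cact_def smult_sum_right)

lemma cact_0 [simp]: "cact n p q r s 0 = 0"
  by (simp add: cact_def)

lemma cact_diff: "cact n p q r s (P - Q) = cact n p q r s P - cact n p q r s Q"
  by (simp add: cact_def smult_diff_left sum_subtractf)

lemma cact_minus: "cact n p q r s (- Q) = - cact n p q r s Q"
  using cact_diff[of n p q r s 0 Q] by simp

lemma cact_sum: "cact n p q r s (sum f A) = (\<Sum>x\<in>A. cact n p q r s (f x))"
  by (induction A rule: infinite_finite_induct) (simp_all add: cact_add)

lemma degree_linear_powers:
  fixes A B :: "complex poly"
  assumes "degree A \<le> 1" "degree B \<le> 1" "i \<le> n"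
  shows "degree (A ^ i * B ^ (n - i)) \<le> n"
proof -
  have "degree (A ^ i * B ^ (n - i)) \<le> degree A * i + degree B * (n - i)"
    by (meson add_mono degree_mult_le degree_power_le order_trans)
  also have "\<dots> \<le> 1 * i + 1 * (n - i)" using assms by (intro add_mono mult_right_mono) auto
  finally show ?thesis using assms(3) by simp
qed

lemma degree_cact: "degree (cact n p q r s P) \<le> n"
  unfolding cact_def
  by (intro degree_sum_le) (auto intro!: order.trans[OF degree_smult_le] degree_linear_powers)

lemma poly_eq_sum_le:
  fixes P :: "'a::comm_semiring_1 poly"
  assumes "degree P \<le> n" shows "poly P x = (\<Sum>i\<le>n. coeff P i * x ^ i)"
proof -
  have "poly P x = (\<Sum>i\<le>degree P. coeff P i * x ^ i)" by (rule poly_altdef)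
  also have "\<dots> = (\<Sum>i\<le>n. coeff P i * x ^ i)"
    using assms by (intro sum.mono_neutral_left) (auto simp: coeff_eq_0)
  finally show ?thesis .
qed

text \<open>
  In terms of values, the action is substitution of a fractional linear expression. The composition
  and multiplicativity laws below follow by comparing values outside the zeros of denominators.
\<close>

lemma poly_cact:
  assumes "degree P \<le> n" "p + q * x \<noteq> 0"
  shows "poly (cact n p q r s P) x = (p + q * x) ^ n * poly P ((r + s * x) / (p + q * x))"
proof -
  have "(r + s * x) ^ i * (p + q * x) ^ (n - i) = (p + q * x) ^ n * ((r + s * x) / (p + q * x)) ^ i"
    if "i \<le> n" for i
    using that assms(2) by (simp add: power_divide power_diff)
  then show ?thesis
    unfolding cact_def poly_eq_sum_le[OF assms(1)]
    by (simp add: poly_sum sum_distrib_left mult_ac)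
qed

lemma poly_eqI_cofinite:
  fixes P Q :: "complex poly"
  assumes "finite A" "\<And>x. x \<notin> A \<Longrightarrow> poly P x = poly Q x"
  shows "P = Q"
proof (rule ccontr)
  assume "P \<noteq> Q"
  then have "finite {x. poly (P - Q) x = 0}" by (intro poly_roots_finite) simp
  moreover have "UNIV \<subseteq> A \<union> {x. poly (P - Q) x = 0}" using assms(2) by auto
  ultimately have "finite (UNIV :: complex set)" using assms(1) finite_subset by blast
  then show False using infinite_UNIV_char_0 by blast
qed

lemma finite_linear_zeros:
  fixes p q :: complex
  assumes "p \<noteq> 0 \<or> q \<noteq> 0" shows "finite {x. p + q * x = 0}"
proof -
  have "finite {x. poly [:p, q:] x = 0}" using assms by (intro poly_roots_finite) auto
  then show ?thesis by (simp add: mult.commute)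
qed

lemma cact_cact:
  assumes "degree P \<le> n" "p' \<noteq> 0 \<or> q' \<noteq> 0" "p * p' + q * r' \<noteq> 0 \<or> p * q' + q * s' \<noteq> 0"
  shows "cact n p' q' r' s' (cact n p q r s P) =
         cact n (p * p' + q * r') (p * q' + q * s') (r * p' + s * r') (r * q' + s * s') P"
proof (rule poly_eqI_cofinite)
  show "finite ({x. p' + q' * x = 0} \<union> {x. (p * p' + q * r') + (p * q' + q * s') * x = 0})"
    by (intro finite_UnI finite_linear_zeros assms)
next
  fix x assume "x \<notin> {x. p' + q' * x = 0} \<union> {x. (p * p' + q * r') + (p * q' + q * s') * x = 0}"
  then have x: "p' + q' * x \<noteq> 0" "(p * p' + q * r') + (p * q' + q * s') * x \<noteq> 0" by auto
  define w where "w = (r' + s' * x) / (p' + q' * x)"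
  have e: "(p * p' + q * r') + (p * q' + q * s') * x = (p' + q' * x) * (p + q * w)"
    "(r * p' + s * r') + (r * q' + s * s') * x = (p' + q' * x) * (r + s * w)"
    using x(1) by (simp_all add: w_def field_simps)
  then have w: "p + q * w \<noteq> 0" using x(2) by auto
  show "poly (cact n p' q' r' s' (cact n p q r s P)) x =
      poly (cact n (p * p' + q * r') (p * q' + q * s') (r * p' + s * r') (r * q' + s * s') P) x"
    unfolding poly_cact[OF degree_cact x(1)] poly_cact[OF assms(1) x(2)] w_def[symmetric]
      poly_cact[OF assms(1) w] e using x(1) by (simp add: power_mult_distrib)
qed

lemma cact_one: "degree P \<le> n \<Longrightarrow> cact n 1 0 0 1 P = P"
  by (rule poly_eqI_cofinite[of "{}"]) (auto simp: poly_cact)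

lemma cact_inverse:
  assumes "degree P \<le> n" and d: "d = p * s - q * r" "d \<noteq> 0"
  shows "cact n (s / d) (- q / d) (- r / d) (p / d) (cact n p q r s P) = P"
    and "cact n p q r s (cact n (s / d) (- q / d) (- r / d) (p / d) P) = P"
proof -
  have e: "p * (s / d) + q * (- r / d) = 1" "p * (- q / d) + q * (p / d) = 0"
    "r * (s / d) + s * (- r / d) = 0" "r * (- q / d) + s * (p / d) = 1"
    "s / d * p + - q / d * r = 1" "s / d * q + - q / d * s = 0"
    "- r / d * p + p / d * r = 0" "- r / d * q + p / d * s = 1"
    using d(2) by (simp_all add: field_simps) (simp_all add: d(1) algebra_simps)
  have "s / d \<noteq> 0 \<or> - q / d \<noteq> 0" "p \<noteq> 0 \<or> q \<noteq> 0" using d by auto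
  then show "cact n (s / d) (- q / d) (- r / d) (p / d) (cact n p q r s P) = P"
    "cact n p q r s (cact n (s / d) (- q / d) (- r / d) (p / d) P) = P"
    using cact_cact[OF assms(1), of "s / d" "- q / d" p q "- r / d" "p / d" r s]
      cact_cact[OF assms(1), of p q "s / d" "- q / d" r s "- r / d" "p / d"]
    unfolding e by (simp_all add: cact_one[OF assms(1)])
qed

lemma cact_linear_powers:
  assumes "degree A \<le> 1" "degree B \<le> 1" "i \<le> n" "p \<noteq> 0 \<or> q \<noteq> 0"
  shows "cact n p q r s (A ^ i * B ^ (n - i)) = cact 1 p q r s A ^ i * cact 1 p q r s B ^ (n - i)"
proof (rule poly_eqI_cofinite[OF finite_linear_zeros[OF assms(4)]])
  fix x assume "x \<notin> {x. p + q * x = 0}"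
  then have x: "p + q * x \<noteq> 0" by simp
  have n: "(p + q * x) ^ n = (p + q * x) ^ i * (p + q * x) ^ (n - i)"
    using assms(3) by (simp flip: power_add)
  show "poly (cact n p q r s (A ^ i * B ^ (n - i))) x =
      poly (cact 1 p q r s A ^ i * cact 1 p q r s B ^ (n - i)) x"
    unfolding poly_cact[OF degree_linear_powers[OF assms(1,2,3)] x] n
    by (simp add: poly_cact[OF assms(1) x] poly_cact[OF assms(2) x] power_mult_distrib mult_ac del: One_nat_def)
qed

lemma actB_mult:
  assumes "\<gamma> \<in> SL2Z" "\<gamma>' \<in> SL2Z" "degree P \<le> n"
  shows "actB n (\<gamma> ** \<gamma>') P = actB n \<gamma>' (actB n \<gamma> P)"
proof -
  have nz: "complex_of_int (ea \<gamma>) \<noteq> 0 \<or> complex_of_int (eb \<gamma>) \<noteq> 0" if "\<gamma> \<in> SL2Z" for \<gamma>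
    using that by (auto simp: SL2Z_iff)
  have "complex_of_int (ea \<gamma>) * of_int (ea \<gamma>') + of_int (eb \<gamma>) * of_int (ec \<gamma>') \<noteq> 0 \<or>
        complex_of_int (ea \<gamma>) * of_int (eb \<gamma>') + of_int (eb \<gamma>) * of_int (ed \<gamma>') \<noteq> 0"
    using nz[OF SL2Z_mult[OF assms(1,2)]] by simp
  then show ?thesis
    by (simp add: actB_cact cact_cact[OF assms(3) nz[OF assms(2)]])
qed

lemma actB_linear_powers:
  assumes "degree A \<le> 1" "degree B \<le> 1" "i \<le> n" "\<gamma> \<in> SL2Z"
  shows "actB n \<gamma> (A ^ i * B ^ (n - i)) = actB 1 \<gamma> A ^ i * actB 1 \<gamma> B ^ (n - i)"
  using assms unfolding actB_cact by (intro cact_linear_powers) (auto simp: SL2Z_iff)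

lemma cact_1: "cact 1 p q r s [:a, b:] = smult a [:p, q:] + smult b [:r, s:]"
  by (simp add: cact_def)

lemma actB_add: "actB n \<gamma> (P + Q) = actB n \<gamma> P + actB n \<gamma> Q"
  by (simp add: actB_cact cact_add)

lemma actB_diff: "actB n \<gamma> (P - Q) = actB n \<gamma> P - actB n \<gamma> Q"
  by (simp add: actB_cact cact_diff)

lemma actB_smult: "actB n \<gamma> (smult c P) = smult c (actB n \<gamma> P)"
  by (simp add: actB_cact cact_smult)

lemma actB_sum: "actB n \<gamma> (sum f A) = (\<Sum>x\<in>A. actB n \<gamma> (f x))"
  by (simp add: actB_cact cact_sum)

section \<open>Partial fractions of the cotangent\<close>

lemma deriv_eq_on_open:
  assumes "open U" "z \<in> U" "\<And>w. w \<in> U \<Longrightarrow> F w = H w"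
    "(F has_field_derivative F') (at z)" "(H has_field_derivative H') (at z)"
  shows "F' = H'"
  using has_field_derivative_transform_within_open[OF assms(4,1,2,3)] assms(5) DERIV_unique by blast

text \<open>
  The \<open>s\<close>-th derivative of \<open>- \<pi> cot(\<pi> z)\<close>, by the reflection formula of the Gamma function; the series
  for the polygamma functions turn it into Euler's sum over \<open>\<int>\<close>.
\<close>

definition DD :: "nat \<Rightarrow> complex \<Rightarrow> complex" where
  "DD s z = Polygamma s z - (-1) ^ s * Polygamma s (1 - z)"

lemma not_int_shift:
  assumes "(z::complex) \<notin> \<int>"
  shows "z \<notin> \<int>\<^sub>\<le>\<^sub>0" "1 - z \<notin> \<int>\<^sub>\<le>\<^sub>0"
proof -
  show "z \<notin> \<int>\<^sub>\<le>\<^sub>0" using assms nonpos_Ints_Int by blast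
  show "1 - z \<notin> \<int>\<^sub>\<le>\<^sub>0"
  proof
    assume "1 - z \<in> \<int>\<^sub>\<le>\<^sub>0"
    then have "1 - (1 - z) \<in> \<int>" by (intro Ints_diff Ints_1 nonpos_Ints_Int)
    then show False using assms by simp
  qed
qed

lemma DD_has_derivative:
  assumes "z \<notin> \<int>"
  shows "(DD s has_field_derivative DD (Suc s) z) (at z)"
  unfolding DD_def[abs_def]
  by (rule derivative_eq_intros not_int_shift assms refl | simp)+

lemma sin_pi_nz: "z \<notin> \<int> \<Longrightarrow> sin (of_real pi * z :: complex) \<noteq> 0"
proof
  assume z: "z \<notin> \<int>" and "sin (of_real pi * z) = 0"
  then obtain n :: int where "of_real pi * z = of_real (n * pi)"
    unfolding sin_eq_0 by blast
  then have "z = of_int n" by (simp add: mult.commute)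
  then show False using z by simp
qed

lemma DD_0:
  assumes z: "z \<notin> \<int>"
  shows "DD 0 z = - of_real pi * cos (of_real pi * z) / sin (of_real pi * z)"
proof -
  let ?s = "sin (of_real pi * z)" and ?c = "cos (of_real pi * z)"
  have s: "?s \<noteq> 0" by (rule sin_pi_nz[OF z])
  have "((\<lambda>w. Gamma w * Gamma (1 - w)) has_field_derivative
      Gamma z * Digamma z * Gamma (1 - z) - Gamma z * (Gamma (1 - z) * Digamma (1 - z))) (at z)"
    by (rule derivative_eq_intros not_int_shift z refl | simp)+
  moreover have "((\<lambda>w. of_real pi / sin (of_real pi * w)) has_field_derivative
      - (of_real pi * (?c * of_real pi)) / (?s * ?s)) (at z)"
    using s by (auto intro!: derivative_eq_intros)
  ultimately have "Gamma z * Digamma z * Gamma (1 - z) - Gamma z * (Gamma (1 - z) * Digamma (1 - z))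
      = - (of_real pi * (?c * of_real pi)) / (?s * ?s)"
    by (intro deriv_eq_on_open[of UNIV z, OF _ _ Gamma_reflection_complex]) auto
  also have "Gamma z * Digamma z * Gamma (1 - z) - Gamma z * (Gamma (1 - z) * Digamma (1 - z))
      = (Gamma z * Gamma (1 - z)) * DD 0 z"
    by (simp add: DD_def algebra_simps)
  also have "\<dots> = of_real pi / ?s * DD 0 z" by (simp only: Gamma_reflection_complex)
  finally have "of_real pi / ?s * DD 0 z = of_real pi / ?s * (- of_real pi * ?c / ?s)" by (simp add: mult_ac)
  then show ?thesis using s by (simp only: mult_cancel_left divide_eq_0_iff) simp
qed

text \<open>
  The derivatives are computed as polynomials in \<open>1/sin\<close> and \<open>cos\<close>, the latter at most linearly
  because \<open>cos\<^sup>2 = 1 - sin\<^sup>2\<close>.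
\<close>

lemma DD_trig:
  assumes z: "z \<notin> \<int>"
  defines "s \<equiv> sin (of_real pi * z)"
  shows "DD 3 z = of_real pi ^ 4 * (6 / s ^ 4 - 4 / s ^ 2)"
    and "DD 5 z = of_real pi ^ 6 * (120 / s ^ 6 - 120 / s ^ 4 + 16 / s ^ 2)"
proof -
  let ?p = "of_real pi :: complex"
  have step: "\<forall>z\<in>-\<int>. DD (Suc n) z = H' z"
    if "\<forall>z\<in>-\<int>. DD n z = H z" "\<And>z. z \<notin> \<int> \<Longrightarrow> (H has_field_derivative H' z) (at z)" for n H H'
  proof
    fix z :: complex assume "z \<in> -\<int>"
    moreover have "open (- (\<int> :: complex set))" by (simp add: closed_Ints open_Compl)
    ultimately show "DD (Suc n) z = H' z"
      using that(1) by (intro deriv_eq_on_open[OF _ _ _ DD_has_derivative that(2)]) blast+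
  qed
  define c i where "c z = cos (?p * z)" and "i z = inverse (sin (?p * z))" for z
  have dc: "(c has_field_derivative - ?p * sin (?p * z)) (at z)" for z
    unfolding c_def by (auto intro!: derivative_eq_intros)
  have di: "(i has_field_derivative - ?p * c z * i z ^ 2) (at z)" if "z \<notin> \<int>" for z
    unfolding c_def i_def using sin_pi_nz[OF that]
    by (auto intro!: derivative_eq_intros simp: power2_eq_square)
  have rel: "sin (?p * z) * i z = 1" "c z ^ 2 = 1 - sin (?p * z) ^ 2" if "z \<notin> \<int>" for z
  proof -
    show "sin (?p * z) * i z = 1" unfolding i_def by (rule right_inverse[OF sin_pi_nz[OF that]])
    show "c z ^ 2 = 1 - sin (?p * z) ^ 2" unfolding c_def by (rule cos_squared_eq)
  qed
  have alg: "sn * iv = 1 \<Longrightarrow> cs ^ 2 = 1 - sn ^ 2 \<Longrightarrow> cs ^ 2 * iv ^ (m + 2) = iv ^ (m + 2) - iv ^ m"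
    "sn * iv = 1 \<Longrightarrow> sn * iv ^ (m + 1) = iv ^ m" for sn iv cs :: complex and m
  proof -
    assume a: "sn * iv = 1" and b: "cs ^ 2 = 1 - sn ^ 2"
    have "cs ^ 2 * iv ^ (m + 2) = iv ^ (m + 2) - (sn * iv) ^ 2 * iv ^ m"
      unfolding b by (simp add: algebra_simps power_add power_mult_distrib power2_eq_square)
    then show "cs ^ 2 * iv ^ (m + 2) = iv ^ (m + 2) - iv ^ m" by (simp add: a)
  next
    assume a: "sn * iv = 1"
    have "sn * iv ^ (m + 1) = (sn * iv) * iv ^ m" by (simp add: mult_ac)
    then show "sn * iv ^ (m + 1) = iv ^ m" by (simp add: a)
  qed
  note alg1 = alg(1)[OF rel] and alg2 = alg(2)[OF rel(1)]
  have 0: "\<forall>z\<in>-\<int>. DD 0 z = - ?p * (c z * i z)" by (simp add: DD_0 c_def i_def divide_inverse)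
  have 1: "\<forall>z\<in>-\<int>. DD (Suc 0) z = ?p ^ 2 * i z ^ 2"
  proof (rule step[OF 0])
    fix z :: complex assume z: "z \<notin> \<int>"
    have "((\<lambda>z. - ?p * (c z * i z)) has_field_derivative
        - ?p * ((- ?p * sin (?p * z)) * i z + (- ?p * c z * i z ^ 2) * c z)) (at z)"
      by (intro DERIV_cmult DERIV_mult dc di z)
    also have "- ?p * ((- ?p * sin (?p * z)) * i z + (- ?p * c z * i z ^ 2) * c z) =
        ?p ^ 2 * (sin (?p * z) * i z ^ (0 + 1) + c z ^ 2 * i z ^ (0 + 2))"
      by (simp add: algebra_simps power2_eq_square)
    also have "\<dots> = ?p ^ 2 * i z ^ 2" unfolding alg1[OF z z] alg2[OF z] by (simp add: power2_eq_square)
    finally show "((\<lambda>z. - ?p * (c z * i z)) has_field_derivative ?p ^ 2 * i z ^ 2) (at z)" .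
  qed
  have di_pow: "((\<lambda>z. i z ^ Suc m) has_field_derivative - of_nat (Suc m) * ?p * c z * i z ^ (m + 2)) (at z)"
    if "z \<notin> \<int>" for z m
    by (rule DERIV_cong[OF DERIV_power_Suc[OF di[OF that], of m]])
      (simp add: power_add power2_eq_square algebra_simps)
  have di_pow_c: "((\<lambda>z. c z * i z ^ Suc m) has_field_derivative
      ?p * (of_nat m * i z ^ m - of_nat (Suc m) * i z ^ (m + 2))) (at z)"
    if "z \<notin> \<int>" for z m
  proof -
    have "((\<lambda>z. c z * i z ^ Suc m) has_field_derivative
       (- ?p * sin (?p * z)) * i z ^ Suc m + (- of_nat (Suc m) * ?p * c z * i z ^ (m + 2)) * c z) (at z)"
      by (intro DERIV_mult dc di_pow that)
    also have "(- ?p * sin (?p * z)) * i z ^ Suc m + (- of_nat (Suc m) * ?p * c z * i z ^ (m + 2)) * c z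
      = - ?p * (sin (?p * z) * i z ^ (m + 1)) - of_nat (Suc m) * ?p * (c z ^ 2 * i z ^ (m + 2))"
      by (simp add: power2_eq_square mult_ac del: of_nat_Suc)
    also have "\<dots> = ?p * (of_nat m * i z ^ m - of_nat (Suc m) * i z ^ (m + 2))"
      unfolding alg1[OF that that] alg2[OF that] by (simp add: algebra_simps)
    finally show ?thesis .
  qed
  have 2: "\<forall>z\<in>-\<int>. DD (Suc (Suc 0)) z = - 2 * ?p ^ 3 * (c z * i z ^ 3)"
  proof (rule step[OF 1])
    fix z :: complex assume z: "z \<notin> \<int>"
    show "((\<lambda>z. ?p ^ 2 * i z ^ 2) has_field_derivative - 2 * ?p ^ 3 * (c z * i z ^ 3)) (at z)"
      using DERIV_cmult[OF di_pow[OF z, of 1], of "?p ^ 2"]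
      by (simp add: eval_nat_numeral mult_ac)
  qed
  have 3: "\<forall>z\<in>-\<int>. DD (Suc (Suc (Suc 0))) z = ?p ^ 4 * (6 * i z ^ 4 - 4 * i z ^ 2)"
  proof (rule step[OF 2])
    fix z :: complex assume z: "z \<notin> \<int>"
    show "((\<lambda>z. - 2 * ?p ^ 3 * (c z * i z ^ 3)) has_field_derivative ?p ^ 4 * (6 * i z ^ 4 - 4 * i z ^ 2)) (at z)"
      using DERIV_cmult[OF di_pow_c[OF z, of 2], of "- 2 * ?p ^ 3"]
      by (simp add: eval_nat_numeral algebra_simps)
  qed
  have 4: "\<forall>z\<in>-\<int>. DD (Suc (Suc (Suc (Suc 0)))) z = ?p ^ 5 * (- 24 * (c z * i z ^ 5) + 8 * (c z * i z ^ 3))"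
  proof (rule step[OF 3])
    fix z :: complex assume z: "z \<notin> \<int>"
    show "((\<lambda>z. ?p ^ 4 * (6 * i z ^ 4 - 4 * i z ^ 2)) has_field_derivative
       ?p ^ 5 * (- 24 * (c z * i z ^ 5) + 8 * (c z * i z ^ 3))) (at z)"
      using DERIV_cmult[OF DERIV_diff[OF DERIV_cmult[OF di_pow[OF z, of 3], of 6]
        DERIV_cmult[OF di_pow[OF z, of 1], of 4]], of "?p ^ 4"]
      by (simp add: eval_nat_numeral algebra_simps)
  qed
  have 5: "\<forall>z\<in>-\<int>. DD (Suc (Suc (Suc (Suc (Suc 0))))) z = ?p ^ 6 * (120 * i z ^ 6 - 120 * i z ^ 4 + 16 * i z ^ 2)"
  proof (rule step[OF 4])
    fix z :: complex assume z: "z \<notin> \<int>"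
    show "((\<lambda>z. ?p ^ 5 * (- 24 * (c z * i z ^ 5) + 8 * (c z * i z ^ 3))) has_field_derivative
       ?p ^ 6 * (120 * i z ^ 6 - 120 * i z ^ 4 + 16 * i z ^ 2)) (at z)"
      using DERIV_cmult[OF DERIV_add[OF DERIV_cmult[OF di_pow_c[OF z, of 4], of "- 24"]
        DERIV_cmult[OF di_pow_c[OF z, of 2], of 8]], of "?p ^ 5"]
      by (simp add: eval_nat_numeral algebra_simps)
  qed
  show "DD 3 z = of_real pi ^ 4 * (6 / s ^ 4 - 4 / s ^ 2)"
    using 3 z by (simp add: s_def i_def numeral_3_eq_3 divide_inverse power_inverse)
  show "DD 5 z = of_real pi ^ 6 * (120 / s ^ 6 - 120 / s ^ 4 + 16 / s ^ 2)"
  proof -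
    have "DD 5 z = ?p ^ 6 * (120 * i z ^ 6 - 120 * i z ^ 4 + 16 * i z ^ 2)"
      using 5 z by (simp only: eval_nat_numeral BitM.simps) simp
    then show ?thesis unfolding i_def s_def power_inverse divide_inverse .
  qed
qed

text \<open>
  The values of \<open>\<zeta>(4)\<close> and \<open>\<zeta>(6)\<close>, in the form of polygamma values at \<open>1\<close>: subtract the pole at
  \<open>0\<close> from the derivative of the cotangent and let \<open>x \<rightarrow> 0\<close>.
\<close>

lemma Polygamma_at_1_aux:
  fixes h :: "real \<Rightarrow> real"
  assumes odd: "odd s"
    and h: "\<And>x. x \<in> {0<..<1} \<Longrightarrow> DD s (of_real x) = of_real (h x)"
    and lim: "((\<lambda>x. h x - fact s / x ^ Suc s) \<longlongrightarrow> c) (at_right 0)"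
  shows "2 * Polygamma s (1::complex) = of_real c"
proof -
  have "((\<lambda>x. Polygamma s (x + 1) + Polygamma s (1 - x)) \<longlongrightarrow> Polygamma s (0 + 1) + Polygamma s (1 - 0)) (at_right (0::real))"
    by (intro tendsto_intros) auto
  moreover have "\<forall>\<^sub>F x in at_right (0::real). h x - fact s / x ^ Suc s = Polygamma s (x + 1) + Polygamma s (1 - x)"
  proof (rule eventually_at_rightI[of 0 1])
    fix x :: real assume x: "x \<in> {0<..<1}"
    then have "complex_of_real (h x) = Polygamma s (of_real x) + Polygamma s (of_real (1 - x))"
      using h[OF x] odd by (simp add: DD_def)
    also have "\<dots> = of_real (Polygamma s x + Polygamma s (1 - x))"
      using x by (subst (1 2) Polygamma_of_real) auto
    finally have "h x = Polygamma s x + Polygamma s (1 - x)" using of_real_eq_iff by blast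
    then show "h x - fact s / x ^ Suc s = Polygamma s (x + 1) + Polygamma s (1 - x)"
      using x odd by (simp add: Polygamma_plus1)
  qed simp
  ultimately have "((\<lambda>x. h x - fact s / x ^ Suc s) \<longlongrightarrow> Polygamma s (0 + 1) + Polygamma s (1 - 0)) (at_right 0)"
    using tendsto_cong by fast
  with lim have "c = 2 * Polygamma s 1"
    using tendsto_unique[of "at_right (0::real)"] by (simp add: trivial_limit_at_right_real) fastforce
  moreover have "Polygamma s (of_real 1 :: complex) = of_real (Polygamma s 1)"
    by (rule Polygamma_of_real) simp
  ultimately show ?thesis by simp
qed

lemma real_not_int:
  assumes "x \<in> {0<..<(1::real)}" shows "complex_of_real x \<notin> \<int>"
proof
  assume "complex_of_real x \<in> \<int>"
  then obtain n where "complex_of_real x = of_int n" by (elim Ints_cases)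
  then have "x = of_int n" by (metis of_real_eq_iff of_real_of_int_eq)
  then show False using assms by auto
qed

lemma Polygamma_3_at_1: "2 * Polygamma 3 (1::complex) = 2 * of_real pi ^ 4 / 15"
proof -
  have scale: "filterlim (\<lambda>x. pi * x) (at_right 0) (at_right 0)" by real_asymp
  have "2 * Polygamma 3 (1::complex) = of_real (2 * pi ^ 4 / 15)"
  proof (rule Polygamma_at_1_aux[where h = "\<lambda>x. pi ^ 4 * (6 / sin (pi * x) ^ 4 - 4 / sin (pi * x) ^ 2)"])
    fix x :: real assume x: "x \<in> {0<..<1}"
    show "DD 3 (of_real x) = of_real (pi ^ 4 * (6 / sin (pi * x) ^ 4 - 4 / sin (pi * x) ^ 2))"
      unfolding DD_trig(1)[OF real_not_int[OF x]]
      of_real_mult[symmetric, of pi x] sin_of_real by simp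
  next
    have "((\<lambda>y::real. 6 / sin y ^ 4 - 4 / sin y ^ 2 - 6 / y ^ 4) \<longlongrightarrow> 2 / 15) (at_right 0)"
      by real_asymp
    then have "((\<lambda>x. pi ^ 4 * (6 / sin (pi * x) ^ 4 - 4 / sin (pi * x) ^ 2 - 6 / (pi * x) ^ 4))
        \<longlongrightarrow> pi ^ 4 * (2 / 15)) (at_right 0)"
      by (intro tendsto_mult_left) (rule filterlim_compose[OF _ scale], assumption)
    then show "((\<lambda>x. pi ^ 4 * (6 / sin (pi * x) ^ 4 - 4 / sin (pi * x) ^ 2) - fact 3 / x ^ Suc 3)
        \<longlongrightarrow> 2 * pi ^ 4 / 15) (at_right 0)"
      by (simp add: fact_numeral power_mult_distrib right_diff_distrib mult_ac)
  qed simp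
  then show ?thesis by simp
qed

lemma Polygamma_5_at_1: "2 * Polygamma 5 (1::complex) = 16 * of_real pi ^ 6 / 63"
proof -
  have scale: "filterlim (\<lambda>x. pi * x) (at_right 0) (at_right 0)" by real_asymp
  have "2 * Polygamma 5 (1::complex) = of_real (16 * pi ^ 6 / 63)"
  proof (rule Polygamma_at_1_aux[where h = "\<lambda>x. pi ^ 6 * (120 / sin (pi * x) ^ 6 - 120 / sin (pi * x) ^ 4 + 16 / sin (pi * x) ^ 2)"])
    fix x :: real assume x: "x \<in> {0<..<1}"
    show "DD 5 (of_real x) = of_real (pi ^ 6 * (120 / sin (pi * x) ^ 6 - 120 / sin (pi * x) ^ 4 + 16 / sin (pi * x) ^ 2))"
      unfolding DD_trig(2)[OF real_not_int[OF x]]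
      of_real_mult[symmetric, of pi x] sin_of_real by simp
  next
    have "((\<lambda>y::real. 120 / sin y ^ 6 - 120 / sin y ^ 4 + 16 / sin y ^ 2 - 120 / y ^ 6) \<longlongrightarrow> 16 / 63) (at_right 0)"
      by real_asymp
    then have "((\<lambda>x. pi ^ 6 * (120 / sin (pi * x) ^ 6 - 120 / sin (pi * x) ^ 4 + 16 / sin (pi * x) ^ 2 - 120 / (pi * x) ^ 6))
        \<longlongrightarrow> pi ^ 6 * (16 / 63)) (at_right 0)"
      by (intro tendsto_mult_left) (rule filterlim_compose[OF _ scale], assumption)
    then show "((\<lambda>x. pi ^ 6 * (120 / sin (pi * x) ^ 6 - 120 / sin (pi * x) ^ 4 + 16 / sin (pi * x) ^ 2) - fact 5 / x ^ Suc 5)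
        \<longlongrightarrow> 16 * pi ^ 6 / 63) (at_right 0)"
      by (simp add: fact_numeral power_mult_distrib right_diff_distrib distrib_left mult_ac)
  qed simp
  then show ?thesis by simp
qed

section \<open>Power series in \<open>q\<close>\<close>

definition qq :: "complex \<Rightarrow> complex" where "qq z = exp (tpi * z)"

lemma norm_qq: "norm (qq z) = exp (- 2 * pi * Im z)"
  by (simp add: qq_def)

lemma norm_qq_less_1: "z \<in> \<HH> \<Longrightarrow> norm (qq z) < 1"
  by (simp add: norm_qq upper_half_iff)

lemma qq_nonzero [simp]: "qq z \<noteq> 0"
  by (simp add: qq_def)

lemma qq_add_int: "qq (z + of_int m) = qq z"
proof -
  have "qq (z + of_int m) = qq z * exp (2 * of_int m * of_real pi * \<i>)"
    by (simp add: qq_def algebra_simps flip: exp_add)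
  also have "exp (2 * of_int m * of_real pi * \<i>) = 1"
    using exp_integer_2pi[of "of_int m"] by simp
  finally show ?thesis by simp
qed

lemma qq_has_derivative: "(qq has_field_derivative tpi * qq z) (at z)"
  unfolding qq_def by (auto intro!: derivative_eq_intros)

lemma qq_surj:
  assumes "q \<noteq> 0" "norm q < 1"
  obtains z where "z \<in> \<HH>" "qq z = q"
proof -
  define z where "z = Ln q / tpi"
  have q: "qq z = q" using assms(1) by (simp add: z_def qq_def)
  then have "exp (- 2 * pi * Im z) < 1" using assms(2) norm_qq[of z] by simp
  then have "z \<in> \<HH>" by (simp add: upper_half_iff zero_less_mult_iff)
  with q show ?thesis using that by blast
qed

lemma summable_power_times:
  fixes r :: real
  assumes "\<bar>r\<bar> < 1"
  shows "summable (\<lambda>n. real (Suc n) ^ k * r ^ n)"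
  using assms
proof (induction k arbitrary: r)
  case 0
  then show ?case by (simp add: summable_geometric)
next
  case (Suc k)
  have a: "\<bar>\<bar>r\<bar>\<bar> < 1" using Suc.prems by simp
  have "summable (\<lambda>n. diffs (\<lambda>n. real (Suc n) ^ k) n * \<bar>r\<bar> ^ n)"
    by (rule termdiff_converges[of _ 1]) (use a Suc.IH in auto)
  then have "summable (\<lambda>n. norm (real (Suc n) ^ Suc k * r ^ n))"
  proof (rule summable_comparison_test'[where N = 0])
    fix n :: nat
    have "real (Suc n) ^ k \<le> real (Suc (Suc n)) ^ k" by (intro power_mono) auto
    then have "real (Suc n) ^ Suc k \<le> diffs (\<lambda>n. real (Suc n) ^ k) n"
      by (simp add: diffs_def mult_left_mono del: of_nat_Suc)
    then have "real (Suc n) ^ Suc k * \<bar>r\<bar> ^ n \<le> diffs (\<lambda>n. real (Suc n) ^ k) n * \<bar>r\<bar> ^ n"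
      by (rule mult_right_mono) simp
    then show "norm (norm (real (Suc n) ^ Suc k * r ^ n)) \<le> diffs (\<lambda>n. real (Suc n) ^ k) n * \<bar>r\<bar> ^ n"
      by (simp only: real_norm_def abs_abs abs_mult power_abs abs_of_nat)
  qed
  then show ?case by (rule summable_norm_cancel)
qed

lemma summable_powser_bounded:
  fixes a :: "nat \<Rightarrow> complex"
  assumes "\<And>n. norm (a n) \<le> real (Suc n) ^ k" "norm q < 1"
  shows "summable (\<lambda>n. norm (a n * q ^ n))"
proof (rule summable_comparison_test'[OF summable_power_times[of "norm q" k], where N = 0])
  show "norm (norm (a n * q ^ n)) \<le> real (Suc n) ^ k * norm q ^ n" for n
    using assms(1)[of n] by (simp add: norm_mult norm_power mult_right_mono)
qed (use assms(2) in auto)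

text \<open>
  The coefficients of the Eisenstein series; the factor \<open>q\<close> is split off from the series below, so
  that its coefficients start with \<open>1\<close>.
\<close>

definition divsum :: "nat \<Rightarrow> nat \<Rightarrow> nat" where
  "divsum s m = (\<Sum>d | d dvd m. d ^ s)"

lemma divsum_le: "divsum s (Suc n) \<le> Suc n ^ Suc s"
proof -
  have "divsum s (Suc n) \<le> (\<Sum>d | d dvd Suc n. Suc n ^ s)"
    unfolding divsum_def by (intro sum_mono power_mono) (auto dest: dvd_imp_le)
  also have "\<dots> = card {d. d dvd Suc n} * Suc n ^ s" by simp
  also have "card {d. d dvd Suc n} \<le> card {1..Suc n}"
    by (intro card_mono) (auto dest: dvd_imp_le intro!: Suc_leI dvd_pos_nat[of "Suc n"])
  finally show ?thesis by simp
qed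

lemma divsum_values: "divsum s (Suc 0) = 1" "divsum s (Suc (Suc 0)) = 1 + 2 ^ s"
proof -
  have "d dvd Suc (Suc 0) \<longleftrightarrow> d = 1 \<or> d = 2" for d :: nat
    using two_is_prime_nat unfolding prime_nat_iff numeral_2_eq_2 by (metis dvd_refl one_dvd)
  then have 2: "{d::nat. d dvd Suc (Suc 0)} = {1, 2}" by auto
  show "divsum s (Suc 0) = 1" by (simp add: divsum_def)
  show "divsum s (Suc (Suc 0)) = 1 + 2 ^ s" by (simp only: divsum_def 2) simp
qed

definition Sg :: "nat \<Rightarrow> complex \<Rightarrow> complex" where
  "Sg s q = suminf (\<lambda>n. of_nat (divsum s (Suc n)) * q ^ n)"

lemma norm_divsum_le: "norm (of_nat (divsum s (Suc n)) :: complex) \<le> real (Suc n) ^ Suc s"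
  using divsum_le[of s n] by (metis norm_of_nat of_nat_le_iff of_nat_power)

lemma Sg_sums:
  assumes "norm q < 1"
  shows "(\<lambda>n. of_nat (divsum s (Suc n)) * q ^ n) sums Sg s q"
  unfolding Sg_def
  by (intro summable_sums summable_norm_cancel[OF summable_powser_bounded[OF norm_divsum_le assms]])

lemma Sg_holomorphic: "Sg s holomorphic_on ball 0 1"
proof (rule power_series_holomorphic)
  fix w :: complex assume "w \<in> ball 0 1"
  then show "(\<lambda>n. of_nat (divsum s (Suc n)) * (w - 0) ^ n) sums Sg s w"
    using Sg_sums[of w s] by simp
qed

lemma Sg_0: "Sg s 0 = 1"
proof -
  have "(\<lambda>n. of_nat (divsum s (Suc n)) * 0 ^ n) sums (of_nat (divsum s (Suc 0)) :: complex)"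
    using powser_sums_zero[of "\<lambda>n. of_nat (divsum s (Suc n)) :: complex"] by simp
  then show ?thesis unfolding Sg_def by (simp add: sums_iff divsum_values)
qed

lemma eisenstein_G_qq:
  assumes "z \<in> \<HH>" "k \<noteq> 0"
  shows "eisenstein_G k z = - of_rat (bernoulli k) / of_nat (2 * k) + qq z * Sg (k - 1) (qq z)"
proof -
  have "(\<lambda>m. qq z * (of_nat (divsum (k - 1) (Suc m)) * qq z ^ m)) sums (qq z * Sg (k - 1) (qq z))"
    by (intro sums_mult Sg_sums norm_qq_less_1 assms)
  then have "(\<lambda>m. of_nat (divsum (k - 1) (Suc m)) * qq z ^ Suc m) sums (qq z * Sg (k - 1) (qq z))"
    by (simp add: mult_ac)
  then show ?thesis
    unfolding eisenstein_G_def divsum_def qq_def by (simp add: sums_iff)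
qed

lemma bernoulli_values: "bernoulli 4 = - 1 / 30" "bernoulli 6 = 1 / 42"
proof -
  have 0: "bernoulli 0 = 1" by (subst bernoulli.simps) simp
  have 1: "bernoulli (Suc 0) = - 1 / 2" by (subst bernoulli.simps) (simp add: 0)
  have 2: "bernoulli (Suc (Suc 0)) = 1 / 6" by (subst bernoulli.simps) (simp add: 0 1)
  have 3: "bernoulli (Suc (Suc (Suc 0))) = 0"
    by (subst bernoulli.simps) (simp add: 0 1 2)
  have 4: "bernoulli (Suc (Suc (Suc (Suc 0)))) = - 1 / 30"
    by (subst bernoulli.simps) (simp add: 0 1 2 3)
  have 5: "bernoulli (Suc (Suc (Suc (Suc (Suc 0))))) = 0"
    by (subst bernoulli.simps) (simp add: 0 1 2 3 4)
  show "bernoulli 4 = - 1 / 30" using 4 by (simp add: eval_nat_numeral)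
  have "bernoulli (Suc (Suc (Suc (Suc (Suc (Suc 0)))))) = 1 / 42"
    by (subst bernoulli.simps) (simp add: 0 1 2 3 4 5)
  then show "bernoulli 6 = 1 / 42" by (simp add: eval_nat_numeral)
qed

text \<open>
  The \<open>q\<close>-expansions of \<open>u = E\<^sub>4/12\<close> and \<open>v = - E\<^sub>6/216\<close>, as functions on the unit disc.
\<close>

definition uhat :: "complex \<Rightarrow> complex" where "uhat q = 1 / 12 + 20 * (q * Sg 3 q)"
definition vhat :: "complex \<Rightarrow> complex" where "vhat q = - 1 / 216 + 7 / 3 * (q * Sg 5 q)"

lemma rho_hat:
  assumes "z \<in> \<HH>"
  shows "rho_u z = uhat (qq z)" "rho_v z = vhat (qq z)"
  using assms
  by (simp_all add: rho_u_def rho_v_def uhat_def vhat_def eisenstein_G_qq bernoulli_values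
      of_rat_minus of_rat_divide distrib_left)

lemma hat_holomorphic: "uhat holomorphic_on ball 0 1" "vhat holomorphic_on ball 0 1"
  unfolding uhat_def[abs_def] vhat_def[abs_def] by (intro holomorphic_intros Sg_holomorphic)+

lemma hat_0: "uhat 0 = 1 / 12" "vhat 0 = - 1 / 216"
  by (simp_all add: uhat_def vhat_def)

lemma hat_deriv_0: "deriv uhat 0 = 20" "deriv vhat 0 = 7 / 3"
proof -
  have "(Sg s has_field_derivative deriv (Sg s) 0) (at 0)" for s
    by (rule holomorphic_derivI[OF Sg_holomorphic]) auto
  then have "((\<lambda>q. q * Sg s q) has_field_derivative 1) (at 0)" for s
    using DERIV_mult[OF DERIV_ident, of "Sg s" "deriv (Sg s) 0" 0] by (simp add: Sg_0)
  then have "(uhat has_field_derivative 0 + 20 * 1) (at 0)" "(vhat has_field_derivative 0 + 7 / 3 * 1) (at 0)"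
    unfolding uhat_def[abs_def] vhat_def[abs_def]
    by (intro DERIV_add DERIV_const DERIV_cmult; assumption)+
  then show "deriv uhat 0 = 20" "deriv vhat 0 = 7 / 3"
    by (auto dest: DERIV_imp_deriv)
qed

section \<open>Nonvanishing of the discriminant\<close>

text \<open>
  The coefficient of \<open>q\<^sup>n\<^sup>+\<^sup>2\<close> is at most \<open>(n + 3)\<^sup>s\<^sup>+\<^sup>1 \<le> 3\<^sup>s\<^sup>+\<^sup>1 6\<^sup>n\<close>, and the geometric series for
  \<open>6 \<bar>q\<bar> \<le> 3/100\<close> contributes the factor \<open>104/100\<close>.
\<close>

lemma Sg_tail:
  assumes q: "norm q \<le> 1 / 200" and s: "s \<le> 5"
  shows "norm (Sg s q - 1 - (1 + 2 ^ s) * q) \<le> 3 ^ Suc s * (104 / 100) * norm q ^ 2"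
proof -
  define a where "a n = of_nat (divsum s (Suc n)) * q ^ n" for n
  have q1: "norm q < 1" using q by simp
  have sm: "a sums Sg s q" unfolding a_def by (rule Sg_sums[OF q1])
  have "(\<lambda>n. a (n + 2)) sums (Sg s q - (\<Sum>n<2. a n))"
    using sums_iff_shift[of a 2 "Sg s q - (\<Sum>n<2. a n)"] sm by simp
  moreover have "(\<Sum>n<2. a n) = 1 + (1 + 2 ^ s) * q"
    by (simp add: a_def eval_nat_numeral lessThan_Suc divsum_values)
  ultimately have tail: "(\<lambda>n. a (n + 2)) sums (Sg s q - 1 - (1 + 2 ^ s) * q)" by (simp add: algebra_simps)
  have pw: "real (n + 3) ^ Suc s \<le> 3 ^ Suc s * 6 ^ n" for n
  proof (induction n)
    case 0
    then show ?case by simp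
  next
    case (Suc n)
    have "real (Suc n + 3) \<le> 4 / 3 * real (n + 3)" by simp
    then have "real (Suc n + 3) ^ Suc s \<le> (4 / 3 * real (n + 3)) ^ Suc s" by (intro power_mono) auto
    also have "\<dots> = (4 / 3) ^ Suc s * real (n + 3) ^ Suc s" by (rule power_mult_distrib)
    also have "(4 / 3 :: real) ^ Suc s \<le> (4 / 3) ^ 6" using s by (intro power_increasing) auto
    also have "(4 / 3 :: real) ^ 6 \<le> 6" by (simp add: eval_nat_numeral)
    finally have "real (Suc n + 3) ^ Suc s \<le> 6 * real (n + 3) ^ Suc s" by (simp add: mult_right_mono)
    also have "\<dots> \<le> 6 * (3 ^ Suc s * 6 ^ n)" using Suc.IH by simp
    finally show ?case by simp
  qed
  have bd: "norm (a (n + 2)) \<le> (3 ^ Suc s * norm q ^ 2) * (6 * norm q) ^ n" for n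
  proof -
    have "norm (a (n + 2)) \<le> real (n + 3) ^ Suc s * norm q ^ (n + 2)"
      using norm_divsum_le[of s "n + 2"]
      by (simp add: a_def norm_mult norm_power mult_right_mono numeral_3_eq_3 del: power_Suc of_nat_Suc)
    also have "\<dots> \<le> (3 ^ Suc s * 6 ^ n) * norm q ^ (n + 2)"
      by (intro mult_right_mono pw) auto
    finally show ?thesis by (simp add: power_mult_distrib power_add power2_eq_square mult_ac)
  qed
  have "norm (6 * norm q) < 1" using q by simp
  then have geo: "(\<lambda>n. (3 ^ Suc s * norm q ^ 2) * (6 * norm q) ^ n) sums
      ((3 ^ Suc s * norm q ^ 2) * (1 / (1 - 6 * norm q)))"
    by (intro sums_mult geometric_sums)
  have "norm (Sg s q - 1 - (1 + 2 ^ s) * q) \<le> (3 ^ Suc s * norm q ^ 2) * (1 / (1 - 6 * norm q))"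
    using norm_suminf_le[OF bd sums_summable[OF geo]] tail geo by (simp add: sums_iff)
  also have "\<dots> \<le> (3 ^ Suc s * norm q ^ 2) * (104 / 100)"
    using q by (intro mult_left_mono) (auto simp: field_simps)
  finally show ?thesis by (simp only: mult_ac)
qed

text \<open>
  Expanding \<open>E\<^sub>4\<^sup>3 - E\<^sub>6\<^sup>2 = 1728 q (1 - 24 q + \<dots>)\<close>: after the first two coefficients have been
  combined exactly, the triangle inequality for the remaining terms is good enough on
  \<open>\<bar>q\<bar> \<le> 1/200\<close>, and this disc contains the image of the fundamental domain.
\<close>

lemma Delta_hat_estimate:
  assumes q: "norm q \<le> 1 / 200"
  shows "norm ((uhat q) ^ 3 - 27 * (vhat q) ^ 2 - q) \<le> 3 / 4 * norm q"
proof -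
  define r where "r = norm q"
  have r: "0 \<le> r" "r \<le> 1 / 200" using q by (auto simp: r_def)
  define A where "A = q * Sg 3 q"
  define B where "B = q * Sg 5 q"
  define A3 where "A3 = A - q - 9 * q ^ 2"
  define B3 where "B3 = B - q - 33 * q ^ 2"
  have nA3: "norm A3 \<le> 85 * r ^ 3"
  proof -
    have "A3 = q * (Sg 3 q - 1 - (1 + 2 ^ 3) * q)"
      by (simp add: A3_def A_def algebra_simps power2_eq_square)
    then have "norm A3 \<le> r * (3 ^ Suc 3 * (104 / 100) * r ^ 2)"
      unfolding r_def by (simp only: norm_mult) (rule mult_left_mono[OF Sg_tail[OF q]], simp_all)
    also have "\<dots> \<le> 85 * r ^ 3" using r by (simp add: eval_nat_numeral)
    finally show ?thesis .
  qed
  have nB3: "norm B3 \<le> 760 * r ^ 3"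
  proof -
    have "B3 = q * (Sg 5 q - 1 - (1 + 2 ^ 5) * q)"
      by (simp add: B3_def B_def algebra_simps power2_eq_square)
    then have "norm B3 \<le> r * (3 ^ Suc 5 * (104 / 100) * r ^ 2)"
      unfolding r_def by (simp only: norm_mult) (rule mult_left_mono[OF Sg_tail[OF q]], simp_all)
    also have "\<dots> \<le> 760 * r ^ 3" using r by (simp add: eval_nat_numeral)
    finally show ?thesis .
  qed
  have r2: "0 \<le> r ^ 2" by simp
  have r32: "r ^ 3 \<le> (1 / 200) * r ^ 2" using mult_right_mono[OF r(2), of "r ^ 2"]
    by (simp add: power3_eq_cube power2_eq_square mult_ac)
  have r21: "r ^ 2 \<le> (1 / 200) * r" using mult_right_mono[OF r(2) r(1)] by (simp add: power2_eq_square)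
  have nA2: "norm (A - q) \<le> 95 / 10 * r ^ 2"
  proof -
    have "norm (A - q) = norm (A3 + 9 * q ^ 2)" by (simp add: A3_def)
    also have "\<dots> \<le> 85 * r ^ 3 + 9 * r ^ 2"
      using nA3 norm_triangle_ineq[of A3 "9 * q ^ 2"] by (simp add: norm_mult norm_power r_def)
    finally show ?thesis using r32 r2 by linarith
  qed
  have nB2: "norm (B - q) \<le> 37 * r ^ 2"
  proof -
    have "norm (B - q) = norm (B3 + 33 * q ^ 2)" by (simp add: B3_def)
    also have "\<dots> \<le> 760 * r ^ 3 + 33 * r ^ 2"
      using nB3 norm_triangle_ineq[of B3 "33 * q ^ 2"] by (simp add: norm_mult norm_power r_def)
    finally show ?thesis using r32 r2 by linarith
  qed
  have nA: "norm A \<le> 105 / 100 * r"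
  proof -
    have "norm A \<le> norm (A - q) + r" using norm_triangle_ineq[of "A - q" q] by (simp add: r_def)
    then show ?thesis using nA2 r21 r by linarith
  qed
  have nB: "norm B \<le> 119 / 100 * r"
  proof -
    have "norm B \<le> norm (B - q) + r" using norm_triangle_ineq[of "B - q" q] by (simp add: r_def)
    then show ?thesis using nB2 r21 r by linarith
  qed
  have nAA: "norm (A ^ 2 - q ^ 2) \<le> 20 * r ^ 3"
  proof -
    have "norm (A ^ 2 - q ^ 2) = norm (A - q) * norm (A + q)"
      by (simp add: power2_eq_square norm_mult[symmetric] algebra_simps)
    also have "\<dots> \<le> (95 / 10 * r ^ 2) * (205 / 100 * r)"
      using nA2 nA norm_triangle_ineq[of A q] r by (intro mult_mono) (auto simp: r_def)
    also have "\<dots> \<le> 20 * r ^ 3" using r by (simp add: eval_nat_numeral)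
    finally show ?thesis .
  qed
  have nBB: "norm (B ^ 2 - q ^ 2) \<le> 82 * r ^ 3"
  proof -
    have "norm (B ^ 2 - q ^ 2) = norm (B - q) * norm (B + q)"
      by (simp add: power2_eq_square norm_mult[symmetric] algebra_simps)
    also have "\<dots> \<le> (37 * r ^ 2) * (219 / 100 * r)"
      using nB2 nB norm_triangle_ineq[of B q] r by (intro mult_mono) (auto simp: r_def)
    also have "\<dots> \<le> 82 * r ^ 3" using r by (simp add: eval_nat_numeral)
    finally show ?thesis .
  qed
  have nAAA: "norm (A ^ 3) \<le> 12 / 10 * r ^ 3"
  proof -
    have "norm (A ^ 3) \<le> (105 / 100 * r) ^ 3" unfolding norm_power by (intro power_mono nA) auto
    also have "\<dots> \<le> 12 / 10 * r ^ 3" using r by (simp add: eval_nat_numeral)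
    finally show ?thesis .
  qed
  have e: "(uhat q) ^ 3 - 27 * (vhat q) ^ 2 - q = - 24 * q ^ 2 +
      (5 / 12 * A3 + 7 / 12 * B3 + 100 * (A ^ 2 - q ^ 2) + 8000 * A ^ 3 - 147 * (B ^ 2 - q ^ 2))"
    unfolding uhat_def vhat_def A_def[symmetric] B_def[symmetric] A3_def B3_def
    by (simp add: field_simps power2_eq_square power3_eq_cube)
  have six: "norm (x1 + (x2 + x3 + x4 + x5 - x6)) \<le>
      norm x1 + (norm x2 + norm x3 + norm x4 + norm x5 + norm x6)" for x1 x2 x3 x4 x5 x6 :: complex
    by (intro order_trans[OF norm_triangle_ineq] order_trans[OF norm_triangle_ineq4] add_mono order_refl)
  have "norm ((uhat q) ^ 3 - 27 * (vhat q) ^ 2 - q) \<le> norm (- 24 * q ^ 2) +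
      (norm (5 / 12 * A3) + norm (7 / 12 * B3) + norm (100 * (A ^ 2 - q ^ 2)) + norm (8000 * A ^ 3)
       + norm (147 * (B ^ 2 - q ^ 2)))"
    unfolding e by (rule six)
  also have "\<dots> = 24 * r ^ 2 + (5 / 12 * norm A3 + 7 / 12 * norm B3 + 100 * norm (A ^ 2 - q ^ 2)
      + 8000 * norm (A ^ 3) + 147 * norm (B ^ 2 - q ^ 2))"
    by (simp only: norm_mult norm_minus_cancel norm_numeral norm_divide norm_power norm_neg_numeral r_def)
  also have "\<dots> \<le> 24 * r ^ 2 + (5 / 12 * (85 * r ^ 3) + 7 / 12 * (760 * r ^ 3) + 100 * (20 * r ^ 3)
      + 8000 * (12 / 10 * r ^ 3) + 147 * (82 * r ^ 3))"
    using nA3 nB3 nAA nAAA nBB by (intro add_mono mult_left_mono) auto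
  also have "\<dots> \<le> 3 / 4 * r" using r r2 r21 r32 by linarith
  finally show ?thesis by (simp add: r_def)
qed

text \<open>
  Here \<open>exp(\<pi> sqrt 3) > 200\<close> is shown via \<open>\<pi> sqrt 3 \<ge> 5 + 2/5\<close>.
\<close>

lemma norm_qq_fundamental:
  assumes "Im z \<ge> sqrt 3 / 2"
  shows "norm (qq z) \<le> 1 / 200"
proof -
  have "sqrt 3 \<ge> 173 / 100" by (rule real_le_rsqrt) (simp add: power2_eq_square)
  then have s3: "(314 / 100) * (173 / 100) \<le> pi * sqrt 3" using pi_approx by (intro mult_mono) auto
  have "5 + 2 / 5 \<le> (314 / 100) * (173 / 100 :: real)" by simp
  also note s3
  also have "pi * sqrt 3 \<le> 2 * pi * Im z" using mult_left_mono[OF assms, of "2 * pi"] by simp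
  finally have "2 * pi * Im z \<ge> 5 + 2 / 5" .
  then have "exp (- 2 * pi * Im z) \<le> exp (- (5 + 2 / 5))" by simp
  also have "\<dots> = 1 / (exp 1 ^ 5 * exp (2 / 5))"
    by (simp only: exp_minus inverse_eq_divide exp_add exp_of_nat_mult[symmetric]) simp
  also have "\<dots> \<le> 1 / 200"
  proof -
    have e: "exp (1::real) \<ge> 27 / 10" using e_approx_32 by (simp add: abs_if split: if_splits)
    have "exp (2 / 5 :: real) \<ge> 1 + 2 / 5 + (2 / 5)\<^sup>2 / 2" by (rule exp_lower_Taylor_quadratic) simp
    then have "exp (2 / 5 :: real) \<ge> 148 / 100" by (simp add: power2_eq_square)
    moreover have "exp (1::real) ^ 5 \<ge> (27 / 10) ^ 5" using e by (intro power_mono) auto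
    ultimately have "exp (1::real) ^ 5 * exp (2 / 5) \<ge> (27 / 10) ^ 5 * (148 / 100)" by (intro mult_mono) auto
    then have "exp (1::real) ^ 5 * exp (2 / 5) \<ge> 200" by (simp add: eval_nat_numeral)
    then show ?thesis by (simp add: field_simps)
  qed
  finally show ?thesis by (simp add: norm_qq)
qed

section \<open>Lipschitz's formula\<close>

text \<open>
  The rows of the lattice sum: \<open>q \<Sum> (n+1)\<^sup>s q\<^sup>n\<close> arises from \<open>q/(1 - q)\<^sup>2\<close> by iterating \<open>q d/dq\<close>.
\<close>

definition Ps :: "nat \<Rightarrow> complex \<Rightarrow> complex" where
  "Ps s q = suminf (\<lambda>n. of_nat (Suc n) ^ s * q ^ n)"

lemma Ps_norm_summable:
  "norm q < 1 \<Longrightarrow> summable (\<lambda>n. norm (of_nat (Suc n) ^ s * q ^ n :: complex))"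
  by (rule summable_powser_bounded[of _ s]) (simp_all add: norm_power del: of_nat_Suc)

lemma Ps_sums:
  "norm q < 1 \<Longrightarrow> (\<lambda>n. of_nat (Suc n) ^ s * q ^ n) sums Ps s q"
  unfolding Ps_def by (intro summable_sums summable_norm_cancel[OF Ps_norm_summable])

lemma Ps_1: "norm q < 1 \<Longrightarrow> Ps (Suc 0) q = 1 / (1 - q) ^ 2"
  using geometric_deriv_sums[of q] unfolding Ps_def by (simp add: sums_iff)

lemma times_Ps_has_derivative:
  assumes "norm q < 1" "s > 0"
  shows "((\<lambda>q. q * Ps s q) has_field_derivative Ps (Suc s) q) (at q)"
proof -
  define c :: "nat \<Rightarrow> complex" where "c n = of_nat n ^ s" for n
  have sums: "(\<lambda>n. c n * q ^ n) sums (q * Ps s q)" if "norm q < 1" for q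
  proof -
    have "(\<lambda>n. q * (of_nat (Suc n) ^ s * q ^ n)) sums (q * Ps s q)"
      by (intro sums_mult Ps_sums that)
    then have "(\<lambda>n. c (Suc n) * q ^ Suc n) sums (q * Ps s q)"
      by (simp add: c_def mult_ac)
    then show ?thesis using assms(2) by (subst (asm) sums_Suc_iff) (simp add: c_def power_0_left)
  qed
  have "((\<lambda>q. suminf (\<lambda>n. c n * q ^ n)) has_field_derivative suminf (\<lambda>n. diffs c n * q ^ n)) (at q)"
    by (rule termdiffs_strong'[of 1]) (use sums assms(1) in \<open>auto simp: sums_iff\<close>)
  moreover have "suminf (\<lambda>n. diffs c n * q ^ n) = Ps (Suc s) q"
    by (simp add: Ps_def diffs_def c_def)
  ultimately have "((\<lambda>q. suminf (\<lambda>n. c n * q ^ n)) has_field_derivative Ps (Suc s) q) (at q)" by simp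
  then show ?thesis
    by (rule has_field_derivative_transform_within_open[of _ _ _ "ball 0 1"])
      (use sums assms(1) in \<open>auto simp: sums_iff\<close>)
qed

lemma upper_half_not_int: "z \<in> \<HH> \<Longrightarrow> z \<notin> \<int>"
  by (auto simp: upper_half_iff elim!: Ints_cases)

lemma DD_0_qq:
  assumes z: "z \<in> \<HH>"
  shows "DD 0 z = of_real pi * \<i> * (1 + qq z) / (1 - qq z)"
proof -
  define w where "w = exp (\<i> * (of_real pi * z))"
  have w: "w \<noteq> 0" by (simp add: w_def)
  have q: "qq z = w ^ 2" by (simp add: w_def qq_def power2_eq_square mult_ac flip: exp_add)
  have q1: "qq z \<noteq> 1" using norm_qq_less_1[OF z] by auto
  have c: "cos (of_real pi * z) = (w + 1 / w) / 2"
    by (simp add: cos_exp_eq w_def exp_minus inverse_eq_divide)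
  have s: "sin (of_real pi * z) = (w - 1 / w) / (2 * \<i>)"
    by (simp add: sin_exp_eq w_def exp_minus inverse_eq_divide)
  have "w - 1 / w \<noteq> 0" using w q1 by (simp add: q field_simps power2_eq_square)
  then show ?thesis
    unfolding DD_0[OF upper_half_not_int[OF z]] c s q using w q1[unfolded q]
    by (simp add: divide_simps) (simp add: algebra_simps power2_eq_square)
qed

text \<open>
  Both sides are derivatives of the cotangent, which in terms of \<open>q\<close> is a fractional linear function;
  \<open>d/dz\<close> is \<open>2\<pi>i q d/dq\<close>.
\<close>

lemma DD_qq:
  assumes "z \<in> \<HH>"
  shows "DD (Suc s) z = tpi ^ (s + 2) * (qq z * Ps (Suc s) (qq z))"
  using assms
proof (induction s arbitrary: z)
  case 0
  have "DD (Suc 0) z = tpi ^ 2 * qq z / (1 - qq z) ^ 2"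
  proof (rule deriv_eq_on_open[OF open_upper_half 0 DD_0_qq DD_has_derivative[OF upper_half_not_int[OF 0]]])
    have "qq z \<noteq> 1" using norm_qq_less_1[OF 0] by auto
    then show "((\<lambda>w. of_real pi * \<i> * (1 + qq w) / (1 - qq w)) has_field_derivative
        tpi ^ 2 * qq z / (1 - qq z) ^ 2) (at z)"
      by (auto intro!: derivative_eq_intros qq_has_derivative simp: power2_eq_square)
        (simp add: algebra_simps)
  qed
  then show ?case using Ps_1[OF norm_qq_less_1[OF 0]] by (simp add: power2_eq_square mult_ac)
next
  case (Suc s)
  show ?case
  proof (rule deriv_eq_on_open[OF open_upper_half Suc.prems Suc.IH DD_has_derivative[OF upper_half_not_int[OF Suc.prems]]])
    have "((\<lambda>w. tpi ^ (s + 2) * (qq w * Ps (Suc s) (qq w))) has_field_derivative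
       tpi ^ (s + 2) * (Ps (Suc (Suc s)) (qq z) * (tpi * qq z))) (at z)"
      by (intro DERIV_cmult DERIV_chain2[OF times_Ps_has_derivative qq_has_derivative])
        (use norm_qq_less_1[OF Suc.prems] in auto)
    then show "((\<lambda>w. tpi ^ (s + 2) * (qq w * Ps (Suc s) (qq w))) has_field_derivative
        tpi ^ (Suc s + 2) * (qq z * Ps (Suc (Suc s)) (qq z))) (at z)"
      by (simp add: mult_ac)
  qed
qed

section \<open>Eisenstein series as lattice sums\<close>

lemma int_split: "(UNIV :: int set) = range int \<union> range (\<lambda>n. - 1 - int n)"
  "range int \<inter> range (\<lambda>n. - 1 - int n) = {}"
proof -
  have "x \<in> range int \<union> range (\<lambda>n. - 1 - int n)" for x
  proof (cases "x \<ge> 0")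
    case True
    then have "x = int (nat x)" by simp
    then show ?thesis by blast
  next
    case False
    then have "x = - 1 - int (nat (- 1 - x))" by simp
    then show ?thesis by blast
  qed
  then show "(UNIV :: int set) = range int \<union> range (\<lambda>n. - 1 - int n)" by blast
qed auto

lemma has_sum_int_split:
  fixes f :: "int \<Rightarrow> 'a::banach"
  assumes "((\<lambda>n. f (int n)) has_sum a) UNIV" "((\<lambda>n. f (- 1 - int n)) has_sum b) UNIV"
  shows "(f has_sum (a + b)) UNIV"
proof -
  have "(f has_sum a) (range int)"
    using assms(1) by (subst has_sum_reindex) (auto simp: o_def)
  moreover have "(f has_sum b) (range (\<lambda>n. - 1 - int n))"
    using assms(2) by (subst has_sum_reindex) (auto simp: o_def inj_on_def)
  ultimately show ?thesis
    by (subst int_split(1)) (intro has_sum_Un_disjoint int_split(2))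
qed

lemma Polygamma_sums:
  assumes "z \<noteq> 0" "odd s"
  shows "(\<lambda>n. 1 / (z + of_nat n) ^ Suc s) sums (Polygamma s z / fact s :: complex)"
proof -
  have s: "s \<noteq> 0" using assms(2) by (cases s) auto
  have "summable (\<lambda>n. inverse ((z + of_nat n) ^ Suc s))"
    using assms(1) s by (intro Polygamma_converges') auto
  then have "(\<lambda>n. inverse ((z + of_nat n) ^ Suc s)) sums suminf (\<lambda>n. inverse ((z + of_nat n) ^ Suc s))"
    by (rule summable_sums)
  moreover have "Polygamma s z / fact s = suminf (\<lambda>n. inverse ((z + of_nat n) ^ Suc s))"
    using s assms(2) by (simp add: Polygamma_def)
  ultimately show ?thesis by (simp add: inverse_eq_divide del: power_Suc)
qed

text \<open>
  A summable weight on \<open>\<int>\<close> whose products dominate the terms of the lattice sums.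
\<close>

definition gweight :: "int \<Rightarrow> real" where "gweight m = 1 / (1 + of_int \<bar>m\<bar>) ^ 2"

lemma gweight_summable: "gweight summable_on UNIV"
proof -
  have s: "summable (\<lambda>n. 1 / (1 + real n) ^ 2)"
    using inverse_squares_sums by (auto simp: sums_iff add.commute)
  have nn: "(f has_sum suminf f) UNIV" if "summable f" "\<And>n. f n \<ge> 0" for f :: "nat \<Rightarrow> real"
    using that by (intro norm_summable_imp_has_sum summable_sums) auto
  have "(\<lambda>n. gweight (int n)) = (\<lambda>n. 1 / (1 + real n) ^ 2)"
    by (simp add: fun_eq_iff gweight_def)
  then have 1: "((\<lambda>n. gweight (int n)) has_sum suminf (\<lambda>n. 1 / (1 + real n) ^ 2)) UNIV"
    using nn[OF s] by simp
  have e: "(\<lambda>n. gweight (- 1 - int n)) = (\<lambda>n. 1 / (1 + real (Suc n)) ^ 2)"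
    by (simp add: fun_eq_iff gweight_def abs_if)
  have "summable (\<lambda>n. 1 / (1 + real (Suc n)) ^ 2)" using s summable_Suc_iff[of "\<lambda>n. 1 / (1 + real n) ^ 2"] by simp
  then have 2: "((\<lambda>n. gweight (- 1 - int n)) has_sum suminf (\<lambda>n. 1 / (1 + real (Suc n)) ^ 2)) UNIV"
    unfolding e by (rule nn) simp
  show ?thesis using has_sum_int_split[OF 1 2] by (auto simp: summable_on_def)
qed

lemma gweight_nonneg: "gweight m \<ge> 0"
  by (simp add: gweight_def)

lemma gweight_product_summable: "(\<lambda>(m, n). gweight m * gweight n) summable_on (UNIV \<times> UNIV)"
proof (rule summable_on_SigmaI)
  show "((\<lambda>n. case (m, n) of (m, n) \<Rightarrow> gweight m * gweight n) has_sum gweight m * infsum gweight UNIV) UNIV" for m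
    using has_sum_cmult_right[OF has_sum_infsum[OF gweight_summable]] by simp
  show "(\<lambda>m. gweight m * infsum gweight UNIV) summable_on UNIV"
    by (intro summable_on_cmult_left gweight_summable)
qed (auto simp: gweight_nonneg)

lemma lattice_bound:
  assumes z: "z \<in> \<HH>"
  obtains K where "K > 0" "\<And>m n. m \<noteq> 0 \<or> n \<noteq> 0 \<Longrightarrow>
    1 + real_of_int \<bar>m\<bar> \<le> K * norm (of_int m * z + of_int n) \<and>
    1 + real_of_int \<bar>n\<bar> \<le> K * norm (of_int m * z + of_int n)"
proof -
  define M where "M = 1 / Im z"
  define N where "N = 1 + norm z * M"
  have y: "Im z > 0" using z by (simp add: upper_half_iff)
  have M: "M > 0" and N: "N > 0" using y by (auto simp: M_def N_def intro!: add_pos_nonneg)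
  show ?thesis
  proof (rule that[of "2 * M + 2 * N"])
    show "2 * M + 2 * N > 0" using M N by simp
  next
    fix m n :: int assume mn: "m \<noteq> 0 \<or> n \<noteq> 0"
    define t where "t = norm (of_int m * z + of_int n)"
    have t: "t \<ge> 0" by (simp add: t_def)
    have "\<bar>Im (of_int m * z + of_int n)\<bar> \<le> t" unfolding t_def by (rule abs_Im_le_cmod)
    then have "real_of_int \<bar>m\<bar> * Im z \<le> t" using y by (simp add: abs_mult)
    then have m: "real_of_int \<bar>m\<bar> \<le> M * t" using y by (simp add: M_def field_simps)
    have "norm (of_int n :: complex) \<le> t + norm (of_int m * z)"
      unfolding t_def by (metis add_diff_cancel_left' norm_triangle_ineq4 add.commute)
    also have "norm (of_int m * z) \<le> (M * t) * norm z"
      using m by (simp add: norm_mult mult_right_mono)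
    finally have n: "real_of_int \<bar>n\<bar> \<le> N * t" by (simp add: N_def algebra_simps)
    have "1 \<le> \<bar>m\<bar> + \<bar>n\<bar>" using mn by linarith
    then have "1 \<le> real_of_int \<bar>m\<bar> + real_of_int \<bar>n\<bar>"
      by (metis of_int_1 of_int_add of_int_le_iff)
    with m n have 1: "1 \<le> (M + N) * t" by (simp add: algebra_simps)
    have "M * t \<ge> 0" "N * t \<ge> 0" using M N t by auto
    with 1 m n show "1 + real_of_int \<bar>m\<bar> \<le> (2 * M + 2 * N) * norm (of_int m * z + of_int n) \<and>
      1 + real_of_int \<bar>n\<bar> \<le> (2 * M + 2 * N) * norm (of_int m * z + of_int n)"
      unfolding t_def[symmetric] by (simp add: algebra_simps)
  qed
qed

lemma lattice_summable:
  assumes z: "z \<in> \<HH>" and k: "k \<ge> 4"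
  shows "(\<lambda>(m, n). 1 / (of_int m * z + of_int n) ^ k) summable_on (UNIV \<times> UNIV)"
proof -
  obtain K where K: "K > 0" "\<And>m n. m \<noteq> 0 \<or> n \<noteq> 0 \<Longrightarrow>
    1 + real_of_int \<bar>m\<bar> \<le> K * norm (of_int m * z + of_int n) \<and>
    1 + real_of_int \<bar>n\<bar> \<le> K * norm (of_int m * z + of_int n)"
    using lattice_bound[OF z] by blast
  have "(\<lambda>p. norm (case p of (m, n) \<Rightarrow> 1 / (of_int m * z + of_int n) ^ k)) summable_on (UNIV \<times> UNIV)"
  proof (rule Infinite_Sum.abs_summable_on_comparison_test'[where g = "\<lambda>p. K ^ k * (case p of (m, n) \<Rightarrow> gweight m * gweight n)"])
    show "(\<lambda>p. K ^ k * (case p of (m, n) \<Rightarrow> gweight m * gweight n)) summable_on (UNIV \<times> UNIV)"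
      by (intro summable_on_cmult_right gweight_product_summable)
    fix p :: "int \<times> int"
    obtain m n where p: "p = (m, n)" by (cases p)
    define t where "t = norm (of_int m * z + of_int n)"
    show "norm (case p of (m, n) \<Rightarrow> 1 / (of_int m * z + of_int n) ^ k) \<le> K ^ k * (case p of (m, n) \<Rightarrow> gweight m * gweight n)"
    proof (cases "m = 0 \<and> n = 0")
      case True
      then show ?thesis using k K(1) by (simp add: p gweight_def power_0_left)
    next
      case False
      then have b: "1 + real_of_int \<bar>m\<bar> \<le> K * t" "1 + real_of_int \<bar>n\<bar> \<le> K * t"
        using K(2) by (auto simp: t_def)
      have Kt: "1 \<le> K * t" using b(1) by simp
      then have t: "t > 0" using K(1) by (smt (verit, best) mult_nonneg_nonpos)
      have "(1 + real_of_int \<bar>m\<bar>) ^ 2 * (1 + real_of_int \<bar>n\<bar>) ^ 2 \<le> (K * t) ^ 2 * (K * t) ^ 2"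
        using b by (intro mult_mono power_mono) auto
      also have "\<dots> = (K * t) ^ 4" by (simp flip: power_add)
      also have "\<dots> \<le> (K * t) ^ k" using Kt k by (intro power_increasing) auto
      finally have "1 / (K * t) ^ k \<le> 1 / ((1 + real_of_int \<bar>m\<bar>) ^ 2 * (1 + real_of_int \<bar>n\<bar>) ^ 2)"
        by (intro divide_left_mono) (use t K(1) in \<open>auto intro!: mult_pos_pos zero_less_power add_pos_nonneg\<close>)
      then have "K ^ k * (1 / (K * t) ^ k) \<le> K ^ k * (gweight m * gweight n)"
        using K(1) by (intro mult_left_mono) (auto simp: gweight_def)
      moreover have "K ^ k * (1 / (K * t) ^ k) = 1 / t ^ k" using K(1) by (simp add: power_mult_distrib)
      ultimately show ?thesis by (simp add: p t_def norm_divide norm_power)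
    qed
  qed
  then show ?thesis by (rule abs_summable_summable)
qed

text \<open>
  The term at \<open>(0, 0)\<close> is \<open>1/0 = 0\<close> and does not contribute.
\<close>

definition lat :: "nat \<Rightarrow> complex \<Rightarrow> complex" where
  "lat k z = infsum (\<lambda>(m, n). 1 / (of_int m * z + of_int n) ^ k) (UNIV \<times> UNIV)"

text \<open>
  The substitution \<open>(m, n) \<mapsto> (n, -m)\<close> permutes the lattice points.
\<close>

lemma lat_S:
  assumes z: "z \<in> \<HH>"
  shows "lat k (- 1 / z) = z ^ k * lat k z"
proof -
  have z0: "z \<noteq> 0" using z by (auto simp: upper_half_iff)
  have "lat k (- 1 / z) = infsum (\<lambda>p. z ^ k * (case p of (m, n) \<Rightarrow> 1 / (of_int n * z + of_int (- m)) ^ k)) (UNIV \<times> UNIV)"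
    unfolding lat_def
  proof (intro infsum_cong, clarify)
    fix m n :: int
    have "of_int m * (- 1 / z) + of_int n = (of_int n * z + of_int (- m)) / z" using z0 by (simp add: field_simps)
    then show "1 / (of_int m * (- 1 / z) + of_int n) ^ k = z ^ k * (1 / (of_int n * z + of_int (- m)) ^ k)"
      by (simp add: power_divide)
  qed
  also have "\<dots> = z ^ k * infsum (\<lambda>p. case p of (m, n) \<Rightarrow> 1 / (of_int n * z + of_int (- m)) ^ k) (UNIV \<times> UNIV)"
    by (rule infsum_cmult_right')
  also have "infsum (\<lambda>p. case p of (m, n) \<Rightarrow> 1 / (of_int n * z + of_int (- m)) ^ k) (UNIV \<times> UNIV)
      = infsum (\<lambda>p. (\<lambda>(m, n). 1 / (of_int m * z + of_int n) ^ k) ((\<lambda>(m, n). (n, - m)) p)) (UNIV \<times> UNIV)"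
    by (intro infsum_cong) auto
  also have "\<dots> = lat k z"
    unfolding lat_def
    by (rule infsum_reindex_bij_betw)
      (auto simp: bij_betw_def inj_on_def image_def intro: exI[of _ "- x" for x])
  finally show ?thesis .
qed

lemma row_has_sum:
  assumes "w \<notin> \<int>" "odd s"
  shows "((\<lambda>n. 1 / (w + of_int n) ^ Suc s) has_sum (DD s w / fact s)) UNIV"
proof -
  have w: "w \<noteq> 0" "1 - w \<noteq> 0" using assms(1) by auto
  have sum: "((\<lambda>n. 1 / (z + of_nat n) ^ Suc s) has_sum (Polygamma s z / fact s)) UNIV" if "z \<noteq> 0" for z :: complex
  proof (rule norm_summable_imp_has_sum[OF _ Polygamma_sums[OF that assms(2)]])
    have "s \<noteq> 0" using assms(2) by (cases s) auto
    then have s2: "Suc s \<ge> 2" by auto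
    define N where "N = nat \<lceil>2 * norm z\<rceil> + 1"
    have "summable (\<lambda>n. 4 / real (Suc n) ^ 2 * 2 ^ Suc s)"
      using inverse_squares_sums by (intro summable_mult2) (auto simp: sums_iff intro: summable_divide dest: summable_mult[of _ 4])
    then show "summable (\<lambda>n. norm (1 / (z + of_nat n) ^ Suc s))"
    proof (rule summable_comparison_test'[where N = N])
      fix n assume n: "n \<ge> N"
      then have n1: "n \<ge> 1" and nz: "real n \<ge> 2 * norm z" unfolding N_def by linarith+
      have "norm (z + of_nat n) \<ge> real n - norm z"
        using norm_triangle_ineq4[of "z + of_nat n" z] by simp
      then have b: "norm (z + of_nat n) \<ge> real n / 2" using nz by simp
      have "1 / norm (z + of_nat n) ^ Suc s \<le> 1 / (real n / 2) ^ Suc s"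
        using b n1 by (intro divide_left_mono power_mono mult_pos_pos zero_less_power) auto
      also have "\<dots> = 2 ^ Suc s * (1 / real n ^ Suc s)" by (simp add: power_divide)
      also have "\<dots> \<le> 2 ^ Suc s * (4 / real (Suc n) ^ 2)"
      proof (intro mult_left_mono)
        have "real (Suc n) ^ 2 \<le> (2 * real n) ^ 2" using n1 by (intro power_mono) auto
        also have "\<dots> = 4 * real n ^ 2" by (simp add: power_mult_distrib)
        also have "\<dots> \<le> 4 * real n ^ Suc s" using n1 s2 by (intro mult_left_mono power_increasing) auto
        finally show "1 / real n ^ Suc s \<le> 4 / real (Suc n) ^ 2" using n1 by (simp add: field_simps del: power_Suc of_nat_Suc)
      qed simp
      finally show "norm (norm (1 / (z + of_nat n) ^ Suc s)) \<le> 4 / real (Suc n) ^ 2 * 2 ^ Suc s"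
        by (simp add: norm_divide norm_power mult_ac del: power_Suc of_nat_Suc)
    qed
  qed
  have 1: "((\<lambda>n. 1 / (w + of_int (int n)) ^ Suc s) has_sum (Polygamma s w / fact s)) UNIV"
    using sum[OF w(1)] by simp
  have "(w + of_int (- 1 - int n)) ^ Suc s = (1 - w + of_nat n) ^ Suc s" for n
  proof -
    have "w + of_int (- 1 - int n) = - (1 - w + of_nat n)" by simp
    moreover have "even (Suc s)" using assms(2) by simp
    ultimately show ?thesis by (metis power_minus_even)
  qed
  then have 2: "((\<lambda>n. 1 / (w + of_int (- 1 - int n)) ^ Suc s) has_sum (Polygamma s (1 - w) / fact s)) UNIV"
    using sum[OF w(2)] by presburger
  show ?thesis
    using has_sum_int_split[OF 1 2] assms(2) by (simp add: DD_def add_divide_distrib)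
qed

lemma row_0_has_sum:
  assumes "odd s"
  shows "((\<lambda>n. 1 / (of_int n :: complex) ^ Suc s) has_sum (2 * Polygamma s 1 / fact s)) UNIV"
proof -
  let ?a = "\<lambda>n::nat. 1 / (1 + of_nat n :: complex) ^ Suc s"
  have "s \<noteq> 0" using assms by (cases s) auto
  then have s2: "Suc s \<ge> 2" by auto
  have "summable (\<lambda>n. norm (?a n))"
  proof (rule summable_comparison_test'[where N = 0])
    show "summable (\<lambda>n. 1 / real (Suc n) ^ 2)" using inverse_squares_sums by (simp add: sums_iff)
    fix n
    have "norm (1 + of_nat n :: complex) = real (Suc n)" by (metis of_nat_Suc norm_of_nat)
    moreover have "1 / real (Suc n) ^ Suc s \<le> 1 / real (Suc n) ^ 2"
      using s2 by (intro divide_left_mono power_increasing mult_pos_pos zero_less_power) auto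
    ultimately show "norm (norm (?a n)) \<le> 1 / real (Suc n) ^ 2"
      unfolding real_norm_def abs_norm_cancel by (simp only: norm_divide norm_power norm_one)
  qed
  then have a: "(?a has_sum (Polygamma s 1 / fact s)) UNIV"
    by (rule norm_summable_imp_has_sum[OF _ Polygamma_sums[OF _ assms]]) simp
  have "((\<lambda>n. 1 / (of_int n :: complex) ^ Suc s) has_sum (Polygamma s 1 / fact s)) (range (\<lambda>n. 1 + int n))"
    using a by (subst has_sum_reindex) (auto simp: o_def inj_on_def)
  moreover have "(of_int (- 1 - int n) :: complex) ^ Suc s = (1 + of_nat n) ^ Suc s" for n
  proof -
    have "(of_int (- 1 - int n) :: complex) = - (1 + of_nat n)" by simp
    moreover have "even (Suc s)" using assms by simp
    ultimately show ?thesis by (metis power_minus_even)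
  qed
  then have "((\<lambda>n. 1 / (of_int n :: complex) ^ Suc s) has_sum (Polygamma s 1 / fact s)) (range (\<lambda>n. - 1 - int n))"
    using a by (subst has_sum_reindex) (auto simp: o_def inj_on_def simp del: of_int_diff of_int_minus power_Suc)
  ultimately have "((\<lambda>n. 1 / (of_int n :: complex) ^ Suc s) has_sum (Polygamma s 1 / fact s + Polygamma s 1 / fact s))
      (range (\<lambda>n. 1 + int n) \<union> range (\<lambda>n. - 1 - int n))"
    by (intro has_sum_Un_disjoint) auto
  moreover have "((\<lambda>n. 1 / (of_int n :: complex) ^ Suc s) has_sum v) (range (\<lambda>n. 1 + int n) \<union> range (\<lambda>n. - 1 - int n))
     \<longleftrightarrow> ((\<lambda>n. 1 / (of_int n :: complex) ^ Suc s) has_sum v) UNIV" for v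
  proof (rule has_sum_cong_neutral)
    fix x :: int assume "x \<in> UNIV - (range (\<lambda>n. 1 + int n) \<union> range (\<lambda>n. - 1 - int n))"
    moreover have "x \<in> range (\<lambda>n. - 1 - int n) \<or> x \<in> range int" using int_split(1) by blast
    ultimately obtain n where n: "x = int n" "int n \<notin> range (\<lambda>n. 1 + int n)" by blast
    have "n = 0"
    proof (rule ccontr)
      assume "n \<noteq> 0"
      then have "int n = 1 + int (n - 1)" by simp
      then show False using n(2) by blast
    qed
    then show "1 / (of_int x :: complex) ^ Suc s = 0" by (simp add: n(1))
  qed auto
  ultimately show ?thesis by simp
qed

text \<open>
  Double summation over \<open>(m, r)\<close> of \<open>r\<^sup>s q\<^sup>m\<^sup>r\<close>, grouped by \<open>m\<close> on the left and by \<open>N = m r\<close> on the right.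
\<close>

lemma divisor_sum_regroup:
  assumes q: "norm q < 1"
  shows "((\<lambda>m. q ^ Suc m * Ps s (q ^ Suc m)) has_sum (q * Sg s q)) UNIV"
proof -
  define f :: "nat \<times> nat \<Rightarrow> complex" where "f = (\<lambda>(N, d). of_nat d ^ s * q ^ N)"
  let ?A = "SIGMA N:{1::nat..}. {d. d dvd N}"
  have inner: "((\<lambda>d. f (N, d)) has_sum (of_nat (divsum s N) * q ^ N)) {d. d dvd N}" if "N \<in> {1..}" for N
    using that by (intro has_sum_finiteI) (auto simp: f_def divsum_def sum_distrib_right)
  have innern: "((\<lambda>d. norm (f (N, d))) has_sum norm (of_nat (divsum s N) * q ^ N)) {d. d dvd N}" if "N \<in> {1..}" for N
  proof (rule has_sum_finiteI)
    show "norm (of_nat (divsum s N) * q ^ N) = (\<Sum>d | d dvd N. norm (f (N, d)))"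
    proof -
      have "norm (of_nat (divsum s N) * q ^ N) = real (divsum s N) * norm q ^ N"
        by (simp only: norm_mult norm_power norm_of_nat)
      also have "\<dots> = (\<Sum>d | d dvd N. norm (f (N, d)))"
        by (simp only: f_def case_prod_conv norm_mult norm_power norm_of_nat divsum_def of_nat_sum
            of_nat_power sum_distrib_right)
      finally show ?thesis .
    qed
  qed (use that in auto)
  have range: "{1..} = range Suc" by (auto simp: image_iff dest: Suc_le_D)
  have sn: "summable (\<lambda>n. norm (of_nat (divsum s (Suc n)) * q ^ n))"
    by (rule summable_powser_bounded[OF norm_divsum_le q])
  have "((\<lambda>n. q * (of_nat (divsum s (Suc n)) * q ^ n)) has_sum (q * Sg s q)) UNIV"
    by (intro has_sum_cmult_right norm_summable_imp_has_sum sn Sg_sums q)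
  then have outer: "((\<lambda>N. of_nat (divsum s N) * q ^ N) has_sum (q * Sg s q)) {1..}"
    unfolding range by (subst has_sum_reindex) (auto simp: o_def mult_ac)
  have outern: "(\<lambda>N. norm (of_nat (divsum s N) * q ^ N)) summable_on {1..}"
    using outer by (simp add: summable_on_iff_abs_summable_on_complex[symmetric] has_sum_imp_summable)
  have "(\<lambda>p. norm (f p)) summable_on ?A"
    by (rule summable_on_SigmaI[OF innern outern]) auto
  then have fs: "f summable_on ?A" by (rule abs_summable_summable)
  have tot: "(f has_sum (q * Sg s q)) ?A"
    by (rule has_sum_SigmaI[OF inner outer fs])
  have bij: "bij_betw (\<lambda>(m, r). (Suc m * Suc r, Suc r)) (UNIV \<times> UNIV) ?A"
  proof (rule bij_betwI[where g = "\<lambda>(N, d). (N div d - 1, d - 1)"])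
    show "(\<lambda>(m, r). (Suc m * Suc r, Suc r)) \<in> UNIV \<times> UNIV \<rightarrow> ?A"
      by (auto simp del: mult_Suc mult_Suc_right simp: Suc_le_eq)
    show "(\<lambda>(N, d). (N div d - 1, d - 1)) \<in> ?A \<rightarrow> UNIV \<times> UNIV" by auto
    show "(case (case x of (m, r) \<Rightarrow> (Suc m * Suc r, Suc r)) of (N, d) \<Rightarrow> (N div d - 1, d - 1)) = x" for x
      by (cases x) (simp del: mult_Suc mult_Suc_right)
    fix y assume "y \<in> ?A"
    then obtain N d where y: "y = (N, d)" "N \<ge> 1" "d dvd N" by auto
    then obtain e where e: "N = d * e" by (elim dvdE)
    then have "d * e \<noteq> 0" using y(2) by linarith
    then have "d \<noteq> 0" "e \<noteq> 0" by simp_all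
    then have "d \<ge> 1" "e \<ge> 1" by linarith+
    then show "(case (case y of (N, d) \<Rightarrow> (N div d - 1, d - 1)) of (m, r) \<Rightarrow> (Suc m * Suc r, Suc r)) = y"
      using y(1) e by (simp add: mult.commute del: mult_Suc mult_Suc_right)
  qed
  have "((\<lambda>p. f (case p of (m, r) \<Rightarrow> (Suc m * Suc r, Suc r))) has_sum (q * Sg s q)) (UNIV \<times> UNIV)"
    using tot has_sum_reindex_bij_betw[OF bij, of f] by blast
  then have "((\<lambda>(m, r). of_nat (Suc r) ^ s * q ^ (Suc m * Suc r)) has_sum (q * Sg s q)) (UNIV \<times> UNIV)"
    by (simp add: f_def case_prod_unfold)
  then show ?thesis
  proof (rule has_sum_SigmaD)
    fix m :: nat
    have qm: "norm (q ^ Suc m) < 1" using q by (metis norm_power power_Suc_less_one norm_ge_zero linorder_not_less power_less_one_iff zero_less_Suc less_one)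
    have "((\<lambda>r. q ^ Suc m * (of_nat (Suc r) ^ s * (q ^ Suc m) ^ r)) has_sum (q ^ Suc m * Ps s (q ^ Suc m))) UNIV"
      by (intro has_sum_cmult_right norm_summable_imp_has_sum Ps_norm_summable Ps_sums qm)
    then show "((\<lambda>r. case (m, r) of (m, r) \<Rightarrow> of_nat (Suc r) ^ s * q ^ (Suc m * Suc r)) has_sum
        (q ^ Suc m * Ps s (q ^ Suc m))) UNIV"
    proof (rule has_sum_cong[THEN iffD1, rotated])
      show "q ^ Suc m * (of_nat (Suc r) ^ s * (q ^ Suc m) ^ r) =
          (case (m, r) of (m, r) \<Rightarrow> of_nat (Suc r) ^ s * q ^ (Suc m * Suc r))" for r
        unfolding case_prod_conv power_mult[of q "Suc m"] power_Suc[of "q ^ Suc m" r]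
        by (simp only: mult_ac)
    qed
  qed
qed

text \<open>
  Summation over rows: the rows \<open>m\<close> and \<open>-m\<close> agree and are given by Lipschitz's formula at \<open>m z\<close>, while
  the row \<open>m = 0\<close> is a zeta value.
\<close>

lemma lat_expansion:
  assumes z: "z \<in> \<HH>" and s: "odd s" "s \<ge> 3"
  shows "lat (Suc s) z = 2 * Polygamma s 1 / fact s + 2 * tpi ^ Suc s / fact s * (qq z * Sg s (qq z))"
proof -
  let ?f = "\<lambda>(m, n). 1 / (of_int m * z + of_int n) ^ Suc s"
  define C where "C = tpi ^ Suc s / fact s"
  define R where "R m = infsum (\<lambda>n. 1 / (of_int m * z + of_int n) ^ Suc s) (UNIV :: int set)" for m :: int
  have sm: "?f summable_on (UNIV \<times> UNIV)" by (rule lattice_summable[OF z]) (use s in simp)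
  have pos: "R (1 + int m) = C * (qq z ^ Suc m * Ps s (qq z ^ Suc m))" for m
  proof -
    have w: "of_int (1 + int m) * z \<in> \<HH>"
      using z by (simp add: upper_half_iff)
    have qw: "qq (of_int (1 + int m) * z) = qq z ^ Suc m"
      by (simp add: qq_def algebra_simps flip: exp_of_nat_mult exp_add)
    obtain s' where s': "s = Suc s'" using s by (cases s) auto
    show ?thesis
      unfolding R_def C_def
      using infsumI[OF row_has_sum[OF upper_half_not_int[OF w] s(1)]] DD_qq[OF w, of s']
      unfolding qw s' by (simp only: add_2_eq_Suc' times_divide_eq_left)
  qed
  have neg: "R (- 1 - int m) = R (1 + int m)" for m
  proof -
    have "R (1 + int m) = infsum (\<lambda>n. (\<lambda>n. 1 / (of_int (1 + int m) * z + of_int n) ^ Suc s) (- n)) UNIV"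
      unfolding R_def by (rule infsum_reindex_bij_betw[symmetric]) (auto simp: bij_betw_def inj_on_def intro!: image_eqI[where x = "- x" for x])
    also have "\<dots> = R (- 1 - int m)"
      unfolding R_def
    proof (rule infsum_cong)
      fix n :: int
      have "of_int (- 1 - int m) * z + of_int n = - (of_int (1 + int m) * z + of_int (- n))"
        by (simp add: algebra_simps)
      moreover have "even (Suc s)" using s(1) by simp
      ultimately show "1 / (of_int (1 + int m) * z + of_int (- n)) ^ Suc s = 1 / (of_int (- 1 - int m) * z + of_int n) ^ Suc s"
        by (metis power_minus_even)
    qed
    finally show ?thesis by simp
  qed
  have R0: "R 0 = 2 * Polygamma s 1 / fact s"
    unfolding R_def using infsumI[OF row_0_has_sum[OF s(1)]] by simp
  define Q where "Q = C * (qq z * Sg s (qq z))"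
  have reg: "((\<lambda>m. R (1 + int m)) has_sum Q) UNIV"
    unfolding pos Q_def by (intro has_sum_cmult_right divisor_sum_regroup norm_qq_less_1 z)
  have "((\<lambda>m. R (int m)) has_sum (R 0 + Q)) UNIV"
  proof -
    have U: "(UNIV :: nat set) = insert 0 (range Suc)" by (metis UNIV_nat_eq)
    have "((\<lambda>m. R (int m)) has_sum Q) (range Suc)"
      using reg by (subst has_sum_reindex) (auto simp: o_def)
    then have "((\<lambda>m. R (int m)) has_sum (R 0 + Q)) (insert 0 (range Suc))"
      using has_sum_insert[of 0 "range Suc" "\<lambda>m. R (int m)" Q] by simp
    then show ?thesis unfolding U[symmetric] .
  qed
  then have "(R has_sum (R 0 + Q + Q)) UNIV"
    by (rule has_sum_int_split) (use reg in \<open>simp add: neg\<close>)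
  moreover have "lat (Suc s) z = infsum R UNIV"
    unfolding lat_def R_def using infsum_Sigma_banach[OF sm] by simp
  ultimately have "lat (Suc s) z = R 0 + Q + Q" by (simp add: infsumI)
  then show ?thesis by (simp add: R0 Q_def C_def algebra_simps)
qed

lemma eisenstein_G_lat:
  assumes "z \<in> \<HH>"
  shows "lat 4 z = 16 * of_real pi ^ 4 / 3 * eisenstein_G 4 z"
    and "lat 6 z = - 16 * of_real pi ^ 6 / 15 * eisenstein_G 6 z"
proof -
  have i: "\<i> ^ 4 = 1" "\<i> ^ 6 = - 1" by (simp_all add: eval_nat_numeral)
  have f: "fact 3 = (6::complex)" "fact 5 = (120::complex)" by (simp_all add: fact_numeral)
  have e: "eisenstein_G 4 z = 1 / 240 + qq z * Sg 3 (qq z)" "eisenstein_G 6 z = - 1 / 504 + qq z * Sg 5 (qq z)"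
    using assms by (simp_all add: eisenstein_G_qq bernoulli_values of_rat_minus of_rat_divide)
  have p4: "Suc 3 = 4" "Suc 5 = 6" by simp_all
  have pi: "tpi ^ 4 = 16 * of_real pi ^ 4" "tpi ^ 6 = - 64 * (of_real pi ^ 6 :: complex)"
    using i by (simp_all add: power_mult_distrib)
  have l: "lat 4 z = (2 * of_real pi ^ 4 / 15) / 6 + 2 * (16 * of_real pi ^ 4) / 6 * (qq z * Sg 3 (qq z))"
    "lat 6 z = (16 * of_real pi ^ 6 / 63) / 120 + 2 * (- 64 * of_real pi ^ 6) / 120 * (qq z * Sg 5 (qq z))"
    using lat_expansion[OF assms, of 3] lat_expansion[OF assms, of 5]
    unfolding Polygamma_3_at_1 Polygamma_5_at_1 f p4 pi by simp_all
  show "lat 4 z = 16 * of_real pi ^ 4 / 3 * eisenstein_G 4 z"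
    unfolding l e by (simp add: distrib_left)
  show "lat 6 z = - 16 * of_real pi ^ 6 / 15 * eisenstein_G 6 z"
    unfolding l e by (simp add: right_diff_distrib distrib_left)
qed

text \<open>
  The transformation of the Eisenstein series under \<open>S\<close> is that of the lattice sums.
\<close>

lemma rho_S:
  assumes z: "z \<in> \<HH>"
  shows "rho_u (- 1 / z) = z ^ 4 * rho_u z" "rho_v (- 1 / z) = z ^ 6 * rho_v z"
proof -
  have Sz: "- 1 / z \<in> \<HH>"
    using moebius_upper_half[of SS z] z by (simp add: moebius_gens)
  have "of_real pi \<noteq> (0::complex)" by simp
  then show "rho_u (- 1 / z) = z ^ 4 * rho_u z" "rho_v (- 1 / z) = z ^ 6 * rho_v z"
    using lat_S[OF z, of 4] lat_S[OF z, of 6]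
    unfolding eisenstein_G_lat[OF z] eisenstein_G_lat[OF Sz] rho_u_def rho_v_def
    by (simp_all add: field_simps)
qed

section \<open>Modular forms of level one\<close>

definition modular :: "int \<Rightarrow> (complex \<Rightarrow> complex) \<Rightarrow> bool" where
  "modular k f \<longleftrightarrow> (\<forall>\<gamma>\<in>SL2Z. \<forall>z\<in>\<HH>. f (moebius \<gamma> z) = jfac \<gamma> z powi k * f z)"

lemma modularD:
  "modular k f \<Longrightarrow> \<gamma> \<in> SL2Z \<Longrightarrow> z \<in> \<HH> \<Longrightarrow> f (moebius \<gamma> z) = jfac \<gamma> z powi k * f z"
  by (simp add: modular_def)

lemma modularI_gens:
  assumes T: "\<And>z. z \<in> \<HH> \<Longrightarrow> f (z + 1) = f z"
    and S: "\<And>z. z \<in> \<HH> \<Longrightarrow> f (- 1 / z) = z powi k * f z"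
  shows "modular k f"
  unfolding modular_def
proof
  fix \<gamma> assume "\<gamma> \<in> SL2Z"
  then show "\<forall>z\<in>\<HH>. f (moebius \<gamma> z) = jfac \<gamma> z powi k * f z"
  proof (induction rule: SL2Z_induct)
    case one
    then show ?case by (simp add: moebius_gens)
  next
    case (S \<gamma>)
    show ?case
    proof
      fix z assume z: "z \<in> \<HH>"
      have Sz: "- 1 / z \<in> \<HH>" using moebius_upper_half[of SS z] z by (simp add: moebius_gens)
      show "f (moebius (\<gamma> ** SS) z) = jfac (\<gamma> ** SS) z powi k * f z"
        using S Sz z assms(2)[OF z] by (simp add: moebius_mult jfac_mult moebius_gens power_int_mult_distrib)
    qed
  next
    case (T \<gamma>)
    show ?case
    proof
      fix z assume z: "z \<in> \<HH>"
      then have Tz: "z + 1 \<in> \<HH>" by (simp add: upper_half_iff)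
      show "f (moebius (\<gamma> ** ST 1) z) = jfac (\<gamma> ** ST 1) z powi k * f z"
        using T Tz z by (simp add: moebius_mult jfac_mult moebius_gens assms(1))
    qed
  next
    case (T' \<gamma>)
    show ?case
    proof
      fix z assume z: "z \<in> \<HH>"
      then have Tz: "z - 1 \<in> \<HH>" by (simp add: upper_half_iff)
      show "f (moebius (\<gamma> ** ST (- 1)) z) = jfac (\<gamma> ** ST (- 1)) z powi k * f z"
        using T' Tz z assms(1)[OF Tz] by (simp add: moebius_mult jfac_mult moebius_gens)
    qed
  qed
qed

lemma modular_mult: "modular k f \<Longrightarrow> modular l g \<Longrightarrow> modular (k + l) (\<lambda>z. f z * g z)"
  unfolding modular_def by (auto simp: power_int_add jfac_nonzero)

lemma modular_cmult: "modular k f \<Longrightarrow> modular k (\<lambda>z. c * f z)"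
  unfolding modular_def by auto

lemma modular_diff: "modular k f \<Longrightarrow> modular k g \<Longrightarrow> modular k (\<lambda>z. f z - g z)"
  unfolding modular_def by (auto simp: right_diff_distrib)

lemma modular_divide: "modular k f \<Longrightarrow> modular l g \<Longrightarrow> modular (k - l) (\<lambda>z. f z / g z)"
  unfolding modular_def by (auto simp: power_int_diff jfac_nonzero)

lemma modular_power: "modular k f \<Longrightarrow> modular (k * int m) (\<lambda>z. f z ^ m)"
  unfolding modular_def by (auto simp: power_mult_distrib power_int_mult)

lemma modular_periodic:
  assumes "modular k f" "z \<in> \<HH>"
  shows "f (z + of_int m) = f z"
  using modularD[OF assms(1) _ assms(2), of "ST m"] by (simp add: moebius_gens)

lemma qq_add_1: "qq (z + 1) = qq z"
  using qq_add_int[of z 1] by simp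

lemma rho_modular: "modular 4 rho_u" "modular 6 rho_v"
proof -
  have 1: "z + 1 \<in> \<HH>" if "z \<in> \<HH>" for z using that by (simp add: upper_half_iff)
  show "modular 4 rho_u" "modular 6 rho_v"
    using rho_S by (auto intro!: modularI_gens simp: rho_hat 1 qq_add_1)
qed

lemma rho_Delta_modular: "modular 12 rho_Delta"
proof -
  have "modular (4 * int 3) (\<lambda>z. rho_u z ^ 3)" "modular (6 * int 2) (\<lambda>z. 27 * rho_v z ^ 2)"
    by (intro modular_power modular_cmult rho_modular)+
  from modular_diff[OF this(1)[simplified] this(2)[simplified]] show ?thesis
    by (simp add: rho_Delta_def[abs_def])
qed

lemma qq_holomorphic: "qq holomorphic_on A"
  unfolding qq_def[abs_def] by (intro holomorphic_intros)

lemma qq_ball: "z \<in> \<HH> \<Longrightarrow> qq z \<in> ball 0 1"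
  using norm_qq_less_1 by simp

lemma holomorphic_qq_compose:
  assumes "g holomorphic_on ball 0 1" "\<And>z. z \<in> \<HH> \<Longrightarrow> f z = g (qq z)"
  shows "f holomorphic_on \<HH>"
proof -
  have "(g \<circ> qq) holomorphic_on \<HH>"
    by (rule holomorphic_on_compose_gen[OF qq_holomorphic assms(1)]) (auto intro: qq_ball)
  then show ?thesis by (rule holomorphic_transform) (simp add: assms(2))
qed

lemma rho_holomorphic: "rho_u holomorphic_on \<HH>" "rho_v holomorphic_on \<HH>"
  by (rule holomorphic_qq_compose[OF hat_holomorphic(1) rho_hat(1)], assumption)
    (rule holomorphic_qq_compose[OF hat_holomorphic(2) rho_hat(2)], assumption)

lemma rho_Delta_holomorphic: "rho_Delta holomorphic_on \<HH>"
  unfolding rho_Delta_def[abs_def] by (intro holomorphic_intros rho_holomorphic)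

lemma sqrt3_half_less_1: "sqrt 3 / 2 \<le> 1"
proof -
  have "sqrt 3 \<le> 2" by (rule real_le_lsqrt) auto
  then show ?thesis by simp
qed

lemma rho_Delta_bounds:
  assumes "Im z \<ge> sqrt 3 / 2"
  shows "norm (rho_Delta z) \<ge> norm (qq z) / 4" "norm (rho_Delta z) \<le> 2 * norm (qq z)"
proof -
  have "sqrt 3 / 2 > 0" by simp
  then have "Im z > 0" using assms by linarith
  then have z: "z \<in> \<HH>" by (simp add: upper_half_iff)
  have "norm (rho_Delta z - qq z) \<le> 3 / 4 * norm (qq z)"
    unfolding rho_Delta_def rho_hat[OF z] by (rule Delta_hat_estimate[OF norm_qq_fundamental[OF assms]])
  then show "norm (rho_Delta z) \<ge> norm (qq z) / 4" "norm (rho_Delta z) \<le> 2 * norm (qq z)"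
    using norm_triangle_ineq2[of "qq z" "rho_Delta z"] norm_triangle_ineq2[of "rho_Delta z" "qq z"]
      norm_minus_commute[of "qq z" "rho_Delta z"] norm_ge_zero[of "qq z"] by linarith+
qed

theorem rho_Delta_nonzero:
  assumes z: "z \<in> \<HH>"
  shows "rho_Delta z \<noteq> 0"
proof -
  obtain \<gamma> where \<gamma>: "\<gamma> \<in> SL2Z" "Im (moebius \<gamma> z) \<ge> sqrt 3 / 2"
    using fundamental_domain[OF z] by blast
  have "norm (qq (moebius \<gamma> z)) > 0" by simp
  then have "norm (rho_Delta (moebius \<gamma> z)) > 0" using rho_Delta_bounds(1)[OF \<gamma>(2)] by linarith
  then show ?thesis using modularD[OF rho_Delta_modular \<gamma>(1) z] by auto
qed

text \<open>
  A periodic function of moderate growth is a function of \<open>q\<close> which has at \<open>q = 0\<close> a singularity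
  weaker than a pole, hence a removable one.
\<close>

lemma qexp_exists:
  assumes hol: "f holomorphic_on \<HH>"
    and per: "\<And>z m. z \<in> \<HH> \<Longrightarrow> f (z + of_int m) = f z"
    and growth: "\<And>z. Im z \<ge> 1 \<Longrightarrow> \<bar>Re z\<bar> \<le> 1 \<Longrightarrow> norm (f z) \<le> C * exp (pi * Im z)"
  obtains g where "g holomorphic_on ball 0 1" "\<And>z. z \<in> \<HH> \<Longrightarrow> f z = g (qq z)"
proof -
  define c where "c = 2 * complex_of_real pi * \<i>"
  have c: "c \<noteq> 0" by (simp add: c_def)
  define h where "h q = f (Ln q / c)" for q
  have H: "w / c \<in> \<HH>" if "exp w \<in> ball 0 1" for w
  proof -
    have "qq (w / c) = exp w" using c by (simp add: qq_def c_def)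
    then have "exp (- 2 * pi * Im (w / c)) < 1" using that norm_qq[of "w / c"] by (simp only: mem_ball_0)
    then show ?thesis by (simp add: upper_half_iff zero_less_mult_iff)
  qed
  have h: "h (exp w) = f (w / c)" if "exp w \<in> ball 0 1" for w
  proof -
    have "exp w = exp (Ln (exp w))" by simp
    then obtain n where n: "w = Ln (exp w) + of_real (of_int (2 * n) * pi) * \<i>"
      using exp_eq[of w "Ln (exp w)"] by blast
    define L where "L = Ln (exp w)"
    have "w = L + of_int n * c" unfolding L_def by (rule n[unfolded of_real_mult, THEN trans]) (simp add: c_def)
    then have "w / c = (L + of_int n * c) / c" by simp
    also have "\<dots> = L / c + of_int n" using c by (simp add: add_divide_distrib)
    finally have "w / c = Ln (exp w) / c + of_int n" unfolding L_def .
    moreover have "Ln (exp w) / c \<in> \<HH>" by (rule H) (use that in simp)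
    ultimately show ?thesis unfolding h_def using per by metis
  qed
  let ?A = "{q \<in> ball 0 1 - {0::complex}. q \<notin> \<real>\<^sub>\<le>\<^sub>0}" and ?B = "{q \<in> ball 0 1 - {0::complex}. - q \<notin> \<real>\<^sub>\<le>\<^sub>0}"
  have o1: "open (- \<real>\<^sub>\<le>\<^sub>0 :: complex set)" by (intro open_Compl closed_nonpos_Reals_complex)
  have o2: "open (ball 0 1 - {0} :: complex set)" by (intro open_delete open_ball)
  have oA: "open ?A"
  proof -
    have e: "?A = (ball 0 1 - {0}) \<inter> - \<real>\<^sub>\<le>\<^sub>0" by auto
    show ?thesis unfolding e by (rule open_Int[OF o2 o1])
  qed
  have oB: "open ?B"
  proof -
    have e: "?B = (ball 0 1 - {0}) \<inter> uminus ` (- \<real>\<^sub>\<le>\<^sub>0)"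
      by (auto intro: image_eqI[where x = "- x" for x])
    show ?thesis unfolding e by (rule open_Int[OF o2 open_negations[OF o1]])
  qed
  have "h holomorphic_on ?A"
    unfolding h_def[abs_def]
  proof (rule holomorphic_on_compose_gen[of "\<lambda>q. Ln q / c" ?A f \<HH>, unfolded o_def])
    show "(\<lambda>q. Ln q / c) holomorphic_on ?A" using c by (intro holomorphic_intros) auto
    show "(\<lambda>q. Ln q / c) ` ?A \<subseteq> \<HH>" by (auto intro!: H)
  qed (rule hol)
  moreover have "h holomorphic_on ?B"
  proof -
    have e: "h q = f ((Ln (- q) + of_real pi * \<i>) / c)" "(Ln (- q) + of_real pi * \<i>) / c \<in> \<HH>" if "q \<in> ?B" for q
    proof -
      have "exp (Ln (- q) + of_real pi * \<i>) = q" using that by (simp add: exp_add)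
      then show "h q = f ((Ln (- q) + of_real pi * \<i>) / c)" "(Ln (- q) + of_real pi * \<i>) / c \<in> \<HH>"
        using h[of "Ln (- q) + of_real pi * \<i>"] H[of "Ln (- q) + of_real pi * \<i>"] that by auto
    qed
    have "(\<lambda>q. f ((Ln (- q) + of_real pi * \<i>) / c)) holomorphic_on ?B"
    proof (rule holomorphic_on_compose_gen[of "\<lambda>q. (Ln (- q) + of_real pi * \<i>) / c" ?B f \<HH>, unfolded o_def])
      show "(\<lambda>q. (Ln (- q) + of_real pi * \<i>) / c) holomorphic_on ?B" using c by (intro holomorphic_intros) auto
      show "(\<lambda>q. (Ln (- q) + of_real pi * \<i>) / c) ` ?B \<subseteq> \<HH>" using e(2) by blast
    qed (rule hol)
    then show ?thesis by (rule holomorphic_transform) (rule e(1)[symmetric])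
  qed
  ultimately have "h holomorphic_on (?A \<union> ?B)" by (rule holomorphic_on_Un) (rule oA oB)+
  moreover have "?A \<union> ?B = ball 0 1 - {0}"
    by (auto simp: complex_nonpos_Reals_iff complex_eq_iff)
  ultimately have hol_h: "h holomorphic_on ball 0 1 - {0}" by simp
  have "((\<lambda>q. (q - 0) * h q) \<longlongrightarrow> 0) (at 0)"
  proof (rule Lim_null_comparison)
    have "\<forall>\<^sub>F q in at 0. q \<in> ball 0 (exp (- 2 * pi)) - {0 :: complex}"
      by (rule eventually_at_in_open) auto
    then show "\<forall>\<^sub>F q in at 0. norm ((q - 0) * h q) \<le> C * sqrt (norm q)"
    proof eventually_elim
      case (elim q)
      then have q: "q \<noteq> 0" "norm q < exp (- 2 * pi)" by auto
      define z where "z = Ln q / c"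
      have "qq z = q" using q(1) c by (simp add: z_def qq_def c_def)
      then have nq: "norm q = exp (- 2 * pi * Im z)" using norm_qq[of z] by simp
      then have "- 2 * pi * Im z < - 2 * pi" using q(2) by simp
      then have Im: "Im z \<ge> 1" by simp
      have "Re z = Im (Ln q) / (2 * pi)" by (simp add: z_def c_def Re_divide power2_eq_square field_simps)
      then have "\<bar>Re z\<bar> = \<bar>Im (Ln q)\<bar> / (2 * pi)" by simp
      also have "\<dots> \<le> pi / (2 * pi)"
        using mpi_less_Im_Ln[OF q(1)] Im_Ln_le_pi[OF q(1)] by (intro divide_right_mono) auto
      finally have Re: "\<bar>Re z\<bar> \<le> 1" by simp
      have "norm ((q - 0) * h q) \<le> norm q * (C * exp (pi * Im z))"
        using growth[OF Im Re] by (simp add: norm_mult h_def z_def mult_left_mono)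
      also have "exp (pi * Im z) = 1 / sqrt (norm q)"
      proof -
        have "exp (- pi * Im z) ^ 2 = norm q"
          unfolding nq exp_of_nat_mult[symmetric] by simp
        then have "sqrt (norm q) = exp (- pi * Im z)" by (rule real_sqrt_unique) simp
        then show ?thesis by (simp add: exp_minus inverse_eq_divide)
      qed
      also have "norm q * (C * (1 / sqrt (norm q))) = C * sqrt (norm q)"
        using q(1) by (simp add: field_simps)
      finally show ?case .
    qed
    have "isCont (\<lambda>q::complex. C * sqrt (norm q)) 0" by (intro continuous_intros)
    then show "((\<lambda>q::complex. C * sqrt (norm q)) \<longlongrightarrow> 0) (at 0)" by (simp add: isCont_def)
  qed
  then obtain g where g: "g holomorphic_on ball 0 1" "\<forall>z\<in>ball 0 1 - {0}. g z = h z"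
    using holomorphic_on_extend_lim[OF hol_h] by auto
  show ?thesis
  proof (rule that[OF g(1)])
    fix z assume z: "z \<in> \<HH>"
    have "qq z = exp (c * z)" by (simp add: qq_def c_def)
    moreover have "h (exp (c * z)) = f (c * z / c)"
      by (rule h) (use qq_ball[OF z] in \<open>simp add: qq_def c_def\<close>)
    ultimately show "f z = g (qq z)" using g(2) qq_ball[OF z] c by simp
  qed
qed

lemma power_le_fact_exp:
  assumes "x \<ge> (0::real)" shows "x ^ n \<le> fact n * exp x"
proof -
  have "(\<Sum>k\<in>{n}. x ^ k /\<^sub>R fact k) \<le> suminf (\<lambda>k. x ^ k /\<^sub>R fact k)"
    using assms by (intro sum_le_suminf summable_exp_generic) auto
  then show ?thesis by (simp add: exp_def field_simps)
qed

text \<open>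
  Holomorphy at the cusp is expressed by an expansion in \<open>q\<close> on the whole unit disc.
\<close>

definition modform :: "int \<Rightarrow> (complex \<Rightarrow> complex) \<Rightarrow> bool" where
  "modform k f \<longleftrightarrow> f holomorphic_on \<HH> \<and> modular k f \<and>
     (\<exists>g. g holomorphic_on ball 0 1 \<and> (\<forall>z\<in>\<HH>. f z = g (qq z)))"

lemma modformI:
  assumes "f holomorphic_on \<HH>" "modular k f"
    and "\<And>z. Im z \<ge> 1 \<Longrightarrow> \<bar>Re z\<bar> \<le> 1 \<Longrightarrow> norm (f z) \<le> C * exp (pi * Im z)"
  shows "modform k f"
  unfolding modform_def using assms qexp_exists[of f C] modular_periodic[OF assms(2)] by metis

lemma modformI_poly:
  assumes "f holomorphic_on \<HH>" "modular k f"
    and "\<And>z. Im z \<ge> 1 \<Longrightarrow> \<bar>Re z\<bar> \<le> 1 \<Longrightarrow> norm (f z) \<le> C * Im z ^ m"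
  shows "modform k f"
proof (rule modformI[OF assms(1,2)])
  fix z :: complex assume z: "Im z \<ge> 1" "\<bar>Re z\<bar> \<le> 1"
  have "norm (f \<i>) \<le> C" using assms(3)[of \<i>] by simp
  then have C: "C \<ge> 0" using norm_ge_zero order_trans by blast
  have "Im z ^ m \<le> fact m * exp (Im z)" using z by (intro power_le_fact_exp) simp
  also have "\<dots> \<le> fact m * exp (pi * Im z)"
    using z pi_ge_two by (intro mult_left_mono) (auto intro!: mult_right_mono[of 1 pi, simplified])
  finally have "C * Im z ^ m \<le> C * (fact m * exp (pi * Im z))" using C by (rule mult_left_mono)
  then show "norm (f z) \<le> (C * fact m) * exp (pi * Im z)" using assms(3)[OF z] by (simp add: mult_ac)
qed

lemma modform_bounded:
  assumes "g holomorphic_on ball 0 1"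
  obtains B where "B \<ge> 0" "\<And>z. Im z \<ge> 1 \<Longrightarrow> norm (g (qq z)) \<le> B"
proof -
  have "compact (g ` cball 0 (1/2))"
    by (intro compact_continuous_image holomorphic_on_imp_continuous_on holomorphic_on_subset[OF assms]) auto
  then obtain B where B: "\<And>q. q \<in> cball 0 (1/2) \<Longrightarrow> norm (g q) \<le> B"
    by (meson bounded_iff compact_imp_bounded imageI)
  show ?thesis
  proof (rule that[of B])
    show "B \<ge> 0" using order_trans[OF norm_ge_zero B[of 0]] by simp
    fix z :: complex assume "Im z \<ge> 1"
    then have "sqrt 3 / 2 \<le> Im z" using sqrt3_half_less_1 by linarith
    then have "norm (qq z) \<le> 1 / 200" by (rule norm_qq_fundamental)
    then have "qq z \<in> cball 0 (1/2)" by simp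
    then show "norm (g (qq z)) \<le> B" by (rule B)
  qed
qed

lemma hol_factor_q:
  assumes g: "g holomorphic_on ball 0 1" and "g 0 = (0::complex)"
  obtains g1 where "g1 holomorphic_on ball 0 1" "\<And>q. q \<in> ball 0 1 \<Longrightarrow> g q = q * g1 q"
proof -
  define g1 where "g1 q = (if q = 0 then deriv g 0 else g q / q)" for q
  have "(\<lambda>q. if q = 0 then deriv g 0 else (g q - g 0) / (q - 0)) holomorphic_on ball 0 1"
    by (rule pole_lemma_open[OF g]) auto
  then have "g1 holomorphic_on ball 0 1"
    by (rule holomorphic_transform) (simp add: g1_def assms(2))
  then show ?thesis using assms(2) by (intro that[of g1]) (auto simp: g1_def)
qed

lemma modform_hol: "modform k f \<Longrightarrow> f holomorphic_on \<HH>"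
  by (simp add: modform_def)

lemma modform_modular: "modform k f \<Longrightarrow> modular k f"
  by (simp add: modform_def)

lemma modformE:
  assumes "modform k f"
  obtains g where "g holomorphic_on ball 0 1" "\<And>z. z \<in> \<HH> \<Longrightarrow> f z = g (qq z)"
  using assms unfolding modform_def by blast

lemma modformI_qexp:
  assumes "modular k f" "g holomorphic_on ball 0 1" "\<And>z. z \<in> \<HH> \<Longrightarrow> f z = g (qq z)"
  shows "modform k f"
  unfolding modform_def using assms holomorphic_qq_compose[OF assms(2,3)] by blast

lemma modform_mult:
  assumes "modform k f" "modform l g"
  shows "modform (k + l) (\<lambda>z. f z * g z)"
proof -
  obtain f' g' where *: "f' holomorphic_on ball 0 1" "\<And>z. z \<in> \<HH> \<Longrightarrow> f z = f' (qq z)"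
    "g' holomorphic_on ball 0 1" "\<And>z. z \<in> \<HH> \<Longrightarrow> g z = g' (qq z)"
    using assms by (metis modformE)
  show ?thesis
    by (rule modformI_qexp[of _ _ "\<lambda>q. f' q * g' q"])
      (use * assms in \<open>auto intro: modular_mult modform_modular holomorphic_on_mult\<close>)
qed

lemma modform_cmult:
  assumes "modform k f"
  shows "modform k (\<lambda>z. c * f z)"
proof -
  obtain f' where *: "f' holomorphic_on ball 0 1" "\<And>z. z \<in> \<HH> \<Longrightarrow> f z = f' (qq z)"
    using assms by (metis modformE)
  show ?thesis
    by (rule modformI_qexp[of _ _ "\<lambda>q. c * f' q"])
      (use * assms in \<open>auto intro: modular_cmult modform_modular holomorphic_on_mult\<close>)
qed

lemma modform_diff:
  assumes "modform k f" "modform k g"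
  shows "modform k (\<lambda>z. f z - g z)"
proof -
  obtain f' g' where *: "f' holomorphic_on ball 0 1" "\<And>z. z \<in> \<HH> \<Longrightarrow> f z = f' (qq z)"
    "g' holomorphic_on ball 0 1" "\<And>z. z \<in> \<HH> \<Longrightarrow> g z = g' (qq z)"
    using assms by (metis modformE)
  show ?thesis
    by (rule modformI_qexp[of _ _ "\<lambda>q. f' q - g' q"])
      (use * assms in \<open>auto intro: modular_diff modform_modular holomorphic_on_diff\<close>)
qed

lemma modform_const: "modform 0 (\<lambda>z. c)"
  unfolding modform_def by (auto simp: modular_def intro: exI[of _ "\<lambda>_. c"])

lemma modform_power: "modform k f \<Longrightarrow> modform (k * int m) (\<lambda>z. f z ^ m)"
proof (induction m)
  case 0
  then show ?case using modform_const[of 1] by simp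
next
  case (Suc m)
  from modform_mult[OF Suc.prems Suc.IH[OF Suc.prems]] show ?case by (simp add: algebra_simps)
qed

lemma modform_rho: "modform 4 rho_u" "modform 6 rho_v" "modform 12 rho_Delta"
proof -
  show u: "modform 4 rho_u" and v: "modform 6 rho_v"
    unfolding modform_def using rho_modular rho_holomorphic hat_holomorphic rho_hat by blast+
  show "modform 12 rho_Delta"
    using modform_diff[OF modform_power[OF u, of 3, simplified] modform_cmult[OF modform_power[OF v, of 2, simplified], of 27]]
    by (simp add: rho_Delta_def[abs_def])
qed

lemma modform_div_Delta:
  assumes f: "modform k f" and g: "g holomorphic_on ball 0 1" "\<And>z. z \<in> \<HH> \<Longrightarrow> f z = g (qq z)"
    and g0: "g 0 = 0"
  shows "modform (k - 12) (\<lambda>z. f z / rho_Delta z)"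
proof -
  obtain g1 where g1: "g1 holomorphic_on ball 0 1" "\<And>q. q \<in> ball 0 1 \<Longrightarrow> g q = q * g1 q"
    using hol_factor_q[OF g(1) g0] by blast
  obtain B where B: "\<And>z. Im z \<ge> 1 \<Longrightarrow> norm (g1 (qq z)) \<le> B" using modform_bounded[OF g1(1)] by blast
  show ?thesis
  proof (rule modformI_poly[of _ _ "4 * B" 0])
    show "(\<lambda>z. f z / rho_Delta z) holomorphic_on \<HH>"
      using modform_hol[OF f] rho_Delta_nonzero by (intro holomorphic_intros rho_Delta_holomorphic) auto
    show "modular (k - 12) (\<lambda>z. f z / rho_Delta z)"
      by (intro modular_divide modform_modular[OF f] rho_Delta_modular)
    fix z :: complex assume z: "Im z \<ge> 1"
    then have zH: "z \<in> \<HH>" by (simp add: upper_half_iff)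
    have D: "norm (rho_Delta z) \<ge> norm (qq z) / 4"
      by (rule rho_Delta_bounds) (use z sqrt3_half_less_1 in linarith)
    have p: "norm (qq z) > 0" by simp
    have "norm (f z / rho_Delta z) = norm (qq z) * norm (g1 (qq z)) / norm (rho_Delta z)"
      using g(2)[OF zH] g1(2)[OF qq_ball[OF zH]] by (simp add: norm_divide norm_mult)
    also have "\<dots> \<le> norm (qq z) * norm (g1 (qq z)) / (norm (qq z) / 4)"
      using D p by (intro divide_left_mono mult_pos_pos) (auto intro: mult_nonneg_nonneg)
    also have "\<dots> = 4 * norm (g1 (qq z))" using p by simp
    also have "\<dots> \<le> 4 * B" using B[OF z] by simp
    finally show "norm (f z / rho_Delta z) \<le> 4 * B * Im z ^ 0" by simp
  qed
qed

text \<open>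
  As a function of \<open>q\<close> in the unit disc, a form of weight \<open>0\<close> attains the maximum of its absolute
  value, because every orbit contains a point with \<open>\<bar>q\<bar> \<le> 1/200\<close>.
\<close>

lemma modform_0_const:
  assumes f: "modform 0 f"
  obtains c where "\<And>z. z \<in> \<HH> \<Longrightarrow> f z = c"
proof -
  obtain g where g: "g holomorphic_on ball 0 1" "\<And>z. z \<in> \<HH> \<Longrightarrow> f z = g (qq z)"
    using f unfolding modform_def by blast
  have "continuous_on (cball 0 (1/200)) (\<lambda>q. norm (g q))"
    by (intro continuous_intros holomorphic_on_imp_continuous_on holomorphic_on_subset[OF g(1)]) auto
  then obtain q0 where q0: "q0 \<in> cball 0 (1/200)" "\<And>q. q \<in> cball 0 (1/200) \<Longrightarrow> norm (g q) \<le> norm (g q0)"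
    using continuous_attains_sup[of "cball (0::complex) (1/200)" "\<lambda>q. norm (g q)"] by auto
  have le: "norm (g q) \<le> norm (g q0)" if "q \<in> ball 0 1" for q
  proof (cases "q = 0")
    case True
    then show ?thesis using q0(2) by simp
  next
    case False
    have "norm q < 1" using that by simp
    obtain z where z: "z \<in> \<HH>" "qq z = q" by (rule qq_surj[OF False \<open>norm q < 1\<close>])
    obtain \<gamma> where \<gamma>: "\<gamma> \<in> SL2Z" "Im (moebius \<gamma> z) \<ge> sqrt 3 / 2"
      using fundamental_domain[OF z(1)] by blast
    have "g q = f (moebius \<gamma> z)"
      using g(2)[OF z(1)] z(2) modularD[OF modform_modular[OF f] \<gamma>(1) z(1)] by simp
    also have "\<dots> = g (qq (moebius \<gamma> z))" by (rule g(2)[OF moebius_upper_half[OF \<gamma>(1) z(1)]])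
    finally show ?thesis using q0(2)[of "qq (moebius \<gamma> z)"] norm_qq_fundamental[OF \<gamma>(2)] by simp
  qed
  have "g constant_on ball 0 1"
    by (rule maximum_modulus_principle[OF g(1), of "ball 0 1" q0]) (use q0(1) le in auto)
  then obtain c where "\<And>q. q \<in> ball 0 1 \<Longrightarrow> g q = c" unfolding constant_on_def by blast
  then show ?thesis using that g(2) qq_ball by metis
qed

lemma qexp_unique:
  assumes "g holomorphic_on ball 0 1" "h holomorphic_on ball 0 1"
    and eq: "\<And>z. z \<in> \<HH> \<Longrightarrow> g (qq z) = h (qq z)" and q: "q \<in> ball 0 1"
  shows "g q = (h q :: complex)"
proof -
  have e: "g q - h q = 0" if q: "q \<in> ball 0 1 - {0}" for q
  proof -
    have q': "q \<noteq> 0" "norm q < 1" using q by auto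
    obtain z where z: "z \<in> \<HH>" "qq z = q" by (rule qq_surj[OF q'])
    then show ?thesis using eq[OF z(1)] by simp
  qed
  have "g 0 - h 0 = 0"
  proof (rule tendsto_unique[OF at_neq_bot])
    have "(\<lambda>q. g q - h q) holomorphic_on ball 0 1" by (intro holomorphic_on_diff assms)
    then have "isCont (\<lambda>q. g q - h q) 0"
      by (intro continuous_on_interior[OF holomorphic_on_imp_continuous_on]) (auto simp: interior_open)
    then show "((\<lambda>q. g q - h q) \<longlongrightarrow> g 0 - h 0) (at 0)" by (simp add: isCont_def)
    have "\<forall>\<^sub>F q in at 0. q \<in> ball 0 1 - {0 :: complex}" by (rule eventually_at_in_open) auto
    then have "\<forall>\<^sub>F q in at 0. g q - h q = 0" by eventually_elim (rule e)
    then show "((\<lambda>q. g q - h q) \<longlongrightarrow> 0) (at 0)" by (rule tendsto_eventually)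
  qed
  then show ?thesis using e q by (cases "q = 0") auto
qed

text \<open>
  The form \<open>f\<^sup>1\<^sup>2 \<Delta>\<^sup>-\<^sup>k\<close> has weight \<open>0\<close>, so it is constant; it vanishes at the cusp because \<open>\<Delta>\<close> does.
\<close>

lemma modform_neg_zero:
  assumes f: "modform k f" and k: "k < 0" and z: "z \<in> \<HH>"
  shows "f z = 0"
proof -
  define m where "m = nat (- k)"
  have m: "int m = - k" "m > 0" using k by (auto simp: m_def)
  have "modform (k * int 12 + 12 * int m) (\<lambda>z. f z ^ 12 * rho_Delta z ^ m)"
    by (intro modform_mult modform_power f modform_rho)
  then have F: "modform 0 (\<lambda>z. f z ^ 12 * rho_Delta z ^ m)" by (simp add: m(1))
  then obtain c where c: "\<And>z. z \<in> \<HH> \<Longrightarrow> f z ^ 12 * rho_Delta z ^ m = c"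
    using modform_0_const by blast
  obtain g where g: "g holomorphic_on ball 0 1" "\<And>z. z \<in> \<HH> \<Longrightarrow> f z = g (qq z)"
    using f unfolding modform_def by blast
  define D where "D q = uhat q ^ 3 - 27 * vhat q ^ 2" for q
  have D: "D holomorphic_on ball 0 1" unfolding D_def[abs_def] by (intro holomorphic_intros hat_holomorphic)
  have "g 0 ^ 12 * D 0 ^ m = c"
  proof (rule qexp_unique[of "\<lambda>q. g q ^ 12 * D q ^ m" "\<lambda>_. c"])
    show "(\<lambda>q. g q ^ 12 * D q ^ m) holomorphic_on ball 0 1" by (intro holomorphic_intros g D)
    show "g (qq z) ^ 12 * D (qq z) ^ m = c" if "z \<in> \<HH>" for z
      using c[OF that] g(2)[OF that] rho_hat[OF that] by (simp add: D_def rho_Delta_def)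
  qed auto
  then have "c = g 0 ^ 12 * D 0 ^ m" ..
  also have "D 0 = 0" by (simp add: D_def hat_0 power2_eq_square power3_eq_cube)
  finally have "c = 0" using m(2) by simp
  then show ?thesis using c[OF z] rho_Delta_nonzero[OF z] by simp
qed

text \<open>Subtract a monomial with the same value at the cusp; the rest is divisible by \<open>\<Delta>\<close>.\<close>

lemma modform_step:
  assumes f: "modform k f" and k: "4 * int a + 6 * int b = k"
  obtains c h where "modform (k - 12) h"
    "\<And>z. z \<in> \<HH> \<Longrightarrow> f z = c * (rho_u z ^ a * rho_v z ^ b) + rho_Delta z * h z"
proof -
  obtain g where g: "g holomorphic_on ball 0 1" "\<And>z. z \<in> \<HH> \<Longrightarrow> f z = g (qq z)"
    using f unfolding modform_def by blast
  define c where "c = g 0 / (uhat 0 ^ a * vhat 0 ^ b)"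
  define r where "r z = f z - c * (rho_u z ^ a * rho_v z ^ b)" for z
  have "modform (4 * int a + 6 * int b) (\<lambda>z. rho_u z ^ a * rho_v z ^ b)"
    by (intro modform_mult modform_power modform_rho)
  then have r: "modform k r" unfolding r_def[abs_def] k by (intro modform_diff modform_cmult f)
  have "modform (k - 12) (\<lambda>z. r z / rho_Delta z)"
  proof (rule modform_div_Delta[OF r, of "\<lambda>q. g q - c * (uhat q ^ a * vhat q ^ b)"])
    show "(\<lambda>q. g q - c * (uhat q ^ a * vhat q ^ b)) holomorphic_on ball 0 1"
      by (intro holomorphic_intros g hat_holomorphic)
    show "g 0 - c * (uhat 0 ^ a * vhat 0 ^ b) = 0" by (simp add: c_def hat_0)
  qed (simp add: r_def g rho_hat)
  then show ?thesis
    by (rule that[of _ c]) (use rho_Delta_nonzero in \<open>simp add: r_def\<close>)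
qed

lemma modform_one_dim:
  assumes "modform k f" "4 * int a + 6 * int b = k" "k < 12"
  obtains c where "\<And>z. z \<in> \<HH> \<Longrightarrow> f z = c * (rho_u z ^ a * rho_v z ^ b)"
proof -
  obtain c h where h: "modform (k - 12) h"
    "\<And>z. z \<in> \<HH> \<Longrightarrow> f z = c * (rho_u z ^ a * rho_v z ^ b) + rho_Delta z * h z"
    using modform_step[OF assms(1,2)] by blast
  show ?thesis by (rule that[of c]) (use h modform_neg_zero[OF h(1)] assms(3) in auto)
qed

text \<open>
  Since \<open>f\<^sup>2\<close> is a multiple of \<open>u\<close> and \<open>f\<^sup>3\<close> one of \<open>v\<close>, a nonzero \<open>f\<close> would make \<open>u\<^sup>3\<close> and \<open>v\<^sup>2\<close>
  proportional; comparison at the cusp turns this into \<open>\<Delta> = 0\<close>.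
\<close>

lemma modform_2_zero:
  assumes f: "modform 2 f" and z: "z \<in> \<HH>"
  shows "f z = 0"
proof -
  obtain \<alpha> where \<alpha>: "\<And>z. z \<in> \<HH> \<Longrightarrow> f z ^ 2 = \<alpha> * (rho_u z ^ 1 * rho_v z ^ 0)"
    using modform_one_dim[OF modform_power[OF f, of 2], of 1 0] by auto
  obtain \<beta> where \<beta>: "\<And>z. z \<in> \<HH> \<Longrightarrow> f z ^ 3 = \<beta> * (rho_u z ^ 0 * rho_v z ^ 1)"
    using modform_one_dim[OF modform_power[OF f, of 3], of 0 1] by auto
  have e: "\<alpha> ^ 3 * uhat q ^ 3 = \<beta> ^ 2 * vhat q ^ 2" if "q \<in> ball 0 1" for q
  proof (rule qexp_unique[OF _ _ _ that])
    show "(\<lambda>q. \<alpha> ^ 3 * uhat q ^ 3) holomorphic_on ball 0 1" "(\<lambda>q. \<beta> ^ 2 * vhat q ^ 2) holomorphic_on ball 0 1"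
      by (intro holomorphic_intros hat_holomorphic)+
    fix z assume z: "z \<in> \<HH>"
    have "(f z ^ 2) ^ 3 = (f z ^ 3) ^ 2" by (simp flip: power_mult)
    then show "\<alpha> ^ 3 * uhat (qq z) ^ 3 = \<beta> ^ 2 * vhat (qq z) ^ 2"
      using z by (simp add: \<alpha> \<beta> power_mult_distrib rho_hat)
  qed
  have "\<alpha> ^ 3 * uhat 0 ^ 3 = \<beta> ^ 2 * vhat 0 ^ 2" by (rule e) simp
  then have ab: "\<beta> ^ 2 = 27 * \<alpha> ^ 3" by (simp add: hat_0 power2_eq_square power3_eq_cube field_simps)
  have "\<alpha> ^ 3 * rho_Delta z = 0"
    using e[of "qq z"] qq_ball[OF z] by (simp add: rho_Delta_def rho_hat[OF z] ab algebra_simps)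
  then show ?thesis using \<alpha>[OF z] rho_Delta_nonzero[OF z] by simp
qed

lemma modular_odd_zero:
  assumes "modular k f" "odd k" "z \<in> \<HH>"
  shows "f z = 0"
proof -
  have m: "mat2 (- 1) 0 0 (- 1) \<in> SL2Z" by (simp add: SL2Z_iff)
  have "moebius (mat2 (- 1) 0 0 (- 1)) z = z" "jfac (mat2 (- 1) 0 0 (- 1)) z = - 1"
    by (simp_all add: moebius_def jfac_def)
  then have "f z = (- 1) powi k * f z" using modularD[OF assms(1) m assms(3)] by simp
  then show ?thesis using assms(2) by (simp add: power_int_minus_left)
qed

definition uvD :: "nat \<Rightarrow> nat \<Rightarrow> nat \<Rightarrow> complex \<Rightarrow> complex" where
  "uvD a b e z = rho_u z ^ a * rho_v z ^ b * rho_Delta z ^ e"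

text \<open>
  The premises of an induction over modular forms of weight \<open>k\<close>: the rule below says that the
  monomials \<open>u\<^sup>a v\<^sup>b \<Delta>\<^sup>e\<close> with \<open>b < 2\<close> span. Modular forms are functions on all of \<open>\<complex>\<close> of which
  only the values on \<open>\<HH>\<close> matter, whence the first clause.
\<close>

definition modform_closed :: "int \<Rightarrow> ((complex \<Rightarrow> complex) \<Rightarrow> bool) \<Rightarrow> bool" where
  "modform_closed k Q \<longleftrightarrow>
     (\<forall>f g. (\<forall>z\<in>\<HH>. f z = g z) \<longrightarrow> Q f \<longrightarrow> Q g) \<and> Q (\<lambda>z. 0) \<and>
     (\<forall>a b e c. b < 2 \<longrightarrow> 4 * int a + 6 * int b + 12 * int e = k \<longrightarrow> Q (\<lambda>z. c * uvD a b e z)) \<and>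
     (\<forall>f g. Q f \<longrightarrow> Q g \<longrightarrow> Q (\<lambda>z. f z + g z))"

text \<open>
  A monomial of weight \<open>k\<close> exists unless \<open>k\<close> is negative, odd or \<open>2\<close>, when all forms vanish. Otherwise
  \<open>modform_step\<close> lowers the weight by \<open>12\<close>.
\<close>

theorem modform_induct:
  assumes "modform k f" "modform_closed k Q"
  shows "Q f"
  using assms
proof (induction "nat k" arbitrary: k f Q rule: less_induct)
  case less
  have cong: "Q g" if "\<And>z. z \<in> \<HH> \<Longrightarrow> f z = g z" "Q f" for f g
    using less.prems(2) that unfolding modform_closed_def by blast
  have zero: "Q (\<lambda>z. 0)"
    using less.prems(2) unfolding modform_closed_def by blast
  have mono: "Q (\<lambda>z. c * uvD a b e z)" if "b < 2" "4 * int a + 6 * int b + 12 * int e = k" for a b e c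
    using less.prems(2) that unfolding modform_closed_def by blast
  have add: "Q (\<lambda>z. f z + g z)" if "Q f" "Q g" for f g
    using less.prems(2) that unfolding modform_closed_def by blast
  show ?case
  proof (cases "k < 0 \<or> k = 2 \<or> odd k")
    case True
    then have "f z = 0" if "z \<in> \<HH>" for z
      using modform_neg_zero[OF less.prems(1) _ that] modform_2_zero[OF _ that]
        modular_odd_zero[OF modform_modular[OF less.prems(1)] _ that] less.prems(1) by blast
    then show ?thesis using cong[OF _ zero, of f] by simp
  next
    case False
    obtain a b where ab: "b < 2" "4 * int a + 6 * int b = k"
    proof (cases "k mod 4 = 0")
      case True
      then have "4 * int (nat (k div 4)) + 6 * int 0 = k" using False by auto
      then show ?thesis using that[of 0 "nat (k div 4)"] by simp
    next
      case F: False
      then have k4: "k mod 4 = 2" using False by presburger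
      then have "k \<ge> 6" using False by presburger
      then have "4 * int (nat ((k - 6) div 4)) + 6 * int 1 = k" using k4 by simp presburger
      then show ?thesis using that[of 1 "nat ((k - 6) div 4)"] by simp
    qed
    obtain c h where h: "modform (k - 12) h"
      "\<And>z. z \<in> \<HH> \<Longrightarrow> f z = c * (rho_u z ^ a * rho_v z ^ b) + rho_Delta z * h z"
      using modform_step[OF less.prems(1) ab(2)] by blast
    have Q1: "Q (\<lambda>z. c * uvD a b 0 z)" by (rule mono) (use ab in auto)
    have Q2: "Q (\<lambda>z. rho_Delta z * h z)"
    proof (cases "k < 12")
      case True
      then have "h z = 0" if "z \<in> \<HH>" for z using modform_neg_zero[OF h(1) _ that] by simp
      then show ?thesis using cong[OF _ zero, of "\<lambda>z. rho_Delta z * h z"] by simp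
    next
      case False
      define R where "R h = Q (\<lambda>z. rho_Delta z * h z)" for h
      have "nat (k - 12) < nat k" using False by simp
      moreover have "modform_closed (k - 12) R"
        unfolding modform_closed_def
      proof (intro conjI allI impI)
        show "R g" if "\<forall>z\<in>\<HH>. f z = g z" "R f" for f g
          unfolding R_def by (rule cong[OF _ that(2)[unfolded R_def]]) (simp add: that(1))
        show "R (\<lambda>z. 0)" unfolding R_def mult_zero_right by (rule zero)
        show "R (\<lambda>z. c' * uvD a' b' e z)"
          if "b' < 2" "4 * int a' + 6 * int b' + 12 * int e = k - 12" for a' b' e c'
        proof -
          have "Q (\<lambda>z. c' * uvD a' b' (Suc e) z)" using that by (intro mono) auto
          then show ?thesis by (simp add: R_def uvD_def mult_ac)
        qed
        show "R (\<lambda>z. f z + g z)" if "R f" "R g" for f g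
          using add[OF that[unfolded R_def]] by (simp add: R_def distrib_left)
      qed
      ultimately have "R h" using less.hyps h(1) by blast
      then show ?thesis unfolding R_def .
    qed
    from add[OF Q1 Q2] show ?thesis by (rule cong[rotated]) (simp add: h(2) uvD_def)
  qed
qed

section \<open>The differential relations between \<open>u\<close>, \<open>v\<close> and \<open>\<Delta>\<close>\<close>

lemma deriv_qexp:
  assumes g: "g holomorphic_on ball 0 1" and f: "\<And>z. z \<in> \<HH> \<Longrightarrow> f z = g (qq z)" and z: "z \<in> \<HH>"
  shows "deriv f z = tpi * (qq z * deriv g (qq z))"
proof -
  have "(g has_field_derivative deriv g (qq z)) (at (qq z))"
    by (rule holomorphic_derivI[OF g]) (use qq_ball[OF z] in auto)
  from DERIV_chain2[OF this qq_has_derivative]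
  have "((\<lambda>z. g (qq z)) has_field_derivative deriv g (qq z) * (tpi * qq z)) (at z)" .
  then have "(f has_field_derivative deriv g (qq z) * (tpi * qq z)) (at z)"
    by (rule has_field_derivative_transform_within_open[OF _ open_upper_half z]) (simp add: f)
  then show ?thesis by (simp add: DERIV_imp_deriv mult_ac)
qed

lemma deriv_modular:
  assumes f: "f holomorphic_on \<HH>" "modular (int (Suc k)) f" and \<gamma>: "\<gamma> \<in> SL2Z" and z: "z \<in> \<HH>"
  shows "deriv f (moebius \<gamma> z) =
    jfac \<gamma> z ^ (k + 3) * deriv f z + of_nat (Suc k) * of_int (ec \<gamma>) * jfac \<gamma> z ^ (k + 2) * f z"
proof -
  let ?j = "jfac \<gamma> z"
  have j: "?j \<noteq> 0" by (rule jfac_nonzero[OF \<gamma> z])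
  have fd: "(f has_field_derivative deriv f w) (at w)" if "w \<in> \<HH>" for w
    by (rule holomorphic_derivI[OF f(1) open_upper_half that])
  have 1: "((\<lambda>w. f (moebius \<gamma> w)) has_field_derivative deriv f (moebius \<gamma> z) * (1 / ?j ^ 2)) (at z)"
    by (rule DERIV_chain2[OF fd[OF moebius_upper_half[OF \<gamma> z]] moebius_has_derivative[OF \<gamma> z]])
  have jd: "(jfac \<gamma> has_field_derivative of_int (ec \<gamma>)) (at z)"
    unfolding jfac_def[abs_def] by (auto intro!: derivative_eq_intros)
  have 2: "((\<lambda>w. jfac \<gamma> w ^ Suc k * f w) has_field_derivative
      (of_nat (Suc k) * of_int (ec \<gamma>) * ?j ^ k) * f z + deriv f z * ?j ^ Suc k) (at z)"
    by (rule DERIV_cong[OF DERIV_mult[OF DERIV_power_Suc[OF jd, of k] fd[OF z]]])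
      (simp add: algebra_simps)
  have "deriv f (moebius \<gamma> z) * (1 / ?j ^ 2) =
      (of_nat (Suc k) * of_int (ec \<gamma>) * ?j ^ k) * f z + deriv f z * ?j ^ Suc k"
  proof (rule deriv_eq_on_open[OF open_upper_half z _ 1 2])
    fix w assume "w \<in> \<HH>"
    then show "f (moebius \<gamma> w) = jfac \<gamma> w ^ Suc k * f w"
      using modularD[OF f(2) \<gamma>, of w] by (simp only: power_int_of_nat)
  qed
  then have "deriv f (moebius \<gamma> z) = ((of_nat (Suc k) * of_int (ec \<gamma>) * ?j ^ k) * f z + deriv f z * ?j ^ Suc k) * ?j ^ 2"
    using j by (simp add: field_simps)
  then show ?thesis by (simp add: algebra_simps power_add power2_eq_square power3_eq_cube)
qed

definition Dhat :: "complex \<Rightarrow> complex" where "Dhat q = uhat q ^ 3 - 27 * vhat q ^ 2"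

lemma Dhat_holomorphic: "Dhat holomorphic_on ball 0 1"
  unfolding Dhat_def[abs_def] by (intro holomorphic_intros hat_holomorphic)

lemma rho_Delta_hat: "z \<in> \<HH> \<Longrightarrow> rho_Delta z = Dhat (qq z)"
  by (simp add: rho_Delta_def Dhat_def rho_hat)

lemma Dhat_0: "Dhat 0 = 0"
  by (simp add: Dhat_def hat_0 power2_eq_square power3_eq_cube)

lemma hat_has_derivative:
  assumes "q \<in> ball 0 1"
  shows "(uhat has_field_derivative deriv uhat q) (at q)" "(vhat has_field_derivative deriv vhat q) (at q)"
    "(Dhat has_field_derivative deriv Dhat q) (at q)"
  by (rule holomorphic_derivI[OF _ open_ball assms], rule hat_holomorphic Dhat_holomorphic)+

lemma deriv_Dhat_0: "deriv Dhat 0 = 1"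
proof -
  have "(Dhat has_field_derivative 3 * uhat 0 ^ 2 * deriv uhat 0 - 27 * (2 * vhat 0 * deriv vhat 0)) (at 0)"
    unfolding Dhat_def[abs_def]
    by (auto intro!: derivative_eq_intros hat_has_derivative)
  then have "deriv Dhat 0 = 3 * uhat 0 ^ 2 * deriv uhat 0 - 27 * (2 * vhat 0 * deriv vhat 0)"
    by (rule DERIV_imp_deriv)
  then show ?thesis by (simp add: hat_0 hat_deriv_0 power2_eq_square)
qed

lemma deriv_hat_holomorphic: "g holomorphic_on ball 0 1 \<Longrightarrow> deriv g holomorphic_on ball (0::complex) 1"
  by (rule holomorphic_deriv) auto

text \<open>
  The Wronskian \<open>2 u v' - 3 v u'\<close> is a form of weight \<open>12\<close> that vanishes at the cusp, hence a multiple of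
  \<open>\<Delta>\<close>; the factor is found from the coefficients of \<open>q\<close>.
\<close>

lemma rho_omega_eq:
  assumes z: "z \<in> \<HH>"
  shows "rho_omega z = tpi"
proof -
  define W where "W z = 2 * rho_u z * deriv rho_v z - 3 * rho_v z * deriv rho_u z" for z
  define w where "w q = tpi * (q * (2 * uhat q * deriv vhat q - 3 * vhat q * deriv uhat q))" for q
  have w: "w holomorphic_on ball 0 1"
    unfolding w_def by (intro holomorphic_intros hat_holomorphic deriv_hat_holomorphic)
  have Ww: "W z = w (qq z)" if "z \<in> \<HH>" for z
    unfolding W_def w_def using that
    by (simp add: deriv_qexp[OF hat_holomorphic(1) rho_hat(1) that]
        deriv_qexp[OF hat_holomorphic(2) rho_hat(2) that] rho_hat algebra_simps)
  have Wmod: "modular 12 W"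
    unfolding modular_def
  proof (intro ballI)
    fix \<gamma> z assume \<gamma>: "\<gamma> \<in> SL2Z" and z: "z \<in> \<HH>"
    have u: "rho_u (moebius \<gamma> z) = jfac \<gamma> z ^ 4 * rho_u z"
      "rho_v (moebius \<gamma> z) = jfac \<gamma> z ^ 6 * rho_v z"
      using modularD[OF rho_modular(1) \<gamma> z] modularD[OF rho_modular(2) \<gamma> z] by simp_all
    have du: "deriv rho_u (moebius \<gamma> z) = jfac \<gamma> z ^ 6 * deriv rho_u z + 4 * of_int (ec \<gamma>) * jfac \<gamma> z ^ 5 * rho_u z"
      using deriv_modular[OF rho_holomorphic(1) _ \<gamma> z, of 3] rho_modular(1) by simp
    have dv: "deriv rho_v (moebius \<gamma> z) = jfac \<gamma> z ^ 8 * deriv rho_v z + 6 * of_int (ec \<gamma>) * jfac \<gamma> z ^ 7 * rho_v z"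
      using deriv_modular[OF rho_holomorphic(2) _ \<gamma> z, of 5] rho_modular(2) by simp
    have "W (moebius \<gamma> z) = jfac \<gamma> z ^ 12 * W z"
      unfolding W_def u du dv by (simp add: algebra_simps flip: power_add)
    then show "W (moebius \<gamma> z) = jfac \<gamma> z powi 12 * W z" by simp
  qed
  have "modform 12 W" by (rule modformI_qexp[OF Wmod w Ww])
  then have "modform (12 - 12) (\<lambda>z. W z / rho_Delta z)"
    by (rule modform_div_Delta[OF _ w Ww]) (simp_all add: w_def)
  then have "modform 0 (\<lambda>z. W z / rho_Delta z)" by simp
  then obtain c where c: "\<And>z. z \<in> \<HH> \<Longrightarrow> W z / rho_Delta z = c"
    using modform_0_const by blast
  have e: "w q = c * Dhat q" if "q \<in> ball 0 1" for q
  proof (rule qexp_unique[OF w _ _ that])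
    show "(\<lambda>q. c * Dhat q) holomorphic_on ball 0 1" by (intro holomorphic_intros Dhat_holomorphic)
    fix z assume z: "z \<in> \<HH>"
    then show "w (qq z) = c * Dhat (qq z)"
      using c[OF z] rho_Delta_nonzero[OF z] by (simp add: Ww rho_Delta_hat[OF z] field_simps)
  qed
  define w1 where "w1 q = 2 * uhat q * deriv vhat q - 3 * vhat q * deriv uhat q" for q
  have "w1 holomorphic_on ball 0 1"
    unfolding w1_def by (intro holomorphic_intros hat_holomorphic deriv_hat_holomorphic)
  then have "(w1 has_field_derivative deriv w1 0) (at 0)"
    by (rule holomorphic_derivI) auto
  then have "((\<lambda>q. tpi * (q * w1 q)) has_field_derivative tpi * (1 * w1 0 + deriv w1 0 * 0)) (at 0)"
    by (intro DERIV_cmult DERIV_mult DERIV_ident)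
  then have A: "(w has_field_derivative tpi * w1 0) (at 0)"
    unfolding w_def[abs_def] w1_def by simp
  have B: "((\<lambda>q. c * Dhat q) has_field_derivative c * deriv Dhat 0) (at 0)"
    by (intro DERIV_cmult hat_has_derivative) simp
  have "tpi * w1 0 = c * deriv Dhat 0"
    by (rule deriv_eq_on_open[OF open_ball[of 0 1] centre_in_ball[THEN iffD2, OF zero_less_one] e A B])
  then have "c = tpi * (2 / 3)"
    by (simp add: deriv_Dhat_0 w1_def hat_0 hat_deriv_0)
  then show ?thesis
    using c[OF z] unfolding rho_omega_def W_def times_divide_eq_right[symmetric]
    by (simp add: mult.commute)
qed

lemma W_eq:
  assumes z: "z \<in> \<HH>"
  shows "2 * rho_u z * deriv rho_v z - 3 * rho_v z * deriv rho_u z = 4 / 3 * of_real pi * \<i> * rho_Delta z"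
  using rho_omega_eq[OF z] rho_Delta_nonzero[OF z] unfolding rho_omega_def by (simp add: field_simps)

lemma rho_has_derivative:
  assumes "z \<in> \<HH>"
  shows "(rho_u has_field_derivative deriv rho_u z) (at z)" "(rho_v has_field_derivative deriv rho_v z) (at z)"
    "(rho_Delta has_field_derivative deriv rho_Delta z) (at z)"
  by (rule holomorphic_derivI[OF _ open_upper_half assms], rule rho_holomorphic rho_Delta_holomorphic)+

lemma deriv_rho_Delta:
  assumes "z \<in> \<HH>"
  shows "deriv rho_Delta z = 3 * rho_u z ^ 2 * deriv rho_u z - 54 * rho_v z * deriv rho_v z"
proof -
  have "(rho_Delta has_field_derivative 3 * rho_u z ^ 2 * deriv rho_u z - 27 * (2 * rho_v z * deriv rho_v z)) (at z)"
    unfolding rho_Delta_def[abs_def]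
    by (auto intro!: derivative_eq_intros rho_has_derivative assms)
  then show ?thesis by (simp add: DERIV_imp_deriv)
qed

lemma deriv_rho_Delta_psi:
  assumes "z \<in> \<HH>"
  shows "deriv rho_Delta z = 12 * rho_psi z * rho_Delta z"
  using rho_Delta_nonzero[OF assms] by (simp add: rho_psi_def)

text \<open>Ramanujan's formulas for the derivatives of \<open>E\<^sub>4\<close> and \<open>E\<^sub>6\<close>.\<close>

lemma serre_derivative:
  assumes z: "z \<in> \<HH>"
  shows "deriv rho_u z = 4 * rho_psi z * rho_u z + 12 * of_real pi * \<i> * rho_v z"
    and "deriv rho_v z = 6 * rho_psi z * rho_v z + 2 / 3 * of_real pi * \<i> * rho_u z ^ 2"
proof -
  have D: "rho_Delta z \<noteq> 0" by (rule rho_Delta_nonzero[OF z])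
  have d: "12 * rho_psi z * rho_Delta z = 3 * rho_u z ^ 2 * deriv rho_u z - 54 * rho_v z * deriv rho_v z"
    using deriv_rho_Delta_psi[OF z] deriv_rho_Delta[OF z] by simp
  have "rho_Delta z * (deriv rho_u z - 4 * rho_psi z * rho_u z) =
      rho_Delta z * deriv rho_u z - rho_u z / 3 * (12 * rho_psi z * rho_Delta z)" by (simp add: algebra_simps)
  also have "\<dots> = 9 * rho_v z * (2 * rho_u z * deriv rho_v z - 3 * rho_v z * deriv rho_u z)"
    unfolding d by (simp add: rho_Delta_def algebra_simps power2_eq_square power3_eq_cube)
  also have "\<dots> = rho_Delta z * (12 * of_real pi * \<i> * rho_v z)"
    unfolding W_eq[OF z] by simp
  finally have "deriv rho_u z - 4 * rho_psi z * rho_u z = 12 * of_real pi * \<i> * rho_v z"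
    using D by (simp only: mult_cancel_left) simp
  then show "deriv rho_u z = 4 * rho_psi z * rho_u z + 12 * of_real pi * \<i> * rho_v z"
    by (simp add: algebra_simps)
  have "rho_Delta z * (deriv rho_v z - 6 * rho_psi z * rho_v z) =
      rho_Delta z * deriv rho_v z - rho_v z / 2 * (12 * rho_psi z * rho_Delta z)" by (simp add: algebra_simps)
  also have "\<dots> = rho_u z ^ 2 / 2 * (2 * rho_u z * deriv rho_v z - 3 * rho_v z * deriv rho_u z)"
    unfolding d by (simp add: rho_Delta_def algebra_simps power2_eq_square power3_eq_cube)
  also have "\<dots> = rho_Delta z * (2 / 3 * of_real pi * \<i> * rho_u z ^ 2)"
    unfolding W_eq[OF z] by simp
  finally have "deriv rho_v z - 6 * rho_psi z * rho_v z = 2 / 3 * of_real pi * \<i> * rho_u z ^ 2"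
    using D by (simp only: mult_cancel_left) simp
  then show "deriv rho_v z = 6 * rho_psi z * rho_v z + 2 / 3 * of_real pi * \<i> * rho_u z ^ 2"
    by (simp only: diff_eq_eq) (simp only: add.commute)
qed

lemma rho_psi_holomorphic: "rho_psi holomorphic_on \<HH>"
proof -
  have "deriv rho_Delta holomorphic_on \<HH>"
    by (rule holomorphic_deriv[OF rho_Delta_holomorphic open_upper_half])
  then show ?thesis
    unfolding rho_psi_def[abs_def] using rho_Delta_nonzero
    by (intro holomorphic_on_divide holomorphic_on_mult holomorphic_on_const rho_Delta_holomorphic) auto
qed

text \<open>
  As \<open>\<psi>\<close> is a logarithmic derivative of a form of weight \<open>12\<close>, it transforms like \<open>E\<^sub>2\<close>.
\<close>

lemma rho_psi_moebius:
  assumes \<gamma>: "\<gamma> \<in> SL2Z" and z: "z \<in> \<HH>"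
  shows "rho_psi (moebius \<gamma> z) = jfac \<gamma> z ^ 2 * rho_psi z + of_int (ec \<gamma>) * jfac \<gamma> z"
proof -
  let ?j = "jfac \<gamma> z"
  have j: "?j \<noteq> 0" by (rule jfac_nonzero[OF \<gamma> z])
  have D: "rho_Delta z \<noteq> 0" by (rule rho_Delta_nonzero[OF z])
  have 1: "rho_Delta (moebius \<gamma> z) = ?j ^ 12 * rho_Delta z"
    using modularD[OF rho_Delta_modular \<gamma> z] by simp
  have "deriv rho_Delta (moebius \<gamma> z) = ?j ^ 14 * deriv rho_Delta z + 12 * of_int (ec \<gamma>) * ?j ^ 13 * rho_Delta z"
    using deriv_modular[OF rho_Delta_holomorphic _ \<gamma> z, of 11] rho_Delta_modular by simp
  also have "\<dots> = 12 * ?j ^ 12 * rho_Delta z * (?j ^ 2 * rho_psi z + of_int (ec \<gamma>) * ?j)"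
    unfolding deriv_rho_Delta_psi[OF z] by (simp add: algebra_simps power_Suc eval_nat_numeral)
  finally show ?thesis unfolding rho_psi_def[of "moebius \<gamma> z"] 1 using j D by simp
qed

lemma rho_psi_qexp:
  obtains p where "p holomorphic_on ball 0 1" "\<And>z. z \<in> \<HH> \<Longrightarrow> rho_psi z = p (qq z)"
    "p 0 = of_real pi * \<i> / 6"
proof -
  obtain B where B: "\<And>z. Im z \<ge> 1 \<Longrightarrow> norm (deriv Dhat (qq z)) \<le> B"
    using modform_bounded[OF deriv_hat_holomorphic[OF Dhat_holomorphic]] by blast
  have per: "rho_psi (z + of_int m) = rho_psi z" if "z \<in> \<HH>" for z m
    using rho_psi_moebius[of "ST m" z] that by (simp add: moebius_gens) (simp add: ST_def)
  have bd: "norm (rho_psi z) \<le> 2 / 3 * pi * B * exp (pi * Im z)" if "Im z \<ge> 1" for z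
  proof -
    have z: "z \<in> \<HH>" using that by (simp add: upper_half_iff)
    have D: "norm (rho_Delta z) \<ge> norm (qq z) / 4"
      by (rule rho_Delta_bounds) (use that sqrt3_half_less_1 in linarith)
    have p: "norm (qq z) > 0" by simp
    have B0: "B \<ge> 0" using order_trans[OF norm_ge_zero B[OF that]] .
    have "norm (rho_psi z) = 1 / 12 * (2 * pi * (norm (qq z) * norm (deriv Dhat (qq z)))) / norm (rho_Delta z)"
    proof -
      have "deriv rho_Delta z = tpi * (qq z * deriv Dhat (qq z))"
        by (rule deriv_qexp[OF Dhat_holomorphic rho_Delta_hat z])
      then show ?thesis by (simp add: rho_psi_def norm_mult norm_divide)
    qed
    also have "\<dots> \<le> 1 / 12 * (2 * pi * (norm (qq z) * B)) / (norm (qq z) / 4)"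
      using D p B[OF that] B0 by (intro frac_le mult_left_mono) auto
    also have "\<dots> = 2 / 3 * pi * B" using p by simp
    also have "\<dots> \<le> 2 / 3 * pi * B * exp (pi * Im z)"
    proof -
      have "1 \<le> exp (pi * Im z)" using that by simp
      from mult_left_mono[OF this, of "2 / 3 * pi * B"] B0 show ?thesis by simp
    qed
    finally show ?thesis .
  qed
  obtain p where p: "p holomorphic_on ball 0 1" "\<And>z. z \<in> \<HH> \<Longrightarrow> rho_psi z = p (qq z)"
    using qexp_exists[OF rho_psi_holomorphic per bd] by blast
  have e: "tpi * (q * deriv Dhat q) = 12 * (p q * Dhat q)" if "q \<in> ball 0 1" for q
  proof (rule qexp_unique[OF _ _ _ that])
    show "(\<lambda>q. tpi * (q * deriv Dhat q)) holomorphic_on ball 0 1"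
      "(\<lambda>q. 12 * (p q * Dhat q)) holomorphic_on ball 0 1"
      by (intro holomorphic_intros p Dhat_holomorphic deriv_hat_holomorphic)+
    fix z assume z: "z \<in> \<HH>"
    show "tpi * (qq z * deriv Dhat (qq z)) = 12 * (p (qq z) * Dhat (qq z))"
      using deriv_rho_Delta_psi[OF z] deriv_qexp[OF Dhat_holomorphic rho_Delta_hat z]
      by (simp add: p(2)[OF z] rho_Delta_hat[OF z])
  qed
  have d: "(f has_field_derivative deriv f 0) (at 0)" if "f holomorphic_on ball 0 1" for f :: "complex \<Rightarrow> complex"
    by (rule holomorphic_derivI[OF that]) auto
  have A: "((\<lambda>q. tpi * (q * deriv Dhat q)) has_field_derivative
      tpi * (1 * deriv Dhat 0 + deriv (deriv Dhat) 0 * 0)) (at 0)"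
    by (intro DERIV_cmult DERIV_mult DERIV_ident d deriv_hat_holomorphic Dhat_holomorphic)
  have B: "((\<lambda>q. 12 * (p q * Dhat q)) has_field_derivative 12 * (deriv p 0 * Dhat 0 + deriv Dhat 0 * p 0)) (at 0)"
    by (intro DERIV_cmult DERIV_mult d p Dhat_holomorphic)
  have "tpi * (1 * deriv Dhat 0 + deriv (deriv Dhat) 0 * 0) = 12 * (deriv p 0 * Dhat 0 + deriv Dhat 0 * p 0)"
    by (rule deriv_eq_on_open[OF open_ball[of 0 1] centre_in_ball[THEN iffD2, OF zero_less_one] e A B])
  then have "6 * p 0 = of_real pi * \<i>" by (simp add: Dhat_0 deriv_Dhat_0 mult.commute)
  then have "p 0 = of_real pi * \<i> / 6" by (metis nonzero_mult_div_cancel_left zero_neq_numeral)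
  with p show ?thesis using that by blast
qed

text \<open>
  Ramanujan's formula for the derivative of \<open>E\<^sub>2\<close>, which is \<open>6/(\<pi>i)\<close> times \<open>\<psi>\<close>: the
  anomalies of \<open>\<psi>'\<close> and \<open>\<psi>\<^sup>2\<close> under the modular group cancel, and what remains is a form of
  weight \<open>4\<close>, hence a multiple of \<open>u\<close>.
\<close>

lemma deriv_rho_psi:
  assumes z: "z \<in> \<HH>"
  shows "deriv rho_psi z = rho_psi z ^ 2 + of_real pi ^ 2 / 3 * rho_u z"
proof -
  obtain p where p: "p holomorphic_on ball 0 1" "\<And>z. z \<in> \<HH> \<Longrightarrow> rho_psi z = p (qq z)"
    "p 0 = of_real pi * \<i> / 6" using rho_psi_qexp by blast
  define Q where "Q z = deriv rho_psi z - rho_psi z ^ 2" for z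
  have "modular 4 Q"
    unfolding modular_def
  proof (intro ballI)
    fix \<gamma> z assume \<gamma>: "\<gamma> \<in> SL2Z" and z: "z \<in> \<HH>"
    let ?j = "jfac \<gamma> z" and ?c = "of_int (ec \<gamma>) :: complex"
    have j: "?j \<noteq> 0" by (rule jfac_nonzero[OF \<gamma> z])
    have fd: "(rho_psi has_field_derivative deriv rho_psi w) (at w)" if "w \<in> \<HH>" for w
      by (rule holomorphic_derivI[OF rho_psi_holomorphic open_upper_half that])
    have 1: "((\<lambda>w. rho_psi (moebius \<gamma> w)) has_field_derivative deriv rho_psi (moebius \<gamma> z) * (1 / ?j ^ 2)) (at z)"
      by (rule DERIV_chain2[OF fd[OF moebius_upper_half[OF \<gamma> z]] moebius_has_derivative[OF \<gamma> z]])
    have jd: "(jfac \<gamma> has_field_derivative ?c) (at z)"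
      unfolding jfac_def[abs_def] by (auto intro!: derivative_eq_intros)
    have 2: "((\<lambda>w. jfac \<gamma> w ^ 2 * rho_psi w + ?c * jfac \<gamma> w) has_field_derivative
        (2 * ?j * ?c * rho_psi z + ?j ^ 2 * deriv rho_psi z + ?c * ?c)) (at z)"
      by (auto intro!: derivative_eq_intros jd fd z)
    have "deriv rho_psi (moebius \<gamma> z) * (1 / ?j ^ 2) = 2 * ?j * ?c * rho_psi z + ?j ^ 2 * deriv rho_psi z + ?c * ?c"
      by (rule deriv_eq_on_open[OF open_upper_half z rho_psi_moebius[OF \<gamma>] 1 2])
    then have "deriv rho_psi (moebius \<gamma> z) = (2 * ?j * ?c * rho_psi z + ?j ^ 2 * deriv rho_psi z + ?c * ?c) * ?j ^ 2"
      using j by (simp add: field_simps)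
    then have "Q (moebius \<gamma> z) = ?j ^ 4 * Q z"
      unfolding Q_def rho_psi_moebius[OF \<gamma> z] by (simp add: algebra_simps power2_eq_square power4_eq_xxxx)
    then show "Q (moebius \<gamma> z) = ?j powi 4 * Q z" by simp
  qed
  moreover define r where "r q = tpi * (q * deriv p q) - p q ^ 2" for q
  have r: "r holomorphic_on ball 0 1"
    unfolding r_def by (intro holomorphic_intros p deriv_hat_holomorphic)
  have Qr: "Q z = r (qq z)" if "z \<in> \<HH>" for z
    using deriv_qexp[OF p(1,2) that] p(2)[OF that] by (simp add: Q_def r_def)
  ultimately have "modform 4 Q" by (intro modformI_qexp[OF _ r Qr])
  then obtain c where c: "\<And>z. z \<in> \<HH> \<Longrightarrow> Q z = c * (rho_u z ^ 1 * rho_v z ^ 0)"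
    using modform_one_dim[of 4 Q 1 0] by auto
  have "r 0 = c * uhat 0"
  proof (rule qexp_unique[OF r])
    show "(\<lambda>q. c * uhat q) holomorphic_on ball 0 1" by (intro holomorphic_intros hat_holomorphic)
    fix z assume z: "z \<in> \<HH>"
    then show "r (qq z) = c * uhat (qq z)" using c[OF z] Qr[OF z] rho_hat[OF z] by simp
  qed simp
  then have "c = of_real pi ^ 2 / 3"
    by (simp add: r_def p(3) hat_0 power2_eq_square field_simps)
  then show ?thesis using c[OF z] by (simp add: Q_def algebra_simps)
qed

section \<open>The frame and the lift to \<open>Z\<close>\<close>

lemma frame_S_eq:
  assumes "z \<in> \<HH>"
  shows "frame_S z = [:- rho_psi z, 1 + rho_psi z * z:]"
proof -
  define c where "c = tpi"
  have "c \<noteq> 0" by (simp add: c_def)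
  moreover have "frame_S z = smult (1 / c) ([:0, c:] + smult (rho_psi z) [:- c, c * z:])"
    by (simp add: frame_S_def frame_T_def rho_omega_eq[OF assms] c_def)
  ultimately show ?thesis by (simp add: field_simps)
qed

lemma frame_T_alt: "frame_T z = smult tpi [:- 1, z:]"
  by (simp add: frame_T_def)

lemma frame_T_moebius:
  assumes \<gamma>: "\<gamma> \<in> SL2Z" and z: "z \<in> \<HH>"
  shows "actB 1 \<gamma> (frame_T (moebius \<gamma> z)) = smult (1 / jfac \<gamma> z) (frame_T z)"
proof -
  let ?j = "jfac \<gamma> z" and ?w = "moebius \<gamma> z"
  have j: "?j \<noteq> 0" by (rule jfac_nonzero[OF \<gamma> z])
  have det: "complex_of_int (ea \<gamma>) * of_int (ed \<gamma>) - of_int (eb \<gamma>) * of_int (ec \<gamma>) = 1"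
    by (rule SL2Z_det_of_int[OF \<gamma>])
  have "?j * (?w * of_int (ec \<gamma>) - of_int (ea \<gamma>)) = (?w * ?j) * of_int (ec \<gamma>) - of_int (ea \<gamma>) * ?j"
    by (simp add: algebra_simps)
  also have "\<dots> = - (complex_of_int (ea \<gamma>) * of_int (ed \<gamma>) - of_int (eb \<gamma>) * of_int (ec \<gamma>))"
    unfolding moebius_jfac[OF \<gamma> z] by (simp add: jfac_def algebra_simps)
  finally have 1: "?w * of_int (ec \<gamma>) - of_int (ea \<gamma>) = - 1 / ?j" unfolding det using j by (simp add: field_simps)
  have "?j * (?w * of_int (ed \<gamma>) - of_int (eb \<gamma>)) = (?w * ?j) * of_int (ed \<gamma>) - of_int (eb \<gamma>) * ?j"
    by (simp add: algebra_simps)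
  also have "\<dots> = (complex_of_int (ea \<gamma>) * of_int (ed \<gamma>) - of_int (eb \<gamma>) * of_int (ec \<gamma>)) * z"
    unfolding moebius_jfac[OF \<gamma> z] by (simp add: jfac_def algebra_simps)
  finally have 2: "?w * of_int (ed \<gamma>) - of_int (eb \<gamma>) = z / ?j" unfolding det using j by (simp add: field_simps)
  have "actB 1 \<gamma> (frame_T ?w) = [:tpi * (?w * of_int (ec \<gamma>) - of_int (ea \<gamma>)),
      tpi * (?w * of_int (ed \<gamma>) - of_int (eb \<gamma>)):]"
    unfolding actB_cact frame_T_def cact_1 by (simp add: algebra_simps)
  then show ?thesis unfolding 1 2 frame_T_def by simp
qed

text \<open>
  The anomaly of \<open>\<psi>\<close> cancels the one of the constant vector \<open>a\<close>.
\<close>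

lemma frame_S_moebius:
  assumes \<gamma>: "\<gamma> \<in> SL2Z" and z: "z \<in> \<HH>"
  shows "actB 1 \<gamma> (frame_S (moebius \<gamma> z)) = smult (jfac \<gamma> z) (frame_S z)"
proof -
  let ?j = "jfac \<gamma> z" and ?w = "moebius \<gamma> z"
  have j: "?j \<noteq> 0" by (rule jfac_nonzero[OF \<gamma> z])
  have e: "frame_S z = [:0, 1:] + smult (rho_psi z / tpi) (frame_T z)"
    if "z \<in> \<HH>" for z
  proof -
    have "rho_psi z / tpi * tpi = rho_psi z" by simp
    then show ?thesis unfolding frame_S_eq[OF that] frame_T_alt smult_smult by simp
  qed
  have "actB 1 \<gamma> (frame_S ?w) = actB 1 \<gamma> [:0, 1:] +
      smult (rho_psi ?w / tpi) (actB 1 \<gamma> (frame_T ?w))"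
    unfolding e[OF moebius_upper_half[OF \<gamma> z]] by (simp only: actB_add actB_smult)
  also have "\<dots> = [:of_int (ec \<gamma>), of_int (ed \<gamma>):] +
      smult (rho_psi ?w / tpi) (smult (1 / ?j) (frame_T z))"
    unfolding frame_T_moebius[OF \<gamma> z] by (simp add: actB_cact cact_1 del: One_nat_def)
  also have "\<dots> = smult ?j (frame_S z)"
    unfolding rho_psi_moebius[OF \<gamma> z] e[OF z] using j
    by (simp add: frame_T_def field_simps power2_eq_square) (simp add: jfac_def algebra_simps)
  finally show ?thesis .
qed

lemma lam_spec: "lam holomorphic_on \<HH>" "z \<in> \<HH> \<Longrightarrow> lam z ^ 12 * rho_Delta z = 1"
proof -
  have "contractible \<HH>" by (rule convex_imp_contractible[OF convex_upper_half])
  then obtain g where g: "g holomorphic_on \<HH>" "\<And>z. z \<in> \<HH> \<Longrightarrow> rho_Delta z = exp (g z)"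
    using contractible_imp_holomorphic_log[OF rho_Delta_holomorphic] rho_Delta_nonzero by blast
  have "\<exists>l. l holomorphic_on \<HH> \<and> (\<forall>z\<in>\<HH>. l z ^ 12 * rho_Delta z = 1)"
  proof (intro exI conjI ballI)
    show "(\<lambda>z. exp (- g z / 12)) holomorphic_on \<HH>" by (intro holomorphic_intros g) auto
    fix z assume "z \<in> \<HH>"
    then show "exp (- g z / 12) ^ 12 * rho_Delta z = 1"
      by (simp add: g(2) flip: exp_of_nat_mult exp_add)
  qed
  from someI_ex[OF this] show "lam holomorphic_on \<HH>" "z \<in> \<HH> \<Longrightarrow> lam z ^ 12 * rho_Delta z = 1"
    unfolding lam_def[symmetric] by blast+
qed

lemma lam_nonzero: "z \<in> \<HH> \<Longrightarrow> lam z \<noteq> 0"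
  using lam_spec(2)[of z] by auto

lemma lam_has_derivative:
  assumes z: "z \<in> \<HH>"
  shows "(lam has_field_derivative - rho_psi z * lam z) (at z)"
proof -
  have l: "(lam has_field_derivative deriv lam z) (at z)"
    by (rule holomorphic_derivI[OF lam_spec(1) open_upper_half z])
  have "((\<lambda>z. lam z ^ 12 * rho_Delta z) has_field_derivative
      12 * lam z ^ 11 * deriv lam z * rho_Delta z + lam z ^ 12 * deriv rho_Delta z) (at z)"
    by (auto intro!: derivative_eq_intros l rho_has_derivative z)
  moreover have "((\<lambda>z. 1) has_field_derivative 0) (at z)" by simp
  ultimately have "12 * lam z ^ 11 * deriv lam z * rho_Delta z + lam z ^ 12 * deriv rho_Delta z = 0"
    by (intro deriv_eq_on_open[OF open_upper_half z lam_spec(2)]) auto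
  then have "12 * (lam z ^ 11 * rho_Delta z) * (deriv lam z + rho_psi z * lam z) = 0"
    unfolding deriv_rho_Delta_psi[OF z] by (simp add: algebra_simps eval_nat_numeral)
  then have "deriv lam z = - rho_psi z * lam z"
    using lam_nonzero[OF z] rho_Delta_nonzero[OF z] by (simp add: add_eq_0_iff)
  then show ?thesis using l by simp
qed

lemma lift_on_Z:
  assumes "z \<in> \<HH>"
  shows "lift_u z ^ 3 - 27 * lift_v z ^ 2 = 1"
proof -
  have "lift_u z ^ 3 - 27 * lift_v z ^ 2 = lam z ^ 12 * rho_Delta z"
    by (simp add: lift_u_def lift_v_def rho_Delta_def power_mult_distrib algebra_simps flip: power_mult)
  then show ?thesis using lam_spec(2)[OF assms] by simp
qed

definition omega_hat :: "complex \<Rightarrow> complex" where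
  "omega_hat z = tpi / lam z ^ 2"

text \<open>
  On \<open>Z\<close> the relations are \<open>du = 6 v \<omega>\<close> and \<open>dv = (u\<^sup>2/3) \<omega>\<close>, and \<open>\<omega>\<close> pulls back to \<open>2\<pi>i \<lambda>\<^sup>-\<^sup>2 dz\<close>: the
  \<open>\<psi>\<close>-terms in Ramanujan's equations are absorbed by \<open>\<lambda>\<close>.
\<close>

lemma lift_has_derivative:
  assumes z: "z \<in> \<HH>"
  shows "(lift_u has_field_derivative 6 * lift_v z * omega_hat z) (at z)"
    and "(lift_v has_field_derivative lift_u z ^ 2 / 3 * omega_hat z) (at z)"
proof -
  have l: "lam z \<noteq> 0" by (rule lam_nonzero[OF z])
  have "(lift_u has_field_derivative 4 * lam z ^ 3 * (- rho_psi z * lam z) * rho_u z + lam z ^ 4 * deriv rho_u z) (at z)"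
    unfolding lift_u_def[abs_def] by (auto intro!: derivative_eq_intros lam_has_derivative rho_has_derivative z)
  also have "4 * lam z ^ 3 * (- rho_psi z * lam z) * rho_u z + lam z ^ 4 * deriv rho_u z = 6 * lift_v z * omega_hat z"
    unfolding serre_derivative(1)[OF z] lift_v_def omega_hat_def using l
    by (simp add: field_simps eval_nat_numeral)
  finally show "(lift_u has_field_derivative 6 * lift_v z * omega_hat z) (at z)" .
  have "(lift_v has_field_derivative 6 * lam z ^ 5 * (- rho_psi z * lam z) * rho_v z + lam z ^ 6 * deriv rho_v z) (at z)"
    unfolding lift_v_def[abs_def] by (auto intro!: derivative_eq_intros lam_has_derivative rho_has_derivative z)
  also have "6 * lam z ^ 5 * (- rho_psi z * lam z) * rho_v z + lam z ^ 6 * deriv rho_v z = lift_u z ^ 2 / 3 * omega_hat z"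
    unfolding serre_derivative(2)[OF z] lift_u_def omega_hat_def using l
    by (simp add: field_simps eval_nat_numeral)
  finally show "(lift_v has_field_derivative lift_u z ^ 2 / 3 * omega_hat z) (at z)" .
qed

lemma lift_holomorphic: "lift_u holomorphic_on \<HH>" "lift_v holomorphic_on \<HH>"
  unfolding lift_u_def[abs_def] lift_v_def[abs_def]
  by (intro holomorphic_intros lam_spec(1) rho_holomorphic)+

text \<open>
  Since \<open>\<Delta>\<close> has weight \<open>12\<close>, the twelfth powers of \<open>\<lambda>(\<gamma>z) (cz + d)\<close> and \<open>\<lambda>(z)\<close> agree.
\<close>

lemma lam_moebius:
  assumes \<gamma>: "\<gamma> \<in> SL2Z" and z: "z \<in> \<HH>"
  obtains \<epsilon> where "\<epsilon> ^ 12 = 1" "lam (moebius \<gamma> z) * jfac \<gamma> z = \<epsilon> * lam z"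
proof -
  let ?j = "jfac \<gamma> z" and ?w = "moebius \<gamma> z"
  have j: "?j \<noteq> 0" by (rule jfac_nonzero[OF \<gamma> z])
  have l: "lam z \<noteq> 0" by (rule lam_nonzero[OF z])
  have D: "rho_Delta z \<noteq> 0" by (rule rho_Delta_nonzero[OF z])
  have "rho_Delta ?w = ?j ^ 12 * rho_Delta z"
    using modularD[OF rho_Delta_modular \<gamma> z] by simp
  then have "(lam ?w * ?j) ^ 12 * rho_Delta z = 1"
    using lam_spec(2)[OF moebius_upper_half[OF \<gamma> z]] by (simp add: power_mult_distrib mult_ac)
  then have "(lam ?w * ?j) ^ 12 = lam z ^ 12" using lam_spec(2)[OF z] D by (metis mult_right_cancel)
  then have "(lam ?w * ?j / lam z) ^ 12 = 1" using l by (simp add: power_divide)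
  then show ?thesis by (rule that) (use l in simp)
qed

section \<open>Quotients of subspaces\<close>

text \<open>
  Closure conditions without reference to a vector space locale, usable for carriers inside any type
  with a scalar multiplication.
\<close>

definition vsub :: "('k \<Rightarrow> 'a \<Rightarrow> 'a) \<Rightarrow> 'a::ab_group_add set \<Rightarrow> bool" where
  "vsub s Z \<longleftrightarrow> 0 \<in> Z \<and> (\<forall>x\<in>Z. \<forall>y\<in>Z. x + y \<in> Z) \<and> (\<forall>x\<in>Z. - x \<in> Z) \<and> (\<forall>r. \<forall>x\<in>Z. s r x \<in> Z)"

lemma vsubD:
  assumes "vsub s Z"
  shows "0 \<in> Z" "x \<in> Z \<Longrightarrow> y \<in> Z \<Longrightarrow> x + y \<in> Z" "x \<in> Z \<Longrightarrow> - x \<in> Z" "x \<in> Z \<Longrightarrow> s r x \<in> Z"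
    "x \<in> Z \<Longrightarrow> y \<in> Z \<Longrightarrow> x - y \<in> Z"
proof -
  show "0 \<in> Z" "x \<in> Z \<Longrightarrow> y \<in> Z \<Longrightarrow> x + y \<in> Z" "x \<in> Z \<Longrightarrow> - x \<in> Z" "x \<in> Z \<Longrightarrow> s r x \<in> Z"
    using assms unfolding vsub_def by blast+
  show "x - y \<in> Z" if "x \<in> Z" "y \<in> Z"
  proof -
    have "x + (- y) \<in> Z" using assms that unfolding vsub_def by blast
    then show ?thesis by simp
  qed
qed

lemma vsub_subspace:
  assumes "vector_space s" "vsub s Z"
  shows "Modules.module.subspace s Z"
proof -
  interpret vector_space s by fact
  show ?thesis using assms(2) unfolding vsub_def subspace_def by blast
qed

lemma subspace_vsub:
  assumes "vector_space s" "Modules.module.subspace s Z"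
  shows "vsub s Z"
proof -
  interpret vector_space s by fact
  show ?thesis using assms(2) unfolding vsub_def
    by (auto intro: subspace_0 subspace_add subspace_neg subspace_scale)
qed

definition cls :: "'a::ab_group_add set \<Rightarrow> 'a \<Rightarrow> 'a set" where
  "cls N x = (\<lambda>n. n + x) ` N"

lemma cls_self: "vsub s N \<Longrightarrow> x \<in> cls N x"
  unfolding cls_def using vsubD(1) by force

lemma mem_cls: "y \<in> cls N x \<longleftrightarrow> y - x \<in> N"
  unfolding cls_def by (auto simp: image_iff) (metis diff_add_cancel)

lemma cls_eq_iff:
  assumes "vsub s N"
  shows "cls N x = cls N y \<longleftrightarrow> x - y \<in> N"
proof
  assume "cls N x = cls N y"
  then show "x - y \<in> N" using cls_self[OF assms, of x] by (simp add: mem_cls)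
next
  assume xy: "x - y \<in> N"
  show "cls N x = cls N y"
  proof (rule Set.set_eqI)
    fix w
    have "w - x \<in> N \<longleftrightarrow> w - y \<in> N"
      using vsubD(2)[OF assms, of "w - x" "x - y"] vsubD(5)[OF assms, of "w - y" "x - y"] xy by auto
    then show "w \<in> cls N x \<longleftrightarrow> w \<in> cls N y" by (simp add: mem_cls)
  qed
qed

lemma cls_r_coset: "N +>\<^bsub>submod s Z\<^esub> x = cls N x"
  by (auto simp: submod_def a_r_coset_def r_coset_def cls_def)

lemma carrier_quot: "carrier (quot_module (submod s Z) N) = cls N ` Z"
  by (auto simp: quot_module_def A_RCOSETS_def RCOSETS_def submod_def r_coset_def cls_def image_iff)

lemma add_quot:
  assumes "vsub s N"
  shows "cls N x \<oplus>\<^bsub>quot_module (submod s Z) N\<^esub> cls N y = cls N (x + y)"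
proof -
  have "cls N x \<oplus>\<^bsub>quot_module (submod s Z) N\<^esub> cls N y = {a + b | a b. a \<in> cls N x \<and> b \<in> cls N y}"
    by (auto simp: quot_module_def submod_def set_add_def set_mult_def)
  also have "\<dots> = cls N (x + y)"
  proof (intro Set.set_eqI iffI)
    fix w assume "w \<in> {a + b | a b. a \<in> cls N x \<and> b \<in> cls N y}"
    then obtain a b where "w = a + b" "a - x \<in> N" "b - y \<in> N" by (auto simp: mem_cls)
    then show "w \<in> cls N (x + y)"
      using vsubD(2)[OF assms, of "a - x" "b - y"] by (simp add: mem_cls algebra_simps)
  next
    fix w assume "w \<in> cls N (x + y)"
    then have "w - y \<in> cls N x" "y \<in> cls N y"
      using cls_self[OF assms] by (auto simp: mem_cls algebra_simps)
    moreover have "w = (w - y) + y" by simp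
    ultimately show "w \<in> {a + b | a b. a \<in> cls N x \<and> b \<in> cls N y}" by blast
  qed
  finally show ?thesis .
qed

lemma smult_quot:
  assumes N: "vsub s N" "N \<subseteq> Z" and Z: "vsub s Z"
    and lin: "\<And>r x y. x \<in> Z \<Longrightarrow> y \<in> Z \<Longrightarrow> s r (x + y) = s r x + s r y" and x: "x \<in> Z"
  shows "r \<odot>\<^bsub>quot_module (submod s Z) N\<^esub> cls N x = cls N (s r x)"
proof -
  have "r \<odot>\<^bsub>quot_module (submod s Z) N\<^esub> cls N x = (\<Union>y\<in>cls N x. cls N (s r y))"
    by (simp add: quot_module_def cls_r_coset) (simp add: submod_def)
  also have "\<dots> = (\<Union>y\<in>cls N x. cls N (s r x))"
  proof (rule SUP_cong[OF refl])
    fix y assume "y \<in> cls N x"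
    then have n: "y - x \<in> N" by (simp add: mem_cls)
    have "s r y = s r ((y - x) + x)" by simp
    also have "\<dots> = s r (y - x) + s r x" using n N(2) x by (intro lin) auto
    finally have "s r y - s r x \<in> N" using vsubD(4)[OF N(1) n] by simp
    then show "cls N (s r y) = cls N (s r x)" by (simp add: cls_eq_iff[OF N(1)])
  qed
  also have "\<dots> = cls N (s r x)" using cls_self[OF N(1)] by auto
  finally show ?thesis .
qed

text \<open>
  A linear map that identifies \<open>N1\<close> with the preimage of \<open>N2\<close> and is surjective modulo \<open>N2\<close> induces an
  isomorphism; \<open>f\<close> is a map of cosets known to be induced by \<open>\<phi>\<close>.
\<close>

lemma module_iso_quot:
  assumes 1: "vsub s1 Z1" "vsub s1 N1" "N1 \<subseteq> Z1"
      "\<And>r x y. x \<in> Z1 \<Longrightarrow> y \<in> Z1 \<Longrightarrow> s1 r (x + y) = s1 r x + s1 r y"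
    and 2: "vsub s2 Z2" "vsub s2 N2" "N2 \<subseteq> Z2"
      "\<And>r x y. x \<in> Z2 \<Longrightarrow> y \<in> Z2 \<Longrightarrow> s2 r (x + y) = s2 r x + s2 r y"
    and \<phi>: "\<And>x. x \<in> Z1 \<Longrightarrow> \<phi> x \<in> Z2"
      "\<And>x y. x \<in> Z1 \<Longrightarrow> y \<in> Z1 \<Longrightarrow> \<phi> (x + y) = \<phi> x + \<phi> y"
      "\<And>r x. x \<in> Z1 \<Longrightarrow> \<phi> (s1 r x) = s2 r (\<phi> x)"
    and inj: "\<And>x. x \<in> Z1 \<Longrightarrow> \<phi> x \<in> N2 \<longleftrightarrow> x \<in> N1"
    and surj: "\<And>y. y \<in> Z2 \<Longrightarrow> \<exists>x\<in>Z1. y - \<phi> x \<in> N2"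
    and f: "\<And>x. x \<in> Z1 \<Longrightarrow> f (cls N1 x) = cls N2 (\<phi> x)"
  shows "module_iso (quot_module (submod s1 Z1) N1) (quot_module (submod s2 Z2) N2) f"
proof -
  let ?M = "quot_module (submod s1 Z1) N1" and ?N = "quot_module (submod s2 Z2) N2"
  have cM: "carrier ?M = cls N1 ` Z1" and cN: "carrier ?N = cls N2 ` Z2"
    by (rule carrier_quot)+
  have diff: "\<phi> (x - y) = \<phi> x - \<phi> y" if "x \<in> Z1" "y \<in> Z1" for x y
  proof -
    have "\<phi> ((x - y) + y) = \<phi> (x - y) + \<phi> y" by (rule \<phi>(2)[OF vsubD(5)[OF 1(1) that] that(2)])
    then show ?thesis by simp
  qed
  have "f \<in> hom (add_monoid ?M) (add_monoid ?N)"
  proof (rule homI)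
    fix X assume "X \<in> carrier (add_monoid ?M)"
    then obtain x where "x \<in> Z1" "X = cls N1 x" using cM by auto
    then show "f X \<in> carrier (add_monoid ?N)" using cN f \<phi>(1) by auto
  next
    fix X Y assume "X \<in> carrier (add_monoid ?M)" "Y \<in> carrier (add_monoid ?M)"
    then obtain x y where *: "x \<in> Z1" "X = cls N1 x" "y \<in> Z1" "Y = cls N1 y" using cM by auto
    then show "f (X \<otimes>\<^bsub>add_monoid ?M\<^esub> Y) = f X \<otimes>\<^bsub>add_monoid ?N\<^esub> f Y"
      using f vsubD(2)[OF 1(1)] \<phi>(2) by (simp add: add_quot[OF 1(2)] add_quot[OF 2(2)])
  qed
  moreover have "bij_betw f (carrier (add_monoid ?M)) (carrier (add_monoid ?N))"
  proof (rule bij_betwI')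
    fix X Y assume "X \<in> carrier (add_monoid ?M)" "Y \<in> carrier (add_monoid ?M)"
    then obtain x y where *: "x \<in> Z1" "X = cls N1 x" "y \<in> Z1" "Y = cls N1 y" using cM by auto
    then have "f X = f Y \<longleftrightarrow> \<phi> (x - y) \<in> N2" by (simp add: f cls_eq_iff[OF 2(2)] diff)
    also have "\<dots> \<longleftrightarrow> x - y \<in> N1" by (rule inj[OF vsubD(5)[OF 1(1) *(1,3)]])
    finally show "f X = f Y \<longleftrightarrow> X = Y" using * by (simp add: cls_eq_iff[OF 1(2)])
  next
    fix X assume "X \<in> carrier (add_monoid ?M)"
    then obtain x where "x \<in> Z1" "X = cls N1 x" using cM by auto
    then show "f X \<in> carrier (add_monoid ?N)" using cN f \<phi>(1) by auto
  next
    fix Y assume "Y \<in> carrier (add_monoid ?N)"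
    then obtain y where y: "y \<in> Z2" "Y = cls N2 y" using cN by auto
    then obtain x where "x \<in> Z1" "y - \<phi> x \<in> N2" using surj by blast
    then have "Y = f (cls N1 x)" "cls N1 x \<in> carrier (add_monoid ?M)"
      using y f cM by (auto simp: cls_eq_iff[OF 2(2)])
    then show "\<exists>X\<in>carrier (add_monoid ?M). Y = f X" by blast
  qed
  ultimately have "f \<in> iso (add_monoid ?M) (add_monoid ?N)" by (simp add: iso_def)
  moreover have "f (r \<odot>\<^bsub>?M\<^esub> X) = r \<odot>\<^bsub>?N\<^esub> f X" if X: "X \<in> carrier ?M" for r X
  proof -
    obtain x where x: "x \<in> Z1" "X = cls N1 x" using X unfolding cM by blast
    then show ?thesis
      using smult_quot[OF 1(2,3,1,4) x(1), where r = r] smult_quot[OF 2(2,3,1,4) \<phi>(1)[OF x(1)], where r = r]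
        f[OF x(1)] f[OF vsubD(4)[OF 1(1) x(1)]] \<phi>(3)[OF x(1)] by simp
  qed
  ultimately show ?thesis unfolding module_iso_def by blast
qed

lemma module_iso_comp:
  assumes "module_iso M N f" "module_iso N P g"
  shows "module_iso M P (g \<circ> f)"
proof -
  have "f \<in> iso (add_monoid M) (add_monoid N)" "g \<in> iso (add_monoid N) (add_monoid P)"
    using assms unfolding module_iso_def by auto
  then have "g \<circ> f \<in> iso (add_monoid M) (add_monoid P)" by (rule iso_set_trans)
  moreover have "f x \<in> carrier N" if "x \<in> carrier M" for x
    using assms(1) that unfolding module_iso_def iso_def bij_betw_def by auto
  ultimately show ?thesis using assms unfolding module_iso_def by simp
qed

lemma abelian_monoid_quot:
  assumes Z: "vsub s Z" and N: "vsub s N"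
  shows "abelian_monoid (quot_module (submod s Z) N)"
proof (rule abelian_monoidI)
  let ?Q = "quot_module (submod s Z) N"
  have zero: "\<zero>\<^bsub>?Q\<^esub> = cls N 0" by (simp add: quot_module_def cls_def)
  show "\<zero>\<^bsub>?Q\<^esub> \<in> carrier ?Q" unfolding zero carrier_quot using vsubD(1)[OF Z] by blast
  show "X \<oplus>\<^bsub>?Q\<^esub> Y \<in> carrier ?Q" if "X \<in> carrier ?Q" "Y \<in> carrier ?Q" for X Y
    using that vsubD(2)[OF Z] unfolding carrier_quot by (auto simp: add_quot[OF N])
  show "X \<oplus>\<^bsub>?Q\<^esub> Y \<oplus>\<^bsub>?Q\<^esub> W = X \<oplus>\<^bsub>?Q\<^esub> (Y \<oplus>\<^bsub>?Q\<^esub> W)"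
    if "X \<in> carrier ?Q" "Y \<in> carrier ?Q" "W \<in> carrier ?Q" for X Y W
    using that unfolding carrier_quot by (auto simp: add_quot[OF N] add.assoc)
  show "\<zero>\<^bsub>?Q\<^esub> \<oplus>\<^bsub>?Q\<^esub> X = X" if "X \<in> carrier ?Q" for X
    using that unfolding carrier_quot zero by (auto simp: add_quot[OF N])
  show "X \<oplus>\<^bsub>?Q\<^esub> Y = Y \<oplus>\<^bsub>?Q\<^esub> X" if "X \<in> carrier ?Q" "Y \<in> carrier ?Q" for X Y
    using that unfolding carrier_quot by (auto simp: add_quot[OF N] add.commute)
qed

lemma finsum_quot:
  assumes Z: "vsub s Z" and N: "vsub s N" and "finite A" "\<And>x. x \<in> A \<Longrightarrow> h x \<in> Z"
  shows "finsum (quot_module (submod s Z) N) (\<lambda>x. cls N (h x)) A = cls N (sum h A)"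
  using assms(3,4)
proof (induction A rule: finite_induct)
  interpret abelian_monoid "quot_module (submod s Z) N" by (rule abelian_monoid_quot[OF Z N])
  case empty
  show ?case unfolding finsum_empty sum.empty by (simp add: quot_module_def cls_def)
next
  interpret abelian_monoid "quot_module (submod s Z) N" by (rule abelian_monoid_quot[OF Z N])
  case (insert x A)
  then have "(\<lambda>x. cls N (h x)) \<in> A \<rightarrow> carrier (quot_module (submod s Z) N)"
    "cls N (h x) \<in> carrier (quot_module (submod s Z) N)"
    unfolding carrier_quot by auto
  then show ?case using insert by (simp add: finsum_insert add_quot[OF N])
qed

section \<open>Finite formal combinations\<close>

lemma lookup_fsmult: "lookup (fsmult c f) x = c * lookup f x"
  by (simp add: fsmult_def Poly_Mapping.map.rep_eq when_def)

lemma fsmult_single: "fsmult c (single x d) = single x (c * d)"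
  by (rule poly_mapping_eqI) (simp add: lookup_fsmult lookup_single when_def)

lemma keys_fsmult: "keys (fsmult c f) \<subseteq> keys f"
  by (auto simp: in_keys_iff lookup_fsmult)

lemma vector_space_fsmult: "vector_space fsmult"
  by unfold_locales
    (auto intro!: poly_mapping_eqI simp: lookup_fsmult lookup_add algebra_simps)

lemma poly_mapping_sum_single:
  fixes f :: "'a \<Rightarrow>\<^sub>0 complex"
  shows "f = (\<Sum>x\<in>keys f. single x (lookup f x))"
proof (rule poly_mapping_eqI)
  fix k
  have "(\<Sum>x\<in>keys f. (lookup f x when x = k)) = lookup f k"
    by (cases "k \<in> keys f") (auto simp: when_def in_keys_iff)
  then show "lookup f k =
     lookup (\<Sum>x\<in>keys f. single x (lookup f x)) k"
    by (simp add: lookup_sum lookup_single)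
qed

text \<open>
  The linear extension of \<open>h\<close> to the free complex space on its domain.
\<close>

definition comb :: "(complex \<Rightarrow> 'c \<Rightarrow> 'c) \<Rightarrow> ('a \<Rightarrow> 'c) \<Rightarrow> ('a \<Rightarrow>\<^sub>0 complex) \<Rightarrow> 'c::ab_group_add" where
  "comb sC h g = (\<Sum>x\<in>keys g. sC (lookup g x) (h x))"

lemma comb_superset:
  assumes "vector_space sC" "finite A" "keys g \<subseteq> A"
  shows "comb sC h g = (\<Sum>x\<in>A. sC (lookup g x) (h x))"
proof -
  interpret vector_space sC by fact
  show ?thesis unfolding comb_def
    by (rule sum.mono_neutral_left) (use assms(2,3) in \<open>auto simp: in_keys_iff\<close>)
qed

lemma comb_add:
  assumes "vector_space sC" shows "comb sC h (f + g) = comb sC h f + comb sC h g"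
proof -
  interpret vector_space sC by fact
  let ?A = "keys f \<union> keys g"
  have "keys (f + g) \<subseteq> ?A" by (rule keys_add)
  then show ?thesis
    by (subst (1 2 3) comb_superset[OF assms, of ?A])
      (auto simp: lookup_add scale_left_distrib sum.distrib)
qed

lemma comb_fsmult:
  assumes "vector_space sC" shows "comb sC h (fsmult c f) = sC c (comb sC h f)"
proof -
  interpret vector_space sC by fact
  show ?thesis
    by (subst comb_superset[OF assms _ keys_fsmult]) (auto simp: comb_def lookup_fsmult scale_sum_right)
qed

lemma comb_single:
  assumes "vector_space sC" shows "comb sC h (single x c) = sC c (h x)"
proof -
  interpret vector_space sC by fact
  show ?thesis by (subst comb_superset[OF assms, of "{x}"]) auto
qed

lemma comb_0 [simp]: "comb sC h 0 = 0"
  by (simp add: comb_def)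

lemma comb_diff:
  assumes "vector_space sC" shows "comb sC h (f - g) = comb sC h f - comb sC h g"
  using comb_add[OF assms, of h "f - g" g] by simp

lemma comb_sum:
  assumes "vector_space sC" shows "comb sC h (sum f A) = (\<Sum>x\<in>A. comb sC h (f x))"
  by (induction A rule: infinite_finite_induct) (simp_all add: comb_add[OF assms])

lemma comb_in_subspace:
  assumes "vector_space sC" "vsub sC N" "\<And>x. x \<in> keys g \<Longrightarrow> h x \<in> N"
  shows "comb sC h g \<in> N"
proof -
  interpret vector_space sC by fact
  have "subspace N" by (rule vsub_subspace[OF assms(1,2)])
  then show ?thesis unfolding comb_def using assms(3) by (auto intro!: subspace_sum subspace_scale)
qed

lemma span_imp_comb:
  assumes "vector_space sC" "y \<in> Modules.module.span sC (h ` E)"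
  obtains g where "keys g \<subseteq> E" "y = comb sC h g"
proof -
  interpret vector_space sC by fact
  from assms(2) have "\<exists>g. keys g \<subseteq> E \<and> y = comb sC h g"
  proof (induction rule: span_induct_alt)
    case base
    show ?case by (rule exI[of _ 0]) simp
  next
    case (step c x y)
    then obtain g e where g: "keys g \<subseteq> E" "y = comb sC h g" and e: "e \<in> E" "x = h e" by blast
    let ?g = "single e c + g"
    have "keys ?g \<subseteq> E"
      using g(1) e(1) keys_add[of "single e c" g] by (auto split: if_splits)
    moreover have "sC c x + y = comb sC h ?g"
      by (simp add: comb_add[OF assms(1)] comb_single[OF assms(1)] g e)
    ultimately show ?case by blast
  qed
  then show ?thesis using that by blast
qed

lemma comb_in_span:
  assumes "vector_space sC" "keys g \<subseteq> E"
  shows "comb sC h g \<in> Modules.module.span sC (h ` E)"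
proof -
  interpret vector_space sC by fact
  show ?thesis unfolding comb_def
    by (intro span_sum span_scale span_base) (use assms(2) in auto)
qed

section \<open>Extension of scalars of a quotient\<close>

text \<open>
  Let \<open>A\<close> be a rational space with subspace \<open>B\<close>, and let \<open>\<psi>\<close> be a rational linear map from \<open>A\<close> to a
  complex space which sends a spanning set \<open>E\<close> of \<open>A\<close> to independent vectors; so \<open>\<psi>\<close> identifies
  \<open>A \<otimes> \<complex>\<close> with the complex span of its image. If that span meets \<open>N\<close> only in the span of the image
  of \<open>B\<close>, then \<open>(A/B) \<otimes> \<complex>\<close> embeds into the quotient of \<open>Z\<close> by \<open>N\<close>; if moreover it covers \<open>Z\<close> modulo
  \<open>N\<close>, the embedding is an isomorphism.
\<close>

locale rational_form =
  fixes sQ :: "rat \<Rightarrow> 'a::ab_group_add \<Rightarrow> 'a" and A B E :: "'a set"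
    and sC :: "complex \<Rightarrow> 'c::ab_group_add \<Rightarrow> 'c" and Z N :: "'c set" and \<psi> :: "'a \<Rightarrow> 'c"
  assumes Q: "vector_space sQ" and C: "vector_space sC"
    and A: "vsub sQ A" and B: "vsub sQ B" "B \<subseteq> A"
    and Z: "vsub sC Z" and N: "vsub sC N" "N \<subseteq> Z"
    and \<psi>_add: "\<And>a b. a \<in> A \<Longrightarrow> b \<in> A \<Longrightarrow> \<psi> (a + b) = \<psi> a + \<psi> b"
    and \<psi>_scale: "\<And>r a. a \<in> A \<Longrightarrow> \<psi> (sQ r a) = sC (of_rat r) (\<psi> a)"
    and \<psi>_Z: "\<And>a. a \<in> A \<Longrightarrow> \<psi> a \<in> Z" and \<psi>_N: "\<And>b. b \<in> B \<Longrightarrow> \<psi> b \<in> N"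
    and E: "E \<subseteq> A" "A \<subseteq> Modules.module.span sQ E"
    and indep: "\<And>g. keys g \<subseteq> E \<Longrightarrow> comb sC \<psi> g = 0 \<Longrightarrow> g = 0"
    and meet: "Modules.module.span sC (\<psi> ` A) \<inter> N \<subseteq> Modules.module.span sC (\<psi> ` B)"
    and gen: "\<And>y. y \<in> Z \<Longrightarrow> \<exists>w\<in>Modules.module.span sC (\<psi> ` A). y - w \<in> N"
begin

sublocale Q: vector_space sQ by (rule Q)
sublocale C: vector_space sC by (rule C)
sublocale F: vector_space fsmult by (rule vector_space_fsmult)

abbreviation "M \<equiv> quot_module (submod sQ A) B"
abbreviation "rels \<equiv> tensor_rels M"
abbreviation "Z1 \<equiv> {f :: 'a set \<Rightarrow>\<^sub>0 complex. keys f \<subseteq> carrier M}"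

definition rep :: "'a set \<Rightarrow> 'a" where "rep X = (SOME a. a \<in> A \<and> cls B a = X)"

lemma rep: assumes "X \<in> carrier M" shows "rep X \<in> A" "cls B (rep X) = X"
proof -
  have "\<exists>a. a \<in> A \<and> cls B a = X" using assms unfolding carrier_quot by blast
  from someI_ex[OF this] show "rep X \<in> A" "cls B (rep X) = X" unfolding rep_def by auto
qed

lemma cls_carrier: "a \<in> A \<Longrightarrow> cls B a \<in> carrier M"
  unfolding carrier_quot by blast

definition sg :: "'a \<Rightarrow> 'a set \<Rightarrow>\<^sub>0 complex" where "sg a = single (cls B a) 1"

lemma sQ_add: "x \<in> A \<Longrightarrow> y \<in> A \<Longrightarrow> sQ r (x + y) = sQ r x + sQ r y"
  by (rule Q.scale_right_distrib)

lemma rels_subspace: "F.subspace rels"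
  unfolding tensor_rels_def by (rule F.subspace_span)

lemma rels_vsub: "vsub fsmult rels"
  by (rule subspace_vsub[OF vector_space_fsmult rels_subspace])

lemma rels_add:
  assumes "X \<in> carrier M" "Y \<in> carrier M"
  shows "single (X \<oplus>\<^bsub>M\<^esub> Y) 1 - single X 1 - single Y 1 \<in> rels"
  unfolding tensor_rels_def by (intro F.span_base UnI1) (use assms in blast)

lemma rels_scale: "X \<in> carrier M \<Longrightarrow> single (r \<odot>\<^bsub>M\<^esub> X) 1 - single X (of_rat r) \<in> rels"
  unfolding tensor_rels_def by (intro F.span_base UnI2) blast

lemma rels_minimal:
  assumes "F.subspace W"
    and "\<And>X Y. X \<in> carrier M \<Longrightarrow> Y \<in> carrier M \<Longrightarrow>
      single (X \<oplus>\<^bsub>M\<^esub> Y) 1 - single X 1 - single Y 1 \<in> W"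
    and "\<And>r X. X \<in> carrier M \<Longrightarrow> single (r \<odot>\<^bsub>M\<^esub> X) 1 - single X (of_rat r) \<in> W"
  shows "rels \<subseteq> W"
  unfolding tensor_rels_def by (intro F.span_minimal[OF _ assms(1)] Un_least) (use assms(2,3) in blast)+

lemma sg_add:
  assumes "a \<in> A" "b \<in> A"
  shows "sg (a + b) - sg a - sg b \<in> rels"
  using rels_add[OF cls_carrier[OF assms(1)] cls_carrier[OF assms(2)]] by (simp only: sg_def add_quot[OF B(1)])

lemma sg_scale:
  assumes "a \<in> A"
  shows "sg (sQ r a) - fsmult (of_rat r) (sg a) \<in> rels"
  using rels_scale[OF cls_carrier[OF assms], of r]
  by (simp only: sg_def smult_quot[OF B A sQ_add assms] fsmult_single mult_1_right)

lemma sg_0: "sg 0 \<in> rels"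
  using sg_scale[OF vsubD(1)[OF A], of 0] by (simp add: F.scale_zero_left)

lemma sg_B: "b \<in> B \<Longrightarrow> sg b \<in> rels"
  using sg_0 cls_eq_iff[OF B(1), of b 0] by (simp add: sg_def)

abbreviation "L \<equiv> comb fsmult sg"

lemma L_Z1: "keys h \<subseteq> A \<Longrightarrow> L h \<in> Z1"
proof -
  assume h: "keys h \<subseteq> A"
  have "vsub fsmult Z1"
    unfolding vsub_def
  proof (intro conjI ballI allI)
    show "x + y \<in> Z1" if "x \<in> Z1" "y \<in> Z1" for x y
      using that keys_add[of x y] by blast
    show "fsmult r x \<in> Z1" if "x \<in> Z1" for r x using that keys_fsmult[of r x] by blast
  qed auto
  then show ?thesis
    by (rule comb_in_subspace[OF vector_space_fsmult])
      (use h cls_carrier in \<open>auto simp: sg_def\<close>)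
qed

lemma Z1_vsub: "vsub fsmult Z1"
  unfolding vsub_def
proof (intro conjI ballI allI)
  show "x + y \<in> Z1" if "x \<in> Z1" "y \<in> Z1" for x y
    using that keys_add[of x y] by blast
  show "fsmult r x \<in> Z1" if "x \<in> Z1" for r x using that keys_fsmult[of r x] by blast
qed auto

lemma rels_Z1: "rels \<subseteq> Z1"
proof -
  have "F.subspace Z1" by (rule vsub_subspace[OF vector_space_fsmult Z1_vsub])
  interpret abelian_monoid M by (rule abelian_monoid_quot[OF A B(1)])
  have sm: "r \<odot>\<^bsub>M\<^esub> x \<in> carrier M" if "x \<in> carrier M" for r x
    using smult_quot[OF B A sQ_add rep(1)[OF that], of r] rep[OF that] cls_carrier[OF vsubD(4)[OF A rep(1)[OF that]]]
    by simp
  have sub: "x - y \<in> Z1" if "x \<in> Z1" "y \<in> Z1" for x y by (rule vsubD(5)[OF Z1_vsub that])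
  have si: "single x c \<in> Z1" if "x \<in> carrier M" for x c using that by auto
  show ?thesis
    by (rule rels_minimal[OF \<open>F.subspace Z1\<close>]) (intro sub si a_closed sm; assumption)+
qed

definition \<phi> :: "('a set \<Rightarrow>\<^sub>0 complex) \<Rightarrow> 'c" where "\<phi> = comb sC (\<lambda>X. \<psi> (rep X))"

lemma \<psi>_diff: "a \<in> A \<Longrightarrow> b \<in> A \<Longrightarrow> \<psi> (a - b) = \<psi> a - \<psi> b"
  using \<psi>_add[of "a - b" b] vsubD(5)[OF A] by simp

lemma \<psi>_rep: assumes "a \<in> A" shows "\<psi> (rep (cls B a)) - \<psi> a \<in> N"
proof -
  have r: "rep (cls B a) \<in> A" "cls B (rep (cls B a)) = cls B a" using rep[OF cls_carrier[OF assms]] by auto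
  then have "rep (cls B a) - a \<in> B" by (simp add: cls_eq_iff[OF B(1)])
  then show ?thesis using \<psi>_N \<psi>_diff[OF r(1) assms] by metis
qed

lemma \<phi>_L: assumes "keys h \<subseteq> A" shows "\<phi> (L h) - comb sC \<psi> h \<in> N"
proof -
  have "\<phi> (L h) = (\<Sum>a\<in>keys h. sC (lookup h a) (\<psi> (rep (cls B a))))"
    by (simp add: comb_def[of fsmult sg] \<phi>_def comb_sum[OF C] comb_fsmult[OF C] sg_def comb_single[OF C])
  then have "\<phi> (L h) - comb sC \<psi> h = (\<Sum>a\<in>keys h. sC (lookup h a) (\<psi> (rep (cls B a)) - \<psi> a))"
    by (simp add: comb_def sum_subtractf C.scale_right_diff_distrib)
  also have "\<dots> \<in> N"
    using assms \<psi>_rep by (intro C.subspace_sum[OF vsub_subspace[OF C N(1)]] vsubD(4)[OF N(1)]) auto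
  finally show ?thesis .
qed

text \<open>
  Elements of the free space on \<open>A/B\<close> are represented by formal combinations of elements of \<open>A\<close>, so
  that the image in the complex space becomes an honest combination.
\<close>

lemma lift_to_A:
  assumes "x \<in> Z1"
  obtains h where "keys h \<subseteq> A" "x = L h" "\<phi> x = comb sC \<psi> h"
proof -
  define h where "h = (\<Sum>X\<in>keys x. single (rep X) (lookup x X))"
  have X: "X \<in> carrier M" if "X \<in> keys x" for X using assms that by auto
  have "keys h \<subseteq> (\<Union>X\<in>keys x. keys (single (rep X) (lookup x X)))"
    unfolding h_def by (rule keys_sum)
  also have "\<dots> \<subseteq> A" using rep(1)[OF X] by (auto split: if_splits)
  finally have "keys h \<subseteq> A" .
  moreover have "L h = (\<Sum>X\<in>keys x. single X (lookup x X))"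
    unfolding h_def comb_sum[OF vector_space_fsmult] comb_single[OF vector_space_fsmult]
    by (intro sum.cong refl) (simp add: sg_def fsmult_single rep(2)[OF X])
  then have "L h = x" by (simp flip: poly_mapping_sum_single)
  moreover have "\<phi> x = comb sC \<psi> h"
    unfolding h_def comb_sum[OF C] comb_single[OF C] by (simp add: \<phi>_def comb_def)
  ultimately show ?thesis using that by metis
qed

text \<open>
  Modulo the relations only symbols of elements of the spanning set \<open>E\<close> remain, with unchanged image.
\<close>

lemma reduce_to_E:
  assumes "keys h \<subseteq> A"
  obtains g where "keys g \<subseteq> E" "L h - L g \<in> rels" "comb sC \<psi> h = comb sC \<psi> g"
proof -
  have one: "\<exists>g. keys g \<subseteq> E \<and> sg a - L g \<in> rels \<and> \<psi> a = comb sC \<psi> g" if "a \<in> A" for a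
  proof -
    have "a \<in> Q.span E" using E(2) that by blast
    then have "a \<in> A \<and> (\<exists>g. keys g \<subseteq> E \<and> sg a - L g \<in> rels \<and> \<psi> a = comb sC \<psi> g)"
    proof (induction rule: Q.span_induct_alt)
      case base
      have "\<psi> 0 = 0" using \<psi>_diff[OF vsubD(1)[OF A] vsubD(1)[OF A]] by simp
      then show ?case using vsubD(1)[OF A] sg_0 by (intro conjI exI[of _ 0]) auto
    next
      case (step c x y)
      then obtain g where xA: "x \<in> A" and yA: "y \<in> A" and
        g: "keys g \<subseteq> E" "sg y - L g \<in> rels" "\<psi> y = comb sC \<psi> g" using E(1) by blast
      have cx: "sQ c x \<in> A" by (rule vsubD(4)[OF A xA])
      let ?g = "single x (of_rat c) + g"
      have "keys ?g \<subseteq> E"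
        using g(1) step keys_add[of "single x (of_rat c)" g] by (auto split: if_splits)
      moreover have "sg (sQ c x + y) - L ?g =
          (sg (sQ c x + y) - sg (sQ c x) - sg y) + (sg (sQ c x) - fsmult (of_rat c) (sg x)) + (sg y - L g)"
        by (simp add: comb_add[OF vector_space_fsmult] comb_single[OF vector_space_fsmult])
      then have "sg (sQ c x + y) - L ?g \<in> rels"
        using vsubD(2)[OF rels_vsub] sg_add[OF cx yA] sg_scale[OF xA] g(2) by metis
      moreover have "\<psi> (sQ c x + y) = comb sC \<psi> ?g"
        by (simp add: \<psi>_add[OF cx yA] \<psi>_scale[OF xA] comb_add[OF C] comb_single[OF C] g(3))
      ultimately show ?case using vsubD(2)[OF A cx yA] by blast
    qed
    then show ?thesis by blast
  qed
  define G where "G a = (SOME g. keys g \<subseteq> E \<and> sg a - L g \<in> rels \<and> \<psi> a = comb sC \<psi> g)" for a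
  have G: "keys (G a) \<subseteq> E" "sg a - L (G a) \<in> rels" "\<psi> a = comb sC \<psi> (G a)"
    if "a \<in> keys h" for a
    using someI_ex[OF one[of a]] that assms unfolding G_def by blast+
  define g where "g = (\<Sum>a\<in>keys h. fsmult (lookup h a) (G a))"
  have "keys g \<subseteq> (\<Union>a\<in>keys h. keys (fsmult (lookup h a) (G a)))"
    unfolding g_def by (rule keys_sum)
  also have "\<dots> \<subseteq> E" by (intro UN_least subset_trans[OF keys_fsmult G(1)])
  finally have 1: "keys g \<subseteq> E" .
  have "L h - L g = (\<Sum>a\<in>keys h. fsmult (lookup h a) (sg a - L (G a)))"
    unfolding g_def comb_sum[OF vector_space_fsmult] comb_fsmult[OF vector_space_fsmult]
    by (simp add: comb_def[of _ _ h] F.scale_right_diff_distrib sum_subtractf)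
  also have "\<dots> \<in> rels"
    using G(2) by (intro F.subspace_sum[OF rels_subspace] F.subspace_scale[OF rels_subspace]) auto
  finally have 2: "L h - L g \<in> rels" .
  have 3: "comb sC \<psi> h = comb sC \<psi> g"
    unfolding g_def comb_sum[OF C] comb_fsmult[OF C] by (simp add: comb_def[of _ _ h] G(3))
  show ?thesis by (rule that[OF 1 2 3])
qed

lemma \<phi>_rels: assumes "x \<in> rels" shows "\<phi> x \<in> N"
proof -
  have sub: "F.subspace {x. \<phi> x \<in> N}"
    unfolding F.subspace_def \<phi>_def
    using vsubD[OF N(1)] by (auto simp: comb_add[OF C] comb_fsmult[OF C])
  have sgl: "\<phi> (single X c) = sC c (\<psi> (rep X))" for X c
    by (simp add: \<phi>_def comb_single[OF C])
  have dif: "\<phi> (f - g) = \<phi> f - \<phi> g" for f g by (simp add: \<phi>_def comb_diff[OF C])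
  have "rels \<subseteq> {x. \<phi> x \<in> N}"
  proof (rule rels_minimal[OF sub])
    fix X Y assume X: "X \<in> carrier M" and Y: "Y \<in> carrier M"
    let ?f = "single (X \<oplus>\<^bsub>M\<^esub> Y) 1 - single X 1 - single Y 1"
    define a b where "a = rep X" and "b = rep Y"
    have ab: "a \<in> A" "b \<in> A" "cls B a = X" "cls B b = Y" using rep[OF X] rep[OF Y] by (auto simp: a_def b_def)
    have "X \<oplus>\<^bsub>M\<^esub> Y = cls B (a + b)" by (simp only: ab(3,4)[symmetric] add_quot[OF B(1)])
    then have "\<phi> ?f = \<psi> (rep (cls B (a + b))) - \<psi> a - \<psi> b"
      unfolding dif sgl a_def b_def C.scale_one by simp
    also have "\<dots> = \<psi> (rep (cls B (a + b))) - \<psi> (a + b)" by (simp add: \<psi>_add[OF ab(1,2)])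
    also have "\<dots> \<in> N" by (rule \<psi>_rep[OF vsubD(2)[OF A ab(1,2)]])
    finally show "?f \<in> {x. \<phi> x \<in> N}" by simp
  next
    fix r X assume X: "X \<in> carrier M"
    let ?f = "single (r \<odot>\<^bsub>M\<^esub> X) 1 - single X (of_rat r)"
    define a where "a = rep X"
    have a: "a \<in> A" "cls B a = X" using rep[OF X] by (auto simp: a_def)
    have rX: "r \<odot>\<^bsub>M\<^esub> X = cls B (sQ r a)" by (simp only: a(2)[symmetric] smult_quot[OF B A sQ_add a(1)])
    have "\<phi> ?f = \<psi> (rep (cls B (sQ r a))) - \<psi> (sQ r a)"
      by (simp only: dif sgl a_def[symmetric] rX \<psi>_scale[OF a(1)] C.scale_one)
    also have "\<dots> \<in> N" by (rule \<psi>_rep[OF vsubD(4)[OF A a(1)]])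
    finally show "?f \<in> {x. \<phi> x \<in> N}" by simp
  qed
  then show ?thesis using assms by blast
qed

text \<open>
  Let the image of \<open>x\<close> lie in \<open>N\<close>. By the assumption on the intersection it is also the image of a
  combination of elements of \<open>B\<close>, which is a relation. Written over \<open>E\<close>, the two
  combinations coincide by independence.
\<close>

lemma \<phi>_inj: assumes x: "x \<in> Z1" and "\<phi> x \<in> N" shows "x \<in> rels"
proof -
  obtain h where h: "keys h \<subseteq> A" "x = L h" "\<phi> x = comb sC \<psi> h" by (rule lift_to_A[OF x])
  obtain g where g: "keys g \<subseteq> E" "L h - L g \<in> rels" "comb sC \<psi> h = comb sC \<psi> g"
    by (rule reduce_to_E[OF h(1)])
  have "comb sC \<psi> h \<in> C.span (\<psi> ` A)" by (rule comb_in_span[OF C h(1)])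
  then have "comb sC \<psi> h \<in> C.span (\<psi> ` B)" using meet assms(2) h(3) by auto
  then obtain h' where h': "keys h' \<subseteq> B" "comb sC \<psi> h = comb sC \<psi> h'" by (rule span_imp_comb[OF C])
  have "keys h' \<subseteq> A" using h'(1) B(2) by blast
  then obtain g' where g': "keys g' \<subseteq> E" "L h' - L g' \<in> rels" "comb sC \<psi> h' = comb sC \<psi> g'"
    by (rule reduce_to_E)
  have "g - g' = 0"
  proof (rule indep)
    show "keys (g - g') \<subseteq> E" using g(1) g'(1) keys_diff[of g g'] by blast
    show "comb sC \<psi> (g - g') = 0" using g(3) g'(3) h'(2) by (simp add: comb_diff[OF C])
  qed
  then have "L g = L g'" by simp
  moreover have "L h' \<in> rels"
    by (rule comb_in_subspace[OF vector_space_fsmult rels_vsub]) (use h'(1) sg_B in blast)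
  moreover have "L h = (L h - L g) + (L h' - (L h' - L g'))" using \<open>L g = L g'\<close> by simp
  ultimately show ?thesis unfolding h(2) using vsubD(2,5)[OF rels_vsub] g(2) g'(2) by metis
qed

lemma \<phi>_Z: "x \<in> Z1 \<Longrightarrow> \<phi> x \<in> Z"
  unfolding \<phi>_def by (rule comb_in_subspace[OF C Z]) (use \<psi>_Z rep(1) in blast)

theorem tensor_iso:
  assumes f: "\<And>x. x \<in> Z1 \<Longrightarrow> f (cls rels x) = cls N (\<phi> x)"
  shows "module_iso (tensor_complex M) (quot_module (submod sC Z) N) f"
  unfolding tensor_complex_def
proof (rule module_iso_quot[where \<phi> = \<phi>])
  show "\<exists>x\<in>Z1. y - \<phi> x \<in> N" if y: "y \<in> Z" for y
  proof -
    obtain w where w: "w \<in> C.span (\<psi> ` A)" "y - w \<in> N" using gen[OF y] by blast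
    obtain h where h: "keys h \<subseteq> A" "w = comb sC \<psi> h" by (rule span_imp_comb[OF C w(1)])
    have "y - \<phi> (L h) = (y - w) - (\<phi> (L h) - comb sC \<psi> h)" by (simp add: h(2))
    also have "\<dots> \<in> N" by (rule vsubD(5)[OF N(1) w(2) \<phi>_L[OF h(1)]])
    finally show ?thesis using L_Z1[OF h(1)] by blast
  qed
  show "\<phi> x \<in> N \<longleftrightarrow> x \<in> rels" if "x \<in> Z1" for x using \<phi>_inj[OF that] \<phi>_rels by blast
qed (use Z1_vsub rels_vsub rels_Z1 F.scale_right_distrib C.scale_right_distrib Z N \<phi>_Z f in
   \<open>simp_all add: \<phi>_def comb_add[OF C] comb_fsmult[OF C]\<close>)

end

section \<open>Functions and differentials on \<open>Z\<close>\<close>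

lemma regZ_cases: obtains P where "x = abs_regZ P"
  using regZ.abs_induct[of "\<lambda>x. \<exists>P. x = abs_regZ P" x] by blast

lemma constZ_hom [simp]:
  "constZ (a + b) = constZ a + constZ b" "constZ (a * b) = constZ a * constZ b"
  "constZ (- a) = - constZ a" "constZ 0 = 0" "constZ 1 = 1"
proof -
  show "constZ (a + b) = constZ a + constZ b" by (simp add: constZ_def plus_regZ.abs_eq)
  show "constZ (a * b) = constZ a * constZ b" by (simp add: constZ_def times_regZ.abs_eq)
  show "constZ (- a) = - constZ a" by (simp add: constZ_def uminus_regZ.abs_eq)
  show "constZ 0 = 0" by (simp add: constZ_def zero_regZ_def)
  show "constZ 1 = 1" by (simp add: constZ_def one_regZ_def one_pCons)
qed

lemma vector_space_regZ: "vector_space (\<lambda>c f. constZ c * f)"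
  by unfold_locales (simp_all add: algebra_simps)

interpretation RZ: vector_space "\<lambda>c f. constZ c * f" by (rule vector_space_regZ)

lemma uZ_vZ_rel: "uZ ^ 3 - constZ 27 * vZ ^ 2 = 1"
proof -
  have "uZ ^ 3 - constZ 27 * vZ ^ 2 = abs_regZ (pol_u ^ 3 - [:[:27:]:] * pol_v ^ 2)"
    by (simp add: uZ_def vZ_def constZ_def times_regZ.abs_eq minus_regZ.abs_eq power2_eq_square power3_eq_cube)
  also have "[:[:27:]:] = (27 :: rat poly poly)" by (simp add: numeral_poly)
  also have "abs_regZ (pol_u ^ 3 - 27 * pol_v ^ 2) = 1"
    unfolding one_regZ_def regZ.abs_eq_iff pol_Delta_def by simp
  finally show ?thesis .
qed

definition monZ :: "nat \<Rightarrow> nat \<Rightarrow> regZ" where "monZ a b = uZ ^ a * vZ ^ b"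

lemma abs_regZ_sum: "abs_regZ (sum f A) = (\<Sum>x\<in>A. abs_regZ (f x))"
  by (induction A rule: infinite_finite_induct) (simp_all add: plus_regZ.abs_eq[symmetric] zero_regZ_def)

lemma abs_regZ_mult: "abs_regZ (p * q) = abs_regZ p * abs_regZ q"
  by (simp add: times_regZ.abs_eq)

lemma abs_regZ_power: "abs_regZ (p ^ k) = abs_regZ p ^ k"
  by (induction k) (simp_all add: abs_regZ_mult one_regZ_def)

lemma abs_regZ_monom: "abs_regZ (monom (monom c a) b) = constZ c * monZ a b"
proof -
  have "monom (monom c a) b = [:[:c:]:] * pol_u ^ a * pol_v ^ b"
  proof -
    have "pol_u ^ a = [:monom 1 a:]"
      by (induction a) (simp_all add: pol_u_def one_pCons monom_Suc monom_0)
    moreover have "pol_v ^ b = monom 1 b"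
    proof -
      have v: "pol_v = pCons 0 1" by (simp add: pol_v_def one_pCons)
      show ?thesis unfolding v by (induction b) (simp_all add: monom_Suc monom_0)
    qed
    ultimately show ?thesis by (simp add: smult_monom)
  qed
  then show ?thesis by (simp only: abs_regZ_mult abs_regZ_power constZ_def monZ_def uZ_def vZ_def mult.assoc)
qed

lemma regZ_weight_cong: "k mod 12 = l mod 12 \<Longrightarrow> regZ_weight k = regZ_weight l"
  by (simp add: regZ_weight_def)

lemma regZ_weight_vsub: "vsub (\<lambda>c f. constZ c * f) (regZ_weight k)"
  unfolding vsub_def
proof (intro conjI ballI allI)
  show "0 \<in> regZ_weight k" unfolding regZ_weight_def zero_regZ_def by force
  fix x assume "x \<in> regZ_weight k"
  then obtain P where P: "x = abs_regZ P"
    "\<And>a b. coeff (coeff P b) a \<noteq> 0 \<Longrightarrow> (4 * int a + 6 * int b) mod 12 = k mod 12"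
    unfolding regZ_weight_def by blast
  have "- x = abs_regZ (- P)" using P(1) by (simp add: uminus_regZ.abs_eq)
  then show "- x \<in> regZ_weight k" unfolding regZ_weight_def using P(2) by force
  have "constZ r * x = abs_regZ (smult [:r:] P)" for r using P(1) by (simp add: constZ_def times_regZ.abs_eq)
  moreover have "coeff (coeff (smult [:r:] P) b) a \<noteq> 0 \<Longrightarrow> (4 * int a + 6 * int b) mod 12 = k mod 12" for r a b
    using P(2)[of b a] by auto
  ultimately show "constZ r * x \<in> regZ_weight k" for r unfolding regZ_weight_def by blast
  fix y assume "y \<in> regZ_weight k"
  then obtain Q where Q: "y = abs_regZ Q"
    "\<And>a b. coeff (coeff Q b) a \<noteq> 0 \<Longrightarrow> (4 * int a + 6 * int b) mod 12 = k mod 12"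
    unfolding regZ_weight_def by blast
  have "x + y = abs_regZ (P + Q)" using P(1) Q(1) by (simp add: plus_regZ.abs_eq)
  moreover have "coeff (coeff (P + Q) b) a \<noteq> 0 \<Longrightarrow> (4 * int a + 6 * int b) mod 12 = k mod 12" for a b
    using P(2)[of b a] Q(2)[of b a] by (cases "coeff (coeff P b) a = 0") auto
  ultimately show "x + y \<in> regZ_weight k" unfolding regZ_weight_def by blast
qed

lemma monZ_weight:
  assumes "(4 * int a + 6 * int b) mod 12 = k mod 12"
  shows "monZ a b \<in> regZ_weight k"
proof -
  have "monZ a b = abs_regZ (monom (monom 1 a) b)" by (simp add: abs_regZ_monom)
  moreover have "coeff (coeff (monom (monom (1::rat) a) b) b') a' \<noteq> 0 \<Longrightarrow> (4 * int a' + 6 * int b') mod 12 = k mod 12" for a' b'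
    using assms by (auto split: if_splits)
  ultimately show ?thesis unfolding regZ_weight_def by blast
qed

definition monset :: "int \<Rightarrow> regZ set" where
  "monset k = {monZ a b | a b. b < 2 \<and> (4 * int a + 6 * int b) mod 12 = k mod 12}"

lemma vZ_square: "vZ ^ 2 = constZ (1 / 27) * uZ ^ 3 - constZ (1 / 27)"
proof -
  have "constZ (1 / 27) * (constZ 27 * vZ ^ 2) = constZ (1 / 27) * (uZ ^ 3 - 1)"
    using uZ_vZ_rel by (simp add: algebra_simps)
  moreover have "constZ (1 / 27) * constZ 27 = 1" using constZ_hom(2)[of "1/27" 27] by (simp del: constZ_hom(2))
  ultimately show ?thesis by (simp add: mult.assoc[symmetric] right_diff_distrib)
qed

text \<open>
  The relation \<open>27 v\<^sup>2 = u\<^sup>3 - 1\<close> has weight \<open>0\<close> modulo \<open>12\<close>, so powers of \<open>v\<close> can be reduced to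
  exponents below \<open>2\<close> without leaving the weight space.
\<close>

lemma monZ_span:
  assumes "(4 * int a + 6 * int b) mod 12 = k mod 12"
  shows "monZ a b \<in> RZ.span (monset k)"
  using assms
proof (induction b arbitrary: a rule: less_induct)
  case (less b)
  show ?case
  proof (cases "b < 2")
    case True
    then show ?thesis using less.prems unfolding monset_def by (intro RZ.span_base) blast
  next
    case False
    then obtain c where b: "b = c + 2" using le_Suc_ex[of 2 b] by (auto simp: add.commute)
    have "monZ a b = uZ ^ a * vZ ^ c * vZ ^ 2" by (simp add: monZ_def b power_add power2_eq_square mult_ac)
    also have "\<dots> = constZ (1 / 27) * monZ (a + 3) c - constZ (1 / 27) * monZ a c"
      unfolding vZ_square by (simp add: monZ_def power_add algebra_simps)
    finally have e: "monZ a b = constZ (1 / 27) * monZ (a + 3) c - constZ (1 / 27) * monZ a c" .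
    have "(4 * int (a + 3) + 6 * int c) mod 12 = k mod 12" "(4 * int a + 6 * int c) mod 12 = k mod 12"
    proof -
      have "(4 * int a + 6 * int c + 12) mod 12 = k mod 12"
        using less.prems by (simp add: b add_ac)
      then show ac: "(4 * int a + 6 * int c) mod 12 = k mod 12" by (simp only: mod_add_self2)
      have "4 * int (a + 3) + 6 * int c = (4 * int a + 6 * int c) + 12" by simp
      then show "(4 * int (a + 3) + 6 * int c) mod 12 = k mod 12" by (simp only: mod_add_self2 ac)
    qed
    then show ?thesis unfolding e
      by (intro RZ.span_diff RZ.span_scale less.IH) (auto simp: b)
  qed
qed

lemma regZ_weight_span: "regZ_weight k = RZ.span (monset k)"
proof
  show "RZ.span (monset k) \<subseteq> regZ_weight k"
    by (rule RZ.span_minimal[OF _ vsub_subspace[OF vector_space_regZ regZ_weight_vsub]])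
      (auto simp: monset_def intro: monZ_weight)
  show "regZ_weight k \<subseteq> RZ.span (monset k)"
  proof
    fix x assume "x \<in> regZ_weight k"
    then obtain P where P: "x = abs_regZ P"
      "\<And>a b. coeff (coeff P b) a \<noteq> 0 \<Longrightarrow> (4 * int a + 6 * int b) mod 12 = k mod 12"
      unfolding regZ_weight_def by blast
    have "P = (\<Sum>b\<le>degree P. monom (\<Sum>a\<le>degree (coeff P b). monom (coeff (coeff P b) a) a) b)"
      by (simp add: poly_as_sum_of_monoms)
    also have "\<dots> = (\<Sum>b\<le>degree P. \<Sum>a\<le>degree (coeff P b). monom (monom (coeff (coeff P b) a) a) b)"
    proof (intro sum.cong refl)
      fix b
      show "monom (\<Sum>a\<le>degree (coeff P b). monom (coeff (coeff P b) a) a) b =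
         (\<Sum>a\<le>degree (coeff P b). monom (monom (coeff (coeff P b) a) a) b)"
        by (rule poly_eqI) (simp add: coeff_sum)
    qed
    finally have "abs_regZ P = abs_regZ (\<Sum>b\<le>degree P. \<Sum>a\<le>degree (coeff P b). monom (monom (coeff (coeff P b) a) a) b)"
      by (rule arg_cong)
    then have "x = (\<Sum>b\<le>degree P. \<Sum>a\<le>degree (coeff P b). constZ (coeff (coeff P b) a) * monZ a b)"
      by (simp only: P(1) abs_regZ_sum abs_regZ_monom)
    moreover have "constZ (coeff (coeff P b) a) * monZ a b \<in> RZ.span (monset k)" for a b
      using P(2)[of b a] monZ_span[of a b k] by (cases "coeff (coeff P b) a = 0") (auto intro: RZ.span_scale RZ.span_zero)
    ultimately show "x \<in> RZ.span (monset k)" by (auto intro!: RZ.span_sum)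
  qed
qed

lemma monZ_mult_weight:
  assumes "f \<in> regZ_weight k" "(4 * int a + 6 * int b + k) mod 12 = l mod 12"
  shows "monZ a b * f \<in> regZ_weight l"
proof -
  have "f \<in> RZ.span (monset k)" using assms(1) by (simp add: regZ_weight_span)
  then show ?thesis
  proof (induction rule: RZ.span_induct_alt)
    case base
    show ?case using vsubD(1)[OF regZ_weight_vsub] by simp
  next
    case (step c x y)
    then obtain a' b' where x: "x = monZ a' b'" "(4 * int a' + 6 * int b') mod 12 = k mod 12"
      unfolding monset_def by blast
    have "monZ a b * x = monZ (a + a') (b + b')" by (simp add: x(1) monZ_def power_add mult_ac)
    also have "\<dots> \<in> regZ_weight l"
    proof (rule monZ_weight)
      have "(4 * int (a + a') + 6 * int (b + b')) mod 12 = ((4 * int a + 6 * int b) + (4 * int a' + 6 * int b')) mod 12"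
        by (simp add: algebra_simps)
      also have "\<dots> = ((4 * int a + 6 * int b) + k) mod 12" using x(2) by (metis mod_add_right_eq)
      finally show "(4 * int (a + a') + 6 * int (b + b')) mod 12 = l mod 12" using assms(2) by simp
    qed
    finally have "constZ c * (monZ a b * x) \<in> regZ_weight l" by (rule vsubD(4)[OF regZ_weight_vsub])
    from vsubD(2)[OF regZ_weight_vsub this step.IH] show ?case by (simp add: algebra_simps)
  qed
qed

subsection \<open>Differentials\<close>

lemma kaehlerZ_of_abs: "kaehlerZ_of f g = abs_kaehlerZ (f, g)"
  by (simp add: kaehlerZ_of_def)

lemma kaehlerZ_cases: obtains f g where "x = kaehlerZ_of f g"
  unfolding kaehlerZ_of_abs using kaehlerZ.abs_induct[of "\<lambda>x. \<exists>f g. x = abs_kaehlerZ (f, g)" x] by auto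

lemma kaehlerZ_of_ops:
  "kaehlerZ_of f g + kaehlerZ_of f' g' = kaehlerZ_of (f + f') (g + g')"
  "- kaehlerZ_of f g = kaehlerZ_of (- f) (- g)"
  "0 = kaehlerZ_of 0 0"
  "kmult r (kaehlerZ_of f g) = kaehlerZ_of (r * f) (r * g)"
  "kaehlerZ_of f g - kaehlerZ_of f' g' = kaehlerZ_of (f - f') (g - g')"
  by (simp_all add: kaehlerZ_of_abs plus_kaehlerZ.abs_eq uminus_kaehlerZ.abs_eq zero_kaehlerZ_def kmult.abs_eq
     minus_kaehlerZ_def)

lemma kmult_simps [simp]:
  "kmult r (x + y) = kmult r x + kmult r y" "kmult (r + s) x = kmult r x + kmult s x"
  "kmult r (kmult s x) = kmult (r * s) x" "kmult 1 x = x" "kmult 0 x = 0" "kmult r 0 = 0"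
  "kmult (- r) x = - kmult r x" "kmult r (- x) = - kmult r x"
  by (cases x rule: kaehlerZ_cases, cases y rule: kaehlerZ_cases,
      simp add: kaehlerZ_of_ops(1,2,4) kaehlerZ_of_ops(3) algebra_simps)+

lemma dZ_abs: "dZ (abs_regZ p) = kaehlerZ_of (abs_regZ (map_poly pderiv p)) (abs_regZ (pderiv p))"
  by (rule dZ.abs_eq)

lemma dZ_add: "dZ (f + g) = dZ f + dZ g"
  by (cases f rule: regZ_cases; cases g rule: regZ_cases)
    (simp add: plus_regZ.abs_eq dZ_abs pderiv_u_add pderiv_add kaehlerZ_of_ops(1))

lemma dZ_mult: "dZ (f * g) = kmult f (dZ g) + kmult g (dZ f)"
  by (cases f rule: regZ_cases; cases g rule: regZ_cases)
    (simp add: times_regZ.abs_eq plus_regZ.abs_eq dZ_abs pderiv_u_mult pderiv_mult kaehlerZ_of_ops(1,4) mult_ac)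

lemma dZ_const [simp]: "dZ (constZ c) = 0"
  by (simp add: constZ_def dZ_abs kaehlerZ_of_ops(3) zero_regZ_def pderiv_pCons map_poly_pCons)

lemma dZ_0 [simp]: "dZ 0 = 0" using dZ_const[of 0] by simp

lemma dZ_uZ: "dZ uZ = kaehlerZ_of 1 0"
  by (simp add: uZ_def pol_u_def dZ_abs zero_regZ_def one_regZ_def pderiv_pCons map_poly_pCons one_pCons)

lemma dZ_vZ: "dZ vZ = kaehlerZ_of 0 1"
  by (simp add: vZ_def pol_v_def dZ_abs zero_regZ_def one_regZ_def pderiv_pCons map_poly_pCons one_pCons pderiv_1)

lemma psiZ_0: "psiZ = 0"
proof -
  have "uZ ^ 3 - 27 * vZ ^ 2 = constZ 1" using uZ_vZ_rel by (simp add: numeral_regZ)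
  then show ?thesis unfolding psiZ_def by (simp only: dZ_const kmult_simps)
qed

lemma omegaZ_eq: "omegaZ = kaehlerZ_of (constZ (- 9 / 2) * vZ) (constZ 3 * uZ)"
proof -
  have c: "constZ (3 / 2) * constZ 2 = constZ 3" "constZ (3 / 2) * constZ (- 3) = constZ (- 9 / 2)"
    by (simp_all flip: constZ_hom(2))
  have "omegaZ = kaehlerZ_of (constZ (3 / 2) * (constZ (- 3) * vZ)) (constZ (3 / 2) * (constZ 2 * uZ))"
    by (simp add: omegaZ_def dZ_uZ dZ_vZ kaehlerZ_of_ops(4,5) numeral_regZ(1))
  then show ?thesis by (simp only: mult.assoc[symmetric] c)
qed

lemma numeral_constZ: "3 = constZ 3" "- 54 = constZ (- 54)"
  by (rule numeral_regZ)+

text \<open>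
  The form \<open>\<omega>\<close> generates the differentials of \<open>Z\<close>, because \<open>u\<^sup>3 - 27 v\<^sup>2 = 1\<close> makes the determinant of
  \<open>d\<Delta>\<close> and \<open>\<omega>\<close> invertible.
\<close>

lemma dZ_uZ_omega: "dZ uZ = kmult (constZ 6 * vZ) omegaZ"
proof -
  have c: "constZ (1 / 3) * constZ 3 = 1" "constZ (1 / 3) * constZ (- 54) = constZ (- 18)"
    "constZ 6 * constZ (- 9 / 2) = constZ (- 27)" "constZ 6 * constZ 3 = constZ 18"
    using constZ_hom(5) by (simp_all flip: constZ_hom(2) del: constZ_hom(5))
  have "kaehlerZ_of 1 0 = kaehlerZ_of (constZ 6 * vZ * (constZ (- 9 / 2) * vZ)) (constZ 6 * vZ * (constZ 3 * uZ))"
  proof (rule kaehlerZ_of_eqI)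
    have "constZ 6 * vZ * (constZ (- 9 / 2) * vZ) = (constZ 6 * constZ (- 9 / 2)) * vZ ^ 2"
      by (simp only: power2_eq_square mult_ac)
    then have "1 - constZ 6 * vZ * (constZ (- 9 / 2) * vZ) = 1 + constZ 27 * vZ ^ 2" unfolding c by simp
    also have "\<dots> = uZ ^ 3" using uZ_vZ_rel by (simp add: algebra_simps)
    also have "\<dots> = (constZ (1 / 3) * constZ 3) * (uZ * uZ ^ 2)" unfolding c by (simp add: power3_eq_cube power2_eq_square)
    finally show "1 - constZ 6 * vZ * (constZ (- 9 / 2) * vZ) = (constZ (1 / 3) * uZ) * (3 * uZ ^ 2)"
      unfolding numeral_constZ by (simp only: mult_ac)
    have "(constZ (1 / 3) * uZ) * (- 54 * vZ) = (constZ (1 / 3) * constZ (- 54)) * (uZ * vZ)"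
      unfolding numeral_constZ by (simp only: mult_ac)
    also have "\<dots> = - ((constZ 6 * constZ 3) * (uZ * vZ))" unfolding c by simp
    finally show "0 - constZ 6 * vZ * (constZ 3 * uZ) = (constZ (1 / 3) * uZ) * (- 54 * vZ)"
      by (simp only: diff_0 mult_ac)
  qed
  then show ?thesis by (simp only: dZ_uZ omegaZ_eq kaehlerZ_of_ops(4))
qed

lemma dZ_vZ_omega: "dZ vZ = kmult (constZ (1 / 3) * uZ ^ 2) omegaZ"
proof -
  have c: "constZ (1 / 2) * constZ 3 = constZ (3 / 2)" "constZ (1 / 2) * constZ (- 54) = constZ (- 27)"
    "constZ (1 / 3) * constZ (- 9 / 2) = constZ (- (3 / 2))" "constZ (1 / 3) * constZ 3 = 1"
    using constZ_hom(5) by (simp_all flip: constZ_hom(2) del: constZ_hom(5) constZ_hom(3))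
  have "kaehlerZ_of 0 1 = kaehlerZ_of (constZ (1 / 3) * uZ ^ 2 * (constZ (- 9 / 2) * vZ)) (constZ (1 / 3) * uZ ^ 2 * (constZ 3 * uZ))"
  proof (rule kaehlerZ_of_eqI)
    have "constZ (1 / 3) * uZ ^ 2 * (constZ (- 9 / 2) * vZ) = (constZ (1 / 3) * constZ (- 9 / 2)) * (uZ ^ 2 * vZ)"
      by (simp only: mult_ac)
    then have "0 - constZ (1 / 3) * uZ ^ 2 * (constZ (- 9 / 2) * vZ) = (constZ (1 / 2) * constZ 3) * (uZ ^ 2 * vZ)"
      unfolding c by simp
    then show "0 - constZ (1 / 3) * uZ ^ 2 * (constZ (- 9 / 2) * vZ) = (constZ (1 / 2) * vZ) * (3 * uZ ^ 2)"
      unfolding numeral_constZ by (simp only: mult_ac)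
    have "constZ (1 / 3) * uZ ^ 2 * (constZ 3 * uZ) = (constZ (1 / 3) * constZ 3) * (uZ ^ 2 * uZ)"
      by (simp only: mult_ac)
    then have "1 - constZ (1 / 3) * uZ ^ 2 * (constZ 3 * uZ) = 1 - uZ ^ 3"
      unfolding c by (simp add: power3_eq_cube power2_eq_square)
    also have "\<dots> = - (constZ 27 * vZ ^ 2)" using uZ_vZ_rel by (simp add: algebra_simps)
    also have "\<dots> = (constZ (1 / 2) * constZ (- 54)) * vZ ^ 2" unfolding c by simp
    finally show "1 - constZ (1 / 3) * uZ ^ 2 * (constZ 3 * uZ) = (constZ (1 / 2) * vZ) * (- 54 * vZ)"
      unfolding numeral_constZ by (simp only: power2_eq_square mult_ac)
  qed
  then show ?thesis by (simp only: dZ_vZ omegaZ_eq kaehlerZ_of_ops(4))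
qed

lemma kaehlerZ_of_omega: "kaehlerZ_of f g = kmult (constZ 6 * monZ 0 1 * f + constZ (1 / 3) * monZ 2 0 * g) omegaZ"
proof -
  have "kaehlerZ_of f g = kmult f (dZ uZ) + kmult g (dZ vZ)"
    by (simp add: dZ_uZ dZ_vZ kaehlerZ_of_ops(1,4))
  then show ?thesis by (simp add: dZ_uZ_omega dZ_vZ_omega monZ_def mult_ac)
qed

text \<open>
  As \<open>\<omega>\<close> has weight \<open>-2\<close>, division by it raises the weight by \<open>2\<close>.
\<close>

lemma kaehlerZ_weight_eq: "kaehlerZ_weight k = (\<lambda>h. kmult h omegaZ) ` regZ_weight (k + 2)"
proof (intro Set.set_eqI iffI)
  fix x assume "x \<in> kaehlerZ_weight k"
  then obtain f g where fg: "x = kaehlerZ_of f g" "f \<in> regZ_weight (k - 4)" "g \<in> regZ_weight (k - 6)"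
    unfolding kaehlerZ_weight_def by blast
  have "monZ 0 1 * f \<in> regZ_weight (k + 2)" "monZ 2 0 * g \<in> regZ_weight (k + 2)"
    by (rule monZ_mult_weight[OF fg(2)], simp add: mod_eq_dvd_iff,
        rule monZ_mult_weight[OF fg(3)], simp add: mod_eq_dvd_iff)
  then have "constZ 6 * (monZ 0 1 * f) + constZ (1 / 3) * (monZ 2 0 * g) \<in> regZ_weight (k + 2)"
    by (intro vsubD[OF regZ_weight_vsub])
  then show "x \<in> (\<lambda>h. kmult h omegaZ) ` regZ_weight (k + 2)"
    unfolding fg(1) kaehlerZ_of_omega mult.assoc by (rule imageI)
next
  fix x assume "x \<in> (\<lambda>h. kmult h omegaZ) ` regZ_weight (k + 2)"
  then obtain h where h: "h \<in> regZ_weight (k + 2)" "x = kmult h omegaZ" by blast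
  have "x = kaehlerZ_of (constZ (- 9 / 2) * (monZ 0 1 * h)) (constZ 3 * (monZ 1 0 * h))"
    unfolding h(2) omegaZ_eq kaehlerZ_of_ops(4) by (simp add: monZ_def mult_ac)
  moreover have "constZ (- 9 / 2) * (monZ 0 1 * h) \<in> regZ_weight (k - 4)"
    by (rule vsubD(4)[OF regZ_weight_vsub], rule monZ_mult_weight[OF h(1)]) (simp add: mod_eq_dvd_iff)
  moreover have "constZ 3 * (monZ 1 0 * h) \<in> regZ_weight (k - 6)"
    by (rule vsubD(4)[OF regZ_weight_vsub], rule monZ_mult_weight[OF h(1)]) (simp add: mod_eq_dvd_iff)
  ultimately show "x \<in> kaehlerZ_weight k" unfolding kaehlerZ_weight_def by blast
qed

definition sK :: "rat \<Rightarrow> kaehlerZ poly \<Rightarrow> kaehlerZ poly" where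
  "sK c = map_poly (kmult (constZ c))"

lemma coeff_sK: "coeff (sK c \<theta>) i = kmult (constZ c) (coeff \<theta> i)"
  by (simp add: sK_def coeff_map_poly)

lemma vector_space_sK: "vector_space sK"
  by unfold_locales (rule poly_eqI; simp add: coeff_sK)+

lemma degree_sK: "degree (sK c \<theta>) \<le> degree \<theta>"
  unfolding sK_def by (rule map_poly_degree_leq)

lemma kaehlerZ_weight_vsub: "vsub (\<lambda>c. kmult (constZ c)) (kaehlerZ_weight k)"
  unfolding vsub_def kaehlerZ_weight_eq
proof (intro conjI ballI allI)
  note V = vsubD[OF regZ_weight_vsub]
  show "0 \<in> (\<lambda>h. kmult h omegaZ) ` regZ_weight (k + 2)" using V(1) by (force intro: image_eqI[of _ _ 0])
  fix x assume "x \<in> (\<lambda>h. kmult h omegaZ) ` regZ_weight (k + 2)"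
  then obtain h where h: "h \<in> regZ_weight (k + 2)" "x = kmult h omegaZ" by blast
  show "- x \<in> (\<lambda>h. kmult h omegaZ) ` regZ_weight (k + 2)"
    by (rule image_eqI[of _ _ "- h"]) (use h V(3) in auto)
  show "kmult (constZ r) x \<in> (\<lambda>h. kmult h omegaZ) ` regZ_weight (k + 2)" for r
    by (rule image_eqI[of _ _ "constZ r * h"]) (use h V(4) in auto)
  fix y assume "y \<in> (\<lambda>h. kmult h omegaZ) ` regZ_weight (k + 2)"
  then obtain h' where h': "h' \<in> regZ_weight (k + 2)" "y = kmult h' omegaZ" by blast
  show "x + y \<in> (\<lambda>h. kmult h omegaZ) ` regZ_weight (k + 2)"
    by (rule image_eqI[of _ _ "h + h'"]) (use h h' V(2) in auto)
qed

lemma invariant_forms_vsub: "vsub sK (invariant_forms n)"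
  unfolding vsub_def invariant_forms_def
  using vsubD[OF kaehlerZ_weight_vsub] order_trans[OF degree_sK]
  by (auto simp: coeff_sK intro: degree_add_le)

definition sR :: "rat \<Rightarrow> regZ poly \<Rightarrow> regZ poly" where "sR c = smult (constZ c)"

lemma invariant_sections_vsub: "vsub sR (invariant_sections n)"
  unfolding vsub_def invariant_sections_def sR_def
  using vsubD[OF regZ_weight_vsub] order_trans[OF degree_smult_le]
  by (auto intro: degree_add_le)

definition basis_form :: "nat \<times> nat \<times> nat \<Rightarrow> kaehlerZ poly" where
  "basis_form = (\<lambda>(i, a, b). monom (kmult (monZ a b) omegaZ) i)"

definition form_indices :: "nat \<Rightarrow> (nat \<times> nat \<times> nat) set" where
  "form_indices n = {(i, a, b). i \<le> n \<and> b < 2 \<and> (4 * int a + 6 * int b) mod 12 = (int n - 2 * int i + 2) mod 12}"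

lemma basis_form_invariant: "basis_form ` form_indices n \<subseteq> invariant_forms n"
proof (clarsimp simp: form_indices_def basis_form_def)
  fix i a b assume *: "i \<le> n" "(4 * int a + 6 * int b) mod 12 = (int n - 2 * int i + 2) mod 12"
  have "kmult (monZ a b) omegaZ \<in> kaehlerZ_weight (int n - 2 * int i)"
    unfolding kaehlerZ_weight_eq using monZ_weight[OF *(2)] by blast
  then show "monom (kmult (monZ a b) omegaZ) i \<in> invariant_forms n"
    using *(1) vsubD(1)[OF kaehlerZ_weight_vsub] unfolding invariant_forms_def
    by (auto intro: order_trans[OF degree_monom_le])
qed

interpretation KZ: vector_space sK by (rule vector_space_sK)

lemma basis_form_spans: "invariant_forms n \<subseteq> KZ.span (basis_form ` form_indices n)"
proof
  fix \<theta> assume "\<theta> \<in> invariant_forms n"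
  then have d: "degree \<theta> \<le> n" and w: "\<And>i. i \<le> n \<Longrightarrow> coeff \<theta> i \<in> kaehlerZ_weight (int n - 2 * int i)"
    unfolding invariant_forms_def by auto
  have m: "monom (kmult h omegaZ) i \<in> KZ.span (basis_form ` form_indices n)"
    if "i \<le> n" "h \<in> regZ_weight (int n - 2 * int i + 2)" for i h
  proof -
    have "h \<in> RZ.span (monset (int n - 2 * int i + 2))" using that(2) by (simp add: regZ_weight_span)
    then show ?thesis
    proof (induction rule: RZ.span_induct_alt)
      case base
      show ?case by (simp add: KZ.span_zero)
    next
      case (step c x y)
      then obtain a b where x: "x = monZ a b" "b < 2" "(4 * int a + 6 * int b) mod 12 = (int n - 2 * int i + 2) mod 12"
        unfolding monset_def by blast
      have "(i, a, b) \<in> form_indices n" using x that(1) by (simp add: form_indices_def)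
      then have "basis_form (i, a, b) \<in> KZ.span (basis_form ` form_indices n)" by (intro KZ.span_base) blast
      then have "sK c (monom (kmult x omegaZ) i) \<in> KZ.span (basis_form ` form_indices n)"
        unfolding x(1) basis_form_def by (simp add: KZ.span_scale)
      moreover have "monom (kmult (constZ c * x + y) omegaZ) i = sK c (monom (kmult x omegaZ) i) + monom (kmult y omegaZ) i"
        by (rule poly_eqI) (simp add: coeff_sK)
      ultimately show ?case using step.IH by (simp add: KZ.span_add)
    qed
  qed
  have "\<theta> = (\<Sum>i\<le>n. monom (coeff \<theta> i) i)" by (rule poly_as_sum_of_monoms'[OF d, symmetric])
  also have "\<dots> \<in> KZ.span (basis_form ` form_indices n)"
  proof (rule KZ.span_sum)
    fix i assume "i \<in> {..n}"
    then show "monom (coeff \<theta> i) i \<in> KZ.span (basis_form ` form_indices n)"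
      using w[of i] m[of i] unfolding kaehlerZ_weight_eq by auto
  qed
  finally show "\<theta> \<in> KZ.span (basis_form ` form_indices n)" .
qed

section \<open>Pullback of sections and forms to the upper half plane\<close>

definition evR :: "complex \<Rightarrow> regZ \<Rightarrow> complex" where "evR z f = eval_regZ f (lift_u z) (lift_v z)"

definition evK :: "complex \<Rightarrow> kaehlerZ \<Rightarrow> complex" where
  "evK z \<kappa> = eval_kaehlerZ \<kappa> (lift_u z) (lift_v z) (deriv lift_u z) (deriv lift_v z)"

lemma evR_add: "evR z (f + g) = evR z f + evR z g"
  and evR_mult: "evR z (f * g) = evR z f * evR z g"
  by (simp_all add: evR_def eval_regZ_add eval_regZ_mult)

lemma evR_gens:
  assumes "z \<in> \<HH>"
  shows "evR z uZ = lift_u z" "evR z vZ = lift_v z" "evR z (constZ c) = of_rat c"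
  unfolding evR_def by (rule eval_regZ_gens[OF lift_on_Z[OF assms]])+

lemma evR_0_1:
  assumes "z \<in> \<HH>" shows "evR z 0 = 0" "evR z 1 = 1"
  using evR_gens(3)[OF assms, of 0] evR_gens(3)[OF assms, of 1] by simp_all

lemma evR_minus: "z \<in> \<HH> \<Longrightarrow> evR z (- f) = - evR z f"
  using evR_add[of z f "- f"] by (simp add: evR_0_1 eq_neg_iff_add_eq_0 add.commute)

lemma evR_power: "z \<in> \<HH> \<Longrightarrow> evR z (f ^ k) = evR z f ^ k"
  by (induction k) (simp_all add: evR_0_1 evR_mult)

lemma evR_of_nat: "z \<in> \<HH> \<Longrightarrow> evR z (of_nat k) = of_nat k"
  by (induction k) (simp_all add: evR_0_1 evR_add)

lemma evR_monZ: "z \<in> \<HH> \<Longrightarrow> evR z (monZ a b) = lift_u z ^ a * lift_v z ^ b"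
  by (simp add: monZ_def evR_mult evR_power evR_gens)

lemma deriv_lift:
  assumes "z \<in> \<HH>"
  shows "deriv lift_u z = 6 * lift_v z * omega_hat z" "deriv lift_v z = lift_u z ^ 2 / 3 * omega_hat z"
  by (rule DERIV_imp_deriv[OF lift_has_derivative(1)[OF assms]])
    (rule DERIV_imp_deriv[OF lift_has_derivative(2)[OF assms]])

lemma evK_of:
  assumes z: "z \<in> \<HH>"
  shows "evK z (kaehlerZ_of f g) = evR z f * deriv lift_u z + evR z g * deriv lift_v z"
proof -
  have "3 * lift_u z ^ 2 * deriv lift_u z - 54 * lift_v z * deriv lift_v z = 0"
    unfolding deriv_lift[OF z] by simp
  then show ?thesis
    unfolding evK_def evR_def kaehlerZ_of_abs eval_kaehlerZ.abs_eq using lift_on_Z[OF z] by simp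
qed

lemma evK_add: "z \<in> \<HH> \<Longrightarrow> evK z (x + y) = evK z x + evK z y"
  by (cases x rule: kaehlerZ_cases, cases y rule: kaehlerZ_cases)
    (simp add: kaehlerZ_of_ops(1) evK_of evR_add algebra_simps)

lemma evK_kmult: "z \<in> \<HH> \<Longrightarrow> evK z (kmult r x) = evR z r * evK z x"
  by (cases x rule: kaehlerZ_cases)
    (simp add: kaehlerZ_of_ops(4) evK_of evR_mult algebra_simps)

lemma evK_0: "z \<in> \<HH> \<Longrightarrow> evK z 0 = 0"
  using evK_kmult[of z 0 0] by (simp add: evR_0_1)

lemma evK_omegaZ:
  assumes z: "z \<in> \<HH>"
  shows "evK z omegaZ = omega_hat z"
proof -
  have "evK z omegaZ = (lift_u z ^ 3 - 27 * lift_v z ^ 2) * omega_hat z"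
    using z by (simp add: omegaZ_eq evK_of evR_mult evR_minus evR_gens deriv_lift of_rat_minus of_rat_divide
        power2_eq_square power3_eq_cube algebra_simps)
  then show ?thesis by (simp add: lift_on_Z[OF z])
qed

lemma regZ_generated:
  assumes "\<And>c. Q (constZ c)" "Q uZ" "Q vZ" "\<And>f g. Q f \<Longrightarrow> Q g \<Longrightarrow> Q (f + g)" "\<And>f g. Q f \<Longrightarrow> Q g \<Longrightarrow> Q (f * g)"
  shows "Q f"
proof -
  have 1: "Q (abs_regZ [:p:])" for p
  proof (induction p)
    case 0
    show ?case using assms(1)[of 0] by (simp add: constZ_def)
  next
    case (pCons c p)
    have "abs_regZ [:pCons c p:] = constZ c + uZ * abs_regZ [:p:]"
      by (simp add: constZ_def uZ_def pol_u_def times_regZ.abs_eq plus_regZ.abs_eq)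
    then show ?case using assms pCons.IH by metis
  qed
  have "Q (abs_regZ P)" for P
  proof (induction P)
    case 0
    show ?case using assms(1)[of 0] by (simp add: zero_regZ_def)
  next
    case (pCons p P)
    have "abs_regZ (pCons p P) = abs_regZ [:p:] + vZ * abs_regZ P"
      by (simp add: vZ_def pol_v_def times_regZ.abs_eq plus_regZ.abs_eq)
    then show ?case using assms pCons.IH 1 by metis
  qed
  then show ?thesis by (cases f rule: regZ_cases) simp
qed

lemma evR_has_derivative:
  assumes z: "z \<in> \<HH>"
  shows "((\<lambda>w. evR w f) has_field_derivative evK z (dZ f)) (at z)"
proof (induction f rule: regZ_generated)
  have tr: "(f has_field_derivative d) (at z) \<Longrightarrow> (\<And>w. w \<in> \<HH> \<Longrightarrow> f w = g w) \<Longrightarrow> (g has_field_derivative d) (at z)"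
    for f g :: "complex \<Rightarrow> complex" and d
    by (rule has_field_derivative_transform_within_open[OF _ open_upper_half z])
  {
    case (1 c)
    show ?case by (rule tr[of "\<lambda>_. of_rat c"]) (use z in \<open>auto simp: evR_gens evK_0\<close>)
  next
    case 2
    show ?case by (rule tr[of lift_u])
      (use z lift_has_derivative(1)[OF z] in \<open>auto simp: evR_gens dZ_uZ evK_of evR_0_1 deriv_lift\<close>)
  next
    case 3
    show ?case by (rule tr[of lift_v])
      (use z lift_has_derivative(2)[OF z] in \<open>auto simp: evR_gens dZ_vZ evK_of evR_0_1 deriv_lift\<close>)
  next
    case (4 f g)
    from DERIV_add[OF this] show ?case by (simp add: evR_add dZ_add evK_add[OF z])
  next
    case (5 f g)
    from DERIV_mult[OF this] show ?case
      by (simp add: evR_mult dZ_mult evK_add[OF z] evK_kmult[OF z] algebra_simps)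
  }
qed

text \<open>
  Coefficientwise derivatives, which obey the Leibniz rule for products of polynomials.
\<close>

definition pder :: "(complex \<Rightarrow> complex poly) \<Rightarrow> complex poly \<Rightarrow> complex \<Rightarrow> bool" where
  "pder F F' z \<longleftrightarrow> (\<forall>i. ((\<lambda>w. coeff (F w) i) has_field_derivative coeff F' i) (at z))"

lemma pder_smult:
  assumes "(f has_field_derivative f') (at z)" "pder F F' z"
  shows "pder (\<lambda>w. smult (f w) (F w)) (smult f' (F z) + smult (f z) F') z"
  unfolding pder_def
proof
  fix i
  show "((\<lambda>w. coeff (smult (f w) (F w)) i) has_field_derivative
      coeff (smult f' (F z) + smult (f z) F') i) (at z)"
    using DERIV_mult[OF assms(1) assms(2)[unfolded pder_def, rule_format, of i]]
    by (simp add: mult.commute add.commute)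
qed

lemma pder_mult:
  assumes "pder F F' z" "pder G G' z"
  shows "pder (\<lambda>w. F w * G w) (F' * G z + F z * G') z"
  unfolding pder_def
proof
  fix i
  have "((\<lambda>w. \<Sum>k\<le>i. coeff (F w) k * coeff (G w) (i - k)) has_field_derivative
      (\<Sum>k\<le>i. coeff (F z) k * coeff G' (i - k) + coeff F' k * coeff (G z) (i - k))) (at z)"
    using assms unfolding pder_def by (intro DERIV_sum DERIV_mult') auto
  then show "((\<lambda>w. coeff (F w * G w) i) has_field_derivative coeff (F' * G z + F z * G') i) (at z)"
    by (simp only: coeff_mult coeff_add sum.distrib add.commute)
qed

lemma pder_const: "pder (\<lambda>_. P) 0 z"
  by (simp add: pder_def)

lemma pder_sum:
  assumes "\<And>x. x \<in> A \<Longrightarrow> pder (F x) (F' x) z"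
  shows "pder (\<lambda>w. \<Sum>x\<in>A. F x w) (\<Sum>x\<in>A. F' x) z"
  unfolding pder_def coeff_sum using assms unfolding pder_def by (auto intro: DERIV_sum)

lemma pder_power:
  assumes "pder F F' z"
  shows "pder (\<lambda>w. F w ^ k) (smult (of_nat k) (F z ^ (k - 1) * F')) z"
proof (induction k)
  case 0
  show ?case by (simp add: pder_const)
next
  case (Suc k)
  have "F z * smult (of_nat k) (F z ^ (k - 1) * F') = smult (of_nat k) (F z ^ k * F')"
    by (cases k) (simp_all add: mult_ac del: of_nat_Suc)
  then have "F' * F z ^ k + F z * smult (of_nat k) (F z ^ (k - 1) * F') =
      smult (of_nat (Suc k)) (F z ^ (Suc k - 1) * F')"
    by (simp add: smult_add_left mult.commute)
  then show ?case using pder_mult[OF assms Suc.IH] by simp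
qed

lemma pder_transform:
  assumes "pder F F' z" "z \<in> \<HH>" "\<And>w. w \<in> \<HH> \<Longrightarrow> F w = G w"
  shows "pder G F' z"
  unfolding pder_def
proof
  fix i
  show "((\<lambda>w. coeff (G w) i) has_field_derivative coeff F' i) (at z)"
    by (rule has_field_derivative_transform_within_open[OF assms(1)[unfolded pder_def, rule_format] open_upper_half assms(2)])
      (simp add: assms(3))
qed

lemma deriv_an_pder:
  assumes "pder G G' z" "z \<in> \<HH>" "degree G' \<le> n"
  shows "deriv_an n G z = G'"
proof -
  have "deriv (\<lambda>w. coeff (G w) i) z = coeff G' i" for i
    using assms(1) unfolding pder_def by (blast intro: DERIV_imp_deriv)
  then show ?thesis using assms(2,3) by (simp add: deriv_an_def poly_as_sum_of_monoms')
qed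

lemma hol_degree: "G \<in> hol n \<Longrightarrow> degree (G z) \<le> n"
  unfolding hol_def by (cases "z \<in> \<HH>") auto

lemma hol_pder:
  assumes G: "G \<in> hol n" and z: "z \<in> \<HH>"
  shows "pder G (deriv_an n G z) z"
  unfolding pder_def
proof
  fix i
  have h: "(\<lambda>w. coeff (G w) i) holomorphic_on \<HH>" using G unfolding hol_def by auto
  have d: "((\<lambda>w. coeff (G w) i) has_field_derivative deriv (\<lambda>w. coeff (G w) i) z) (at z)"
    by (rule holomorphic_derivI[OF h open_upper_half z])
  have "coeff (deriv_an n G z) i = (if i \<le> n then deriv (\<lambda>w. coeff (G w) i) z else 0)"
    using z by (simp add: deriv_an_def coeff_sum)
  also have "\<dots> = deriv (\<lambda>w. coeff (G w) i) z"
  proof (cases "i \<le> n")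
    case False
    then have "coeff (G w) i = 0" for w using hol_degree[OF G, of w] by (intro coeff_eq_0) simp
    then show ?thesis using False by simp
  qed simp
  finally show "((\<lambda>w. coeff (G w) i) has_field_derivative coeff (deriv_an n G z) i) (at z)" using d by simp
qed

lemma holI_pder:
  assumes "\<And>z. z \<in> \<HH> \<Longrightarrow> degree (G z) \<le> n" "\<And>z. z \<notin> \<HH> \<Longrightarrow> G z = 0"
    "\<And>z. z \<in> \<HH> \<Longrightarrow> \<exists>G'. pder G G' z"
  shows "G \<in> hol n"
proof -
  have "(\<lambda>z. coeff (G z) i) holomorphic_on \<HH>" for i
    unfolding holomorphic_on_open[OF open_upper_half] using assms(3) unfolding pder_def by blast
  then show ?thesis using assms(1,2) by (simp add: hol_def)
qed

text \<open>
  The frame on \<open>Z\<close>, transported to \<open>\<HH>\<close> along the lift.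
\<close>

definition Sh :: "complex \<Rightarrow> complex poly" where "Sh z = smult (lam z) (frame_S z)"
definition Th :: "complex \<Rightarrow> complex poly" where "Th z = smult (1 / lam z) (frame_T z)"

lemma pder_linear:
  assumes "(f has_field_derivative f') (at z)" "(g has_field_derivative g') (at z)"
  shows "pder (\<lambda>w. [:f w, g w:]) [:f', g':] z"
  unfolding pder_def
proof
  fix i :: nat
  show "((\<lambda>w. coeff [:f w, g w:] i) has_field_derivative coeff [:f', g':] i) (at z)"
    by (cases i; cases "i - 1") (use assms in \<open>auto simp: coeff_pCons split: nat.splits\<close>)
qed

lemma Sh_eq: "z \<in> \<HH> \<Longrightarrow> Sh z = [:- (lam z * rho_psi z), lam z * (1 + rho_psi z * z):]"
  by (simp add: Sh_def frame_S_eq)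

lemma Th_eq: "Th z = [:- (tpi / lam z), tpi * z / lam z:]"
  by (simp add: Th_def frame_T_def)

lemma rho_psi_has_derivative:
  assumes "z \<in> \<HH>"
  shows "(rho_psi has_field_derivative rho_psi z ^ 2 + of_real pi ^ 2 / 3 * rho_u z) (at z)"
  using holomorphic_derivI[OF rho_psi_holomorphic open_upper_half assms] deriv_rho_psi[OF assms] by simp

text \<open>
  The Gauss-Manin connection in the frame on \<open>Z\<close>, where \<open>\<psi>\<close> vanishes: \<open>S' = - (u/12) \<omega> T\<close> and
  \<open>T' = \<omega> S\<close>. The first equation is Ramanujan's formula for \<open>\<psi>'\<close>.
\<close>

lemma pder_Sh:
  assumes z: "z \<in> \<HH>"
  shows "pder Sh (smult (- (lift_u z / 12 * omega_hat z)) (Th z)) z"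
proof -
  have l: "lam z \<noteq> 0" by (rule lam_nonzero[OF z])
  let ?A = "lam z * of_real pi ^ 2 / 3 * rho_u z"
  have 1: "((\<lambda>w. - (lam w * rho_psi w)) has_field_derivative - ?A) (at z)"
    by (rule DERIV_cong[OF DERIV_minus[OF DERIV_mult[OF lam_has_derivative[OF z] rho_psi_has_derivative[OF z]]]])
      (simp add: algebra_simps power2_eq_square)
  have 2: "((\<lambda>w. lam w * (1 + rho_psi w * w)) has_field_derivative ?A * z) (at z)"
    by (rule DERIV_cong[OF DERIV_mult[OF lam_has_derivative[OF z] DERIV_add[OF DERIV_const
          DERIV_mult[OF rho_psi_has_derivative[OF z] DERIV_ident]]]])
      (simp add: algebra_simps power2_eq_square)
  have c: "lift_u z / 12 * omega_hat z * (tpi / lam z) = - ?A"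
    unfolding lift_u_def omega_hat_def using l by (simp add: field_simps eval_nat_numeral)
  have "smult (- (lift_u z / 12 * omega_hat z)) (Th z) =
      [:lift_u z / 12 * omega_hat z * (tpi / lam z),
        - (lift_u z / 12 * omega_hat z * (tpi / lam z)) * z:]"
    unfolding Th_eq by simp
  then have e: "smult (- (lift_u z / 12 * omega_hat z)) (Th z) = [:- ?A, ?A * z:]"
    unfolding c by simp
  show ?thesis unfolding e
    by (rule pder_transform[OF pder_linear[OF 1 2] z]) (simp add: Sh_eq)
qed

lemma pder_Th:
  assumes z: "z \<in> \<HH>"
  shows "pder Th (smult (omega_hat z) (Sh z)) z"
proof -
  have l: "lam z \<noteq> 0" by (rule lam_nonzero[OF z])
  let ?c = "tpi :: complex"
  have inv: "((\<lambda>w. inverse (lam w)) has_field_derivative rho_psi z * inverse (lam z)) (at z)"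
    by (rule DERIV_cong[OF DERIV_inverse'[OF lam_has_derivative[OF z] l]]) (use l in simp)
  have 1: "((\<lambda>w. - (?c / lam w)) has_field_derivative - (?c * (rho_psi z * inverse (lam z)))) (at z)"
    unfolding divide_inverse by (intro DERIV_minus DERIV_cmult inv)
  have 2: "((\<lambda>w. ?c * w / lam w) has_field_derivative (?c * 1) * inverse (lam z) + (rho_psi z * inverse (lam z)) * (?c * z)) (at z)"
    unfolding divide_inverse by (intro DERIV_mult DERIV_cmult DERIV_ident inv)
  have "smult (omega_hat z) (Sh z) =
     [:- (?c * (rho_psi z * inverse (lam z))), (?c * 1) * inverse (lam z) + (rho_psi z * inverse (lam z)) * (?c * z):]"
    unfolding Sh_eq[OF z] omega_hat_def using l by (simp add: field_simps power2_eq_square)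
  then show ?thesis
    using pder_transform[OF pder_linear[OF 1 2] z] by (simp add: Th_eq)
qed

lemma degree_Sh_Th: "z \<in> \<HH> \<Longrightarrow> degree (Sh z) \<le> 1" "degree (Th z) \<le> 1"
  by (simp_all add: Sh_eq Th_eq degree_pCons_le)

definition ST_mon :: "nat \<Rightarrow> nat \<Rightarrow> complex \<Rightarrow> complex poly" where
  "ST_mon n i z = Sh z ^ i * Th z ^ (n - i)"

lemma degree_ST_mon: "z \<in> \<HH> \<Longrightarrow> i \<le> n \<Longrightarrow> degree (ST_mon n i z) \<le> n"
  unfolding ST_mon_def by (intro degree_linear_powers degree_Sh_Th)

lemma pullback_eq:
  assumes "z \<in> \<HH>"
  shows "pullback n \<theta> z = (\<Sum>i\<le>n. smult (evK z (coeff \<theta> i)) (ST_mon n i z))"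
  using assms by (simp add: pullback_def evK_def ST_mon_def Sh_def Th_def)

lemma pullback_off: "z \<notin> \<HH> \<Longrightarrow> pullback n \<theta> z = 0"
  by (simp add: pullback_def)

lemma pullback_add: "pullback n (\<theta> + \<theta>') z = pullback n \<theta> z + pullback n \<theta>' z"
  by (cases "z \<in> \<HH>")
    (simp_all add: pullback_eq pullback_off evK_add smult_add_left sum.distrib)

lemma pullback_diff: "pullback n (\<theta> - \<theta>') z = pullback n \<theta> z - pullback n \<theta>' z"
  using pullback_add[of n "\<theta> - \<theta>'" \<theta>' z] by simp

lemma pullback_0: "pullback n 0 z = 0"
  using pullback_add[of n 0 0 z] by simp

lemma pullback_sum: "pullback n (sum f A) z = (\<Sum>x\<in>A. pullback n (f x) z)"
  by (induction A rule: infinite_finite_induct) (simp_all add: pullback_0 pullback_add)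

lemma pullback_sK: "pullback n (sK c \<theta>) z = smult (of_rat c) (pullback n \<theta> z)"
proof (cases "z \<in> \<HH>")
  case True
  then show ?thesis by (simp add: pullback_eq coeff_sK evK_kmult evR_gens smult_sum_right)
qed (simp add: pullback_off)

lemma pullback_monom:
  assumes "z \<in> \<HH>" "i \<le> n"
  shows "pullback n (monom \<kappa> i) z = smult (evK z \<kappa>) (ST_mon n i z)"
proof -
  have "pullback n (monom \<kappa> i) z = (\<Sum>j\<le>n. if j = i then smult (evK z \<kappa>) (ST_mon n i z) else 0)"
    unfolding pullback_eq[OF assms(1)] by (rule sum.cong) (auto simp: evK_0[OF assms(1)])
  then show ?thesis using assms(2) by simp
qed

text \<open>
  The connection applied to \<open>f S\<^sup>i T\<^sup>n\<^sup>-\<^sup>i\<close>, with the terms containing \<open>\<psi> = 0\<close> removed.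
\<close>

definition nab :: "nat \<Rightarrow> nat \<Rightarrow> regZ \<Rightarrow> kaehlerZ poly" where
  "nab n i f = monom (dZ f) i - monom (kmult (of_nat i * f * constZ (1 / 12) * uZ) omegaZ) (i - 1)
     + monom (kmult (of_nat (n - i) * f) omegaZ) (i + 1)"

lemma nablaZ_eq: "nablaZ n s = (\<Sum>i\<le>n. nab n i (coeff s i))"
  by (simp add: nablaZ_def nab_def psiZ_0 Let_def)

lemma pder_section_term:
  assumes z: "z \<in> \<HH>" and i: "i \<le> n"
  shows "pder (\<lambda>w. smult (evR w f) (ST_mon n i w)) (pullback n (nab n i f) z) z"
proof -
  let ?S = "Sh z" and ?T = "Th z" and ?o = "omega_hat z" and ?f = "evR z f"
  let ?S' = "smult (- (lift_u z / 12 * ?o)) ?T" and ?T' = "smult ?o ?S"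
  have p: "pder (\<lambda>w. smult (evR w f) (ST_mon n i w))
     (smult (evK z (dZ f)) (ST_mon n i z) + smult ?f
       (smult (of_nat i) (?S ^ (i - 1) * ?S') * ?T ^ (n - i) +
        ?S ^ i * smult (of_nat (n - i)) (?T ^ (n - i - 1) * ?T'))) z"
    unfolding ST_mon_def[abs_def]
    by (intro pder_smult pder_mult pder_power pder_Sh pder_Th evR_has_derivative z)
  have b: "smult ?f (smult (of_nat i) (?S ^ (i - 1) * ?S') * ?T ^ (n - i)) =
      - pullback n (monom (kmult (of_nat i * f * constZ (1 / 12) * uZ) omegaZ) (i - 1)) z"
  proof (cases i)
    case 0
    then show ?thesis by (simp add: pullback_0)
  next
    case (Suc k)
    have "i - 1 \<le> n" using i by simp
    moreover have "?T ^ (n - (i - 1)) = ?T * ?T ^ (n - i)"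
      using i Suc by (metis Suc_diff_Suc Suc_le_lessD diff_Suc_1 power_Suc)
    ultimately show ?thesis
      using z by (simp add: pullback_monom evK_kmult evK_omegaZ evR_mult evR_of_nat evR_gens ST_mon_def
          of_rat_divide mult_ac)
  qed
  have c: "smult ?f (?S ^ i * smult (of_nat (n - i)) (?T ^ (n - i - 1) * ?T')) =
      pullback n (monom (kmult (of_nat (n - i) * f) omegaZ) (i + 1)) z"
  proof (cases "i = n")
    case True
    then show ?thesis by (simp add: pullback_0)
  next
    case False
    then have "i + 1 \<le> n" using i by simp
    moreover have "evR z (of_nat (n - i) * f) = of_nat (n - i) * ?f"
      by (simp only: evR_mult evR_of_nat[OF z])
    ultimately show ?thesis
      unfolding pullback_monom[OF z \<open>i + 1 \<le> n\<close>] evK_kmult[OF z] evK_omegaZ[OF z] ST_mon_def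
      by (simp add: mult_ac del: of_nat_diff)
  qed
  have "smult (evK z (dZ f)) (ST_mon n i z) + smult ?f
       (smult (of_nat i) (?S ^ (i - 1) * ?S') * ?T ^ (n - i) +
        ?S ^ i * smult (of_nat (n - i)) (?T ^ (n - i - 1) * ?T')) = pullback n (nab n i f) z"
    unfolding nab_def pullback_add pullback_diff smult_add_right b c pullback_monom[OF z i] by simp
  with p show ?thesis by simp
qed

definition pullsec :: "nat \<Rightarrow> regZ poly \<Rightarrow> complex \<Rightarrow> complex poly" where
  "pullsec n s z = (if z \<in> \<HH> then \<Sum>i\<le>n. smult (evR z (coeff s i)) (ST_mon n i z) else 0)"

lemma degree_pullback: "degree (pullback n \<theta> z) \<le> n"
proof (cases "z \<in> \<HH>")
  case True
  then show ?thesis unfolding pullback_eq[OF True]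
    by (intro degree_sum_le) (auto intro!: order.trans[OF degree_smult_le] degree_ST_mon)
qed (simp add: pullback_off)

lemma pder_pullsec:
  assumes z: "z \<in> \<HH>"
  shows "pder (pullsec n s) (pullback n (nablaZ n s) z) z"
proof -
  have "pder (\<lambda>w. \<Sum>i\<le>n. smult (evR w (coeff s i)) (ST_mon n i w)) (pullback n (nablaZ n s) z) z"
    unfolding nablaZ_eq pullback_sum by (intro pder_sum pder_section_term z) auto
  then show ?thesis by (rule pder_transform[OF _ z]) (simp add: pullsec_def)
qed

lemma deriv_pullsec: "deriv_an n (pullsec n s) = pullback n (nablaZ n s)"
proof
  fix z
  show "deriv_an n (pullsec n s) z = pullback n (nablaZ n s) z"
  proof (cases "z \<in> \<HH>")
    case True
    show ?thesis by (rule deriv_an_pder[OF pder_pullsec[OF True] True degree_pullback])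
  qed (simp add: deriv_an_def pullback_off)
qed

lemma pullsec_hol: "pullsec n s \<in> hol n"
proof (rule holI_pder)
  fix z assume z: "z \<in> \<HH>"
  show "degree (pullsec n s z) \<le> n"
    unfolding pullsec_def using z
    by (auto intro!: degree_sum_le order.trans[OF degree_smult_le] degree_ST_mon)
  show "\<exists>G'. pder (pullsec n s) G' z" using pder_pullsec[OF z] by blast
qed (simp add: pullsec_def)

lemma evK_holomorphic: "(\<lambda>z. evK z \<kappa>) holomorphic_on \<HH>"
proof -
  obtain f g where fg: "\<kappa> = kaehlerZ_of f g" by (rule kaehlerZ_cases)
  have R: "(\<lambda>z. evR z f) holomorphic_on \<HH>" for f
    unfolding holomorphic_on_open[OF open_upper_half] using evR_has_derivative by blast
  have d: "deriv lift_u holomorphic_on \<HH>" "deriv lift_v holomorphic_on \<HH>"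
    by (rule holomorphic_deriv[OF _ open_upper_half], rule lift_holomorphic)+
  have "(\<lambda>z. evR z f * deriv lift_u z + evR z g * deriv lift_v z) holomorphic_on \<HH>"
    by (intro holomorphic_on_add holomorphic_on_mult R d)
  then show ?thesis by (rule holomorphic_transform) (simp add: fg evK_of)
qed

lemma pullback_hol: "pullback n \<theta> \<in> hol n"
proof (rule holI_pder)
  fix z assume z: "z \<in> \<HH>"
  have d: "((\<lambda>w. evK w \<kappa>) has_field_derivative deriv (\<lambda>w. evK w \<kappa>) z) (at z)" for \<kappa>
    by (rule holomorphic_derivI[OF evK_holomorphic open_upper_half z])
  have "\<exists>G'. pder (ST_mon n i) G' z" for i
    unfolding ST_mon_def[abs_def] using pder_mult[OF pder_power[OF pder_Sh[OF z]] pder_power[OF pder_Th[OF z]]] by blast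
  then obtain M where M: "\<And>i. pder (ST_mon n i) (M i) z" by metis
  have "pder (\<lambda>w. \<Sum>i\<le>n. smult (evK w (coeff \<theta> i)) (ST_mon n i w))
     (\<Sum>i\<le>n. smult (deriv (\<lambda>w. evK w (coeff \<theta> i)) z) (ST_mon n i z) + smult (evK z (coeff \<theta> i)) (M i)) z"
    by (intro pder_sum pder_smult d M)
  then have "pder (pullback n \<theta>) (\<Sum>i\<le>n. smult (deriv (\<lambda>w. evK w (coeff \<theta> i)) z) (ST_mon n i z) + smult (evK z (coeff \<theta> i)) (M i)) z"
    by (rule pder_transform[OF _ z]) (simp add: pullback_eq)
  then show "\<exists>G'. pder (pullback n \<theta>) G' z" by blast
next
  show "degree (pullback n \<theta> z) \<le> n" for z by (rule degree_pullback)
  show "pullback n \<theta> z = 0" if "z \<notin> \<HH>" for z by (rule pullback_off[OF that])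
qed

subsection \<open>Invariance\<close>

lemma root_of_unity_powi:
  assumes "(\<epsilon>::complex) ^ 12 = 1" "k mod 12 = l mod 12"
  shows "\<epsilon> powi k = \<epsilon> powi l"
proof -
  have e: "\<epsilon> \<noteq> 0" using assms(1) by auto
  have "12 dvd k - l" using assms(2) by (simp add: mod_eq_dvd_iff)
  then obtain m where "k - l = 12 * m" by (elim dvdE)
  then have m: "k = l + 12 * m" by simp
  have "\<epsilon> powi k = \<epsilon> powi l * (\<epsilon> ^ 12) powi m"
    unfolding m using e by (simp add: power_int_add power_int_mult)
  then show ?thesis by (simp add: assms(1))
qed

context
  fixes \<gamma> :: "int^2^2" and z \<epsilon> :: complex
  assumes \<gamma>: "\<gamma> \<in> SL2Z" and z: "z \<in> \<HH>"
    and \<epsilon>: "\<epsilon> ^ 12 = 1" "lam (moebius \<gamma> z) * jfac \<gamma> z = \<epsilon> * lam z"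
begin

lemma eps_nonzero: "\<epsilon> \<noteq> 0"
  using \<epsilon>(1) by auto

lemma moebius_z: "moebius \<gamma> z \<in> \<HH>"
  by (rule moebius_upper_half[OF \<gamma> z])

lemma lift_moebius: "lift_u (moebius \<gamma> z) = \<epsilon> ^ 4 * lift_u z" "lift_v (moebius \<gamma> z) = \<epsilon> ^ 6 * lift_v z"
proof -
  have "lift_u (moebius \<gamma> z) = (lam (moebius \<gamma> z) * jfac \<gamma> z) ^ 4 * rho_u z"
    "lift_v (moebius \<gamma> z) = (lam (moebius \<gamma> z) * jfac \<gamma> z) ^ 6 * rho_v z"
    using modularD[OF rho_modular(1) \<gamma> z] modularD[OF rho_modular(2) \<gamma> z]
    by (simp_all add: lift_u_def lift_v_def power_mult_distrib)
  then show "lift_u (moebius \<gamma> z) = \<epsilon> ^ 4 * lift_u z" "lift_v (moebius \<gamma> z) = \<epsilon> ^ 6 * lift_v z"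
    unfolding \<epsilon>(2) by (simp_all add: lift_u_def lift_v_def power_mult_distrib)
qed

lemma evR_moebius:
  assumes "f \<in> regZ_weight k"
  shows "evR (moebius \<gamma> z) f = \<epsilon> powi k * evR z f"
proof -
  have "f \<in> RZ.span (monset k)" using assms by (simp add: regZ_weight_span)
  then show ?thesis
  proof (induction rule: RZ.span_induct_alt)
    case base
    show ?case by (simp add: evR_0_1 z moebius_z)
  next
    case (step c x y)
    then obtain a b where x: "x = monZ a b" "(4 * int a + 6 * int b) mod 12 = k mod 12"
      unfolding monset_def by blast
    have "\<epsilon> powi k = \<epsilon> powi (4 * int a + 6 * int b)"
      by (rule root_of_unity_powi[OF \<epsilon>(1)]) (simp add: x(2))
    also have "\<dots> = (\<epsilon> ^ 4) ^ a * (\<epsilon> ^ 6) ^ b"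
      using eps_nonzero by (simp add: power_int_add power_int_mult)
    finally have "evR (moebius \<gamma> z) x = \<epsilon> powi k * evR z x"
      by (simp add: x(1) evR_monZ z moebius_z lift_moebius power_mult_distrib mult_ac)
    then show ?case using step.IH by (simp add: evR_add evR_mult evR_gens z moebius_z algebra_simps)
  qed
qed

lemma omega_hat_moebius: "omega_hat (moebius \<gamma> z) = jfac \<gamma> z ^ 2 * \<epsilon> powi (- 2) * omega_hat z"
proof -
  have j: "jfac \<gamma> z \<noteq> 0" by (rule jfac_nonzero[OF \<gamma> z])
  have l: "lam z \<noteq> 0" by (rule lam_nonzero[OF z])
  have "lam (moebius \<gamma> z) = \<epsilon> * lam z / jfac \<gamma> z" using \<epsilon>(2) j by (simp add: field_simps)
  then show ?thesis
    unfolding omega_hat_def \<open>lam (moebius \<gamma> z) = _\<close>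
    using j l eps_nonzero by (simp add: power_int_minus power_divide power_mult_distrib field_simps)
qed

lemma evK_moebius:
  assumes "\<kappa> \<in> kaehlerZ_weight k"
  shows "evK (moebius \<gamma> z) \<kappa> = jfac \<gamma> z ^ 2 * \<epsilon> powi k * evK z \<kappa>"
proof -
  obtain h where h: "\<kappa> = kmult h omegaZ" "h \<in> regZ_weight (k + 2)" using assms unfolding kaehlerZ_weight_eq by blast
  have "\<epsilon> powi (k + 2) * \<epsilon> powi (- 2) = \<epsilon> powi k" using eps_nonzero by (simp flip: power_int_add)
  then have "evK (moebius \<gamma> z) \<kappa> = jfac \<gamma> z ^ 2 * (\<epsilon> powi (k + 2) * \<epsilon> powi (- 2)) * evK z \<kappa>"
    by (simp add: h(1) evK_kmult z moebius_z evK_omegaZ evR_moebius[OF h(2)] omega_hat_moebius)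
  then show ?thesis using \<open>_ = \<epsilon> powi k\<close> by simp
qed

text \<open>
  Up to the root of unity \<open>\<epsilon>\<close> the frame is invariant. The weight conditions on
  invariant sections and forms make the powers of \<open>\<epsilon>\<close> cancel.
\<close>

lemma ST_mon_moebius:
  assumes "i \<le> n"
  shows "actB n \<gamma> (ST_mon n i (moebius \<gamma> z)) = smult (\<epsilon> powi (2 * int i - int n)) (ST_mon n i z)"
proof -
  have j: "jfac \<gamma> z \<noteq> 0" by (rule jfac_nonzero[OF \<gamma> z])
  have l: "lam z \<noteq> 0" by (rule lam_nonzero[OF z])
  have S: "actB 1 \<gamma> (Sh (moebius \<gamma> z)) = smult \<epsilon> (Sh z)"
    unfolding Sh_def actB_smult frame_S_moebius[OF \<gamma> z] by (simp add: \<epsilon>(2))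
  have "1 / lam (moebius \<gamma> z) * (1 / jfac \<gamma> z) = 1 / (\<epsilon> * lam z)" by (simp flip: \<epsilon>(2))
  then have T: "actB 1 \<gamma> (Th (moebius \<gamma> z)) = smult (1 / \<epsilon>) (Th z)"
    unfolding Th_def actB_smult frame_T_moebius[OF \<gamma> z] by simp
  have "actB n \<gamma> (ST_mon n i (moebius \<gamma> z)) = (smult \<epsilon> (Sh z)) ^ i * (smult (1 / \<epsilon>) (Th z)) ^ (n - i)"
    unfolding ST_mon_def
    by (subst actB_linear_powers) (auto simp only: S T intro: degree_Sh_Th moebius_z assms \<gamma>)
  also have "\<dots> = smult (\<epsilon> ^ i * (1 / \<epsilon>) ^ (n - i)) (ST_mon n i z)"
    by (simp add: ST_mon_def power_smult mult_ac)
  finally show ?thesis unfolding powi_balanced[OF eps_nonzero assms] .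
qed

lemma pullback_moebius:
  assumes "\<theta> \<in> invariant_forms n"
  shows "actB n \<gamma> (pullback n \<theta> (moebius \<gamma> z)) = smult (jfac \<gamma> z ^ 2) (pullback n \<theta> z)"
proof -
  have "actB n \<gamma> (pullback n \<theta> (moebius \<gamma> z)) =
      (\<Sum>i\<le>n. smult (evK (moebius \<gamma> z) (coeff \<theta> i)) (actB n \<gamma> (ST_mon n i (moebius \<gamma> z))))"
    unfolding pullback_eq[OF moebius_z] actB_sum actB_smult ..
  also have "\<dots> = (\<Sum>i\<le>n. smult (jfac \<gamma> z ^ 2) (smult (evK z (coeff \<theta> i)) (ST_mon n i z)))"
  proof (rule sum.cong[OF refl])
    fix i assume "i \<in> {..n}"
    then have i: "i \<le> n" by simp
    have w: "coeff \<theta> i \<in> kaehlerZ_weight (int n - 2 * int i)" using assms i unfolding invariant_forms_def by auto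
    have "\<epsilon> powi (int n - 2 * int i) * \<epsilon> powi (2 * int i - int n) = 1"
      using eps_nonzero by (simp flip: power_int_add)
    then show "smult (evK (moebius \<gamma> z) (coeff \<theta> i)) (actB n \<gamma> (ST_mon n i (moebius \<gamma> z))) =
       smult (jfac \<gamma> z ^ 2) (smult (evK z (coeff \<theta> i)) (ST_mon n i z))"
      unfolding evK_moebius[OF w] ST_mon_moebius[OF i] by (simp add: mult_ac)
  qed
  also have "\<dots> = smult (jfac \<gamma> z ^ 2) (pullback n \<theta> z)"
    unfolding pullback_eq[OF z] smult_sum_right ..
  finally show ?thesis .
qed

lemma pullsec_moebius:
  assumes "s \<in> invariant_sections n"
  shows "actB n \<gamma> (pullsec n s (moebius \<gamma> z)) = pullsec n s z"
proof -
  have "actB n \<gamma> (pullsec n s (moebius \<gamma> z)) =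
      (\<Sum>i\<le>n. smult (evR (moebius \<gamma> z) (coeff s i)) (actB n \<gamma> (ST_mon n i (moebius \<gamma> z))))"
    unfolding pullsec_def using moebius_z by (simp add: actB_sum actB_smult)
  also have "\<dots> = (\<Sum>i\<le>n. smult (evR z (coeff s i)) (ST_mon n i z))"
  proof (rule sum.cong[OF refl])
    fix i assume "i \<in> {..n}"
    then have i: "i \<le> n" by simp
    have w: "coeff s i \<in> regZ_weight (int n - 2 * int i)" using assms i unfolding invariant_sections_def by auto
    have "\<epsilon> powi (int n - 2 * int i) * \<epsilon> powi (2 * int i - int n) = 1"
      using eps_nonzero by (simp flip: power_int_add)
    then show "smult (evR (moebius \<gamma> z) (coeff s i)) (actB n \<gamma> (ST_mon n i (moebius \<gamma> z))) =
       smult (evR z (coeff s i)) (ST_mon n i z)"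
      unfolding evR_moebius[OF w] ST_mon_moebius[OF i] by (simp add: mult_ac)
  qed
  finally show ?thesis using z by (simp add: pullsec_def)
qed

end

lemma pullback_an_forms:
  assumes "\<theta> \<in> invariant_forms n" shows "pullback n \<theta> \<in> an_forms n"
  unfolding an_forms_def
proof (intro CollectI conjI pullback_hol ballI)
  fix \<gamma> z assume *: "\<gamma> \<in> SL2Z" "z \<in> \<HH>"
  obtain \<epsilon> where \<epsilon>: "\<epsilon> ^ 12 = 1" "lam (moebius \<gamma> z) * jfac \<gamma> z = \<epsilon> * lam z" by (rule lam_moebius[OF *])
  show "smult (1 / (of_int (ec \<gamma>) * z + of_int (ed \<gamma>)) ^ 2) (actB n \<gamma> (pullback n \<theta> (moebius \<gamma> z))) = pullback n \<theta> z"
    unfolding pullback_moebius[OF * \<epsilon> assms] jfac_def[symmetric] using jfac_nonzero[OF *] by simp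
qed

lemma pullsec_an_functions:
  assumes "s \<in> invariant_sections n" shows "pullsec n s \<in> an_functions n"
  unfolding an_functions_def
proof (intro CollectI conjI pullsec_hol ballI)
  fix \<gamma> z assume *: "\<gamma> \<in> SL2Z" "z \<in> \<HH>"
  obtain \<epsilon> where \<epsilon>: "\<epsilon> ^ 12 = 1" "lam (moebius \<gamma> z) * jfac \<gamma> z = \<epsilon> * lam z" by (rule lam_moebius[OF *])
  show "actB n \<gamma> (pullsec n s (moebius \<gamma> z)) = pullsec n s z" by (rule pullsec_moebius[OF * \<epsilon> assms])
qed

section \<open>The spaces of vector-valued functions and forms\<close>

definition sF :: "complex \<Rightarrow> (complex \<Rightarrow> complex poly) \<Rightarrow> (complex \<Rightarrow> complex poly)" where
  "sF c F = (\<lambda>z. smult c (F z))"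

lemma vector_space_sF: "vector_space sF"
  by unfold_locales (simp_all add: sF_def fun_eq_iff smult_add_right smult_add_left)

interpretation FZ: vector_space sF by (rule vector_space_sF)

abbreviation "an_exact n \<equiv> deriv_an n ` an_functions n"
abbreviation "alg_forms n \<equiv> FZ.span (pullback n ` invariant_forms n)"
abbreviation "alg_exact n \<equiv> FZ.span (pullback n ` nablaZ n ` invariant_sections n)"

lemma sF_apply [simp]: "sF c F z = smult c (F z)"
  by (simp add: sF_def)

lemma fun_sum_apply: "sum f A z = (\<Sum>x\<in>A. f x z)"
  by (induction A rule: infinite_finite_induct) simp_all

lemma hol_vsub: "vsub sF (hol n)"
  unfolding vsub_def
proof (intro conjI ballI allI)
  show "0 \<in> hol n" by (simp add: hol_def)
  show "F + G \<in> hol n" if "F \<in> hol n" "G \<in> hol n" for F G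
    using that unfolding hol_def by (auto intro: degree_add_le holomorphic_on_add)
  show "- F \<in> hol n" if "F \<in> hol n" for F
    using that unfolding hol_def by (auto intro: holomorphic_on_minus)
  show "sF c F \<in> hol n" if "F \<in> hol n" for F c
    using that unfolding hol_def by (auto intro: holomorphic_intros order_trans[OF degree_smult_le])
qed

lemma actB_minus: "actB n \<gamma> (- P) = - actB n \<gamma> P"
  by (simp add: actB_cact cact_minus)

lemma actB_0 [simp]: "actB n \<gamma> 0 = 0"
  by (simp add: actB_cact)

lemma degree_actB: "degree (actB n \<gamma> P) \<le> n"
  by (simp add: actB_cact degree_cact)

lemma an_functions_vsub: "vsub sF (an_functions n)"
  using vsubD[OF hol_vsub[of n]] unfolding vsub_def an_functions_def
  by (auto simp: actB_add actB_minus actB_smult)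

lemma an_forms_vsub: "vsub sF (an_forms n)"
proof -
  have c: "smult (1 / d) (smult r P) = smult r (smult (1 / d) P)"
    for d r :: complex and P by (simp add: mult.commute)
  show ?thesis
    using vsubD[OF hol_vsub[of n]] unfolding vsub_def an_forms_def
    by (auto simp: actB_add actB_minus actB_smult smult_add_right c simp del: smult_smult)
qed

lemma an_functions_hol: "G \<in> an_functions n \<Longrightarrow> G \<in> hol n"
  by (simp add: an_functions_def)

lemma an_forms_hol: "G \<in> an_forms n \<Longrightarrow> G \<in> hol n"
  by (simp add: an_forms_def)

lemma hol_off: "G \<in> hol n \<Longrightarrow> z \<notin> \<HH> \<Longrightarrow> G z = 0"
  by (simp add: hol_def)

lemma deriv_an_off: "z \<notin> \<HH> \<Longrightarrow> deriv_an n G z = 0"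
  by (simp add: deriv_an_def)

lemma degree_deriv_an: "degree (deriv_an n G z) \<le> n"
  unfolding deriv_an_def by (auto intro!: degree_sum_le intro: order_trans[OF degree_monom_le])

lemma pder_add:
  assumes "pder F F' z" "pder G G' z" shows "pder (\<lambda>w. F w + G w) (F' + G') z"
  using assms unfolding pder_def by (auto intro: DERIV_add)

lemma deriv_an_eqI:
  assumes "\<And>z. z \<in> \<HH> \<Longrightarrow> pder G (F z) z" "\<And>z. degree (F z) \<le> n"
    "\<And>z. z \<notin> \<HH> \<Longrightarrow> F z = 0"
  shows "deriv_an n G = F"
proof
  fix z show "deriv_an n G z = F z"
    using deriv_an_pder[OF assms(1) _ assms(2)] assms(3) deriv_an_off by (cases "z \<in> \<HH>") auto
qed

lemma deriv_an_add:
  assumes "F \<in> hol n" "G \<in> hol n" shows "deriv_an n (F + G) = deriv_an n F + deriv_an n G"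
proof (rule deriv_an_eqI)
  fix z assume "z \<in> \<HH>"
  then show "pder (F + G) ((deriv_an n F + deriv_an n G) z) z"
    using pder_add[OF hol_pder[OF assms(1)] hol_pder[OF assms(2)]] by (simp add: plus_fun_def)
qed (auto intro: degree_add_le degree_deriv_an simp: deriv_an_off)

lemma deriv_an_sF:
  assumes "G \<in> hol n" shows "deriv_an n (sF c G) = sF c (deriv_an n G)"
proof (rule deriv_an_eqI)
  fix z assume "z \<in> \<HH>"
  then show "pder (sF c G) (sF c (deriv_an n G) z) z"
    using pder_smult[OF DERIV_const hol_pder[OF assms], of z c] by (simp add: sF_def)
qed (auto intro: order_trans[OF degree_smult_le] degree_deriv_an simp: deriv_an_off)

lemma deriv_an_minus:
  assumes "G \<in> hol n" shows "deriv_an n (- G) = - deriv_an n G"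
proof -
  have "sF (- 1) F = - F" for F by (simp add: fun_eq_iff)
  then show ?thesis using deriv_an_sF[OF assms, of "-1"] by simp
qed

lemma deriv_an_diff:
  assumes "F \<in> hol n" "G \<in> hol n" shows "deriv_an n (F - G) = deriv_an n F - deriv_an n G"
  using deriv_an_add[OF assms(1) vsubD(3)[OF hol_vsub assms(2)]] deriv_an_minus[OF assms(2)] by simp

lemma deriv_an_0 [simp]: "deriv_an n 0 = 0"
  by (rule deriv_an_eqI) (simp_all add: pder_const zero_fun_def)

lemma deriv_an_sum:
  assumes "\<And>x. x \<in> A \<Longrightarrow> f x \<in> hol n"
  shows "deriv_an n (sum f A) = (\<Sum>x\<in>A. deriv_an n (f x))" "sum f A \<in> hol n"
proof -
  have "deriv_an n (sum f A) = (\<Sum>x\<in>A. deriv_an n (f x)) \<and> sum f A \<in> hol n"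
    using assms
  proof (induction A rule: infinite_finite_induct)
    case (insert x A)
    then have A: "deriv_an n (sum f A) = (\<Sum>x\<in>A. deriv_an n (f x))" "sum f A \<in> hol n" "f x \<in> hol n" by blast+
    show ?case unfolding sum.insert[OF insert.hyps]
      using deriv_an_add[OF A(3,2)] vsubD(2)[OF hol_vsub A(3,2)] A(1) by metis
  qed (use vsubD(1)[OF hol_vsub] in auto)
  then show "deriv_an n (sum f A) = (\<Sum>x\<in>A. deriv_an n (f x))" "sum f A \<in> hol n" by auto
qed

lemma exact_vsub: "vsub sF (an_exact n)"
  unfolding vsub_def
proof (intro conjI ballI allI)
  note D = vsubD[OF an_functions_vsub[of n]]
  show "0 \<in> an_exact n" using D(1) deriv_an_0[of n] by (metis imageI)
  fix x assume "x \<in> an_exact n"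
  then obtain F where F: "F \<in> an_functions n" "x = deriv_an n F" by blast
  show "- x \<in> an_exact n"
    using D(3)[OF F(1)] F by (intro image_eqI[of _ _ "- F"]) (auto simp: deriv_an_minus an_functions_hol)
  show "sF c x \<in> an_exact n" for c
    using D(4)[OF F(1)] F by (intro image_eqI[of _ _ "sF c F"]) (auto simp: deriv_an_sF an_functions_hol)
  fix y assume "y \<in> an_exact n"
  then obtain G where G: "G \<in> an_functions n" "y = deriv_an n G" by blast
  show "x + y \<in> an_exact n"
    using D(2)[OF F(1) G(1)] F G by (intro image_eqI[of _ _ "F + G"]) (auto simp: deriv_an_add an_functions_hol)
qed

lemma pder_cact:
  assumes "pder G G' z" shows "pder (\<lambda>w. cact n p q r s (G w)) (cact n p q r s G') z"
proof -
  have "pder (\<lambda>w. smult (coeff (G w) i) P) (smult (coeff G' i) P + smult (coeff (G z) i) 0) z" for i P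
    using assms unfolding pder_def[of G] by (intro pder_smult pder_const) auto
  then have *: "pder (\<lambda>w. smult (coeff (G w) i) P) (smult (coeff G' i) P) z" for i P by simp
  show ?thesis unfolding cact_def by (intro pder_sum *)
qed

lemma pder_moebius:
  assumes G: "pder G G' (moebius \<gamma> z)" and \<gamma>: "\<gamma> \<in> SL2Z" and z: "z \<in> \<HH>"
  shows "pder (\<lambda>w. actB n \<gamma> (G (moebius \<gamma> w))) (smult (1 / jfac \<gamma> z ^ 2) (actB n \<gamma> G')) z"
proof -
  have "pder (\<lambda>w. G (moebius \<gamma> w)) (smult (1 / jfac \<gamma> z ^ 2) G') z"
    unfolding pder_def
  proof
    fix i
    have "((\<lambda>w. coeff (G w) i) has_field_derivative coeff G' i) (at (moebius \<gamma> z))" using G unfolding pder_def by blast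
    from DERIV_chain2[OF this moebius_has_derivative[OF \<gamma> z]]
    show "((\<lambda>w. coeff (G (moebius \<gamma> w)) i) has_field_derivative coeff (smult (1 / jfac \<gamma> z ^ 2) G') i) (at z)"
      by (simp add: mult.commute)
  qed
  from pder_cact[OF this] show ?thesis unfolding actB_smult[symmetric] unfolding actB_cact .
qed

lemma pder_unique: "pder F A z \<Longrightarrow> pder F B z \<Longrightarrow> A = B"
  unfolding pder_def by (intro poly_eqI) (blast intro: DERIV_unique)

text \<open>
  Differentiate the equation that expresses invariance; the chain rule yields the factor \<open>(cz+d)\<^sup>-\<^sup>2\<close>.
\<close>

lemma exact_an_forms: "an_exact n \<subseteq> an_forms n"
proof (rule image_subsetI)
  fix G assume G: "G \<in> an_functions n"
  note h = an_functions_hol[OF G]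
  have "deriv_an n G \<in> hol n"
  proof -
    have "deriv (\<lambda>w. coeff (G w) i) holomorphic_on \<HH>" for i
      using h by (intro holomorphic_deriv open_upper_half) (auto simp: hol_def)
    moreover have "coeff (deriv_an n G z) i = (if i \<le> n then deriv (\<lambda>w. coeff (G w) i) z else 0)" if "z \<in> \<HH>" for z i
      using that by (simp add: deriv_an_def coeff_sum)
    ultimately have "(\<lambda>z. coeff (deriv_an n G z) i) holomorphic_on \<HH>" for i
      by (cases "i \<le> n") (auto cong: holomorphic_cong)
    then show ?thesis by (simp add: hol_def degree_deriv_an deriv_an_off)
  qed
  moreover have "smult (1 / (of_int (ec \<gamma>) * z + of_int (ed \<gamma>)) ^ 2) (actB n \<gamma> (deriv_an n G (moebius \<gamma> z))) = deriv_an n G z"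
    if *: "\<gamma> \<in> SL2Z" "z \<in> \<HH>" for \<gamma> z
    unfolding jfac_def[symmetric]
  proof (rule pder_unique)
    show "pder G (deriv_an n G z) z" by (rule hol_pder[OF h *(2)])
    have "pder (\<lambda>w. actB n \<gamma> (G (moebius \<gamma> w))) (smult (1 / jfac \<gamma> z ^ 2) (actB n \<gamma> (deriv_an n G (moebius \<gamma> z)))) z"
      by (rule pder_moebius[OF hol_pder[OF h] *]) (rule moebius_upper_half[OF *])
    then show "pder G (smult (1 / jfac \<gamma> z ^ 2) (actB n \<gamma> (deriv_an n G (moebius \<gamma> z)))) z"
      by (rule pder_transform[OF _ *(2)]) (use G *(1) in \<open>simp add: an_functions_def\<close>)
  qed
  ultimately show "deriv_an n G \<in> an_forms n" by (simp add: an_forms_def)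
qed

section \<open>Coordinates in the frame\<close>

definition fr_mon :: "nat \<Rightarrow> nat \<Rightarrow> complex \<Rightarrow> complex poly" where
  "fr_mon n i z = frame_S z ^ i * frame_T z ^ (n - i)"

text \<open>
  Coordinates with respect to the monomials in the frame \<open>S, T\<close>, by the substitution inverse to the one
  that expresses \<open>S, T\<close> through \<open>a, b\<close>; its determinant is the constant \<open>-2\<pi>i\<close>.
\<close>

definition FC :: "nat \<Rightarrow> complex \<Rightarrow> complex poly \<Rightarrow> complex poly" where
  "FC n z = cact n (- (1 + rho_psi z * z) / tpi) z (- rho_psi z / tpi) 1"

lemma cact_monom: "i \<le> n \<Longrightarrow> cact n p q r s (monom c i) = smult c ([:r, s:] ^ i * [:p, q:] ^ (n - i))"
proof -
  assume i: "i \<le> n"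
  have "cact n p q r s (monom c i) = (\<Sum>j\<le>n. if j = i then smult c ([:r, s:] ^ i * [:p, q:] ^ (n - i)) else 0)"
    unfolding cact_def by (rule sum.cong) auto
  then show ?thesis using i by simp
qed

lemma fr_mon_cact:
  assumes "z \<in> \<HH>" "i \<le> n"
  shows "fr_mon n i z = cact n (- 2 * of_real pi * \<i>) (tpi * z) (- rho_psi z) (1 + rho_psi z * z) (monom 1 i)"
  unfolding cact_monom[OF assms(2)] fr_mon_def frame_S_eq[OF assms(1)] frame_T_def by simp

lemma FC_inverse:
  assumes "degree P \<le> n"
  shows "FC n z (cact n (- 2 * of_real pi * \<i>) (tpi * z) (- rho_psi z) (1 + rho_psi z * z) P) = P"
    and "cact n (- 2 * of_real pi * \<i>) (tpi * z) (- rho_psi z) (1 + rho_psi z * z) (FC n z P) = P"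
proof -
  define t where "t = - 2 * of_real pi * \<i>"
  have t: "t \<noteq> 0" "tpi = - t" by (simp_all add: t_def)
  have "t = t * (1 + rho_psi z * z) - - t * z * - rho_psi z" by (simp add: algebra_simps)
  note inv = cact_inverse[OF assms this t(1)]
  have "FC n z = cact n ((1 + rho_psi z * z) / t) (- (- t * z) / t) (- (- rho_psi z) / t) (t / t)"
  proof -
    have "- x / (- t) = x / t" for x by simp
    moreover have "- (- t * z) / t = z" "- (- rho_psi z) = rho_psi z" "t / t = 1" using t(1) by simp_all
    ultimately show ?thesis unfolding FC_def t(2) by (simp only:)
  qed
  then show "FC n z (cact n (- 2 * of_real pi * \<i>) (tpi * z) (- rho_psi z) (1 + rho_psi z * z) P) = P"
    "cact n (- 2 * of_real pi * \<i>) (tpi * z) (- rho_psi z) (1 + rho_psi z * z) (FC n z P) = P"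
    using inv unfolding t(2) t_def[symmetric] by simp_all
qed

lemma frame_expansion:
  assumes "z \<in> \<HH>" "degree P \<le> n"
  shows "P = (\<Sum>i\<le>n. smult (coeff (FC n z P) i) (fr_mon n i z))"
proof -
  have "(\<Sum>i\<le>n. smult (coeff (FC n z P) i) (fr_mon n i z)) =
     cact n (- 2 * of_real pi * \<i>) (tpi * z) (- rho_psi z) (1 + rho_psi z * z) (FC n z P)"
    unfolding fr_mon_def frame_S_eq[OF assms(1)] frame_T_def cact_def by simp
  then show ?thesis by (simp only: FC_inverse(2)[OF assms(2)])
qed

lemma degree_monom_1: "k \<le> n \<Longrightarrow> degree (monom (1::complex) k) \<le> n"
  using degree_monom_le[of "1::complex" k] by linarith

lemma FC_fr_mon:
  assumes "z \<in> \<HH>" "i \<le> n"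
  shows "FC n z (fr_mon n i z) = monom 1 i"
  unfolding fr_mon_cact[OF assms] by (rule FC_inverse(1)[OF degree_monom_1[OF assms(2)]])

lemma FC_smult: "FC n z (smult c P) = smult c (FC n z P)" by (simp add: FC_def cact_smult)
lemma FC_sum: "FC n z (sum f A) = (\<Sum>x\<in>A. FC n z (f x))" by (simp add: FC_def cact_sum)
lemma FC_0 [simp]: "FC n z 0 = 0" by (simp add: FC_def)

lemma coeff_FC_combination:
  assumes "z \<in> \<HH>" "k \<le> n"
  shows "coeff (FC n z (\<Sum>i\<le>n. smult (c i) (fr_mon n i z))) k = c k"
proof -
  have "coeff (FC n z (\<Sum>i\<le>n. smult (c i) (fr_mon n i z))) k = (\<Sum>i\<le>n. if i = k then c k else 0)"
    unfolding FC_sum FC_smult coeff_sum by (rule sum.cong) (auto simp: FC_fr_mon[OF assms(1)])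
  then show ?thesis using assms(2) by simp
qed

lemma ST_mon_fr_mon:
  assumes "z \<in> \<HH>" "i \<le> n"
  shows "ST_mon n i z = smult (lam z powi (2 * int i - int n)) (fr_mon n i z)"
proof -
  have l: "lam z \<noteq> 0" by (rule lam_nonzero[OF assms(1)])
  show ?thesis unfolding powi_balanced[OF l assms(2)] ST_mon_def fr_mon_def Sh_def Th_def
    by (simp add: power_smult mult_ac)
qed

text \<open>
  For invariant forms and sections the exponent of \<open>\<lambda>\<close> is a multiple of \<open>12\<close>, so that the
  coefficient is \<open>u\<^sup>a v\<^sup>b\<close> times a power of \<open>\<Delta>\<close>.
\<close>

lemma pullback_basis_form:
  assumes "z \<in> \<HH>" "i \<le> n"
  shows "pullback n (basis_form (i, a, b)) z = smult (tpi *
     (lam z powi (4 * int a + 6 * int b + 2 * int i - int n - 2) * (rho_u z ^ a * rho_v z ^ b))) (fr_mon n i z)"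
proof -
  have l: "lam z \<noteq> 0" by (rule lam_nonzero[OF assms(1)])
  have "lam z powi (4 * int a + 6 * int b + 2 * int i - int n - 2) =
      lam z ^ (4 * a) * lam z ^ (6 * b) / lam z ^ 2 * lam z powi (2 * int i - int n)"
  proof -
    have "4 * int a + 6 * int b + 2 * int i - int n - 2 = int (4 * a) + int (6 * b) + - int 2 + (2 * int i - int n)"
      by simp
    then show ?thesis using l
      by (simp only: power_int_add power_int_minus power_int_of_nat divide_inverse simp_thms de_Morgan_disj)
  qed
  then show ?thesis unfolding basis_form_def
    using assms by (simp add: pullback_monom ST_mon_fr_mon evK_kmult evR_monZ evK_omegaZ lift_u_def lift_v_def
      omega_hat_def power_mult_distrib mult_ac flip: power_mult)
qed

lemma pullsec_monomial:
  assumes "z \<in> \<HH>" "i \<le> n"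
  shows "pullsec n (monom (monZ a b) i) z = smult
     (lam z powi (4 * int a + 6 * int b + 2 * int i - int n) * (rho_u z ^ a * rho_v z ^ b)) (fr_mon n i z)"
proof -
  have l: "lam z \<noteq> 0" by (rule lam_nonzero[OF assms(1)])
  have "lam z powi (4 * int a + 6 * int b + 2 * int i - int n) =
      lam z ^ (4 * a) * lam z ^ (6 * b) * lam z powi (2 * int i - int n)"
  proof -
    have "4 * int a + 6 * int b + 2 * int i - int n = int (4 * a) + int (6 * b) + (2 * int i - int n)"
      by simp
    then show ?thesis using l by (simp only: power_int_add power_int_of_nat simp_thms de_Morgan_disj)
  qed
  moreover have "pullsec n (monom (monZ a b) i) z = (\<Sum>j\<le>n. if j = i then smult (evR z (monZ a b)) (ST_mon n i z) else 0)"
    using assms(1) unfolding pullsec_def if_P[OF assms(1)] by (intro sum.cong) (auto simp: evR_0_1)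
  ultimately show ?thesis
    using assms by (simp add: ST_mon_fr_mon evR_monZ lift_u_def lift_v_def power_mult_distrib mult_ac flip: power_mult)
qed

lemma lam_power_Delta:
  assumes "z \<in> \<HH>" "k = 12 * m"
  shows "lam z powi k = rho_Delta z powi (- m)"
proof -
  have "rho_Delta z \<noteq> 0" by (rule rho_Delta_nonzero[OF assms(1)])
  then have l: "lam z ^ 12 = inverse (rho_Delta z)"
    using lam_spec(2)[OF assms(1)] by (simp add: field_simps)
  have "lam z powi k = (lam z ^ 12) powi m" unfolding assms(2) by (simp add: power_int_mult)
  then show ?thesis by (simp add: l power_int_minus power_int_inverse)
qed

section \<open>Independence of the monomial forms\<close>

lemma limits_at_i_infinity:
  "((\<lambda>t. rho_u (\<i> * of_real t)) \<longlongrightarrow> 1 / 12) at_top"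
  "((\<lambda>t. rho_v (\<i> * of_real t)) \<longlongrightarrow> - 1 / 216) at_top"
  "((\<lambda>t. 1 / lam (\<i> * of_real t)) \<longlongrightarrow> 0) at_top"
proof -
  have H: "eventually (\<lambda>t. \<i> * of_real t \<in> \<HH>) at_top"
    using eventually_gt_at_top[of 0] by eventually_elim (simp add: upper_half_iff)
  have q: "((\<lambda>t. qq (\<i> * of_real t)) \<longlongrightarrow> 0) at_top"
  proof (rule tendsto_norm_zero_cancel)
    have "((\<lambda>t::real. exp (- 2 * pi * t)) \<longlongrightarrow> 0) at_top" by real_asymp
    then show "((\<lambda>t. norm (qq (\<i> * complex_of_real t))) \<longlongrightarrow> 0) at_top" by (simp add: norm_qq)
  qed
  have lim: "((\<lambda>t. f (\<i> * of_real t)) \<longlongrightarrow> g 0) at_top"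
    if g: "g holomorphic_on ball 0 1" and f: "\<And>z. z \<in> \<HH> \<Longrightarrow> f z = g (qq z)"
    for f g :: "complex \<Rightarrow> complex"
  proof -
    have "isCont g 0" using holomorphic_on_imp_continuous_on[OF g] by (simp add: continuous_on_eq_continuous_at)
    then have "((\<lambda>t. g (qq (\<i> * of_real t))) \<longlongrightarrow> g 0) at_top" using q by (rule isCont_tendsto_compose)
    then show ?thesis by (rule Lim_transform_eventually) (use H f in \<open>auto elim: eventually_mono\<close>)
  qed
  show "((\<lambda>t. rho_u (\<i> * of_real t)) \<longlongrightarrow> 1 / 12) at_top"
    using lim[OF hat_holomorphic(1) rho_hat(1)] by (simp add: hat_0)
  show "((\<lambda>t. rho_v (\<i> * of_real t)) \<longlongrightarrow> - 1 / 216) at_top"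
    using lim[OF hat_holomorphic(2) rho_hat(2)] by (simp add: hat_0)
  have "((\<lambda>t. rho_Delta (\<i> * of_real t)) \<longlongrightarrow> 0) at_top"
    using lim[OF Dhat_holomorphic rho_Delta_hat] by (simp add: Dhat_0)
  then have "((\<lambda>t. root 12 (norm (rho_Delta (\<i> * of_real t)))) \<longlongrightarrow> root 12 (norm (0::complex))) at_top"
    by (intro tendsto_real_root tendsto_norm)
  moreover have "eventually (\<lambda>t. root 12 (norm (rho_Delta (\<i> * of_real t))) = norm (1 / lam (\<i> * of_real t))) at_top"
    using H
  proof eventually_elim
    case (elim t)
    have "rho_Delta (\<i> * of_real t) = (1 / lam (\<i> * of_real t)) ^ 12"
      using lam_spec(2)[OF elim] lam_nonzero[OF elim] by (simp add: field_simps)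
    then have "norm (1 / lam (\<i> * of_real t)) ^ 12 = norm (rho_Delta (\<i> * of_real t))"
      by (simp only: norm_power)
    then show ?case by (metis norm_ge_zero real_root_power_cancel zero_less_numeral)
  qed
  ultimately have "((\<lambda>t. norm (1 / lam (\<i> * of_real t))) \<longlongrightarrow> 0) at_top"
    by (simp add: Lim_transform_eventually)
  then show "((\<lambda>t. 1 / lam (\<i> * of_real t)) \<longlongrightarrow> 0) at_top" by (rule tendsto_norm_zero_cancel)
qed

text \<open>
  On the imaginary axis \<open>\<lambda>\<close> tends to infinity, while \<open>u\<close> and \<open>v\<close> have nonzero limits. For \<open>b < 2\<close> the
  exponents \<open>4a + 6b\<close> are distinct, so the term of highest exponent dominates the others.
\<close>

lemma monomials_independent:
  fixes c :: "nat \<times> nat \<Rightarrow> complex"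
  assumes "finite J" "J \<subseteq> {(a, b). b < 2}"
    and "\<And>z. z \<in> \<HH> \<Longrightarrow>
      (\<Sum>(a, b)\<in>J. c (a, b) * (lam z ^ (4 * a + 6 * b) * (rho_u z ^ a * rho_v z ^ b))) = 0"
    and "p \<in> J"
  shows "c p = 0"
proof -
  define f :: "nat \<times> nat \<Rightarrow> nat" where "f = (\<lambda>(a, b). 4 * a + 6 * b)"
  have inj: "p = p'" if "f p = f p'" "snd p < 2" "snd p' < 2" for p p'
  proof -
    obtain a b a' b' where p: "p = (a, b)" "p' = (a', b')" by fastforce
    have "4 * a + 6 * b = 4 * a' + 6 * b'" "b < 2" "b' < 2" using that by (simp_all add: f_def p)
    then have "2 * a + 3 * b = 2 * a' + 3 * b'" "b = 0 \<or> b = 1" "b' = 0 \<or> b' = 1" by auto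
    then have "b = b' \<and> a = a'" by (elim disjE; simp; presburger)
    then show ?thesis by (simp add: p)
  qed
  define g where "g p z = rho_u z ^ fst p * rho_v z ^ snd p" for p :: "nat \<times> nat" and z
  define lim :: "nat \<times> nat \<Rightarrow> complex" where "lim p = (1 / 12) ^ fst p * (- 1 / 216) ^ snd p" for p
  have g: "((\<lambda>t. g p (\<i> * of_real t)) \<longlongrightarrow> (lim p :: complex)) at_top" for p
    unfolding g_def lim_def by (intro tendsto_mult tendsto_power limits_at_i_infinity)
  have "\<forall>p\<in>J. c p = 0"
    if "finite J" "\<forall>p\<in>J. snd p < 2" "\<forall>z\<in>\<HH>. (\<Sum>p\<in>J. c p * (lam z ^ f p * g p z)) = 0" for J
    using that
  proof (induction J rule: finite_ranking_induct[where f = f])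
    case empty
    then show ?case by simp
  next
    case (insert x S)
    show ?case
    proof (cases "x \<in> S")
      case True
      then show ?thesis using insert.IH insert.prems by (simp add: insert_absorb)
    next
      case x: False
    have z0: "(\<Sum>p\<in>insert x S. c p * ((1 / lam z) ^ (f x - f p) * g p z)) = 0" if z: "z \<in> \<HH>" for z
    proof -
      have l: "lam z \<noteq> 0" by (rule lam_nonzero[OF z])
      have "(\<Sum>p\<in>insert x S. c p * ((1 / lam z) ^ (f x - f p) * g p z)) =
          (\<Sum>p\<in>insert x S. (1 / lam z) ^ f x * (c p * (lam z ^ f p * g p z)))"
      proof (rule sum.cong[OF refl])
        fix p assume "p \<in> insert x S"
        then have "f p \<le> f x" using insert.hyps(2) by (metis insert_iff order_refl)
        then have "(1 / lam z) ^ (f x - f p) = (1 / lam z) ^ f x * lam z ^ f p"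
          using l by (simp add: power_diff power_one_over field_simps)
        then show "c p * ((1 / lam z) ^ (f x - f p) * g p z) = (1 / lam z) ^ f x * (c p * (lam z ^ f p * g p z))"
          by simp
      qed
      also have "\<dots> = 0" using insert.prems(2) z unfolding sum_distrib_left[symmetric] by simp
      finally show ?thesis .
    qed
    have "c x = 0"
    proof -
      have "((\<lambda>t. \<Sum>p\<in>insert x S. c p * ((1 / lam (\<i> * of_real t)) ^ (f x - f p) * g p (\<i> * of_real t)))
          \<longlongrightarrow> (\<Sum>p\<in>insert x S. c p * (0 ^ (f x - f p) * lim p))) at_top"
        by (intro tendsto_sum tendsto_mult tendsto_const tendsto_power limits_at_i_infinity g)
      moreover have "eventually (\<lambda>t. (\<Sum>p\<in>insert x S. c p * ((1 / lam (\<i> * of_real t)) ^ (f x - f p) * g p (\<i> * of_real t))) = 0) at_top"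
        using eventually_gt_at_top[of "0::real"] by eventually_elim (rule z0, simp add: upper_half_iff)
      ultimately have "((\<lambda>t::real. 0) \<longlongrightarrow> (\<Sum>p\<in>insert x S. c p * (0 ^ (f x - f p) * lim p))) at_top"
        by (rule Lim_transform_eventually)
      then have "(\<Sum>p\<in>insert x S. c p * (0 ^ (f x - f p) * lim p)) = 0"
        by (simp only: tendsto_const_iff[OF trivial_limit_at_top_linorder])
      moreover have "(\<Sum>p\<in>S. c p * (0 ^ (f x - f p) * lim p)) = (0::complex)"
      proof (rule sum.neutral, intro ballI)
        fix p assume p: "p \<in> S"
        have "p \<noteq> x" "snd p < 2" "snd x < 2" using insert.prems(1) p x by blast+
        then have "f p \<noteq> f x" using inj[of p x] by blast
        then have "f x - f p > 0" using insert.hyps(2)[OF p] by simp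
        then show "c p * (0 ^ (f x - f p) * lim p) = (0::complex)" by simp
      qed
      ultimately have "c x * lim x = 0" using insert.hyps x by simp
      then show ?thesis by (simp add: lim_def)
    qed
    moreover have "\<forall>p\<in>S. c p = 0"
      by (rule insert.IH) (use insert.prems insert.hyps \<open>c x = 0\<close> x in auto)
    ultimately show ?thesis by simp
    qed
  qed
  from this[of J] show ?thesis
    using assms by (auto simp: f_def g_def case_prod_unfold)
qed

lemma forms_independent:
  assumes "finite I" "I \<subseteq> form_indices n"
    and 0: "(\<Sum>m\<in>I. sF (c m) (pullback n (basis_form m))) = 0" and m: "m \<in> I"
  shows "c m = 0"
proof -
  obtain i a b where m_eq: "m = (i, a, b)" by (cases m)
  have i: "i \<le> n" using assms(2) m by (auto simp: m_eq form_indices_def)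
  define J where "J = {(a, b). (i, a, b) \<in> I}"
  have fin: "finite J" unfolding J_def
    by (rule finite_subset[of _ "snd ` I"]) (use assms(1) in \<open>force simp: image_iff\<close>)+
  define w where "w = (\<lambda>z (i, a, b). tpi *
     (lam z powi (4 * int a + 6 * int b + 2 * int i - int n - 2) * (rho_u z ^ a * rho_v z ^ b)))"
  have "(\<lambda>(a, b). c (i, a, b)) (a, b) = 0"
  proof (rule monomials_independent[OF fin])
    show "J \<subseteq> {(a, b). b < 2}" using assms(2) by (auto simp: J_def form_indices_def)
    show "(a, b) \<in> J" using m by (simp add: J_def m_eq)
    fix z assume z: "z \<in> \<HH>"
    have l: "lam z \<noteq> 0" by (rule lam_nonzero[OF z])
    have "0 = FC n z ((\<Sum>m\<in>I. sF (c m) (pullback n (basis_form m))) z)" by (simp add: 0)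
    also have "(\<Sum>m\<in>I. sF (c m) (pullback n (basis_form m))) z = (\<Sum>m\<in>I. smult (c m * w z m) (fr_mon n (fst m) z))"
        unfolding fun_sum_apply
    proof (rule sum.cong[OF refl])
      fix m assume "m \<in> I"
      then obtain j a b where "m = (j, a, b)" "j \<le> n" using assms(2) by (cases m) (auto simp: form_indices_def)
      then show "sF (c m) (pullback n (basis_form m)) z = smult (c m * w z m) (fr_mon n (fst m) z)"
        by (simp add: pullback_basis_form[OF z] w_def)
    qed
    also have "FC n z \<dots> = (\<Sum>m\<in>I. monom (c m * w z m) (fst m))"
      unfolding FC_sum FC_smult
      by (rule sum.cong) (use assms(2) in \<open>auto simp: FC_fr_mon[OF z] form_indices_def smult_monom\<close>)
    finally have "0 = coeff (\<Sum>m\<in>I. monom (c m * w z m) (fst m)) i" by simp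
    also have "\<dots> = (\<Sum>m\<in>I. if fst m = i then c m * w z m else 0)" by (simp add: coeff_sum)
    also have "\<dots> = (\<Sum>m\<in>{m\<in>I. fst m = i}. c m * w z m)"
      by (rule sum.inter_filter[symmetric]) (rule assms(1))
    also have "\<dots> = (\<Sum>p\<in>J. c (i, p) * w z (i, p))"
      by (rule sum.reindex_bij_witness[of _ "\<lambda>p. (i, p)" snd]) (auto simp: J_def)
    also have "\<dots> = tpi * lam z powi (2 * int i - int n - 2) * (\<Sum>(a, b)\<in>J. c (i, a, b) * (lam z ^ (4 * a + 6 * b) * (rho_u z ^ a * rho_v z ^ b)))"
      unfolding sum_distrib_left
    proof (rule sum.cong[OF refl], clarify)
      fix a b
      have "4 * int a + 6 * int b + 2 * int i - int n - 2 = int (4 * a + 6 * b) + (2 * int i - int n - 2)" by simp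
      then have "lam z powi (4 * int a + 6 * int b + 2 * int i - int n - 2) = lam z ^ (4 * a + 6 * b) * lam z powi (2 * int i - int n - 2)"
        using l by (simp only: power_int_add power_int_of_nat simp_thms de_Morgan_disj)
      then show "c (i, a, b) * w z (i, a, b) = tpi * lam z powi (2 * int i - int n - 2) * (c (i, a, b) * (lam z ^ (4 * a + 6 * b) * (rho_u z ^ a * rho_v z ^ b)))"
        by (simp add: w_def)
    qed
    finally show "(\<Sum>(a, b)\<in>J. (case (a, b) of (a, b) \<Rightarrow> c (i, a, b)) * (lam z ^ (4 * a + 6 * b) * (rho_u z ^ a * rho_v z ^ b))) = 0"
      using l by simp
  qed
  then show ?thesis by (simp add: m_eq)
qed

lemma basis_forms_independent:
  assumes "keys g \<subseteq> basis_form ` form_indices n" "comb sF (pullback n) g = 0"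
  shows "g = 0"
proof -
  have "\<forall>e\<in>keys g. \<exists>m. m \<in> form_indices n \<and> basis_form m = e" using assms(1) by blast
  from bchoice[OF this] obtain idx where
    idx: "\<And>e. e \<in> keys g \<Longrightarrow> idx e \<in> form_indices n \<and> basis_form (idx e) = e" by blast
  have inj: "inj_on idx (keys g)" by (rule inj_on_inverseI[of _ basis_form]) (use idx in auto)
  have "(\<Sum>m\<in>idx ` keys g. sF (lookup g (basis_form m)) (pullback n (basis_form m))) = comb sF (pullback n) g"
    unfolding comb_def sum.reindex[OF inj] by (rule sum.cong) (use idx in auto)
  then have 0: "(\<Sum>m\<in>idx ` keys g. sF (lookup g (basis_form m)) (pullback n (basis_form m))) = 0"
    using assms(2) by simp
  have "lookup g e = 0" if e: "e \<in> keys g" for e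
  proof -
    have "lookup g (basis_form (idx e)) = 0"
      by (rule forms_independent[OF _ _ 0]) (use idx e in auto)
    then show ?thesis using idx[OF e] by simp
  qed
  then show ?thesis by (intro poly_mapping_eqI) (auto simp: in_keys_iff)
qed

section \<open>Growth at the cusp\<close>

text \<open>
  Growth at most \<open>\<bar>q\<bar>\<^sup>-\<^sup>N\<close> up to powers of the height; a strip of width \<open>2\<close> contains a period.
\<close>

definition grow :: "real \<Rightarrow> (complex \<Rightarrow> complex) \<Rightarrow> bool" where
  "grow N f \<longleftrightarrow> (\<exists>C m. \<forall>z. 1 \<le> Im z \<longrightarrow> \<bar>Re z\<bar> \<le> 1 \<longrightarrow> norm (f z) \<le> C * exp (2 * pi * N * Im z) * Im z ^ m)"

lemma growE:
  assumes "grow N f"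
  obtains C m where "C \<ge> 0" "\<And>z. 1 \<le> Im z \<Longrightarrow> \<bar>Re z\<bar> \<le> 1 \<Longrightarrow> norm (f z) \<le> C * exp (2 * pi * N * Im z) * Im z ^ m"
proof -
  obtain C m where *: "\<And>z. 1 \<le> Im z \<Longrightarrow> \<bar>Re z\<bar> \<le> 1 \<Longrightarrow> norm (f z) \<le> C * exp (2 * pi * N * Im z) * Im z ^ m"
    using assms unfolding grow_def by blast
  have "0 \<le> C * exp (2 * pi * N)" using *[of \<i>] norm_ge_zero[of "f \<i>"] by (simp del: norm_ge_zero)
  then have "C \<ge> 0" by (simp add: zero_le_mult_iff)
  then show ?thesis using * that by blast
qed

lemma growI:
  assumes "\<And>z. 1 \<le> Im z \<Longrightarrow> \<bar>Re z\<bar> \<le> 1 \<Longrightarrow> norm (f z) \<le> C * exp (2 * pi * N * Im z) * Im z ^ m"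
  shows "grow N f"
  using assms unfolding grow_def by blast

lemma grow_mono:
  assumes "grow N f" "N \<le> M" shows "grow M f"
proof -
  obtain C m where C: "C \<ge> 0" and *: "\<And>z. 1 \<le> Im z \<Longrightarrow> \<bar>Re z\<bar> \<le> 1 \<Longrightarrow> norm (f z) \<le> C * exp (2 * pi * N * Im z) * Im z ^ m"
    using growE[OF assms(1)] by blast
  show ?thesis
  proof (rule growI)
    fix z assume z: "1 \<le> Im z" "\<bar>Re z\<bar> \<le> 1"
    have "C * exp (2 * pi * N * Im z) * Im z ^ m \<le> C * exp (2 * pi * M * Im z) * Im z ^ m"
      using z C assms(2) by (intro mult_right_mono mult_left_mono) auto
    then show "norm (f z) \<le> C * exp (2 * pi * M * Im z) * Im z ^ m" using *[OF z] by linarith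
  qed
qed

lemma grow_add:
  assumes "grow N f" "grow N g" shows "grow N (\<lambda>z. f z + g z)"
proof -
  obtain C m where C: "C \<ge> 0" and *: "\<And>z. 1 \<le> Im z \<Longrightarrow> \<bar>Re z\<bar> \<le> 1 \<Longrightarrow> norm (f z) \<le> C * exp (2 * pi * N * Im z) * Im z ^ m"
    using growE[OF assms(1)] by blast
  obtain D k where D: "D \<ge> 0" and **: "\<And>z. 1 \<le> Im z \<Longrightarrow> \<bar>Re z\<bar> \<le> 1 \<Longrightarrow> norm (g z) \<le> D * exp (2 * pi * N * Im z) * Im z ^ k"
    using growE[OF assms(2)] by blast
  show ?thesis
  proof (rule growI)
    fix z assume z: "1 \<le> Im z" "\<bar>Re z\<bar> \<le> 1"
    let ?e = "exp (2 * pi * N * Im z)"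
    have "Im z ^ m \<le> Im z ^ (m + k)" "Im z ^ k \<le> Im z ^ (m + k)" using z(1) by (auto intro: power_increasing)
    then have "C * ?e * Im z ^ m \<le> C * ?e * Im z ^ (m + k)" "D * ?e * Im z ^ k \<le> D * ?e * Im z ^ (m + k)"
      using C D by (auto intro: mult_left_mono)
    then have "norm (f z) + norm (g z) \<le> (C + D) * ?e * Im z ^ (m + k)"
      using *[OF z] **[OF z] by (simp add: distrib_right)
    then show "norm (f z + g z) \<le> (C + D) * ?e * Im z ^ (m + k)"
      using norm_triangle_ineq order_trans by blast
  qed
qed

lemma grow_mult:
  assumes "grow N f" "grow M g" shows "grow (N + M) (\<lambda>z. f z * g z)"
proof -
  obtain C m where C: "C \<ge> 0" and *: "\<And>z. 1 \<le> Im z \<Longrightarrow> \<bar>Re z\<bar> \<le> 1 \<Longrightarrow> norm (f z) \<le> C * exp (2 * pi * N * Im z) * Im z ^ m"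
    using growE[OF assms(1)] by blast
  obtain D k where D: "D \<ge> 0" and **: "\<And>z. 1 \<le> Im z \<Longrightarrow> \<bar>Re z\<bar> \<le> 1 \<Longrightarrow> norm (g z) \<le> D * exp (2 * pi * M * Im z) * Im z ^ k"
    using growE[OF assms(2)] by blast
  show ?thesis
  proof (rule growI)
    fix z assume z: "1 \<le> Im z" "\<bar>Re z\<bar> \<le> 1"
    have "norm (f z * g z) \<le> (C * exp (2 * pi * N * Im z) * Im z ^ m) * (D * exp (2 * pi * M * Im z) * Im z ^ k)"
      unfolding norm_mult using C z(1) by (intro mult_mono *[OF z] **[OF z]) auto
    also have "\<dots> = (C * D) * exp (2 * pi * (N + M) * Im z) * Im z ^ (m + k)"
      by (simp add: distrib_left distrib_right exp_add power_add)
    finally show "norm (f z * g z) \<le> (C * D) * exp (2 * pi * (N + M) * Im z) * Im z ^ (m + k)" .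
  qed
qed

lemma grow_mult_0: "grow N f \<Longrightarrow> grow 0 g \<Longrightarrow> grow N (\<lambda>z. f z * g z)"
  using grow_mult[of N f 0 g] by simp

lemma grow_const: "grow 0 (\<lambda>z. c)"
  by (rule growI[of _ "norm c" _ 0]) simp

lemma grow_zero: "grow N (\<lambda>z. 0)"
  by (rule growI[of _ 0 _ 0]) simp

lemma grow_sum:
  assumes "\<And>x. x \<in> A \<Longrightarrow> grow N (f x)" shows "grow N (\<lambda>z. \<Sum>x\<in>A. f x z)"
  using assms by (induction A rule: infinite_finite_induct) (simp_all add: grow_zero grow_add)

lemma grow_id: "grow 0 (\<lambda>z. z)"
proof (rule growI[of _ 2 _ 1])
  fix z assume "1 \<le> Im z" "\<bar>Re z\<bar> \<le> 1"
  then show "norm z \<le> 2 * exp (2 * pi * 0 * Im z) * Im z ^ 1" using cmod_le[of z] by simp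
qed

lemma grow_qexp:
  assumes "g holomorphic_on ball 0 1" "\<And>z. z \<in> \<HH> \<Longrightarrow> f z = g (qq z)"
  shows "grow 0 f"
proof -
  obtain B where B: "B \<ge> 0" "\<And>z. Im z \<ge> 1 \<Longrightarrow> norm (g (qq z)) \<le> B" using modform_bounded[OF assms(1)] by blast
  show ?thesis by (rule growI[of _ B _ 0]) (use B(2) assms(2) in \<open>simp add: upper_half_iff\<close>)
qed

lemma grow_rho: "grow 0 rho_u" "grow 0 rho_v" "grow 0 rho_psi"
proof -
  show "grow 0 rho_u" "grow 0 rho_v" using grow_qexp hat_holomorphic rho_hat by blast+
  show "grow 0 rho_psi" using rho_psi_qexp grow_qexp by blast
qed

text \<open>
  Powers of \<open>\<Delta>\<close> with exponents of either sign are controlled by the bounds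
  \<open>\<bar>q\<bar>/4 \<le> \<bar>\<Delta>\<bar> \<le> 2 \<bar>q\<bar>\<close>.
\<close>

lemma grow_Delta: "grow (real_of_int m) (\<lambda>z. rho_Delta z powi (- m))"
proof (rule growI[of _ "4 ^ nat \<bar>m\<bar>" _ 0])
  fix z assume z: "1 \<le> Im z" "\<bar>Re z\<bar> \<le> 1"
  have b: "norm (rho_Delta z) \<ge> norm (qq z) / 4" "norm (rho_Delta z) \<le> 2 * norm (qq z)"
    using rho_Delta_bounds[of z] z(1) sqrt3_half_less_1 by linarith+
  define k where "k = nat \<bar>m\<bar>"
  have e: "exp (2 * pi * real k * Im z) = exp (2 * pi * Im z) ^ k" by (simp flip: exp_of_nat_mult add: mult_ac)
  have q: "norm (qq z) = inverse (exp (2 * pi * Im z))" by (simp add: norm_qq exp_minus)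
  show "norm (rho_Delta z powi (- m)) \<le> 4 ^ nat \<bar>m\<bar> * exp (2 * pi * real_of_int m * Im z) * Im z ^ 0"
  proof (cases "m \<ge> 0")
    case True
    then have m: "m = int k" by (simp add: k_def)
    have "0 < norm (qq z) / 4" by simp
    then have "inverse (norm (rho_Delta z)) \<le> inverse (norm (qq z) / 4)" using b(1) by (intro le_imp_inverse_le)
    also have "\<dots> = 4 * exp (2 * pi * Im z)" unfolding q by (simp add: field_simps)
    finally have "inverse (norm (rho_Delta z)) ^ k \<le> (4 * exp (2 * pi * Im z)) ^ k" by (intro power_mono) auto
    then show ?thesis by (simp add: m power_int_minus norm_inverse norm_power power_inverse power_mult_distrib e)
  next
    case False
    then have m: "m = - int k" by (simp add: k_def)
    have "norm (rho_Delta z) ^ k \<le> (2 * norm (qq z)) ^ k" by (intro power_mono b) auto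
    also have "\<dots> \<le> (4 * norm (qq z)) ^ k" by (intro power_mono) auto
    finally show ?thesis by (simp add: m norm_power power_mult_distrib q power_inverse exp_minus e)
  qed
qed

text \<open>
  Integration from height \<open>1\<close> along a vertical segment multiplies a bound by at most the height,
  which the polynomial factor in the definition of the growth condition absorbs.
\<close>

lemma grow_primitive:
  assumes G: "G \<in> hol n" and N: "N \<ge> 0" and D: "grow N (\<lambda>z. coeff (deriv_an n G z) k)"
  shows "grow N (\<lambda>z. coeff (G z) k)"
proof -
  let ?g = "\<lambda>z. coeff (G z) k"
  obtain C m where C: "C \<ge> 0" and *: "\<And>z. 1 \<le> Im z \<Longrightarrow> \<bar>Re z\<bar> \<le> 1 \<Longrightarrow>
      norm (coeff (deriv_an n G z) k) \<le> C * exp (2 * pi * N * Im z) * Im z ^ m"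
    using growE[OF D] by blast
  have der: "(?g has_field_derivative coeff (deriv_an n G z) k) (at z)" if "z \<in> \<HH>" for z
    using hol_pder[OF G that] unfolding pder_def by blast
  have hg: "?g holomorphic_on \<HH>" using G by (simp add: hol_def)
  have "compact (?g ` closed_segment (\<i> - 1) (\<i> + 1))"
  proof (intro compact_continuous_image holomorphic_on_imp_continuous_on holomorphic_on_subset[OF hg] compact_segment)
    show "closed_segment (\<i> - 1) (\<i> + 1) \<subseteq> \<HH>"
      by (rule closed_segment_subset[OF _ _ convex_upper_half]) (simp_all add: upper_half_iff)
  qed
  then obtain B where B: "\<And>z. z \<in> closed_segment (\<i> - 1) (\<i> + 1) \<Longrightarrow> norm (?g z) \<le> B"
    by (meson bounded_iff compact_imp_bounded imageI)
  have B0: "B \<ge> 0" using B[of "\<i> - 1"] norm_ge_zero[of "?g (\<i> - 1)"] by (simp del: norm_ge_zero)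
  show ?thesis
  proof (rule growI)
    fix z assume z: "1 \<le> Im z" "\<bar>Re z\<bar> \<le> 1"
    define w where "w = Complex (Re z) 1"
    let ?M = "C * exp (2 * pi * N * Im z) * Im z ^ m"
    have S: "1 \<le> Im x \<and> Im x \<le> Im z \<and> Re x = Re z" if "x \<in> closed_segment w z" for x
    proof -
      have "\<exists>u\<ge>0. u \<le> 1 \<and> x = (1 - u) *\<^sub>R w + u *\<^sub>R z" using that by (auto simp: in_segment)
      then obtain u where u: "0 \<le> u" "u \<le> 1" and x: "x = (1 - u) *\<^sub>R w + u *\<^sub>R z" by blast
      have "Im x = 1 + u * (Im z - 1)" "Re x = Re z" by (simp_all add: x w_def algebra_simps)
      moreover have "0 \<le> u * (Im z - 1)" "u * (Im z - 1) \<le> 1 * (Im z - 1)"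
        using u z mult_right_mono[of u 1 "Im z - 1"] by auto
      ultimately show ?thesis by simp
    qed
    have "norm (?g z - ?g w) \<le> ?M * norm (z - w)"
    proof (rule field_differentiable_bound[of "closed_segment w z"])
      fix x assume "x \<in> closed_segment w z"
      note x = S[OF this]
      then have xH: "x \<in> \<HH>" by (simp add: upper_half_iff)
      show "(?g has_field_derivative coeff (deriv_an n G x) k) (at x within closed_segment w z)"
        using der[OF xH] by (rule has_field_derivative_at_within)
      have "C * exp (2 * pi * N * Im x) * Im x ^ m \<le> C * exp (2 * pi * N * Im z) * Im z ^ m"
        using x C N by (intro mult_mono power_mono) (auto intro: mult_left_mono)
      then show "norm (coeff (deriv_an n G x) k) \<le> ?M" using *[of x] x z by simp
    qed auto
    also have "norm (z - w) = Im z - 1" using z by (simp add: w_def cmod_def)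
    also have "?M * (Im z - 1) \<le> C * exp (2 * pi * N * Im z) * Im z ^ Suc m - 0"
      using C z by (simp add: mult_ac) (intro mult_left_mono, auto)
    finally have 1: "norm (?g z - ?g w) \<le> C * exp (2 * pi * N * Im z) * Im z ^ Suc m" by simp
    have "w \<in> closed_segment (\<i> - 1) (\<i> + 1)"
      unfolding in_segment
      by (rule exI[of _ "(Re z + 1) / 2"]) (use z in \<open>auto simp: complex_eq_iff w_def field_simps\<close>)
    then have 2: "norm (?g w) \<le> B" by (rule B)
    have "1 * 1 \<le> exp (2 * pi * N * Im z) * Im z ^ Suc m" using z N by (intro mult_mono one_le_power) auto
    then have 3: "B \<le> B * (exp (2 * pi * N * Im z) * Im z ^ Suc m)" using B0 mult_left_mono[of 1 _ B] by simp
    have "norm (?g z) \<le> norm (?g z - ?g w) + norm (?g w)" using norm_triangle_ineq[of "?g z - ?g w" "?g w"] by simp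
    also have "\<dots> \<le> (C + B) * exp (2 * pi * N * Im z) * Im z ^ Suc m"
      using 1 2 3 by (simp add: distrib_right mult.assoc)
    finally show "norm (?g z) \<le> (C + B) * exp (2 * pi * N * Im z) * Im z ^ Suc m" .
  qed
qed

section \<open>Functions with algebraic derivative are algebraic\<close>

definition gpoly :: "real \<Rightarrow> (complex \<Rightarrow> complex poly) \<Rightarrow> bool" where
  "gpoly N F \<longleftrightarrow> (\<forall>k. grow N (\<lambda>z. coeff (F z) k))"

lemma gpoly_mult: "gpoly N F \<Longrightarrow> gpoly M G \<Longrightarrow> gpoly (N + M) (\<lambda>z. F z * G z)"
  unfolding gpoly_def coeff_mult by (intro allI grow_sum grow_mult) auto

lemma gpoly_const: "gpoly 0 (\<lambda>z. P)"
  unfolding gpoly_def by (simp add: grow_const)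

lemma gpoly_power: "gpoly 0 F \<Longrightarrow> gpoly 0 (\<lambda>z. F z ^ k)"
proof (induction k)
  case (Suc k)
  then show ?case using gpoly_mult[of 0 F 0] by simp
qed (simp add: gpoly_const)

lemma gpoly_linear:
  assumes "grow 0 f" "grow 0 g" shows "gpoly 0 (\<lambda>z. [:f z, g z:])"
  unfolding gpoly_def
proof
  fix k show "grow 0 (\<lambda>z. coeff [:f z, g z:] k)"
    by (cases k; cases "k - 1") (use assms grow_zero in \<open>auto simp: coeff_pCons split: nat.splits\<close>)
qed

lemma gpoly_smult: "grow N f \<Longrightarrow> gpoly M G \<Longrightarrow> gpoly (N + M) (\<lambda>z. smult (f z) (G z))"
  unfolding gpoly_def by (simp add: grow_mult)

lemma gpoly_sum: "(\<And>x. x \<in> A \<Longrightarrow> gpoly N (F x)) \<Longrightarrow> gpoly N (\<lambda>z. \<Sum>x\<in>A. F x z)"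
  unfolding gpoly_def coeff_sum by (intro allI grow_sum) auto

lemma gpoly_cong:
  assumes "\<And>z. z \<in> \<HH> \<Longrightarrow> F z = G z" "gpoly N G" shows "gpoly N F"
proof -
  have "F z = G z" if "1 \<le> Im z" for z using assms(1) that by (simp add: upper_half_iff)
  then show ?thesis using assms(2) unfolding gpoly_def grow_def by simp
qed

lemma gpoly_fr_mon: "gpoly 0 (fr_mon n i)"
proof (rule gpoly_cong)
  fix z assume z: "z \<in> \<HH>"
  show "fr_mon n i z = [:- 1 * rho_psi z, 1 + rho_psi z * z:] ^ i * [:- 2 * of_real pi * \<i>, tpi * z:] ^ (n - i)"
    by (simp add: fr_mon_def frame_S_eq[OF z] frame_T_def)
next
  have "gpoly (0 + 0) (\<lambda>z. [:- 1 * rho_psi z, 1 + rho_psi z * z:] ^ i * [:- 2 * of_real pi * \<i>, tpi * z:] ^ (n - i))"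
    by (intro gpoly_mult gpoly_power gpoly_linear grow_add grow_mult_0 grow_const grow_id grow_rho)
  then show "gpoly 0 (\<lambda>z. [:- 1 * rho_psi z, 1 + rho_psi z * z:] ^ i * [:- 2 * of_real pi * \<i>, tpi * z:] ^ (n - i))"
    by simp
qed

lemma grow_power: "grow 0 f \<Longrightarrow> grow 0 (\<lambda>z. f z ^ k)"
proof (induction k)
  case (Suc k)
  then show ?case using grow_mult[of 0 f 0] by simp
qed (simp add: grow_const)

text \<open>
  The pole order at the cusp is the exponent of \<open>1/\<Delta>\<close> in the coefficient, that is, a twelfth of
  \<open>4a + 6b + 2i - n - 2\<close> for forms and of \<open>4a + 6b + 2i - n\<close> for sections.
\<close>

definition form_indices_le :: "nat \<Rightarrow> nat \<Rightarrow> (nat \<times> nat \<times> nat) set" where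
  "form_indices_le n N = {(i, a, b) \<in> form_indices n. 4 * a + 6 * b + 2 * i \<le> 12 * N + n + 2}"

definition section_indices_le :: "nat \<Rightarrow> nat \<Rightarrow> (nat \<times> nat \<times> nat) set" where
  "section_indices_le n N = {(i, a, b). i \<le> n \<and> b < 2 \<and>
     (4 * int a + 6 * int b) mod 12 = (int n - 2 * int i) mod 12 \<and> 4 * a + 6 * b + 2 * i \<le> 12 * N + n}"

definition basis_section :: "nat \<times> nat \<times> nat \<Rightarrow> regZ poly" where
  "basis_section = (\<lambda>(i, a, b). monom (monZ a b) i)"

abbreviation "forms_le n N \<equiv> FZ.span ((\<lambda>m. pullback n (basis_form m)) ` form_indices_le n N)"
abbreviation "sections_le n N \<equiv> FZ.span ((\<lambda>m. pullsec n (basis_section m)) ` section_indices_le n N)"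

lemma basis_section_invariant: "basis_section ` section_indices_le n N \<subseteq> invariant_sections n"
proof (clarsimp simp: section_indices_le_def basis_section_def)
  fix i a b assume *: "i \<le> n" "(4 * int a + 6 * int b) mod 12 = (int n - 2 * int i) mod 12"
  show "monom (monZ a b) i \<in> invariant_sections n"
    using *(1) monZ_weight[OF *(2)] vsubD(1)[OF regZ_weight_vsub] unfolding invariant_sections_def
    by (auto intro: order_trans[OF degree_monom_le])
qed

lemma gpoly_basis_form:
  assumes m: "m \<in> form_indices_le n N" shows "gpoly (real N) (pullback n (basis_form m))"
proof -
  obtain i a b where m_eq: "m = (i, a, b)" by (cases m)
  have i: "i \<le> n" and w: "(4 * int a + 6 * int b) mod 12 = (int n - 2 * int i + 2) mod 12"
    and le: "4 * a + 6 * b + 2 * i \<le> 12 * N + n + 2"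
    using m by (auto simp: m_eq form_indices_le_def form_indices_def)
  have "12 dvd (4 * int a + 6 * int b) - (int n - 2 * int i + 2)" using w by (simp only: mod_eq_dvd_iff)
  then obtain e where e: "(4 * int a + 6 * int b) - (int n - 2 * int i + 2) = 12 * e" by (elim dvdE)
  have eN: "e \<le> int N" using e le by linarith
  show ?thesis
  proof (rule gpoly_cong)
    fix z assume z: "z \<in> \<HH>"
    have "lam z powi (4 * int a + 6 * int b + 2 * int i - int n - 2) = rho_Delta z powi (- e)"
      by (rule lam_power_Delta[OF z]) (use e in simp)
    then show "pullback n (basis_form m) z = smult
       (rho_Delta z powi (- e) * (tpi * (rho_u z ^ a * rho_v z ^ b))) (fr_mon n i z)"
      unfolding m_eq pullback_basis_form[OF z i] by (simp add: mult_ac)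
  next
    have "grow (real_of_int e) (\<lambda>z. rho_Delta z powi (- e) * (tpi * (rho_u z ^ a * rho_v z ^ b)))"
      by (intro grow_mult_0 grow_Delta grow_const grow_power grow_rho)
    then have "grow (real N) (\<lambda>z. rho_Delta z powi (- e) * (tpi * (rho_u z ^ a * rho_v z ^ b)))"
      by (rule grow_mono) (use eN in linarith)
    from gpoly_smult[OF this gpoly_fr_mon[of n i]]
    show "gpoly (real N) (\<lambda>z. smult
       (rho_Delta z powi (- e) * (tpi * (rho_u z ^ a * rho_v z ^ b))) (fr_mon n i z))" by simp
  qed
qed

lemma gpoly_span:
  assumes "F \<in> forms_le n N"
  shows "gpoly (real N) F"
  using assms
proof (induction rule: FZ.span_induct_alt)
  case base
  show ?case by (simp add: gpoly_def grow_zero)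
next
  case (step c x y)
  then obtain m where m: "m \<in> form_indices_le n N" "x = pullback n (basis_form m)" by blast
  have "grow (real N) (\<lambda>z. coeff (x z) k * c)" "grow (real N) (\<lambda>z. coeff (y z) k)" for k
    using gpoly_basis_form[OF m(1)] step.IH unfolding m(2)[symmetric] gpoly_def by (auto intro: grow_mult_0 grow_const)
  from grow_add[OF this] show ?case unfolding gpoly_def by (simp add: mult.commute)
qed

text \<open>
  The frame vectors \<open>S\<close> and \<open>T\<close> are multiplied by \<open>cz + d\<close> and its inverse, the coordinates of an
  invariant function by the reciprocal factors.
\<close>

lemma frame_coeff_modular:
  assumes "G \<in> an_functions n" "i \<le> n"
  shows "modular (int n - 2 * int i) (\<lambda>z. coeff (FC n z (G z)) i)"
  unfolding modular_def
proof (intro ballI)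
  fix \<gamma> z assume *: "\<gamma> \<in> SL2Z" "z \<in> \<HH>"
  let ?w = "moebius \<gamma> z"
  have w: "?w \<in> \<HH>" by (rule moebius_upper_half[OF *])
  have j: "jfac \<gamma> z \<noteq> 0" by (rule jfac_nonzero[OF *])
  define c where "c k = coeff (FC n ?w (G ?w)) k" for k
  have deg: "degree (frame_S x) \<le> 1" "degree (frame_T x) \<le> 1" if "x \<in> \<HH>" for x
    using that by (simp_all add: frame_S_eq frame_T_def)
  have f: "actB n \<gamma> (fr_mon n k ?w) = smult (jfac \<gamma> z powi (2 * int k - int n)) (fr_mon n k z)" if k: "k \<le> n" for k
  proof -
    show ?thesis unfolding fr_mon_def powi_balanced[OF j k]
      by (subst actB_linear_powers[OF deg[OF w] k *(1)])
        (simp add: frame_S_moebius[OF *] frame_T_moebius[OF *] power_smult mult_ac del: One_nat_def)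
  qed
  have "G z = actB n \<gamma> (G ?w)" using assms(1) * unfolding an_functions_def by simp
  also have "G ?w = (\<Sum>k\<le>n. smult (c k) (fr_mon n k ?w))"
    unfolding c_def by (rule frame_expansion[OF w]) (rule hol_degree[OF an_functions_hol[OF assms(1)]])
  also have "actB n \<gamma> \<dots> = (\<Sum>k\<le>n. smult (c k * jfac \<gamma> z powi (2 * int k - int n)) (fr_mon n k z))"
    unfolding actB_sum actB_smult by (rule sum.cong) (auto simp: f)
  finally have "coeff (FC n z (G z)) i = c i * jfac \<gamma> z powi (2 * int i - int n)"
    using coeff_FC_combination[OF *(2) assms(2)] by metis
  moreover have "jfac \<gamma> z powi (2 * int i - int n) * jfac \<gamma> z powi (int n - 2 * int i) = 1"
    using j by (simp flip: power_int_add)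
  ultimately show "coeff (FC n ?w (G ?w)) i = jfac \<gamma> z powi (int n - 2 * int i) * coeff (FC n z (G z)) i"
    by (simp add: c_def mult.commute)
qed

lemma FC_expand:
  "FC n z P = (\<Sum>k\<le>n. smult (coeff P k)
     ([:- rho_psi z / tpi, 1:] ^ k * [:- (1 + rho_psi z * z) / tpi, z:] ^ (n - k)))"
  by (simp add: FC_def cact_def)

lemma frame_coeff_holomorphic:
  assumes "G \<in> hol n" shows "(\<lambda>z. coeff (FC n z (G z)) i) holomorphic_on \<HH>"
proof -
  have "\<exists>D. pder (\<lambda>z. FC n z (G z)) D z" if z: "z \<in> \<HH>" for z
  proof -
    have psi: "(rho_psi has_field_derivative deriv rho_psi z) (at z)"
      by (rule holomorphic_derivI[OF rho_psi_holomorphic open_upper_half z])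
    obtain A where A: "pder (\<lambda>z. [:- rho_psi z / tpi, 1:]) A z"
    proof (rule that[OF pder_linear])
      show "((\<lambda>z. - rho_psi z / tpi) has_field_derivative - deriv rho_psi z / tpi) (at z)"
        by (intro DERIV_cdivide DERIV_minus psi)
    qed (rule DERIV_const)
    obtain B where B: "pder (\<lambda>z. [:- (1 + rho_psi z * z) / tpi, z:]) B z"
    proof (rule that[OF pder_linear])
      show "((\<lambda>z. - (1 + rho_psi z * z) / tpi) has_field_derivative - (0 + (rho_psi z * 1 + deriv rho_psi z * z)) / tpi) (at z)"
        by (intro DERIV_cdivide DERIV_minus DERIV_add DERIV_const DERIV_mult' psi DERIV_ident)
    qed (rule DERIV_ident)
    have c: "((\<lambda>z. coeff (G z) k) has_field_derivative coeff (deriv_an n G z) k) (at z)" for k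
      using hol_pder[OF assms z] unfolding pder_def by blast
    have "\<exists>M. pder (\<lambda>z. [:- rho_psi z / tpi, 1:] ^ k * [:- (1 + rho_psi z * z) / tpi, z:] ^ (n - k)) M z" for k
      using pder_mult[OF pder_power[OF A] pder_power[OF B]] by blast
    then have "\<forall>k. \<exists>M. pder (\<lambda>z. [:- rho_psi z / tpi, 1:] ^ k * [:- (1 + rho_psi z * z) / tpi, z:] ^ (n - k)) M z" by blast
    from choice[OF this] obtain M where
      M: "\<And>k. pder (\<lambda>z. [:- rho_psi z / tpi, 1:] ^ k * [:- (1 + rho_psi z * z) / tpi, z:] ^ (n - k)) (M k) z"
      by blast
    show ?thesis unfolding FC_expand by (rule exI, rule pder_sum, rule pder_smult[OF c M])
  qed
  then show ?thesis unfolding holomorphic_on_open[OF open_upper_half] pder_def by blast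
qed

lemma frame_coeff_grow:
  assumes "gpoly N G" shows "grow N (\<lambda>z. coeff (FC n z (G z)) i)"
proof -
  have c: "grow N (\<lambda>z. coeff (G z) k)" for k using assms unfolding gpoly_def by blast
  have e: "[:- rho_psi z / tpi, 1:] = [:rho_psi z * (- 1 / tpi), 1:]"
    "[:- (1 + rho_psi z * z) / tpi, z:] = [:(1 + rho_psi z * z) * (- 1 / tpi), z:]" for z
    by (simp_all add: diff_divide_distrib add_divide_distrib)
  have "gpoly (N + (0 + 0)) (\<lambda>z. FC n z (G z))"
    unfolding FC_expand e
    by (intro gpoly_sum gpoly_smult c gpoly_mult gpoly_power gpoly_linear grow_mult_0 grow_add grow_const grow_id grow_rho)
  then show ?thesis unfolding gpoly_def by simp
qed

lemma section_of_modform: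
  assumes f: "modform (int n - 2 * int i + 12 * int N) f" and i: "i \<le> n"
  shows "(\<lambda>z. if z \<in> \<HH> then smult (f z * rho_Delta z powi (- int N)) (fr_mon n i z) else 0)
     \<in> sections_le n N" (is "?X f \<in> ?W")
proof -
  have "modform_closed (int n - 2 * int i + 12 * int N) (\<lambda>f. ?X f \<in> ?W)"
    unfolding modform_closed_def
  proof (intro conjI allI impI)
    fix f g assume "\<forall>z\<in>\<HH>. f z = g z" "?X f \<in> ?W"
    moreover from this(1) have "?X f = ?X g" by (auto simp: fun_eq_iff)
    ultimately show "?X g \<in> ?W" by simp
  next
    have "?X (\<lambda>z. 0) = 0" by (auto simp: fun_eq_iff)
    then show "?X (\<lambda>z. 0) \<in> ?W" using FZ.span_zero by metis
  next
    fix f g assume "?X f \<in> ?W" "?X g \<in> ?W"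
    then have "?X f + ?X g \<in> ?W" by (rule FZ.span_add)
    moreover have "?X f + ?X g = ?X (\<lambda>z. f z + g z)" by (auto simp: fun_eq_iff smult_add_left distrib_right)
    ultimately show "?X (\<lambda>z. f z + g z) \<in> ?W" by simp
  next
    fix a b e :: nat and c :: complex assume b: "b < 2" and e: "4 * int a + 6 * int b + 12 * int e = int n - 2 * int i + 12 * int N"
    have m: "(4 * int a + 6 * int b) mod 12 = (int n - 2 * int i) mod 12"
    proof -
      have "(4 * int a + 6 * int b) - (int n - 2 * int i) = 12 * (int N - int e)" using e by simp
      then show ?thesis unfolding mod_eq_dvd_iff by simp
    qed
    have mem: "(i, a, b) \<in> section_indices_le n N" unfolding section_indices_le_def using i b m e by simp
    have "?X (\<lambda>z. c * uvD a b e z) = sF c (pullsec n (basis_section (i, a, b)))"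
    proof
      fix z
      show "?X (\<lambda>z. c * uvD a b e z) z = sF c (pullsec n (basis_section (i, a, b))) z"
      proof (cases "z \<in> \<HH>")
        case True
        have D: "rho_Delta z \<noteq> 0" by (rule rho_Delta_nonzero[OF True])
        have "lam z powi (4 * int a + 6 * int b + 2 * int i - int n) = rho_Delta z powi (- (int N - int e))"
          by (rule lam_power_Delta[OF True]) (use e in simp)
        also have "- (int N - int e) = int e + - int N" by simp
        also have "rho_Delta z powi (int e + - int N) = rho_Delta z ^ e * rho_Delta z powi (- int N)"
          using D by (subst power_int_add) auto
        finally show ?thesis using True
          by (simp add: basis_section_def pullsec_monomial[OF True i] uvD_def mult_ac)
      qed (simp add: pullsec_def)
    qed
    moreover have "sF c (pullsec n (basis_section (i, a, b))) \<in> ?W"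
      by (intro FZ.span_scale FZ.span_base) (use mem in blast)
    ultimately show "?X (\<lambda>z. c * uvD a b e z) \<in> ?W" by simp
  qed
  from modform_induct[OF f this] show ?thesis .
qed

text \<open>
  An invariant function with algebraic derivative grows no faster at the cusp than its derivative, so
  its coordinates in the frame become modular forms after multiplication with a power of \<open>\<Delta>\<close>.
\<close>

theorem algebraic_primitive:
  assumes G: "G \<in> an_functions n"
    and D: "deriv_an n G \<in> forms_le n N"
  shows "G \<in> sections_le n N"
proof -
  note h = an_functions_hol[OF G]
  have "gpoly (real N) G"
    using gpoly_span[OF D] grow_primitive[OF h, of "real N"] unfolding gpoly_def by simp
  define c where "c i z = coeff (FC n z (G z)) i" for i z
  have cg: "grow (real N) (c i)" for i
    unfolding c_def by (rule frame_coeff_grow[OF \<open>gpoly (real N) G\<close>])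
  have mf: "modform (int n - 2 * int i + 12 * int N) (\<lambda>z. c i z * rho_Delta z ^ N)" if i: "i \<le> n" for i
  proof -
    have "grow (real N + real_of_int (- int N)) (\<lambda>z. c i z * rho_Delta z powi (- (- int N)))"
      by (rule grow_mult[OF cg grow_Delta])
    then have "grow 0 (\<lambda>z. c i z * rho_Delta z ^ N)" by simp
    then obtain C m where "\<And>z. 1 \<le> Im z \<Longrightarrow> \<bar>Re z\<bar> \<le> 1 \<Longrightarrow> norm (c i z * rho_Delta z ^ N) \<le> C * exp (2 * pi * 0 * Im z) * Im z ^ m"
      unfolding grow_def by blast
    then have *: "\<And>z. Im z \<ge> 1 \<Longrightarrow> \<bar>Re z\<bar> \<le> 1 \<Longrightarrow> norm (c i z * rho_Delta z ^ N) \<le> C * Im z ^ m" by simp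
    show ?thesis
    proof (rule modformI_poly[OF _ _ *])
      show "(\<lambda>z. c i z * rho_Delta z ^ N) holomorphic_on \<HH>"
        unfolding c_def by (intro holomorphic_intros frame_coeff_holomorphic[OF h] rho_Delta_holomorphic)
      show "modular (int n - 2 * int i + 12 * int N) (\<lambda>z. c i z * rho_Delta z ^ N)"
        unfolding c_def by (intro modular_mult frame_coeff_modular[OF G i] modular_power rho_Delta_modular)
    qed
  qed
  define X where "X i = (\<lambda>z. if z \<in> \<HH> then smult (c i z * rho_Delta z ^ N * rho_Delta z powi (- int N)) (fr_mon n i z) else 0)" for i
  have "(\<Sum>i\<le>n. X i) \<in> sections_le n N"
    unfolding X_def by (intro FZ.span_sum section_of_modform mf) auto
  also have "(\<Sum>i\<le>n. X i) = G"
  proof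
    fix z show "(\<Sum>i\<le>n. X i) z = G z"
    proof (cases "z \<in> \<HH>")
      case True
      have D: "rho_Delta z \<noteq> 0" by (rule rho_Delta_nonzero[OF True])
      have "(\<Sum>i\<le>n. X i) z = (\<Sum>i\<le>n. smult (coeff (FC n z (G z)) i) (fr_mon n i z))"
        unfolding fun_sum_apply X_def using True D by (intro sum.cong) (auto simp: c_def power_int_minus mult.assoc)
      also have "\<dots> = G z" by (rule frame_expansion[OF True hol_degree[OF h], symmetric])
      finally show ?thesis .
    next
      case False
      then show ?thesis using hol_off[OF h False] by (simp add: fun_sum_apply X_def)
    qed
  qed
  finally show ?thesis .
qed

lemma form_in_bounded_span:
  assumes "F \<in> alg_forms n"
  obtains N where "F \<in> forms_le n N"
proof -
  let ?W = "\<lambda>N. forms_le n N"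
  have mono: "?W N \<subseteq> ?W M" if "N \<le> M" for N M
    by (intro FZ.span_mono image_mono) (use that in \<open>auto simp: form_indices_le_def\<close>)
  have 1: "\<exists>N. pullback n \<theta> \<in> ?W N" if "\<theta> \<in> KZ.span (basis_form ` form_indices n)" for \<theta>
    using that
  proof (induction rule: KZ.span_induct_alt)
    case base
    have "pullback n 0 = 0" by (simp add: fun_eq_iff pullback_0)
    then show ?case using FZ.span_zero by metis
  next
    case (step c x y)
    then obtain m N where m: "m \<in> form_indices n" "x = basis_form m" and N: "pullback n y \<in> ?W N" by blast
    define M where "M = (case m of (i, a, b) \<Rightarrow> 4 * a + 6 * b + 2 * i)"
    have "m \<in> form_indices_le n (max M N)"

    proof -
      have "M \<le> 12 * max M N + n + 2" by simp
      then show ?thesis using m(1) unfolding form_indices_le_def M_def[symmetric] by (cases m) (auto simp: M_def)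
    qed
    then have "pullback n x \<in> ?W (max M N)" unfolding m(2) by (intro FZ.span_base) blast
    moreover have "pullback n y \<in> ?W (max M N)" using mono[of N "max M N"] N by auto
    ultimately have "sF (of_rat c) (pullback n x) + pullback n y \<in> ?W (max M N)"
      by (intro FZ.span_add FZ.span_scale)
    moreover have "pullback n (sK c x + y) = sF (of_rat c) (pullback n x) + pullback n y"
      by (simp add: fun_eq_iff pullback_add pullback_sK)
    ultimately show ?case by metis
  qed
  have "\<exists>N. F \<in> ?W N" using assms
  proof (induction rule: FZ.span_induct_alt)
    case base
    then show ?case using FZ.span_zero by metis
  next
    case (step c x y)
    then obtain \<theta> N where \<theta>: "\<theta> \<in> invariant_forms n" "x = pullback n \<theta>" and N: "y \<in> ?W N" by blast
    obtain M where "x \<in> ?W M" using 1 basis_form_spans \<theta> by blast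
    then have "x \<in> ?W (max M N)" "y \<in> ?W (max M N)" using mono[of M "max M N"] mono[of N "max M N"] N by auto
    then have "sF c x + y \<in> ?W (max M N)" by (intro FZ.span_add FZ.span_scale)
    then show ?case by blast
  qed
  then show ?thesis using that by blast
qed

lemma span_pullsec:
  assumes "G \<in> FZ.span (pullsec n ` invariant_sections n)"
  shows "deriv_an n G \<in> alg_exact n" "G \<in> an_functions n"
proof -
  have "deriv_an n G \<in> alg_exact n \<and> G \<in> an_functions n"
    using assms
  proof (induction rule: FZ.span_induct_alt)
    case base
    show ?case unfolding deriv_an_0 using FZ.span_zero vsubD(1)[OF an_functions_vsub] by blast
  next
    case (step c x y)
    then obtain s where s: "s \<in> invariant_sections n" "x = pullsec n s" by blast
    have x: "x \<in> an_functions n" unfolding s(2) by (rule pullsec_an_functions[OF s(1)])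
    then have cx: "sF c x \<in> an_functions n" by (rule vsubD(4)[OF an_functions_vsub])
    have "deriv_an n (sF c x + y) = sF c (pullback n (nablaZ n s)) + deriv_an n y"
      using step.IH x cx by (simp only: deriv_an_add deriv_an_sF an_functions_hol s(2) deriv_pullsec)
    moreover have "sF c (pullback n (nablaZ n s)) + deriv_an n y \<in> alg_exact n"
      using step.IH s(1) by (intro FZ.span_add FZ.span_scale[OF FZ.span_base]) blast+
    ultimately show ?case using vsubD(2)[OF an_functions_vsub cx] step.IH by metis
  qed
  then show "deriv_an n G \<in> alg_exact n" "G \<in> an_functions n" by auto
qed

lemma basis_section_span: "sections_le n N \<subseteq> FZ.span (pullsec n ` invariant_sections n)"
  using basis_section_invariant by (intro FZ.span_mono) blast

text \<open>
  An algebraic form is a combination of finitely many monomial forms, so its pole order is bounded and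
  \<open>algebraic_primitive\<close> applies to any invariant primitive.
\<close>

theorem exact_algebraic_forms:
  "alg_forms n \<inter> an_exact n
     \<subseteq> alg_exact n"
proof clarify
  fix G assume F: "deriv_an n G \<in> alg_forms n" and G: "G \<in> an_functions n"
  obtain N where "deriv_an n G \<in> forms_le n N"
    by (rule form_in_bounded_span[OF F])
  from algebraic_primitive[OF G this] basis_section_span
  show "deriv_an n G \<in> alg_exact n"
    using span_pullsec(1) by blast
qed

section \<open>Primitives and their period cocycles\<close>

lemma primitive_exists:
  assumes F: "F \<in> hol n"
  shows "\<exists>G\<in>hol n. deriv_an n G = F \<and> G \<i> = 0"
proof -
  have "\<exists>g. \<forall>z\<in>\<HH>. (g has_field_derivative coeff (F z) k) (at z)" for k
  proof -
    have h: "(\<lambda>z. coeff (F z) k) holomorphic_on \<HH>" using F by (simp add: hol_def)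
    obtain g where "\<And>z. z \<in> \<HH> \<Longrightarrow> (g has_field_derivative coeff (F z) k) (at z within \<HH>)"
      using holomorphic_convex_primitive'[OF convex_upper_half open_upper_half h] by blast
    then have "(g has_field_derivative coeff (F z) k) (at z)" if "z \<in> \<HH>" for z
      using that at_within_open[OF that open_upper_half] by metis
    then show ?thesis by blast
  qed
  then have "\<forall>k. \<exists>g. \<forall>z\<in>\<HH>. (g has_field_derivative coeff (F z) k) (at z)" by blast
  from choice[OF this] obtain g where g: "\<And>k z. z \<in> \<HH> \<Longrightarrow> (g k has_field_derivative coeff (F z) k) (at z)" by blast
  define G where "G z = (if z \<in> \<HH> then \<Sum>k\<le>n. monom (g k z - g k \<i>) k else 0)" for z
  have coeffG: "coeff (G z) i = (if i \<le> n then g i z - g i \<i> else 0)" if "z \<in> \<HH>" for z i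
    using that by (simp add: G_def coeff_sum)
  have d: "pder G (F z) z" if z: "z \<in> \<HH>" for z
  proof -
    have "((\<lambda>w. coeff (\<Sum>k\<le>n. monom (g k w - g k \<i>) k) i) has_field_derivative coeff (F z) i) (at z)" for i
    proof (cases "i \<le> n")
      case True
      then show ?thesis by (auto simp: coeff_sum intro!: derivative_eq_intros g[OF z])
    next
      case False
      then have "coeff (F z) i = 0" using hol_degree[OF F, of z] by (intro coeff_eq_0) simp
      then show ?thesis using False by (simp add: coeff_sum)
    qed
    then have "pder (\<lambda>w. \<Sum>k\<le>n. monom (g k w - g k \<i>) k) (F z) z" unfolding pder_def by blast
    then show ?thesis by (rule pder_transform[OF _ z]) (simp add: G_def)
  qed
  have "G \<in> hol n"
  proof (rule holI_pder)
    show "degree (G z) \<le> n" for z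
      unfolding G_def by (auto intro!: degree_sum_le intro: order_trans[OF degree_monom_le])
    show "\<exists>G'. pder G G' z" if "z \<in> \<HH>" for z using d[OF that] by blast
  qed (simp add: G_def)
  moreover have "deriv_an n G = F"
    by (rule deriv_an_eqI) (use d hol_degree[OF F] hol_off[OF F] in auto)
  moreover have "G \<i> = 0" by (simp add: G_def)
  ultimately show ?thesis by blast
qed

lemma pder_zero_const:
  assumes "\<And>z. z \<in> \<HH> \<Longrightarrow> pder G 0 z" and z: "z \<in> \<HH>"
  shows "G z = G \<i>"
proof (rule poly_eqI)
  fix k
  have "((\<lambda>w. coeff (G w) k) has_field_derivative 0) (at w within \<HH>)" if "w \<in> \<HH>" for w
    using assms(1)[OF that] unfolding pder_def by (auto intro: has_field_derivative_at_within)
  then obtain c where "\<And>w. w \<in> \<HH> \<Longrightarrow> coeff (G w) k = c"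
    using has_field_derivative_zero_constant[OF convex_upper_half, of "\<lambda>w. coeff (G w) k"] by blast
  then show "coeff (G z) k = coeff (G \<i>) k" using z i_upper_half by metis
qed

definition cst :: "complex poly \<Rightarrow> complex \<Rightarrow> complex poly" where
  "cst P z = (if z \<in> \<HH> then P else 0)"

lemma pder_cst: "z \<in> \<HH> \<Longrightarrow> pder (cst P) 0 z"
  by (rule pder_transform[OF pder_const[of P]]) (auto simp: cst_def)

lemma cst_hol: "degree P \<le> n \<Longrightarrow> cst P \<in> hol n"
  by (rule holI_pder) (use pder_cst in \<open>auto simp: cst_def\<close>)

lemma deriv_cst [simp]: "deriv_an n (cst P) = 0"
  by (rule deriv_an_eqI) (simp_all add: pder_cst)

lemma deriv_an_zero_const:
  assumes "G \<in> hol n" "deriv_an n G = 0"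
  shows "G = cst (G \<i>)"
proof
  fix z
  have "pder G 0 w" if "w \<in> \<HH>" for w using hol_pder[OF assms(1) that] by (simp add: assms(2))
  then show "G z = cst (G \<i>) z" using pder_zero_const[of G z] hol_off[OF assms(1), of z] by (simp add: cst_def)
qed

text \<open>
  The normalisation at \<open>\<i>\<close> makes the primitive unique and hence linear in the form.
\<close>

definition prim :: "nat \<Rightarrow> (complex \<Rightarrow> complex poly) \<Rightarrow> (complex \<Rightarrow> complex poly)" where
  "prim n F = (SOME G. G \<in> hol n \<and> deriv_an n G = F \<and> G \<i> = 0)"

lemma prim:
  assumes "F \<in> hol n"
  shows "prim n F \<in> hol n" "deriv_an n (prim n F) = F" "prim n F \<i> = 0"
proof -
  have "\<exists>G. G \<in> hol n \<and> deriv_an n G = F \<and> G \<i> = 0" using primitive_exists[OF assms] by blast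
  from someI_ex[OF this] show "prim n F \<in> hol n" "deriv_an n (prim n F) = F" "prim n F \<i> = 0"
    unfolding prim_def by blast+
qed

lemma prim_eqI:
  assumes "G \<in> hol n" "deriv_an n G = F" "G \<i> = 0" "F \<in> hol n"
  shows "prim n F = G"
proof -
  note p = prim[OF assms(4)]
  have "prim n F - G \<in> hol n" by (rule vsubD(5)[OF hol_vsub p(1) assms(1)])
  moreover have "deriv_an n (prim n F - G) = 0" unfolding deriv_an_diff[OF p(1) assms(1)] p(2) assms(2) by simp
  ultimately have "prim n F - G = cst ((prim n F - G) \<i>)" by (rule deriv_an_zero_const)
  also have "\<dots> = 0" by (simp add: p(3) assms(3) cst_def fun_eq_iff)
  finally show ?thesis by simp
qed

lemma prim_add:
  assumes "F \<in> hol n" "F' \<in> hol n" shows "prim n (F + F') = prim n F + prim n F'"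
proof (rule prim_eqI)
  note p = prim[OF assms(1)] and q = prim[OF assms(2)]
  show "prim n F + prim n F' \<in> hol n" by (rule vsubD(2)[OF hol_vsub p(1) q(1)])
  show "deriv_an n (prim n F + prim n F') = F + F'" unfolding deriv_an_add[OF p(1) q(1)] p(2) q(2) ..
  show "F + F' \<in> hol n" by (rule vsubD(2)[OF hol_vsub assms])
qed (simp add: prim[OF assms(1)] prim[OF assms(2)])

lemma prim_sF:
  assumes "F \<in> hol n" shows "prim n (sF c F) = sF c (prim n F)"
proof (rule prim_eqI)
  note p = prim[OF assms(1)]
  show "sF c (prim n F) \<in> hol n" by (rule vsubD(4)[OF hol_vsub p(1)])
  show "deriv_an n (sF c (prim n F)) = sF c F" unfolding deriv_an_sF[OF p(1)] p(2) ..
  show "sF c F \<in> hol n" by (rule vsubD(4)[OF hol_vsub assms])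
qed (simp add: prim[OF assms(1)])

text \<open>
  For a primitive of an invariant form the difference does not depend on the point, and \<open>\<i>\<close> stands for
  any point of \<open>\<HH>\<close>.
\<close>

definition per :: "nat \<Rightarrow> (complex \<Rightarrow> complex poly) \<Rightarrow> (int^2^2 \<Rightarrow> complex poly)" where
  "per n G = (\<lambda>\<gamma>. if \<gamma> \<in> SL2Z then actB n \<gamma> (G (moebius \<gamma> \<i>)) - G \<i> else 0)"

text \<open>
  The difference of \<open>G|\<gamma>\<close> and \<open>G\<close> has derivative zero because the form is invariant.
\<close>

lemma per_eq:
  assumes G: "G \<in> hol n" and F: "deriv_an n G \<in> an_forms n" and \<gamma>: "\<gamma> \<in> SL2Z" and z: "z \<in> \<HH>"
  shows "actB n \<gamma> (G (moebius \<gamma> z)) - G z = per n G \<gamma>"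
proof -
  have "pder (\<lambda>w. actB n \<gamma> (G (moebius \<gamma> w)) - G w) 0 w" if w: "w \<in> \<HH>" for w
  proof -
    have 1: "pder (\<lambda>w. actB n \<gamma> (G (moebius \<gamma> w))) (smult (1 / jfac \<gamma> w ^ 2) (actB n \<gamma> (deriv_an n G (moebius \<gamma> w)))) w"
      by (rule pder_moebius[OF hol_pder[OF G] \<gamma> w]) (rule moebius_upper_half[OF \<gamma> w])
    have "smult (1 / jfac \<gamma> w ^ 2) (actB n \<gamma> (deriv_an n G (moebius \<gamma> w))) = deriv_an n G w"
      using F \<gamma> w unfolding an_forms_def jfac_def by blast
    with 1 hol_pder[OF G w] show ?thesis unfolding pder_def by (auto intro!: derivative_eq_intros)
  qed
  from pder_zero_const[OF this z] show ?thesis using \<gamma> by (simp add: per_def)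
qed

lemma per_cocycle:
  assumes G: "G \<in> hol n" and F: "deriv_an n G \<in> an_forms n"
  shows "per n G \<in> group_cocycles n"
  unfolding group_cocycles_def
proof (intro CollectI conjI ballI allI impI)
  fix \<gamma> :: "int^2^2"
  show "degree (per n G \<gamma>) \<le> n"
    unfolding per_def by (auto intro!: degree_diff_le degree_actB hol_degree[OF G])
  show "per n G \<gamma> = 0" if "\<gamma> \<notin> SL2Z" using that by (simp add: per_def)
  fix \<gamma>' assume *: "\<gamma> \<in> SL2Z" "\<gamma>' \<in> SL2Z"
  let ?w = "moebius \<gamma>' \<i>"
  have w: "?w \<in> \<HH>" by (rule moebius_upper_half[OF *(2) i_upper_half])
  have "per n G (\<gamma> ** \<gamma>') = actB n \<gamma>' (actB n \<gamma> (G (moebius \<gamma> ?w))) - G \<i>"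
    using SL2Z_mult[OF *] by (simp add: per_def actB_mult[OF * hol_degree[OF G]] moebius_mult[OF * i_upper_half])
  also have "actB n \<gamma> (G (moebius \<gamma> ?w)) = per n G \<gamma> + G ?w" using per_eq[OF G F *(1) w] by (simp add: algebra_simps)
  finally show "per n G (\<gamma> ** \<gamma>') = actB n \<gamma>' (per n G \<gamma>) + per n G \<gamma>'"
    using *(2) by (simp add: actB_add per_def[of n G] algebra_simps)
qed

definition sG :: "complex \<Rightarrow> (int^2^2 \<Rightarrow> complex poly) \<Rightarrow> (int^2^2 \<Rightarrow> complex poly)" where
  "sG c \<kappa> = (\<lambda>\<gamma>. smult c (\<kappa> \<gamma>))"

lemma sG_apply [simp]: "sG c \<kappa> \<gamma> = smult c (\<kappa> \<gamma>)"
  by (simp add: sG_def)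

lemma per_add: "per n (F + G) = per n F + per n G"
  by (simp add: per_def fun_eq_iff actB_add)

lemma per_sF: "per n (sF c G) = sG c (per n G)"
  by (simp add: per_def fun_eq_iff actB_smult smult_diff_right)

lemma per_diff: "per n (F - G) = per n F - per n G"
  by (simp add: per_def fun_eq_iff actB_diff)

lemma per_cst: "per n (cst P) = coboundary n P"
  by (auto simp: per_def coboundary_def cst_def fun_eq_iff moebius_upper_half)

lemma per_an_functions: "G \<in> an_functions n \<Longrightarrow> per n G = 0"
  by (auto simp: per_def an_functions_def fun_eq_iff)

lemma an_functions_per:
  assumes "G \<in> hol n" "deriv_an n G \<in> an_forms n" "per n G = 0"
  shows "G \<in> an_functions n"
  using assms per_eq[OF assms(1,2)] by (simp add: an_functions_def)

abbreviation coboundaries :: "nat \<Rightarrow> (int^2^2 \<Rightarrow> complex poly) set" where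
  "coboundaries n \<equiv> coboundary n ` {P. degree P \<le> n}"

lemma per_coboundary_iff:
  assumes G: "G \<in> hol n" and F: "deriv_an n G \<in> an_forms n"
  shows "per n G \<in> coboundaries n \<longleftrightarrow> deriv_an n G \<in> an_exact n"
proof
  assume "per n G \<in> coboundaries n"
  then obtain P where P: "degree P \<le> n" "per n G = coboundary n P" by blast
  have h: "G - cst P \<in> hol n" by (rule vsubD(5)[OF hol_vsub G cst_hol[OF P(1)]])
  have d: "deriv_an n (G - cst P) = deriv_an n G" unfolding deriv_an_diff[OF G cst_hol[OF P(1)]] deriv_cst by simp
  have "G - cst P \<in> an_functions n"
    by (rule an_functions_per[OF h]) (simp_all only: d F per_diff per_cst P(2) diff_self)
  then show "deriv_an n G \<in> an_exact n" using d by (metis imageI)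
next
  assume "deriv_an n G \<in> an_exact n"
  then obtain H where H: "H \<in> an_functions n" "deriv_an n G = deriv_an n H" by blast
  note h = an_functions_hol[OF H(1)]
  have "G - H = cst ((G - H) \<i>)"
    by (rule deriv_an_zero_const[OF vsubD(5)[OF hol_vsub G h]]) (simp only: deriv_an_diff[OF G h] H(2) diff_self)
  then have "per n (G - H) = coboundary n ((G - H) \<i>)" using per_cst by metis
  then have "per n G = coboundary n ((G - H) \<i>)" by (simp only: per_diff per_an_functions[OF H(1)] diff_zero)
  moreover have "degree ((G - H) \<i>) \<le> n" by (rule hol_degree[OF vsubD(5)[OF hol_vsub G h]])
  ultimately show "per n G \<in> coboundaries n" by blast
qed

lemma cocycles_vsub: "vsub sG (group_cocycles n)"
  unfolding vsub_def group_cocycles_def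
  by (auto simp: actB_add actB_minus actB_smult smult_add_right intro: degree_add_le order_trans[OF degree_smult_le])

lemma coboundary_linear:
  "coboundary n (P + Q) = coboundary n P + coboundary n Q" "coboundary n (- P) = - coboundary n P"
  "coboundary n (smult c P) = sG c (coboundary n P)" "coboundary n 0 = 0"
  by (auto simp: coboundary_def fun_eq_iff actB_add actB_minus actB_smult smult_diff_right)

lemma coboundaries_vsub: "vsub sG (coboundaries n)"
  unfolding vsub_def
proof (intro conjI ballI allI)
  have "coboundary n 0 \<in> coboundaries n" by (rule imageI) simp
  then show "0 \<in> coboundaries n" unfolding coboundary_linear .
  fix x assume "x \<in> coboundaries n"
  then obtain P where P: "degree P \<le> n" "x = coboundary n P" by blast
  have "coboundary n (- P) \<in> coboundaries n" by (rule imageI) (use P in simp)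
  then show "- x \<in> coboundaries n" unfolding coboundary_linear P(2) .
  have "coboundary n (smult c P) \<in> coboundaries n" for c
    by (rule imageI) (use P order_trans[OF degree_smult_le] in blast)
  then show "sG c x \<in> coboundaries n" for c unfolding coboundary_linear P(2) .
  fix y assume "y \<in> coboundaries n"
  then obtain Q where Q: "degree Q \<le> n" "y = coboundary n Q" by blast
  have "coboundary n (P + Q) \<in> coboundaries n" by (rule imageI) (use P Q in \<open>auto intro: degree_add_le\<close>)
  then show "x + y \<in> coboundaries n" unfolding coboundary_linear P(2) Q(2) .
qed

lemma coboundaries_cocycles: "coboundaries n \<subseteq> group_cocycles n"
proof clarify
  fix P :: "complex poly" assume P: "degree P \<le> n"
  have "deriv_an n (cst P) \<in> an_forms n" unfolding deriv_cst by (rule vsubD(1)[OF an_forms_vsub])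
  from per_cocycle[OF cst_hol[OF P] this] show "coboundary n P \<in> group_cocycles n" by (simp only: per_cst)
qed

text \<open>
  Injectivity and independence of choices are \<open>per_coboundary_iff\<close>; two primitives of the same form
  differ by a constant, which changes the cocycle by a coboundary.
\<close>

theorem orbifold_iso:
  assumes surj: "\<And>\<kappa>. \<kappa> \<in> group_cocycles n \<Longrightarrow>
      \<exists>G\<in>hol n. deriv_an n G \<in> an_forms n \<and> \<kappa> - per n G \<in> coboundaries n"
  shows "module_iso (H1an n) (H1grp n) (orbifold_to_group n)"
  unfolding H1an_def H1grp_def sF_def[symmetric] sG_def[symmetric]
proof (rule module_iso_quot[where \<phi> = "\<lambda>F. per n (prim n F)"])
  note an = an_forms_hol
  show "per n (prim n x) \<in> group_cocycles n" if "x \<in> an_forms n" for x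
    by (rule per_cocycle) (simp_all add: prim[OF an[OF that]] that)
  show "per n (prim n (x + y)) = per n (prim n x) + per n (prim n y)" if "x \<in> an_forms n" "y \<in> an_forms n" for x y
    by (simp only: prim_add an that per_add)
  show "per n (prim n (sF r x)) = sG r (per n (prim n x))" if "x \<in> an_forms n" for r x
    by (simp only: prim_sF an that per_sF)
  show inj: "per n (prim n x) \<in> coboundaries n \<longleftrightarrow> x \<in> an_exact n" if "x \<in> an_forms n" for x
    using per_coboundary_iff[of "prim n x" n] prim[OF an[OF that]] that by simp
  have shift: "per n G - per n (prim n (deriv_an n G)) \<in> coboundaries n"
    if "G \<in> hol n" "deriv_an n G \<in> an_forms n" for G
  proof -
    note p = prim[OF an[OF that(2)]]
    let ?D = "G - prim n (deriv_an n G)"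
    have D: "?D \<in> hol n" by (rule vsubD(5)[OF hol_vsub that(1) p(1)])
    have "?D = cst (?D \<i>)"
      by (rule deriv_an_zero_const[OF D]) (simp only: deriv_an_diff[OF that(1) p(1)] p(2) diff_self)
    then have "per n ?D = coboundary n (?D \<i>)" using per_cst by metis
    then show ?thesis unfolding per_diff using hol_degree[OF D, of \<i>] by blast
  qed
  show "\<exists>x\<in>an_forms n. y - per n (prim n x) \<in> coboundaries n" if y: "y \<in> group_cocycles n" for y
  proof -
    obtain G where G: "G \<in> hol n" "deriv_an n G \<in> an_forms n" "y - per n G \<in> coboundaries n" using surj[OF y] by blast
    from vsubD(2)[OF coboundaries_vsub G(3) shift[OF G(1,2)]] G(2) show ?thesis by auto
  qed
  show "orbifold_to_group n (cls (an_exact n) x) = cls (coboundaries n) (per n (prim n x))"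
    if x: "x \<in> an_forms n" for x
  proof -
    let ?S = "{cls (coboundaries n) \<kappa> | \<kappa> F. F \<in> cls (an_exact n) x \<and> is_period_cocycle n F \<kappa>}"
    have 1: "cls (coboundaries n) \<kappa> = cls (coboundaries n) (per n (prim n x))"
      if F: "F \<in> cls (an_exact n) x" and k: "is_period_cocycle n F \<kappa>" for F \<kappa>
    proof -
      have Fx: "F - x \<in> an_exact n" using F by (simp add: mem_cls)
      then have Fx': "F - x \<in> an_forms n" using exact_an_forms by blast
      have Fa: "F \<in> an_forms n" using vsubD(2)[OF an_forms_vsub Fx' x] by simp
      obtain G where G: "\<kappa> \<in> group_cocycles n" "G \<in> hol n" "deriv_an n G = F"
        "\<forall>\<gamma>\<in>SL2Z. \<forall>z\<in>\<HH>. \<kappa> \<gamma> = actB n \<gamma> (G (moebius \<gamma> z)) - G z"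
        using k unfolding is_period_cocycle_def by blast
      have kap: "\<kappa> = per n G"
      proof
        fix \<gamma> show "\<kappa> \<gamma> = per n G \<gamma>"
          using G(1,4) by (cases "\<gamma> \<in> SL2Z") (auto simp: per_def group_cocycles_def)
      qed
      have "\<kappa> - per n (prim n F) \<in> coboundaries n" using shift[OF G(2)] Fa by (simp add: G(3) kap)
      moreover have "per n (prim n F) - per n (prim n x) \<in> coboundaries n"
      proof -
        have "prim n F = prim n (F - x) + prim n x" using prim_add[OF an[OF Fx'] an[OF x]] by simp
        then have "per n (prim n F) - per n (prim n x) = per n (prim n (F - x))" by (simp add: per_add)
        then show ?thesis using inj[OF Fx'] Fx by simp
      qed
      ultimately have "(\<kappa> - per n (prim n F)) + (per n (prim n F) - per n (prim n x)) \<in> coboundaries n"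
        by (rule vsubD(2)[OF coboundaries_vsub])
      then show ?thesis by (simp add: cls_eq_iff[OF coboundaries_vsub])
    qed
    have 2: "is_period_cocycle n x (per n (prim n x))"
      unfolding is_period_cocycle_def
    proof (intro conjI bexI[of _ "prim n x"] ballI)
      note p = prim[OF an[OF x]]
      show "deriv_an n (prim n x) = x" "prim n x \<in> hol n" by (rule p)+
      show "per n (prim n x) \<in> group_cocycles n" by (rule per_cocycle) (simp_all add: p x)
      show "per n (prim n x) \<gamma> = actB n \<gamma> (prim n x (moebius \<gamma> z)) - prim n x z"
        if "\<gamma> \<in> SL2Z" "z \<in> \<HH>" for \<gamma> z
        by (rule per_eq[OF p(1) _ that, symmetric]) (simp add: p x)
    qed
    have "?S = {cls (coboundaries n) (per n (prim n x))}"
      using 1 2 cls_self[OF exact_vsub, of x n] by blast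
    then show ?thesis unfolding orbifold_to_group_def cls_r_coset by simp
  qed
qed (use an_forms_vsub exact_vsub exact_an_forms cocycles_vsub coboundaries_vsub coboundaries_cocycles in
   \<open>auto simp: fun_eq_iff smult_add_right\<close>)

section \<open>The connection on invariant sections\<close>

lemma kaehlerZ_weight_cong: "k mod 12 = l mod 12 \<Longrightarrow> kaehlerZ_weight k = kaehlerZ_weight l"
proof -
  assume "k mod 12 = l mod 12"
  then have "(k + 2) mod 12 = (l + 2) mod 12" by (rule mod_add_cong) simp
  then have "regZ_weight (k + 2) = regZ_weight (l + 2)" by (rule regZ_weight_cong)
  then show ?thesis unfolding kaehlerZ_weight_eq by metis
qed

lemma kmult_monZ_weight:
  assumes "\<kappa> \<in> kaehlerZ_weight k" "4 * int a + 6 * int b + k = l"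
  shows "kmult (monZ a b) \<kappa> \<in> kaehlerZ_weight l"
proof -
  obtain h where h: "h \<in> regZ_weight (k + 2)" "\<kappa> = kmult h omegaZ" using assms(1) unfolding kaehlerZ_weight_eq by blast
  have "monZ a b * h \<in> regZ_weight (l + 2)"
    by (rule monZ_mult_weight[OF h(1)]) (simp add: assms(2)[symmetric] add.assoc)
  then show ?thesis unfolding kaehlerZ_weight_eq h(2) kmult_simps by blast
qed

lemma kmult_omegaZ_weight: "h \<in> regZ_weight l \<Longrightarrow> l = k + 2 \<Longrightarrow> kmult h omegaZ \<in> kaehlerZ_weight k"
  unfolding kaehlerZ_weight_eq by blast

lemma dZ_gens_weight: "dZ uZ \<in> kaehlerZ_weight 4" "dZ vZ \<in> kaehlerZ_weight 6"
proof -
  have "constZ 6 * monZ 0 1 \<in> regZ_weight 6" "constZ (1 / 3) * monZ 2 0 \<in> regZ_weight 8"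
    by (intro vsubD(4)[OF regZ_weight_vsub] monZ_weight, simp)+
  then show "dZ uZ \<in> kaehlerZ_weight 4" "dZ vZ \<in> kaehlerZ_weight 6"
    unfolding dZ_uZ_omega dZ_vZ_omega by (auto intro!: kmult_omegaZ_weight simp: monZ_def)
qed

lemma dZ_monZ_weight: "dZ (monZ a b) \<in> kaehlerZ_weight (4 * int a + 6 * int b)"
proof (induction b)
  case 0
  show ?case
  proof (induction a)
    case 0
    then show ?case using dZ_const[of 1] vsubD(1)[OF kaehlerZ_weight_vsub] by (simp add: monZ_def)
  next
    case (Suc a)
    have "monZ (Suc a) 0 = monZ 1 0 * monZ a 0" "uZ = monZ 1 0" by (simp_all add: monZ_def)
    then have "dZ (monZ (Suc a) 0) = kmult (monZ 1 0) (dZ (monZ a 0)) + kmult (monZ a 0) (dZ uZ)"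
      by (simp only: dZ_mult)
    then show ?case
      by (auto intro!: vsubD(2)[OF kaehlerZ_weight_vsub] kmult_monZ_weight[OF Suc] kmult_monZ_weight[OF dZ_gens_weight(1)])
  qed
next
  case (Suc b)
  have "monZ a (Suc b) = monZ 0 1 * monZ a b" "vZ = monZ 0 1" by (simp_all add: monZ_def mult_ac)
  then have "dZ (monZ a (Suc b)) = kmult (monZ 0 1) (dZ (monZ a b)) + kmult (monZ a b) (dZ vZ)"
    by (simp only: dZ_mult)
  then show ?case
    by (auto intro!: vsubD(2)[OF kaehlerZ_weight_vsub] kmult_monZ_weight[OF Suc] kmult_monZ_weight[OF dZ_gens_weight(2)])
qed

lemma dZ_weight:
  assumes "f \<in> regZ_weight k" shows "dZ f \<in> kaehlerZ_weight k"
  using assms unfolding regZ_weight_span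
proof (induction rule: RZ.span_induct_alt)
  case base
  show ?case using vsubD(1)[OF kaehlerZ_weight_vsub] by simp
next
  case (step c x y)
  then obtain a b where "x = monZ a b" "(4 * int a + 6 * int b) mod 12 = k mod 12" unfolding monset_def by blast
  then have "dZ x \<in> kaehlerZ_weight k" using dZ_monZ_weight[of a b] kaehlerZ_weight_cong by metis
  then have "kmult (constZ c) (dZ x) + dZ y \<in> kaehlerZ_weight k"
    using step.IH by (intro vsubD(2,4)[OF kaehlerZ_weight_vsub])
  then show ?case by (simp add: dZ_add dZ_mult)
qed

lemma of_nat_weight: "f \<in> regZ_weight k \<Longrightarrow> of_nat m * f \<in> regZ_weight k"
  by (induction m) (use vsubD(1,2)[OF regZ_weight_vsub] in \<open>auto simp: distrib_right\<close>)

lemma nab_invariant: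
  assumes f: "f \<in> regZ_weight (int n - 2 * int i)" and i: "i \<le> n"
  shows "nab n i f \<in> invariant_forms n"
proof -
  have m: "monom \<kappa> j \<in> invariant_forms n" if "j \<le> n" "\<kappa> \<in> kaehlerZ_weight (int n - 2 * int j)" for j \<kappa>
    using that vsubD(1)[OF kaehlerZ_weight_vsub] unfolding invariant_forms_def
    by (auto intro: order_trans[OF degree_monom_le])
  note V = vsubD[OF invariant_forms_vsub]
  have 2: "monom (kmult (of_nat i * f * constZ (1 / 12) * uZ) omegaZ) (i - 1) \<in> invariant_forms n"
  proof (cases i)
    case 0
    then show ?thesis using V(1) by simp
  next
    case (Suc j)
    have "of_nat i * (constZ (1 / 12) * (monZ 1 0 * f)) \<in> regZ_weight (int n - 2 * int i + 4)"
      by (intro of_nat_weight vsubD(4)[OF regZ_weight_vsub] monZ_mult_weight[OF f]) (simp add: add.commute)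
    moreover have "of_nat i * (constZ (1 / 12) * (monZ 1 0 * f)) = of_nat i * f * constZ (1 / 12) * uZ"
      by (simp add: monZ_def mult_ac)
    ultimately have "kmult (of_nat i * f * constZ (1 / 12) * uZ) omegaZ \<in> kaehlerZ_weight (int n - 2 * int j)"
      by (intro kmult_omegaZ_weight[of _ "int n - 2 * int i + 4"]) (simp_all add: Suc)
    then show ?thesis using m[of j] i Suc by simp
  qed
  have 3: "monom (kmult (of_nat (n - i) * f) omegaZ) (i + 1) \<in> invariant_forms n"
  proof (cases "i = n")
    case True
    then show ?thesis using V(1) by simp
  next
    case False
    then show ?thesis
      using i by (intro m kmult_omegaZ_weight[OF of_nat_weight[OF f]]) auto
  qed
  show ?thesis unfolding nab_def by (intro V(2,5) 2 3 m i dZ_weight f)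
qed

lemma nablaZ_invariant: "s \<in> invariant_sections n \<Longrightarrow> nablaZ n s \<in> invariant_forms n"
proof -
  assume s: "s \<in> invariant_sections n"
  have "KZ.subspace (invariant_forms n)" by (rule vsub_subspace[OF vector_space_sK invariant_forms_vsub])
  then show ?thesis unfolding nablaZ_eq
    by (rule KZ.subspace_sum) (use s in \<open>auto intro: nab_invariant simp: invariant_sections_def\<close>)
qed

lemma nab_add: "nab n i (f + g) = nab n i f + nab n i g"
  unfolding nab_def dZ_add distrib_left distrib_right kmult_simps add_monom[symmetric] by simp

lemma nab_scale: "nab n i (constZ c * f) = sK c (nab n i f)"
proof -
  have m: "sK c (monom \<kappa> j) = monom (kmult (constZ c) \<kappa>) j" for \<kappa> j
    by (rule poly_eqI) (simp add: coeff_sK)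
  have e: "of_nat i * (constZ c * f) * constZ (1 / 12) * uZ = constZ c * (of_nat i * f * constZ (1 / 12) * uZ)"
    "of_nat (n - i) * (constZ c * f) = constZ c * (of_nat (n - i) * f)"
    by (simp_all only: mult_ac)
  have "dZ (constZ c * f) = kmult (constZ c) (dZ f)" by (simp add: dZ_mult)
  then show ?thesis
    unfolding nab_def e KZ.scale_right_distrib KZ.scale_right_diff_distrib m kmult_simps(3) by simp
qed

lemma nablaZ_add: "nablaZ n (s + t) = nablaZ n s + nablaZ n t"
  by (simp add: nablaZ_eq nab_add sum.distrib)

lemma nablaZ_scale: "nablaZ n (sR c s) = sK c (nablaZ n s)"
  by (simp add: nablaZ_eq nab_scale sR_def KZ.scale_sum_right)

lemma exact_invariant_vsub: "vsub sK (nablaZ n ` invariant_sections n)"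
  unfolding vsub_def
proof (intro conjI ballI allI)
  note V = vsubD[OF invariant_sections_vsub[of n]]
  have 0: "nablaZ n 0 = 0" using nablaZ_add[of n 0 0] by simp
  show "0 \<in> nablaZ n ` invariant_sections n" using V(1) 0 by (metis imageI)
  fix x assume "x \<in> nablaZ n ` invariant_sections n"
  then obtain s where s: "s \<in> invariant_sections n" "x = nablaZ n s" by blast
  have "nablaZ n (- s) = - nablaZ n s" using nablaZ_add[of n s "- s"] by (simp add: 0 eq_neg_iff_add_eq_0 add.commute)
  then show "- x \<in> nablaZ n ` invariant_sections n" using V(3)[OF s(1)] s(2) by (metis imageI)
  show "sK c x \<in> nablaZ n ` invariant_sections n" for c using V(4)[OF s(1)] s(2) nablaZ_scale by (metis imageI)
  fix y assume "y \<in> nablaZ n ` invariant_sections n"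
  then obtain t where t: "t \<in> invariant_sections n" "y = nablaZ n t" by blast
  show "x + y \<in> nablaZ n ` invariant_sections n" using V(2)[OF s(1) t(1)] s(2) t(2) nablaZ_add by (metis imageI)
qed

section \<open>The tensor product with the complex numbers\<close>

lemma image_eq_singleton: "a \<in> A \<Longrightarrow> (\<And>x. x \<in> A \<Longrightarrow> h x = c) \<Longrightarrow> h ` A = {c}"
  by blast

text \<open>
  An instance of \<open>rational_form.tensor_iso\<close> with the monomial forms as spanning set. It remains to
  evaluate the map on classes, which is independent of representatives since relations go to exact forms.
\<close>

theorem grothendieck_iso:
  assumes gen: "\<And>y. y \<in> an_forms n \<Longrightarrow>
      \<exists>w\<in>alg_forms n. y - w \<in> an_exact n"
  shows "module_iso (tensor_complex (H1dR n)) (H1an n) (grothendieck n)"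
proof -
  let ?A = "invariant_forms n" and ?B = "nablaZ n ` invariant_sections n" and ?N = "an_exact n"
  let ?val = "\<lambda>f. finsum (H1an n) (\<lambda>X. lookup f X \<odot>\<^bsub>H1an n\<^esub> pullback_class n X) (keys f)"
  interpret R: rational_form sK ?A ?B "basis_form ` form_indices n" sF "an_forms n" ?N "pullback n"
  proof
    show "vsub sK ?A" "vsub sK ?B" "vsub sF (an_forms n)" "vsub sF ?N" "?N \<subseteq> an_forms n"
      by (fact invariant_forms_vsub exact_invariant_vsub an_forms_vsub exact_vsub exact_an_forms)+
    show "?B \<subseteq> ?A" using nablaZ_invariant by blast
    show "pullback n (a + b) = pullback n a + pullback n b" for a b by (simp add: fun_eq_iff pullback_add)
    show "pullback n (sK r a) = sF (of_rat r) (pullback n a)" for r a by (simp add: fun_eq_iff pullback_sK)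
    show "pullback n a \<in> an_forms n" if "a \<in> ?A" for a by (rule pullback_an_forms[OF that])
    show "pullback n b \<in> ?N" if "b \<in> ?B" for b
      using that pullsec_an_functions by (auto simp flip: deriv_pullsec)
    show "basis_form ` form_indices n \<subseteq> ?A" "?A \<subseteq> KZ.span (basis_form ` form_indices n)"
      by (fact basis_form_invariant basis_form_spans)+
    show "g = 0" if "keys g \<subseteq> basis_form ` form_indices n" "comb sF (pullback n) g = 0" for g
      by (rule basis_forms_independent[OF that])
    show "FZ.span (pullback n ` ?A) \<inter> ?N \<subseteq> FZ.span (pullback n ` ?B)" by (rule exact_algebraic_forms)
    show "\<exists>w\<in>FZ.span (pullback n ` ?A). y - w \<in> ?N" if "y \<in> an_forms n" for y by (rule gen[OF that])
  qed
  have H: "H1an n = quot_module (submod sF (an_forms n)) ?N" unfolding H1an_def sF_def[symmetric] ..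
  have H': "H1dR n = R.M" unfolding H1dR_def sK_def[symmetric] ..
  have pc: "pullback_class n X = cls ?N (pullback n (R.rep X))" if X: "X \<in> carrier R.M" for X
  proof -
    have "(\<lambda>\<theta>. cls ?N (pullback n \<theta>)) ` X = {cls ?N (pullback n (R.rep X))}"
    proof -
      have "cls ?N (pullback n \<theta>) = cls ?N (pullback n (R.rep X))" if "\<theta> \<in> X" for \<theta>
      proof -
        have "\<theta> \<in> cls ?B (R.rep X)" using R.rep(2)[OF X] that by simp
        then have "\<theta> - R.rep X \<in> ?B" by (simp add: mem_cls)
        then have "pullback n (\<theta> - R.rep X) \<in> ?N" by (rule R.\<psi>_N)
        moreover have "pullback n (\<theta> - R.rep X) = pullback n \<theta> - pullback n (R.rep X)"
          by (simp add: fun_eq_iff pullback_diff)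
        ultimately show ?thesis by (simp add: cls_eq_iff[OF exact_vsub])
      qed
      moreover have "R.rep X \<in> X" using cls_self[OF exact_invariant_vsub, of "R.rep X" n] R.rep(2)[OF X] by simp
      ultimately show ?thesis by blast
    qed
    then show ?thesis unfolding pullback_class_def cls_r_coset by simp
  qed
  have fs: "?val f = cls ?N (R.\<phi> f)"
    if f: "f \<in> R.Z1" for f
  proof -
    have Z: "sF (lookup f X) (pullback n (R.rep X)) \<in> an_forms n" if "X \<in> keys f" for X
      using f that by (intro vsubD(4)[OF an_forms_vsub] pullback_an_forms R.rep) auto
    have "?val f =
        finsum (H1an n) (\<lambda>X. cls ?N (sF (lookup f X) (pullback n (R.rep X)))) (keys f)"
    proof (rule abelian_monoid.finsum_cong')
      show "abelian_monoid (H1an n)" unfolding H by (rule abelian_monoid_quot[OF an_forms_vsub exact_vsub])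
      show "(\<lambda>X. cls ?N (sF (lookup f X) (pullback n (R.rep X)))) \<in> keys f \<rightarrow> carrier (H1an n)"
        unfolding H carrier_quot using Z by blast
      fix X assume X: "X \<in> keys f"
      then have X': "X \<in> carrier R.M" using f by blast
      show "lookup f X \<odot>\<^bsub>H1an n\<^esub> pullback_class n X = cls ?N (sF (lookup f X) (pullback n (R.rep X)))"
        unfolding pc[OF X'] H
        by (rule smult_quot[OF exact_vsub exact_an_forms an_forms_vsub])
          (use R.rep(1)[OF X'] in \<open>auto simp: fun_eq_iff smult_add_right intro: pullback_an_forms\<close>)
    qed simp
    also have "\<dots> = cls ?N (R.\<phi> f)"
      unfolding H R.\<phi>_def comb_def by (rule finsum_quot[OF an_forms_vsub exact_vsub]) (use Z in auto)
    finally show ?thesis .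
  qed
  have "grothendieck n (cls R.rels x) = cls ?N (R.\<phi> x)" if x: "x \<in> R.Z1" for x
  proof -
    have c: "cls ?N (R.\<phi> f) = cls ?N (R.\<phi> x)" if f: "f \<in> cls R.rels x" for f
    proof -
      have d: "f - x \<in> R.rels" using f by (simp add: mem_cls)
      have "R.\<phi> (f - x) \<in> ?N" by (rule R.\<phi>_rels[OF d])
      then show ?thesis by (simp add: R.\<phi>_def comb_diff[OF vector_space_sF] cls_eq_iff[OF exact_vsub])
    qed
    have z1: "f \<in> R.Z1" if f: "f \<in> cls R.rels x" for f
    proof -
      have "(f - x) + x \<in> R.Z1"
        using f x R.rels_Z1 by (intro vsubD(2)[OF R.Z1_vsub]) (auto simp: mem_cls)
      then show ?thesis by simp
    qed
    have v: "?val f = cls ?N (R.\<phi> x)"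
      if "f \<in> cls R.rels x" for f
      by (rule trans[OF fs[OF z1[OF that]] c[OF that]])
    have "?val ` cls R.rels x = {cls ?N (R.\<phi> x)}"
      by (rule image_eq_singleton[OF cls_self[OF R.rels_vsub] v])
    then show ?thesis unfolding grothendieck_def by simp
  qed
  from R.tensor_iso[OF this] show ?thesis unfolding H H' .
qed

section \<open>Surjectivity by counting dimensions\<close>

text \<open>
  Rank and nullity in a form where the dimensions enter only through the sizes of spanning or
  independent families: lifts of a basis of the image together with \<open>J\<close> span \<open>I\<close>, so the image has
  dimension at least \<open>\<bar>I\<bar> - \<bar>J\<bar> \<ge> \<bar>T\<bar>\<close>.
\<close>

lemma surjective_by_dimension:
  fixes s1 :: "'k::field \<Rightarrow> 'a::ab_group_add \<Rightarrow> 'a" and s2 :: "'k \<Rightarrow> 'b::ab_group_add \<Rightarrow> 'b"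
  assumes lin: "Vector_Spaces.linear s1 s2 \<Phi>"
    and I: "finite I" "\<not> Modules.module.dependent s1 I"
    and J: "finite J" "\<And>w. w \<in> Modules.module.span s1 I \<Longrightarrow> \<Phi> w = 0 \<Longrightarrow> w \<in> Modules.module.span s1 J"
    and T: "finite T" "\<Phi> ` Modules.module.span s1 I \<subseteq> Modules.module.span s2 T"
    and card: "card J + card T \<le> card I"
  shows "Modules.module.span s2 T \<subseteq> \<Phi> ` Modules.module.span s1 I"
proof -
  interpret Vector_Spaces.linear s1 s2 \<Phi> by (rule lin)
  let ?R = "\<Phi> ` vs1.span I"
  have R: "vs2.subspace ?R" by (rule subspace_image[OF vs1.subspace_span])
  obtain B where B: "B \<subseteq> ?R" "vs2.independent B" "?R \<subseteq> vs2.span B"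
    using vs2.maximal_independent_subset[of ?R] by blast
  have fB: "finite B" and cB: "card B \<le> card T"
    using vs2.independent_span_bound[OF T(1) B(2)] B(1) T(2) by auto
  have "\<forall>b\<in>B. \<exists>w. w \<in> vs1.span I \<and> \<Phi> w = b" using B(1) by blast
  from bchoice[OF this] obtain g where g: "\<And>b. b \<in> B \<Longrightarrow> g b \<in> vs1.span I \<and> \<Phi> (g b) = b" by blast
  have "I \<subseteq> vs1.span (g ` B \<union> J)"
  proof
    fix w assume "w \<in> I"
    then have w: "w \<in> vs1.span I" by (rule vs1.span_base)
    then have "\<Phi> w \<in> vs2.span B" using B(3) by blast
    then obtain c where c: "\<Phi> w = (\<Sum>b\<in>B. s2 (c b) b)" unfolding vs2.span_finite[OF fB] by blast
    let ?v = "\<Sum>b\<in>B. s1 (c b) (g b)"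
    have v: "?v \<in> vs1.span I" by (intro vs1.span_sum vs1.span_scale) (use g in blast)
    have "\<Phi> ?v = \<Phi> w" unfolding c sum scale by (rule sum.cong) (use g in auto)
    then have "\<Phi> (w - ?v) = 0" by (simp add: diff)
    then have "w - ?v \<in> vs1.span J" by (rule J(2)[OF vs1.span_diff[OF w v]])
    then have 1: "w - ?v \<in> vs1.span (g ` B \<union> J)" using vs1.span_mono[of J "g ` B \<union> J"] by blast
    have "?v \<in> vs1.span (g ` B \<union> J)" by (intro vs1.span_sum vs1.span_scale vs1.span_base) blast
    from vs1.span_add[OF 1 this] show "w \<in> vs1.span (g ` B \<union> J)" by simp
  qed
  then have "card I \<le> card (g ` B \<union> J)"
    using vs1.independent_span_bound[of "g ` B \<union> J" I] I(2) fB J(1) by blast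
  also have "\<dots> \<le> card B + card J"
    using card_Un_le[of "g ` B" J] card_image_le[OF fB, of g] by linarith
  finally have "card T \<le> card B" using card by linarith
  have "T \<subseteq> vs2.span B"
  proof
    fix t assume t: "t \<in> T"
    show "t \<in> vs2.span B"
    proof (rule ccontr)
      assume n: "t \<notin> vs2.span B"
      then have "vs2.independent (insert t B)" using B(2) by (simp add: vs2.independent_insertI)
      moreover have "insert t B \<subseteq> vs2.span T" using B(1) T(2) vs2.span_base[OF t] by blast
      ultimately have "card (insert t B) \<le> card T" using vs2.independent_span_bound[OF T(1)] by blast
      moreover have "t \<notin> B" using n vs2.span_base by blast
      ultimately show False using fB \<open>card T \<le> card B\<close> by simp
    qed
  qed
  also have "vs2.span B \<subseteq> ?R" by (rule vs2.span_minimal[OF B(1) R])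
  finally show ?thesis by (rule vs2.span_minimal[OF _ R])
qed

lemma independent_family:
  assumes "vector_space s" "finite X"
    and "\<And>c x. (\<Sum>x\<in>X. s (c x) (f x)) = 0 \<Longrightarrow> x \<in> X \<Longrightarrow> c x = 0"
  shows "inj_on f X" "\<not> Modules.module.dependent s (f ` X)"
proof -
  interpret vector_space s by fact
  show inj: "inj_on f X"
  proof (rule inj_onI, rule ccontr)
    fix x y assume xy: "x \<in> X" "y \<in> X" "f x = f y" "x \<noteq> y"
    let ?c = "\<lambda>z. if z = x then 1 else if z = y then - 1 else 0"
    have "(\<Sum>z\<in>X. s (?c z) (f z)) = (\<Sum>z\<in>{x, y}. s (?c z) (f z))"
      by (rule sum.mono_neutral_right) (use assms(2) xy in auto)
    also have "\<dots> = 0" using xy by simp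
    finally show False using assms(3)[where c = ?c and x = x] xy(1) by simp
  qed
  show "independent (f ` X)"
  proof (rule independent_if_scalars_zero)
    fix c y assume 0: "(\<Sum>y\<in>f ` X. s (c y) y) = 0" and y: "y \<in> f ` X"
    have "(\<Sum>x\<in>X. s (c (f x)) (f x)) = 0" using 0 unfolding sum.reindex[OF inj] by simp
    from assms(3)[OF this] y show "c y = 0" by blast
  qed (use assms(2) in simp)
qed

subsection \<open>Elements of finite order\<close>

lemma vector_space_smult: "vector_space (smult :: complex \<Rightarrow> complex poly \<Rightarrow> complex poly)"
  by unfold_locales (simp_all add: smult_add_right smult_add_left)

interpretation PV: vector_space "smult :: complex \<Rightarrow> complex poly \<Rightarrow> complex poly"
  by (rule vector_space_smult)

text \<open>
  In coordinates with respect to two eigenvectors of the matrix its symmetric power is diagonal, and a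
  polynomial relation \<open>a0 + a1 \<gamma> + a2 \<gamma>\<^sup>2 = 0\<close> on a vector kills all coordinates but those whose
  eigenvalue satisfies the same equation.
\<close>

lemma eigenvector_expansion:
  fixes p q r s x1 y1 x2 y2 \<mu>1 \<mu>2 a0 a1 a2 :: complex
  assumes e1: "cact 1 p q r s [:x1, y1:] = smult \<mu>1 [:x1, y1:]"
    and e2: "cact 1 p q r s [:x2, y2:] = smult \<mu>2 [:x2, y2:]"
    and D: "x1 * y2 - y1 * x2 \<noteq> 0" and pq: "p \<noteq> 0 \<or> q \<noteq> 0"
    and Q: "degree Q \<le> n"
    and rel: "smult a0 Q + smult a1 (cact n p q r s Q)
       + smult a2 (cact n p q r s (cact n p q r s Q)) = 0"
  shows "Q \<in> PV.span ((\<lambda>k. [:x2, y2:] ^ k * [:x1, y1:] ^ (n - k)) `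
     {k. k \<le> n \<and> a0 + a1 * (\<mu>2 ^ k * \<mu>1 ^ (n - k)) + a2 * (\<mu>2 ^ k * \<mu>1 ^ (n - k)) ^ 2 = 0})"
proof -
  define d where "d = x1 * y2 - y1 * x2"
  have d: "d \<noteq> 0" using D by (simp add: d_def)
  define E where "E k = [:x2, y2:] ^ k * [:x1, y1:] ^ (n - k)" for k
  define l where "l k = \<mu>2 ^ k * \<mu>1 ^ (n - k)" for k
  define c where "c k = coeff (cact n (y2 / d) (- y1 / d) (- x2 / d) (x1 / d) Q) k" for k
  have "d = x1 * y2 - y1 * x2" by (simp add: d_def)
  note inv = cact_inverse[OF _ this d]
  have Qc: "Q = (\<Sum>k\<le>n. smult (c k) (E k))"
    using inv(2)[OF Q] by (simp add: cact_def[of n x1] E_def c_def)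
  have act: "cact n p q r s (E k) = smult (l k) (E k)" if "k \<le> n" for k
    unfolding E_def l_def
    by (subst cact_linear_powers[OF _ _ that pq]) (simp_all only: e1 e2 power_smult, auto simp: mult_ac)
  have a: "cact n p q r s Q = (\<Sum>k\<le>n. smult (c k * l k) (E k))"
    unfolding Qc cact_sum cact_smult by (rule sum.cong) (auto simp: act)
  have aa: "cact n p q r s (cact n p q r s Q) = (\<Sum>k\<le>n. smult (c k * l k * l k) (E k))"
    unfolding a cact_sum cact_smult by (rule sum.cong) (auto simp: act)
  define w where "w k = c k * (a0 + a1 * l k + a2 * l k ^ 2)" for k
  have "(\<Sum>k\<le>n. smult (w k) (E k)) = smult a0 (\<Sum>k\<le>n. smult (c k) (E k))
     + smult a1 (\<Sum>k\<le>n. smult (c k * l k) (E k))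
     + smult a2 (\<Sum>k\<le>n. smult (c k * l k * l k) (E k))"
    unfolding PV.scale_sum_right sum.distrib[symmetric]
  proof (rule sum.cong[OF refl])
    fix k
    have w: "w k = a0 * c k + a1 * (c k * l k) + a2 * (c k * l k * l k)"
      by (simp add: w_def algebra_simps power2_eq_square)
    show "smult (w k) (E k) = smult a0 (smult (c k) (E k))
        + smult a1 (smult (c k * l k) (E k))
        + smult a2 (smult (c k * l k * l k) (E k))"
      unfolding w smult_add_left smult_smult ..
  qed
  also have "\<dots> = 0" using rel unfolding aa unfolding a unfolding Qc[symmetric] .
  finally have z: "(\<Sum>k\<le>n. smult (w k) (E k)) = 0" .
  define W where "W = (\<Sum>k\<le>n. monom (w k) k)"
  have dW: "degree W \<le> n" unfolding W_def by (intro degree_sum_le) (auto intro: order_trans[OF degree_monom_le])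
  have cW: "coeff W k = w k" if "k \<le> n" for k using that by (simp add: W_def coeff_sum)
  have "cact n x1 y1 x2 y2 W = 0" using z unfolding cact_def by (simp add: cW E_def)
  then have "cact n (y2 / d) (- y1 / d) (- x2 / d) (x1 / d) (cact n x1 y1 x2 y2 W) = 0" by simp
  then have "W = 0" unfolding inv(1)[OF dW] .
  then have w0: "w k = 0" if "k \<le> n" for k using cW[OF that] by simp
  have "smult (c k) (E k) \<in> PV.span (E ` {k. k \<le> n \<and> a0 + a1 * l k + a2 * l k ^ 2 = 0})" if k: "k \<le> n" for k
  proof (cases "a0 + a1 * l k + a2 * l k ^ 2 = 0")
    case True
    then show ?thesis using k by (intro PV.span_scale PV.span_base) auto
  next
    case False
    then have "c k = 0" using w0[OF k] by (simp add: w_def)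
    then show ?thesis by (simp add: PV.span_zero)
  qed
  then have "Q \<in> PV.span (E ` {k. k \<le> n \<and> a0 + a1 * l k + a2 * l k ^ 2 = 0})"
    unfolding Qc by (intro PV.span_sum) auto
  then show ?thesis by (simp only: E_def[abs_def] l_def)
qed

lemma eigenvalue_one:
  fixes \<mu>1 \<mu>2 :: complex
  assumes "\<mu>2 * \<mu>1 = 1" "\<mu>1 ^ (2 * m) = 1" "\<mu>2 ^ (2 * m) = 1" "k \<le> 2 * h" "int m dvd int k - int h"
  shows "\<mu>2 ^ k * \<mu>1 ^ (2 * h - k) = 1"
proof (cases "k \<le> h")
  case True
  then have "m dvd h - k" using assms(5) by (metis dvd_minus_iff int_dvd_int_iff minus_diff_eq of_nat_diff)
  then obtain j where j: "h - k = m * j" by (elim dvdE)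
  have "2 * h - k = k + 2 * m * j" using j True by simp
  then have "\<mu>2 ^ k * \<mu>1 ^ (2 * h - k) = (\<mu>2 * \<mu>1) ^ k * (\<mu>1 ^ (2 * m)) ^ j"
    by (simp add: power_add power_mult power_mult_distrib)
  then show ?thesis by (simp add: assms)
next
  case False
  then have "m dvd k - h" using assms(5) by (metis int_dvd_int_iff nat_le_linear of_nat_diff)
  then obtain j where j: "k - h = m * j" by (elim dvdE)
  have e: "k = (2 * h - k) + 2 * m * j" using j False assms(4) by simp
  have "\<mu>2 ^ k = \<mu>2 ^ (2 * h - k) * (\<mu>2 ^ (2 * m)) ^ j"
    by (subst e) (simp only: power_add power_mult)
  then have "\<mu>2 ^ k * \<mu>1 ^ (2 * h - k) = (\<mu>2 * \<mu>1) ^ (2 * h - k) * (\<mu>2 ^ (2 * m)) ^ j"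
    by (simp add: power_mult_distrib)
  then show ?thesis by (simp add: assms)
qed

text \<open>
  The exponents \<open>k\<close> for which the monomial with eigenvalue \<open>\<mu>\<^sup>2\<^sup>h\<^sup>-\<^sup>2\<^sup>k\<close>, \<open>\<mu>\<close> of order \<open>2m\<close>, is not fixed.
\<close>

definition nonfixed :: "nat \<Rightarrow> nat \<Rightarrow> nat set" where
  "nonfixed h m = {k. k \<le> 2 * h \<and> \<not> int m dvd int k - int h}"

text \<open>
  The fixed monomials are those with \<open>k = h + m j\<close> and \<open>\<bar>j\<bar> \<le> h div m\<close>.
\<close>

lemma card_nonfixed:
  assumes "m > 0" shows "card (nonfixed h m) + (2 * (h div m) + 1) = 2 * h + 1"
proof -
  let ?f = "\<lambda>j. nat (int h + int m * j)" and ?A = "{- int (h div m)..int (h div m)}"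
  let ?B = "{k. k \<le> 2 * h \<and> int m dvd int k - int h}"
  have b: "int m * int (h div m) \<le> int h"
    by (metis of_nat_le_iff of_nat_mult times_div_less_eq_dividend)
  have nn: "0 \<le> int h + int m * j \<and> int h + int m * j \<le> 2 * int h" if "j \<in> ?A" for j
  proof -
    have "int m * j \<le> int m * int (h div m)" "int m * (- int (h div m)) \<le> int m * j"
      using that assms by (auto intro!: mult_left_mono simp del: mult_minus_right)
    then show ?thesis using b by simp
  qed
  have "inj_on ?f ?A"
  proof (rule inj_onI)
    fix i j assume ij: "i \<in> ?A" "j \<in> ?A" "?f i = ?f j"
    then have "int h + int m * i = int h + int m * j" using nn[OF ij(1)] nn[OF ij(2)] by (simp add: eq_nat_nat_iff)
    then show "i = j" using assms by simp
  qed
  moreover have "?f ` ?A \<subseteq> ?B"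
  proof clarify
    fix j assume "j \<in> ?A"
    from nn[OF this] show "?f j \<le> 2 * h \<and> int m dvd int (?f j) - int h" by auto
  qed
  moreover have "finite ?B" by (rule finite_subset[of _ "{..2 * h}"]) auto
  ultimately have "card ?A \<le> card ?B" using card_inj_on_le by blast
  moreover have "?B \<subseteq> ?f ` ?A"
  proof clarify
    fix k assume k: "k \<le> 2 * h" "int m dvd int k - int h"
    then obtain j where j: "int k - int h = int m * j" by (elim dvdE)
    have "int m * j \<le> int h" "int m * (- j) \<le> int h" using j k(1) by auto
    then have "j \<le> int h div int m" "- j \<le> int h div int m"
      using zdiv_mono1[of "int m * j" "int h" "int m"] zdiv_mono1[of "int m * (- j)" "int h" "int m"] assms
      by (simp_all del: mult_minus_right)
    then have "j \<in> ?A" by (auto simp: zdiv_int)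
    moreover have "k = ?f j" using j by simp
    ultimately show "k \<in> ?f ` ?A" by blast
  qed
  then have "card ?B \<le> card ?A" by (rule surj_card_le[rotated]) simp
  ultimately have cB: "card ?B = 2 * (h div m) + 1" by simp
  have "card (nonfixed h m \<union> ?B) = card (nonfixed h m) + card ?B"
    by (rule card_Un_disjoint) (auto simp: nonfixed_def)
  moreover have "nonfixed h m \<union> ?B = {..2 * h}" by (auto simp: nonfixed_def)
  ultimately show ?thesis using cB by simp
qed

subsection \<open>Counting monomials\<close>

text \<open>
  Monomials whose weight, halved, is at most \<open>l\<close> and congruent to \<open>l\<close> modulo \<open>6\<close>; there is one for
  every such halved weight except \<open>1\<close>.
\<close>

definition uv_exponents :: "nat \<Rightarrow> (nat \<times> nat) set" where
  "uv_exponents l = {(a, b). b < 2 \<and> 2 * a + 3 * b \<le> l \<and> (2 * a + 3 * b) mod 6 = l mod 6}"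

lemma finite_uv_exponents: "finite (uv_exponents l)"
  by (rule finite_subset[of _ "{..l} \<times> {..<2}"]) (auto simp: uv_exponents_def)

lemma card_uv_exponents: "card (uv_exponents l) = l div 6 + (if l mod 6 = 1 then 0 else 1)"
proof (induction l rule: less_induct)
  case (less l)
  have 0: "uv_exponents l = (if l \<ge> 6 then uv_exponents (l - 6) else {}) \<union> {(a, b). b < 2 \<and> 2 * a + 3 * b = l}"
  proof -
    have "m \<le> l \<and> m mod 6 = l mod 6 \<longleftrightarrow> (6 \<le> l \<and> m \<le> l - 6 \<and> m mod 6 = (l - 6) mod 6) \<or> m = l" for m
    proof
      assume m: "m \<le> l \<and> m mod 6 = l mod 6"
      then have d: "6 dvd l - m" by (metis mod_eq_dvd_iff_nat)
      show "(6 \<le> l \<and> m \<le> l - 6 \<and> m mod 6 = (l - 6) mod 6) \<or> m = l"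
      proof (cases "m = l")
        case False
        then have "6 \<le> l - m" using d m by (intro dvd_imp_le) auto
        then have "6 \<le> l" "m \<le> l - 6" using m by linarith+
        then show ?thesis using m le_mod_geq[of 6 l] by simp
      qed simp
    qed (auto simp: le_mod_geq)
    then show ?thesis unfolding uv_exponents_def by auto
  qed
  have 1: "{(a, b). b < 2 \<and> 2 * a + 3 * b = l} = (if l = 1 then {} else {((l - 3 * (l mod 2)) div 2, l mod 2)})"
  proof -
    have "b < 2 \<and> 2 * a + 3 * b = l \<longleftrightarrow> l \<noteq> 1 \<and> a = (l - 3 * (l mod 2)) div 2 \<and> b = l mod 2" for a b :: nat
    proof (cases "even l")
      case True
      then obtain q where q: "l = 2 * q" by (elim evenE)
      have "b < 2 \<and> 2 * a + 3 * b = 2 * q \<longleftrightarrow> a = q \<and> b = 0"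
      proof
        assume "b < 2 \<and> 2 * a + 3 * b = 2 * q"
        then have *: "b = 0 \<or> b = 1" "2 * a + 3 * b = 2 * q" by auto
        then have "b \<noteq> 1" by (metis even_add even_mult_iff even_numeral mult.right_neutral odd_numeral)
        then show "a = q \<and> b = 0" using * by simp
      qed simp
      then show ?thesis by (simp add: q)
    next
      case False
      then obtain q where q: "l = 2 * q + 1" by (elim oddE)
      have "b < 2 \<and> 2 * a + 3 * b = 2 * q + 1 \<longleftrightarrow> q \<noteq> 0 \<and> a = q - 1 \<and> b = 1"
      proof
        assume "b < 2 \<and> 2 * a + 3 * b = 2 * q + 1"
        then have *: "b = 0 \<or> b = 1" "2 * a + 3 * b = 2 * q + 1" by auto
        then have "b \<noteq> 0" by (metis add_0_right even_mult_iff even_numeral even_plus_one_iff mult_0_right)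
        then show "q \<noteq> 0 \<and> a = q - 1 \<and> b = 1" using * by simp
      qed auto
      moreover have "(2 * q + 1 - 3) div 2 = q - 1" by simp
      ultimately show ?thesis by (auto simp: q)
    qed
    then show ?thesis by auto
  qed
  show ?case
  proof (cases "l \<ge> 6")
    case True
    have "((l - 3 * (l mod 2)) div 2, l mod 2) \<notin> uv_exponents (l - 6)"
    proof -
      have "((l - 3 * (l mod 2)) div 2, l mod 2) \<in> {(a, b). b < 2 \<and> 2 * a + 3 * b = l}"
        unfolding 1 using True by simp
      moreover have "(a, b) \<notin> uv_exponents (l - 6)" if "2 * a + 3 * b = l" for a b
        using that True by (auto simp: uv_exponents_def)
      ultimately show ?thesis by blast
    qed
    then have "card (uv_exponents l) = Suc (card (uv_exponents (l - 6)))"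
      using True by (subst 0, subst 1) (simp add: finite_uv_exponents)
    also have "\<dots> = Suc ((l - 6) div 6 + (if (l - 6) mod 6 = 1 then 0 else 1))" using less[of "l - 6"] True by simp
    also have "\<dots> = l div 6 + (if l mod 6 = 1 then 0 else 1)" using True by (simp add: le_mod_geq le_div_geq)
    finally show ?thesis .
  next
    case False
    then show ?thesis by (subst 0, subst 1) auto
  qed
qed

text \<open>
  For \<open>n = 2h\<close> all weights are even, and after halving the conditions on \<open>(a, b)\<close> for given \<open>i\<close> are those of
  \<open>uv_exponents\<close>. With pole order \<open>h\<close> the bound \<open>L\<close> is \<open>7h\<close> for sections and \<open>7h + 1\<close> for forms.
\<close>

lemma card_weight_indices:
  assumes "2 * h \<le> L"
  shows "card {(i, a, b). i \<le> 2 * h \<and> b < 2 \<and> (4 * int a + 6 * int b) mod 12 = (2 * int L - 2 * int i) mod 12 \<and>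
     4 * a + 6 * b + 2 * i \<le> 2 * L} = (\<Sum>i\<le>2 * h. card (uv_exponents (L - i)))" (is "card ?A = _")
proof -
  have "?A = (SIGMA i:{..2 * h}. uv_exponents (L - i))"
  proof (intro Set.set_eqI)
    fix x :: "nat \<times> nat \<times> nat"
    obtain i a b where x: "x = (i, a, b)" by (cases x)
    show "x \<in> ?A \<longleftrightarrow> x \<in> (SIGMA i:{..2 * h}. uv_exponents (L - i))"
    proof (cases "i \<le> 2 * h")
      case i: True
      have "(4 * int a + 6 * int b) mod 12 = (2 * int L - 2 * int i) mod 12 \<longleftrightarrow>
          2 * 6 dvd 2 * (int (2 * a + 3 * b) - int (L - i))"
        unfolding mod_eq_dvd_iff using i assms by (simp add: of_nat_diff algebra_simps)
      also have "\<dots> \<longleftrightarrow> int (2 * a + 3 * b) mod 6 = int (L - i) mod 6"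
        unfolding mod_eq_dvd_iff by (rule dvd_mult_cancel_left[THEN trans]) simp
      also have "\<dots> \<longleftrightarrow> (2 * a + 3 * b) mod 6 = (L - i) mod 6"
        by (metis of_nat_eq_iff of_nat_numeral zmod_int)
      finally have m: "(4 * int a + 6 * int b) mod 12 = (2 * int L - 2 * int i) mod 12 \<longleftrightarrow>
          (2 * a + 3 * b) mod 6 = (L - i) mod 6" .
      have "4 * a + 6 * b + 2 * i \<le> 2 * L \<longleftrightarrow> 2 * a + 3 * b \<le> L - i" using i assms by linarith
      then show ?thesis using i m by (simp add: x uv_exponents_def) blast
    qed (simp add: x)
  qed
  then show ?thesis by (simp add: finite_uv_exponents)
qed

lemma card_indices:
  "card (form_indices_le (2 * h) h) = (\<Sum>i\<le>2 * h. card (uv_exponents (7 * h + 1 - i)))"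
  "card (section_indices_le (2 * h) h) = (\<Sum>i\<le>2 * h. card (uv_exponents (7 * h - i)))"
proof -
  have shift: "(k + 12 * int h) mod 12 = k mod 12" for k by (rule mod_mult_self2)
  have "2 * int (7 * h + 1) - 2 * int i = (int (2 * h) - 2 * int i + 2) + 12 * int h" for i by simp
  then have 1: "(2 * int (7 * h + 1) - 2 * int i) mod 12 = (int (2 * h) - 2 * int i + 2) mod 12" for i by (simp only: shift)
  show "card (form_indices_le (2 * h) h) = (\<Sum>i\<le>2 * h. card (uv_exponents (7 * h + 1 - i)))"
    using card_weight_indices[of h "7 * h + 1"] unfolding 1 form_indices_le_def form_indices_def
    by (simp add: conj_assoc)
  have "2 * int (7 * h) - 2 * int i = (int (2 * h) - 2 * int i) + 12 * int h" for i by simp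
  then have 2: "(2 * int (7 * h) - 2 * int i) mod 12 = (int (2 * h) - 2 * int i) mod 12" for i by (simp only: shift)
  show "card (section_indices_le (2 * h) h) = (\<Sum>i\<le>2 * h. card (uv_exponents (7 * h - i)))"
    using card_weight_indices[of h "7 * h"] unfolding 2 section_indices_le_def by (simp add: conj_assoc)
qed

lemma finite_indices: "finite (form_indices_le n N)" "finite (section_indices_le n N)"
  by (rule finite_subset[of _ "{..n} \<times> {..12 * N + n + 2} \<times> {..<2}"],
      auto simp: form_indices_le_def form_indices_def section_indices_le_def)+

lemma telescope:
  fixes d :: "nat \<Rightarrow> nat"
  shows "m \<le> L \<Longrightarrow> (\<Sum>i\<le>m. d (L + 1 - i)) + d (L - m) = (\<Sum>i\<le>m. d (L - i)) + d (L + 1)"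
proof (induction m)
  case (Suc m)
  then have "L + 1 - Suc m = L - m" by simp
  then show ?case using Suc by simp
qed simp

text \<open>
  The numbers of forms and of sections are the same sum, shifted by one step, so their difference
  telescopes to \<open>d(7h + 1) - d(5h)\<close> with \<open>d(l)\<close> the cardinality of \<open>uv_exponents l\<close>. What remains depends
  only on \<open>h\<close> modulo \<open>6\<close>.
\<close>

lemma dimension_count:
  "card (section_indices_le (2 * h) h) + (card (nonfixed h 2) + card (nonfixed h 3))
     \<le> (2 * h + 1) + card (form_indices_le (2 * h) h)"
proof -
  let ?d = "\<lambda>l. card (uv_exponents l)"
  have t: "card (form_indices_le (2 * h) h) + ?d (5 * h) = card (section_indices_le (2 * h) h) + ?d (7 * h + 1)"
    unfolding card_indices using telescope[of "2 * h" "7 * h" ?d] by simp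
  have "?d (5 * h) + (2 * h - 2 * (h div 2)) + (2 * h - 2 * (h div 3)) \<le> 2 * h + 1 + ?d (7 * h + 1)"
  proof -
    define k r where "k = h div 6" and "r = h mod 6"
    have h: "h = 6 * k + r" by (simp add: k_def r_def)
    have e: "5 * h = 5 * r + (5 * k) * 6" "7 * h + 1 = (7 * r + 1) + (7 * k) * 6" by (simp_all add: h)
    have e': "h div 2 = 3 * k + r div 2" "h div 3 = 2 * k + r div 3"
      using div_mult_self1[of 2 r "3 * k"] div_mult_self1[of 3 r "2 * k"] by (simp_all add: h add.commute)
    have dd: "(x + y * 6) div 6 + (if (x + y * 6) mod 6 = 1 then 0 else 1) =
        y + (x div 6 + (if x mod 6 = 1 then 0 else 1))" for x y :: nat
      by simp
    have d: "?d (5 * h) = 5 * k + (5 * r div 6 + (if 5 * r mod 6 = 1 then 0 else 1))"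
      "?d (7 * h + 1) = 7 * k + ((7 * r + 1) div 6 + (if (7 * r + 1) mod 6 = 1 then 0 else 1))"
      unfolding card_uv_exponents e dd by (rule refl)+
    have "r < 6" by (simp add: r_def)
    then consider "r = 0" | "r = 1" | "r = 2" | "r = 3" | "r = 4" | "r = 5" by linarith
    then show ?thesis unfolding d e' by cases (simp_all add: h)
  qed
  moreover have "card (nonfixed h 2) = 2 * h - 2 * (h div 2)" "card (nonfixed h 3) = 2 * h - 2 * (h div 3)"
    using card_nonfixed[of 2 h] card_nonfixed[of 3 h] by simp_all
  ultimately show ?thesis using t by linarith
qed

section \<open>Every cocycle is a period cocycle of an algebraic form\<close>

text \<open>
  The central element and an element of order \<open>6\<close>; \<open>S\<close> and \<open>U\<close> generate the group.
\<close>

definition MI :: "int^2^2" where "MI = mat2 (- 1) 0 0 (- 1)"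
definition UU :: "int^2^2" where "UU = SS ** ST 1"

lemma SL2Z_MI_UU [simp]: "MI \<in> SL2Z" "UU \<in> SL2Z"
  unfolding UU_def by (simp add: SL2Z_iff MI_def) (intro SL2Z_mult SL2Z_gens)

lemma finite_order: "SS ** SS = MI" "(UU ** UU) ** UU = MI"
  by (simp_all add: mat2_eq_iff SS_def ST_def UU_def MI_def)

lemma actB_SI: "degree P \<le> n \<Longrightarrow> actB n SI P = P"
  by (simp add: actB_cact SI_def cact_one)

lemma actB_MI: "degree P \<le> n \<Longrightarrow> actB n MI P = smult ((- 1) ^ n) P"
  unfolding actB_cact by (rule poly_eqI_cofinite[of "{}"]) (simp_all add: poly_cact MI_def)

lemma cocycleD:
  assumes "\<kappa> \<in> group_cocycles n"
  shows "degree (\<kappa> \<gamma>) \<le> n" "\<gamma> \<notin> SL2Z \<Longrightarrow> \<kappa> \<gamma> = 0"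
    "\<gamma> \<in> SL2Z \<Longrightarrow> \<gamma>' \<in> SL2Z \<Longrightarrow> \<kappa> (\<gamma> ** \<gamma>') = actB n \<gamma>' (\<kappa> \<gamma>) + \<kappa> \<gamma>'"
proof -
  show "degree (\<kappa> \<gamma>) \<le> n" using assms unfolding group_cocycles_def by (cases "\<gamma> \<in> SL2Z") auto
qed (use assms in \<open>simp_all add: group_cocycles_def\<close>)

lemma cocycle_SI:
  assumes "\<kappa> \<in> group_cocycles n" shows "\<kappa> SI = 0"
proof -
  have "SI ** SI = SI" by (simp add: mat2_eq_iff SI_def)
  then have "\<kappa> SI = actB n SI (\<kappa> SI) + \<kappa> SI" using cocycleD(3)[OF assms, of SI SI] by simp
  then show ?thesis by (simp add: actB_SI[OF cocycleD(1)[OF assms]])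
qed

lemma cocycle_eq_0:
  assumes k: "\<kappa> \<in> group_cocycles n" and S: "\<kappa> SS = 0" and U: "\<kappa> UU = 0"
  shows "\<kappa> = 0"
proof
  fix \<gamma>
  note m = cocycleD(3)[OF k]
  have T: "\<kappa> (ST 1) = 0" using m[of SS "ST 1"] S U by (simp add: UU_def)
  have "ST 1 ** ST (- 1) = SI" by (simp add: mat2_eq_iff ST_def SI_def)
  then have T': "\<kappa> (ST (- 1)) = 0" using m[of "ST 1" "ST (- 1)"] T cocycle_SI[OF k] by simp
  have "\<kappa> \<gamma> = 0" if "\<gamma> \<in> SL2Z" using that
    by (induction rule: SL2Z_induct) (simp_all add: m S T T' cocycle_SI[OF k])
  then show "\<kappa> \<gamma> = 0 \<gamma>" using cocycleD(2)[OF k] by auto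
qed

definition eig_S :: "nat \<Rightarrow> nat \<Rightarrow> complex poly" where
  "eig_S h k = [:1, - \<i>:] ^ k * [:1, \<i>:] ^ (2 * h - k)"

definition zeta6 :: complex where "zeta6 = Complex (1 / 2) (sqrt 3 / 2)"

definition eig_U :: "nat \<Rightarrow> nat \<Rightarrow> complex poly" where
  "eig_U h k = [:1, 1 - zeta6:] ^ k * [:1, zeta6:] ^ (2 * h - k)"

lemma zeta6: "zeta6 ^ 2 = zeta6 - 1" "zeta6 ^ 6 = 1" "(1 - zeta6) ^ 6 = 1" "(1 - zeta6) * zeta6 = 1"
    "1 - 2 * zeta6 \<noteq> 0"
proof -
  show 2: "zeta6 ^ 2 = zeta6 - 1" by (simp add: zeta6_def complex_eq_iff power2_eq_square)
  have "zeta6 ^ 3 = zeta6 * zeta6 ^ 2" by (simp add: power3_eq_cube power2_eq_square)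
  also have "\<dots> = - 1" unfolding 2 using 2 by (simp add: algebra_simps power2_eq_square)
  finally have 3: "zeta6 ^ 3 = - 1" .
  show 6: "zeta6 ^ 6 = 1" using power_mult[of zeta6 3 2] 3 by simp
  show 1: "(1 - zeta6) * zeta6 = 1" using 2 by (simp add: algebra_simps power2_eq_square)
  have "((1 - zeta6) * zeta6) ^ 6 = (1 - zeta6) ^ 6" unfolding power_mult_distrib 6 by simp
  then show "(1 - zeta6) ^ 6 = 1" unfolding 1 by simp
  show "1 - 2 * zeta6 \<noteq> 0" by (simp add: zeta6_def complex_eq_iff)
qed

text \<open>
  As \<open>n\<close> is even, a cocycle vanishes at \<open>-1 = S\<^sup>2 = U\<^sup>3\<close>. The cocycle relation thus gives
  \<open>\<kappa>(S)|(1 + S) = 0\<close> and \<open>\<kappa>(U)|(1 + U + U\<^sup>2) = 0\<close>, which excludes the eigenvalue \<open>1\<close>.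
\<close>

lemma cocycle_eigenvectors:
  assumes k: "\<kappa> \<in> group_cocycles (2 * h)"
  shows "\<kappa> SS \<in> PV.span (eig_S h ` nonfixed h 2)" "\<kappa> UU \<in> PV.span (eig_U h ` nonfixed h 3)"
proof -
  let ?n = "2 * h"
  note m = cocycleD(3)[OF k] and d = cocycleD(1)[OF k]
  have "MI ** MI = SI" by (simp add: mat2_eq_iff MI_def SI_def)
  then have "\<kappa> MI + \<kappa> MI = 0" using m[of MI MI] by (simp add: actB_MI[OF d] cocycle_SI[OF k])
  then have "smult 2 (\<kappa> MI) = 0" by (simp flip: mult_2 add: numeral_mult_conv_smult smult_add_left[of 1 1, simplified])
  then have MI0: "\<kappa> MI = 0" by simp
  have aS: "actB ?n SS = cact ?n 0 (- 1) 1 0" by (simp add: actB_cact SS_def)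
  have aU: "actB ?n UU = cact ?n 0 (- 1) 1 1" by (simp add: actB_cact SS_def ST_def UU_def)
  have S: "actB ?n SS (\<kappa> SS) + \<kappa> SS = 0" using m[of SS SS] MI0 by (simp add: finite_order)
  have "\<kappa> (UU ** UU) = actB ?n UU (\<kappa> UU) + \<kappa> UU" by (simp add: m)
  then have U: "actB ?n UU (actB ?n UU (\<kappa> UU)) + actB ?n UU (\<kappa> UU) + \<kappa> UU = 0"
    using m[of "UU ** UU" UU] MI0 by (simp add: SL2Z_mult finite_order actB_add)
  have "\<kappa> SS \<in> PV.span ((\<lambda>k. [:1, - \<i>:] ^ k * [:1, \<i>:] ^ (?n - k)) `
     {k. k \<le> ?n \<and> 1 + 1 * ((- \<i>) ^ k * \<i> ^ (?n - k)) + 0 * ((- \<i>) ^ k * \<i> ^ (?n - k)) ^ 2 = 0})"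
  proof (rule eigenvector_expansion[of 0 "- 1" 1 0])
    show "smult 1 (\<kappa> SS) + smult 1 (cact ?n 0 (- 1) 1 0 (\<kappa> SS))
      + smult 0 (cact ?n 0 (- 1) 1 0 (cact ?n 0 (- 1) 1 0 (\<kappa> SS))) = 0"
      using S unfolding aS by (simp add: add.commute)
  qed (use d in \<open>simp_all add: cact_1 complex_eq_iff del: One_nat_def\<close>)
  also have "\<dots> \<subseteq> PV.span (eig_S h ` nonfixed h 2)"
  proof (rule PV.span_mono, rule image_subsetI)
    fix k assume "k \<in> {k. k \<le> ?n \<and> 1 + 1 * ((- \<i>) ^ k * \<i> ^ (?n - k)) + 0 * ((- \<i>) ^ k * \<i> ^ (?n - k)) ^ 2 = 0}"
    then have k: "k \<le> ?n" "1 + (- \<i>) ^ k * \<i> ^ (?n - k) = 0" by auto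
    have "\<i> ^ 4 = 1" "(- \<i>) ^ 4 = 1" by (simp_all add: power4_eq_xxxx)
    have "\<not> int 2 dvd int k - int h"
    proof
      assume "int 2 dvd int k - int h"
      then have "(- \<i>) ^ k * \<i> ^ (?n - k) = 1"
        by (intro eigenvalue_one[of "- \<i>" \<i> 2 k h]) (use k(1) \<open>\<i> ^ 4 = 1\<close> \<open>(- \<i>) ^ 4 = 1\<close> in auto)
      then show False using k(2) by (simp only:) simp
    qed
    then show "[:1, - \<i>:] ^ k * [:1, \<i>:] ^ (?n - k) \<in> eig_S h ` nonfixed h 2"
      using k(1) by (auto simp: eig_S_def nonfixed_def)
  qed
  finally show "\<kappa> SS \<in> PV.span (eig_S h ` nonfixed h 2)" .
  have "\<kappa> UU \<in> PV.span ((\<lambda>k. [:1, 1 - zeta6:] ^ k * [:1, zeta6:] ^ (?n - k)) `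
     {k. k \<le> ?n \<and> 1 + 1 * ((1 - zeta6) ^ k * zeta6 ^ (?n - k)) + 1 * ((1 - zeta6) ^ k * zeta6 ^ (?n - k)) ^ 2 = 0})"
  proof (rule eigenvector_expansion[of 0 "- 1" 1 1])
    show "smult 1 (\<kappa> UU) + smult 1 (cact ?n 0 (- 1) 1 1 (\<kappa> UU))
      + smult 1 (cact ?n 0 (- 1) 1 1 (cact ?n 0 (- 1) 1 1 (\<kappa> UU))) = 0"
      using U unfolding aU by (simp add: add_ac)
    show "cact 1 0 (- 1) 1 1 [:1, zeta6:] = smult zeta6 [:1, zeta6:]"
      using zeta6(1) by (simp add: cact_1 power2_eq_square del: One_nat_def)
    show "cact 1 0 (- 1) 1 1 [:1, 1 - zeta6:] = smult (1 - zeta6) [:1, 1 - zeta6:]"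
      using zeta6(1) by (simp add: cact_1 power2_eq_square algebra_simps del: One_nat_def)
    show "1 * (1 - zeta6) - zeta6 * 1 \<noteq> 0" using zeta6(5) by simp
  qed (use d in simp_all)
  also have "\<dots> \<subseteq> PV.span (eig_U h ` nonfixed h 3)"
  proof (rule PV.span_mono, rule image_subsetI)
    fix k assume "k \<in> {k. k \<le> ?n \<and> 1 + 1 * ((1 - zeta6) ^ k * zeta6 ^ (?n - k)) + 1 * ((1 - zeta6) ^ k * zeta6 ^ (?n - k)) ^ 2 = 0}"
    then have k: "k \<le> ?n" "1 + (1 - zeta6) ^ k * zeta6 ^ (?n - k) + ((1 - zeta6) ^ k * zeta6 ^ (?n - k)) ^ 2 = 0" by auto
    have "\<not> int 3 dvd int k - int h" using eigenvalue_one[of "1 - zeta6" zeta6 3 k h] k zeta6 by auto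
    then show "[:1, 1 - zeta6:] ^ k * [:1, zeta6:] ^ (?n - k) \<in> eig_U h ` nonfixed h 3"
      using k(1) by (auto simp: eig_U_def nonfixed_def)
  qed
  finally show "\<kappa> UU \<in> PV.span (eig_U h ` nonfixed h 3)" .
qed

definition sP :: "complex \<Rightarrow> complex poly \<times> complex poly \<Rightarrow> complex poly \<times> complex poly" where
  "sP c p = (smult c (fst p), smult c (snd p))"

lemma vector_space_sP: "vector_space sP"
  by unfold_locales (simp_all add: sP_def smult_add_right smult_add_left prod_eq_iff)

interpretation PP: vector_space sP by (rule vector_space_sP)

lemma pair_in_span:
  assumes "P \<in> PV.span A" "Q \<in> PV.span B"
  shows "(P, Q) \<in> PP.span ((\<lambda>P. (P, 0)) ` A \<union> (\<lambda>Q. (0, Q)) ` B)" (is "_ \<in> PP.span ?T")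
proof -
  have span: "f P \<in> PP.span ?T" if "P \<in> PV.span A" "Vector_Spaces.linear smult sP f" "f ` A \<subseteq> ?T" for f P A
  proof -
    interpret Vector_Spaces.linear smult sP f by (rule that)
    have "f P \<in> f ` PV.span A" using that(1) by blast
    also have "\<dots> = PP.span (f ` A)" by (rule span_image[symmetric])
    also have "\<dots> \<subseteq> PP.span ?T" by (rule PP.span_mono[OF that(3)])
    finally show ?thesis .
  qed
  have "(P, 0) \<in> PP.span ?T" by (rule span[OF assms(1)]) (unfold_locales, auto simp: sP_def)
  moreover have "(0, Q) \<in> PP.span ?T" by (rule span[OF assms(2)]) (unfold_locales, auto simp: sP_def)
  ultimately show ?thesis using PP.span_add[of "(P, 0)" ?T "(0, Q)"] by simp
qed

text \<open>
  The functions whose periods are considered: the constants, with coboundaries as periods, and the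
  primitives of the monomial forms.
\<close>

definition gen_function :: "nat \<Rightarrow> nat + nat \<times> nat \<times> nat \<Rightarrow> complex \<Rightarrow> complex poly" where
  "gen_function n x = (case x of Inl k \<Rightarrow> cst (monom 1 k) | Inr m \<Rightarrow> prim n (pullback n (basis_form m)))"

lemma gen_function_independent:
  assumes 0: "(\<Sum>x\<in>{..n} <+> form_indices_le n N. sF (c x) (gen_function n x)) = 0"
    and x: "x \<in> {..n} <+> form_indices_le n N"
  shows "c x = 0"
proof -
  let ?F = "form_indices_le n N"
  define A where "A = (\<Sum>k\<le>n. sF (c (Inl k)) (cst (monom 1 k)))"
  define B where "B = (\<Sum>m\<in>?F. sF (c (Inr m)) (prim n (pullback n (basis_form m))))"
  have AB: "A + B = 0" using 0 by (simp add: sum.Plus finite_indices A_def B_def gen_function_def)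
  have cA: "sF (c (Inl k)) (cst (monom 1 k)) \<in> hol n" if "k \<in> {..n}" for k
    using that by (intro vsubD(4)[OF hol_vsub] cst_hol degree_monom_1) simp
  have cB: "sF (c (Inr m)) (prim n (pullback n (basis_form m))) \<in> hol n" for m
    by (intro vsubD(4)[OF hol_vsub] prim pullback_hol)
  have "deriv_an n A = (\<Sum>k\<le>n. deriv_an n (sF (c (Inl k)) (cst (monom 1 k))))"
    unfolding A_def by (rule deriv_an_sum(1)) (rule cA)
  also have "\<dots> = 0"
  proof (rule sum.neutral, rule ballI)
    fix k assume "k \<in> {..n}"
    then have h: "cst (monom 1 k) \<in> hol n" by (intro cst_hol degree_monom_1) simp
    show "deriv_an n (sF (c (Inl k)) (cst (monom 1 k))) = 0"
      unfolding deriv_an_sF[OF h] deriv_cst by (rule FZ.scale_zero_right)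
  qed
  finally have A: "deriv_an n A = 0" "A \<in> hol n"
    unfolding A_def by simp (rule deriv_an_sum(2), rule cA)
  have B: "deriv_an n B = (\<Sum>m\<in>?F. sF (c (Inr m)) (pullback n (basis_form m)))" "B \<in> hol n"
    unfolding B_def using deriv_an_sum[OF cB] by (simp_all only: deriv_an_sF prim pullback_hol)
  have "deriv_an n (A + B) = 0" unfolding AB by (rule deriv_an_0)
  then have "(\<Sum>m\<in>?F. sF (c (Inr m)) (pullback n (basis_form m))) = 0"
    by (simp only: deriv_an_add[OF A(2) B(2)] A(1) B(1) add_0_left)
  then have cm: "c (Inr m) = 0" if "m \<in> ?F" for m
    using forms_independent[of ?F n "\<lambda>m. c (Inr m)" m] that finite_indices by (auto simp: form_indices_le_def)
  have "B = 0" unfolding B_def by (rule sum.neutral) (simp add: cm fun_eq_iff)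
  then have "A \<i> = 0" using AB by simp
  then have "(\<Sum>k\<le>n. monom (c (Inl k)) k) = 0"
    by (simp add: A_def fun_sum_apply cst_def smult_monom)
  then have "coeff (\<Sum>k\<le>n. monom (c (Inl k)) k) j = 0" for j by simp
  then have "(if j \<le> n then c (Inl j) else 0) = 0" for j by (simp add: coeff_sum)
  then have "c (Inl j) = 0" if "j \<le> n" for j using that by metis
  then show ?thesis using x cm by auto
qed

lemma gen_function_span:
  assumes "w \<in> FZ.span (gen_function n ` ({..n} <+> form_indices_le n N))"
  shows "w \<in> hol n" "deriv_an n w \<in> forms_le n N"
proof -
  let ?W = "forms_le n N"
  have g: "gen_function n x \<in> hol n \<and> deriv_an n (gen_function n x) \<in> ?W" if "x \<in> {..n} <+> form_indices_le n N" for x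
    using that
  proof (rule PlusE)
    fix k assume k: "k \<in> {..n}" "x = Inl k"
    then show ?thesis unfolding gen_function_def
      using cst_hol[OF degree_monom_1, of k n] FZ.span_zero by (simp only: sum.case deriv_cst) auto
  next
    fix m assume m: "m \<in> form_indices_le n N" "x = Inr m"
    have "pullback n (basis_form m) \<in> ?W" by (intro FZ.span_base imageI m)
    then show ?thesis unfolding gen_function_def m(2) sum.case using prim[OF pullback_hol] by metis
  qed
  have "w \<in> hol n \<and> deriv_an n w \<in> ?W" using assms
  proof (induction rule: FZ.span_induct_alt)
    case base
    show ?case unfolding deriv_an_0 using FZ.span_zero vsubD(1)[OF hol_vsub] by blast
  next
    case (step c x y)
    have x: "x \<in> hol n" "deriv_an n x \<in> ?W" using step.hyps g by blast+
    then have cx: "sF c x \<in> hol n" by (intro vsubD(4)[OF hol_vsub])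
    have "deriv_an n (sF c x + y) = sF c (deriv_an n x) + deriv_an n y"
      using step.IH cx x by (simp only: deriv_an_add deriv_an_sF)
    moreover have "sF c (deriv_an n x) + deriv_an n y \<in> ?W"
      using x step.IH by (intro FZ.span_add FZ.span_scale) blast+
    moreover have "sF c x + y \<in> hol n" using step.IH by (intro vsubD(2)[OF hol_vsub] cx) auto
    ultimately show ?case by metis
  qed
  then show "w \<in> hol n" "deriv_an n w \<in> ?W" by auto
qed

lemma form_span_subset:
  "forms_le n N \<subseteq> alg_forms n"
  using basis_form_invariant by (intro FZ.span_mono) (auto simp: form_indices_le_def)

lemma form_span_an_forms: "alg_forms n \<subseteq> an_forms n"
  by (rule FZ.span_minimal[OF _ vsub_subspace[OF vector_space_sF an_forms_vsub]]) (use pullback_an_forms in blast)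

text \<open>
  The values at \<open>S\<close> and \<open>U\<close> map the space spanned by constants and primitives to a space with at most
  as many dimensions as \<open>dimension_count\<close> leaves after removing the kernel, and the kernel consists of
  algebraic sections.
\<close>

lemma cocycles_even:
  assumes k: "\<kappa> \<in> group_cocycles (2 * h)"
  shows "\<exists>G\<in>hol (2 * h). deriv_an (2 * h) G \<in> FZ.span (pullback (2 * h) ` invariant_forms (2 * h)) \<and> \<kappa> = per (2 * h) G"
proof -
  define n where "n = 2 * h"
  let ?X = "{..n} <+> form_indices_le n h"
  define I where "I = gen_function n ` ?X"
  define J where "J = (\<lambda>m. pullsec n (basis_section m)) ` section_indices_le n h"
  define T where "T = (\<lambda>P. (P, 0)) ` eig_S h ` nonfixed h 2 \<union> (\<lambda>Q. (0, Q)) ` eig_U h ` nonfixed h 3"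
  define \<Phi> where "\<Phi> G = (per n G SS, per n G UU)" for G
  have alg: "deriv_an n w \<in> an_forms n" if "w \<in> FZ.span I" for w
    using gen_function_span(2)[of w n h] that form_span_subset form_span_an_forms unfolding I_def by blast
  have hol: "w \<in> hol n" if "w \<in> FZ.span I" for w using gen_function_span(1) that unfolding I_def by blast
  have coc: "per n w \<in> group_cocycles n" if "w \<in> FZ.span I" for w by (rule per_cocycle[OF hol alg]) (fact that)+
  have fin: "finite ?X" "finite (nonfixed h m)" for m
    by (simp_all add: finite_indices nonfixed_def)
  have inT: "(\<kappa>' SS, \<kappa>' UU) \<in> PP.span T" if "\<kappa>' \<in> group_cocycles n" for \<kappa>'
    unfolding T_def using cocycle_eigenvectors[of \<kappa>' h] that by (intro pair_in_span) (simp_all add: n_def)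
  have fam: "inj_on (gen_function n) ?X" "FZ.independent I"
    unfolding I_def by (rule independent_family[OF vector_space_sF fin(1)], erule gen_function_independent, assumption)+
  have "PP.span T \<subseteq> \<Phi> ` FZ.span I"
  proof (rule surjective_by_dimension[where J = J])
    show "Vector_Spaces.linear sF sP \<Phi>"
      unfolding Vector_Spaces.linear_iff
      by (intro conjI allI vector_space_sF vector_space_sP) (simp_all only: \<Phi>_def per_add per_sF sP_def fst_conv snd_conv sG_apply plus_fun_apply add_Pair)
    show "finite I" unfolding I_def using fin(1) by blast
    show "FZ.independent I" by (rule fam(2))
    show "finite J" "finite T" unfolding J_def T_def using finite_indices fin(2) by auto
    show "\<Phi> ` FZ.span I \<subseteq> PP.span T" using inT coc by (auto simp: \<Phi>_def)
    show "w \<in> FZ.span J" if w: "w \<in> FZ.span I" and 0: "\<Phi> w = 0" for w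
    proof -
      have "per n w = 0" using cocycle_eq_0[OF coc[OF w]] 0 by (simp add: \<Phi>_def zero_prod_def)
      then have "w \<in> an_functions n" by (rule an_functions_per[OF hol[OF w] alg[OF w]])
      from algebraic_primitive[OF this, of h] show ?thesis
        using gen_function_span(2)[of w n h] w unfolding I_def J_def by blast
    qed
    have "card I = card ?X"
      unfolding I_def by (rule card_image[OF fam(1)])
    also have "\<dots> = (2 * h + 1) + card (form_indices_le n h)"
      by (simp add: card_Plus finite_indices n_def)
    finally have cI: "card I = (2 * h + 1) + card (form_indices_le n h)" .
    have cJ: "card J \<le> card (section_indices_le n h)" unfolding J_def by (rule card_image_le[OF finite_indices(2)])
    have "card T \<le> card (nonfixed h 2) + card (nonfixed h 3)"
      unfolding T_def using fin(2) card_Un_le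
      by (meson add_mono card_image_le finite_imageI order_trans)
    then show "card J + card T \<le> card I" using cI cJ dimension_count[of h] unfolding n_def by linarith
  qed
  then obtain G where G: "G \<in> FZ.span I" "(\<kappa> SS, \<kappa> UU) = \<Phi> G" using inT[of \<kappa>] k unfolding n_def by blast
  have "\<kappa> - per n G \<in> group_cocycles n" using k coc[OF G(1)] unfolding n_def by (intro vsubD(5)[OF cocycles_vsub])
  then have "\<kappa> - per n G = 0" by (rule cocycle_eq_0) (use G(2) in \<open>simp_all add: \<Phi>_def\<close>)
  then have "\<kappa> = per n G" by simp
  moreover have "deriv_an n G \<in> alg_forms n"
    using gen_function_span(2)[of G n h] G(1) form_span_subset unfolding I_def by blast
  ultimately show ?thesis using hol[OF G(1)] unfolding n_def by blast
qed

text \<open>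
  As \<open>-1\<close> is central and acts by \<open>-1\<close>, the two evaluations of the cocycle at \<open>-\<gamma>\<close> give
  \<open>2 \<kappa>(\<gamma>) = \<kappa>(-1) - \<kappa>(-1)|\<gamma>\<close>.
\<close>

lemma cocycles_odd:
  assumes k: "\<kappa> \<in> group_cocycles n" and n: "odd n"
  shows "\<kappa> \<in> coboundaries n"
proof -
  note m = cocycleD(3)[OF k] and d = cocycleD(1)[OF k]
  define P where "P = smult (- 1 / 2) (\<kappa> MI)"
  have "\<kappa> \<gamma> = coboundary n P \<gamma>" for \<gamma>
  proof (cases "\<gamma> \<in> SL2Z")
    case True
    have "MI ** \<gamma> = \<gamma> ** MI" by (simp add: mat2_eq_iff MI_def)
    then have "actB n \<gamma> (\<kappa> MI) + \<kappa> \<gamma> = actB n MI (\<kappa> \<gamma>) + \<kappa> MI"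
      using m[of MI \<gamma>] m[of \<gamma> MI] True by simp
    then have e: "actB n \<gamma> (\<kappa> MI) - \<kappa> MI = - \<kappa> \<gamma> - \<kappa> \<gamma>" using n by (simp add: actB_MI[OF d] algebra_simps)
    have "coboundary n P \<gamma> = smult (- 1 / 2) (actB n \<gamma> (\<kappa> MI) - \<kappa> MI)"
      unfolding coboundary_def if_P[OF True] P_def actB_smult smult_diff_right ..
    also have "\<dots> = \<kappa> \<gamma>" unfolding e
      by (rule poly_eqI) (simp only: coeff_smult coeff_diff coeff_minus, simp)
    finally show ?thesis by simp
  qed (simp add: coboundary_def cocycleD(2)[OF k])
  then have "\<kappa> = coboundary n P" by blast
  moreover have "degree P \<le> n" unfolding P_def using d order_trans[OF degree_smult_le] by blast
  ultimately show ?thesis by blast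
qed

theorem cocycles_are_algebraic_periods:
  assumes "\<kappa> \<in> group_cocycles n"
  shows "\<exists>G\<in>hol n. deriv_an n G \<in> alg_forms n \<and> \<kappa> - per n G \<in> coboundaries n"
proof (cases "even n")
  case True
  then obtain h where "n = 2 * h" by (elim evenE)
  with cocycles_even[of \<kappa> h] assms show ?thesis using vsubD(1)[OF coboundaries_vsub] by fastforce
next
  case False
  have "per n 0 = 0" using per_an_functions vsubD(1)[OF an_functions_vsub] by blast
  then show ?thesis
    using cocycles_odd[OF assms False] vsubD(1)[OF hol_vsub] FZ.span_zero
    by (intro bexI[of _ 0]) (simp_all only: deriv_an_0 diff_zero simp_thms)
qed

section \<open>The comparison isomorphism\<close>

theorem corollary1p3:
  fixes n :: nat
  shows "module_iso (tensor_complex (H1dR n)) (H1an n) (grothendieck n) \<and>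
         module_iso (H1an n) (H1grp n) (orbifold_to_group n) \<and>
         module_iso (tensor_complex (H1dR n)) (H1grp n) (comp_B_dR n)"
proof (intro conjI)
  show A: "module_iso (tensor_complex (H1dR n)) (H1an n) (grothendieck n)"
  proof (rule grothendieck_iso)
    fix y assume y: "y \<in> an_forms n"
    note p = prim[OF an_forms_hol[OF y]]
    have "per n (prim n y) \<in> group_cocycles n" by (rule per_cocycle) (simp_all add: p y)
    from cocycles_are_algebraic_periods[OF this] obtain G where G: "G \<in> hol n"
      "deriv_an n G \<in> alg_forms n" "per n (prim n y - G) \<in> coboundaries n"
      unfolding per_diff by blast
    have h: "prim n y - G \<in> hol n" by (rule vsubD(5)[OF hol_vsub p(1) G(1)])
    have d: "deriv_an n (prim n y - G) = y - deriv_an n G" unfolding deriv_an_diff[OF p(1) G(1)] p(2) ..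
    have "deriv_an n G \<in> an_forms n" using G(2) form_span_an_forms by blast
    then have "y - deriv_an n G \<in> an_forms n" by (rule vsubD(5)[OF an_forms_vsub y])
    then have "y - deriv_an n G \<in> an_exact n"
      using per_coboundary_iff[OF h] G(3) unfolding d by blast
    then show "\<exists>w\<in>alg_forms n. y - w \<in> an_exact n"
      using G(2) by blast
  qed
  show B: "module_iso (H1an n) (H1grp n) (orbifold_to_group n)"
    by (rule orbifold_iso) (use cocycles_are_algebraic_periods form_span_an_forms in blast)
  show "module_iso (tensor_complex (H1dR n)) (H1grp n) (comp_B_dR n)"
    unfolding comp_B_dR_def by (rule module_iso_comp[OF A B])
qed

end
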